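(* Assume that $q=p$ is prime and let $n\ge0$ be an integer. Then the map $$r_B:\operatorname{Ext}^{1,\mathrm{reg}}_A(\mathbb{1},\underline A(-n))\longrightarrow H^1(G_\infty,\underline A(-n)_B)$$ is an isomorphism if, and only if, the sum of the digits of $n$ written in base $p$ is $<p-1$.
   Context: $\mathbb{F}$ is a finite field with $q$ elements, $\theta,t$ are independent indeterminates, $A=\mathbb{F}[\theta]$, $K_\infty=\mathbb{F}((1/\theta))$, $K_\infty^s$ a separable closure, $\mathbb{C}_\infty$ its completion, $G_\infty=\operatorname{Gal}(K_\infty^s|K_\infty)$. $\tau:\mathbb{F}[\theta,t]\to\mathbb{F}[\theta,t]$ is the $\mathbb{F}[t]$-algebra endomorphism with $\theta\mapsto\theta^q$. A $t$-motive over $A$ is $\underline M=(M,\tau_M)$, $M$ a finite free $\mathbb{F}[\theta,t]$-module and $\tau_M:(\tau^*M)[\frac1{t-\theta}]\to M[\frac1{t-\theta}]$ an $\mathbb{F}[\theta,t]$-linear isomorphism; morphisms are linear maps $f$ with $f\circ\tau_M=\tau_N\circ\tau^*f$. A sequence is exact if the underlying sequence of modules is; this gives an $\mathbb{F}[t]$-linear exact category, with extension modules $\operatorname{Ext}^1_A(\underline N,\underline M)$. $\mathbb{1}=(\mathbb{F}[\theta,t],1)$, and for $k\in\mathbb{Z}$, $\underline A(k)$ is the $t$-motive with module $\mathbb{F}[\theta,t]$ and $\tau_M=(t-\theta)^{-k}\cdot\mathbf 1$. Hodge polygon: with $M_K=M\otimes_{\mathbb{F}[\theta]}\mathbb{F}(\theta)$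 of rank $r$, the relative elementary divisors of $\tau_M(\tau^*M_K)$ and $M_K$ locally at $(t-\theta)$ give integers $w_1\le\dots\le w_r$; the Hodge polygon is the convex piecewise linear function on $[0,r]$ starting at $(0,0)$ with slopes $w_i$ (with multiplicity). An extension $0\to\underline M\to\underline E\to\underline N\to0$ is regulated if $\underline E$ and $\underline M\oplus\underline N$ have the same Hodge polygon; regulated extensions form a submodule $\operatorname{Ext}^{1,\mathrm{reg}}_A$. $\mathbb{C}_\infty\langle t\rangle$ is the Tate algebra, with $\tau$ raising coefficients to the $q$th power. The Betti realization is $\underline M_B=\{f\in M\otimes_{\mathbb{F}[\theta,t]}\mathbb{C}_\infty\langle t\rangle:\tau_M(\tau^*f)=f\}$, an $\mathbb{F}[t]$-module with continuous $G_\infty$-action. All $\underline A(k)$ are rigid analytically trivial (i.e. $\underline M_B\otimes_{\mathbb{F}[t]}\mathbb{C}_\infty\langle t\rangle\to M\otimes\mathbb{C}_\infty\langle t\rangle$ is bijective), and on such objects $\underline M\mapsto\underline M_B$ is exact. The map $r_B$ sends the class of a regulated extension of $\mathbb{1}$ by $\underline M$ to the class of its Betti realization, an extension of continuous $\mathbb{F}[t]$-linear representations of $G_\infty$, i.e. an element of $H^1(G_\infty,\underline M_B)$. *)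

theory Defs
  imports
    "HOL-Library.Cardinality"
    "HOL-Analysis.Function_Topology"
    "HOL-Computational_Algebra.Computational_Algebra"
    "HOL-Algebra.Algebraic_Closure_Type"
    "Jordan_Normal_Form.Matrix"
    "Jordan_Normal_Form.Missing_VectorSpace"
begin

text \<open>
  Conventions. The finite field \<open>\<F>\<close> is a type \<open>'f\<close>, with \<open>q = CARD('f)\<close>.
  \<open>A = \<F>[\<theta>]\<close> is \<open>'f poly\<close>, and \<open>\<F>[\<theta>,t] = A[t]\<close> is \<open>'f poly poly\<close>: the outer variable is \<open>t\<close>, the
  inner one is \<open>\<theta>\<close>. \<open>K\<^sub>\<infinity> = \<F>((1/\<theta>))\<close> is \<open>'f fls\<close> with formal variable \<open>1/\<theta>\<close>, so that \<open>\<theta>\<close> is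
  \<^const>\<open>fls_X_inv\<close>.

  A finite free module over \<open>\<F>[\<theta>,t]\<close> is taken to be \<open>\<F>[\<theta>,t]\<^sup>r\<close> (column vectors of dimension \<open>r\<close>), and
  linear maps are matrices; every finite free module has this form up to isomorphism. Then \<open>\<tau>\<^sup>*M\<close> is again \<open>\<F>[\<theta>,t]\<^sup>r\<close>, \<open>\<tau>\<^sup>*f\<close> is the matrix \<open>f\<close> with \<open>\<tau>\<close> applied
  to its entries, and for a vector \<open>f\<close> the element \<open>\<tau>\<^sup>*f\<close> is \<open>\<tau>\<close> applied coordinatewise.
\<close>

section \<open>The rings \<open>\<F>[\<theta>,t]\<close> and \<open>\<F>[\<theta>,t][1/(t-\<theta>)]\<close>\<close>

definition t_minus_theta :: "'f::field poly poly" where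
  "t_minus_theta = [:- [:0, 1:], 1:]"

definition frob_At :: "'f::{finite,field} poly poly \<Rightarrow> 'f poly poly" where
  "frob_At = map_poly (\<lambda>a. pcompose a ([:0, 1:] ^ CARD('f)))"

definition Ft_to_At :: "'f::field poly \<Rightarrow> 'f poly poly" where
  "Ft_to_At = map_poly (\<lambda>c. [:c:])"

definition At_loc :: "'f::field poly poly fract set" where
  "At_loc = {Fract a (t_minus_theta ^ k) |a k. True}"

text \<open>The local ring of \<open>\<F>(\<theta>)[t]\<close> at \<open>(t - \<theta>)\<close>. Denominators in \<open>\<F>(\<theta>)[t]\<close> can be cleared to
  \<open>\<F>[\<theta>,t]\<close>, because no nonzero element of \<open>\<F>[\<theta>]\<close> is divisible by \<open>t - \<theta>\<close>.\<close>

definition K_local :: "'f::field poly poly fract set" where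
  "K_local = {Fract a b |a b. \<not> t_minus_theta dvd b}"

definition GL_over :: "'a::comm_ring_1 set \<Rightarrow> nat \<Rightarrow> 'a mat set" where
  "GL_over S r = {U \<in> carrier_mat r r. elements_mat U \<subseteq> S \<and>
     (\<exists>V \<in> carrier_mat r r. elements_mat V \<subseteq> S \<and> U * V = 1\<^sub>m r \<and> V * U = 1\<^sub>m r)}"

section \<open>\<open>t\<close>-motives over \<open>A\<close>\<close>

text \<open>The \<open>t\<close>-motive \<open>(\<F>[\<theta>,t]\<^sup>r, \<tau>\<^sub>M)\<close> is represented by the matrix of \<open>\<tau>\<^sub>M\<close> in the standard bases.\<close>

type_synonym 'f motive = "'f poly poly fract mat"

definition t_motive :: "'f::field motive \<Rightarrow> bool" where
  "t_motive M \<longleftrightarrow> M \<in> GL_over At_loc (dim_row M)"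

definition motive_hom :: "'f::{finite,field} motive \<Rightarrow> 'f motive \<Rightarrow> 'f poly poly mat \<Rightarrow> bool" where
  "motive_hom M N f \<longleftrightarrow> f \<in> carrier_mat (dim_row N) (dim_row M) \<and>
     map_mat to_fract f * M = N * map_mat to_fract (map_mat frob_At f)"

definition mat_dsum :: "'a::zero mat \<Rightarrow> 'a mat \<Rightarrow> 'a mat" (infixr "\<oplus>\<^sub>m" 65) where
  "A \<oplus>\<^sub>m B = four_block_mat A (0\<^sub>m (dim_row A) (dim_col B)) (0\<^sub>m (dim_row B) (dim_col A)) B"

definition unit_motive :: "'f::field motive" where
  "unit_motive = 1\<^sub>m 1"

definition A_motive :: "int \<Rightarrow> 'f::field motive" where
  "A_motive k = Matrix.mat 1 1 (\<lambda>_. to_fract t_minus_theta powi (- k))"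

section \<open>Hodge polygons\<close>

text \<open>With \<open>U\<close> and \<open>V\<close> as below, the columns \<open>u\<^sub>i\<close> of \<open>U\<close> form a local basis of \<open>M\<^sub>K\<close> such that the
  \<open>(t - \<theta>)\<^bsup>w\<^sub>i\<^esup> u\<^sub>i\<close> form a local basis of \<open>\<tau>\<^sub>M(\<tau>\<^sup>*M\<^sub>K)\<close>.\<close>

definition hodge_slopes :: "'f::field motive \<Rightarrow> int list" where
  "hodge_slopes M = (THE ws. sorted ws \<and> length ws = dim_row M \<and>
     (\<exists>U \<in> GL_over K_local (dim_row M). \<exists>V \<in> GL_over K_local (dim_row M).
        M = U * mat_diag (dim_row M) (\<lambda>i. to_fract t_minus_theta powi (ws ! i)) * V))"

text \<open>The factor \<open>max 0 (min 1 (x - i))\<close> is the length of \<open>[0,x] \<inter> [i,i+1]\<close>.\<close>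

definition hodge_polygon :: "'f::field motive \<Rightarrow> real \<Rightarrow> real" where
  "hodge_polygon M = restrict
     (\<lambda>x. \<Sum>i<dim_row M. of_int (hodge_slopes M ! i) * max 0 (min 1 (x - real i)))
     {0..real (dim_row M)}"

section \<open>Extensions of \<open>t\<close>-motives\<close>

record (overloaded) 'f ext =
  mid :: "'f motive"
  incl :: "'f poly poly mat"
  proj :: "'f poly poly mat"

definition short_exact :: "nat \<Rightarrow> nat \<Rightarrow> nat \<Rightarrow> 'a::comm_ring_1 mat \<Rightarrow> 'a mat \<Rightarrow> bool" where
  "short_exact m e n f g \<longleftrightarrow> f \<in> carrier_mat e m \<and> g \<in> carrier_mat n e \<and>
     inj_on ((*\<^sub>v) f) (carrier_vec m) \<and>
     (*\<^sub>v) f ` carrier_vec m = {v \<in> carrier_vec e. g *\<^sub>v v = 0\<^sub>v n} \<and>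
     (*\<^sub>v) g ` carrier_vec e = carrier_vec n"

text \<open>\<open>extensions N M\<close> consists of the extensions \<open>0 \<rightarrow> M \<rightarrow> E \<rightarrow> N \<rightarrow> 0\<close>.\<close>

definition extensions :: "'f::{finite,field} motive \<Rightarrow> 'f motive \<Rightarrow> 'f ext set" where
  "extensions N M = {E. t_motive (mid E) \<and>
     motive_hom M (mid E) (incl E) \<and> motive_hom (mid E) N (proj E) \<and>
     short_exact (dim_row M) (dim_row (mid E)) (dim_row N) (incl E) (proj E)}"

text \<open>Existence of a morphism of extensions which is \<open>\<alpha>\<close> on the subobject and \<open>\<beta>\<close> on the quotient.\<close>

definition ext_morphism ::
  "'f::{finite,field} poly poly mat \<Rightarrow> 'f poly poly mat \<Rightarrow> 'f ext \<Rightarrow> 'f ext \<Rightarrow> bool" where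
  "ext_morphism \<alpha> \<beta> E E' \<longleftrightarrow> (\<exists>g. motive_hom (mid E) (mid E') g \<and>
     g * incl E = incl E' * \<alpha> \<and> proj E' * g = \<beta> * proj E)"

definition ext_class :: "'f::{finite,field} motive \<Rightarrow> 'f motive \<Rightarrow> 'f ext \<Rightarrow> 'f ext set" where
  "ext_class N M E = {E' \<in> extensions N M. ext_morphism (1\<^sub>m (dim_row M)) (1\<^sub>m (dim_row N)) E E'}"

definition ext_dsum :: "'f::{finite,field} ext \<Rightarrow> 'f ext \<Rightarrow> 'f ext" where
  "ext_dsum E E' = \<lparr>mid = mid E \<oplus>\<^sub>m mid E', incl = incl E \<oplus>\<^sub>m incl E', proj = proj E \<oplus>\<^sub>m proj E'\<rparr>"

text \<open>A morphism of extensions that is the identity on the subobject exhibits its source as a pullback,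
  one that is the identity on the quotient exhibits its target as a pushout. So \<open>P\<close> is the pullback of
  \<open>E \<oplus> E'\<close> along the diagonal \<open>N \<rightarrow> N \<oplus> N\<close> and \<open>E''\<close> is the pushout of \<open>P\<close> along the sum \<open>M \<oplus> M \<rightarrow> M\<close>.\<close>

definition baer_sum ::
  "'f::{finite,field} motive \<Rightarrow> 'f motive \<Rightarrow> 'f ext \<Rightarrow> 'f ext \<Rightarrow> 'f ext \<Rightarrow> bool" where
  "baer_sum N M E E' E'' \<longleftrightarrow> (let m = dim_row M; n = dim_row N in
     \<exists>P \<in> extensions N (M \<oplus>\<^sub>m M).
       ext_morphism (1\<^sub>m (m + m)) (1\<^sub>m n @\<^sub>r 1\<^sub>m n) P (ext_dsum E E') \<and>
       ext_morphism (transpose_mat (1\<^sub>m m @\<^sub>r 1\<^sub>m m)) (1\<^sub>m n) P E'')"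

text \<open>The \<open>\<F>[t]\<close>-module of Yoneda extension classes. A scalar acts by pushout along its multiplication
  on \<open>M\<close>; the zero class consists of the split extensions. The ring multiplication and unit in the
  record type are not used for modules.\<close>

definition Ext1 ::
  "'f::{finite,field} motive \<Rightarrow> 'f motive \<Rightarrow> ('f poly, 'f ext set) module" where
  "Ext1 N M = \<lparr>
     carrier = ext_class N M ` extensions N M,
     monoid.mult = undefined,
     one = undefined,
     zero = {E \<in> extensions N M. \<exists>s. motive_hom N (mid E) s \<and> proj E * s = 1\<^sub>m (dim_row N)},
     add = (\<lambda>C D. {E'' \<in> extensions N M. \<exists>E\<in>C. \<exists>E'\<in>D. baer_sum N M E E' E''}),
     module.smult = (\<lambda>a C. {E'' \<in> extensions N M. \<exists>E\<in>C.
       ext_morphism (Ft_to_At a \<cdot>\<^sub>m 1\<^sub>m (dim_row M)) (1\<^sub>m (dim_row N)) E E''})\<rparr>"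

definition regulated ::
  "'f::{finite,field} motive \<Rightarrow> 'f motive \<Rightarrow> 'f ext \<Rightarrow> bool" where
  "regulated N M E \<longleftrightarrow> hodge_polygon (mid E) = hodge_polygon (M \<oplus>\<^sub>m N)"

definition Ext1_reg ::
  "'f::{finite,field} motive \<Rightarrow> 'f motive \<Rightarrow> ('f poly, 'f ext set) module" where
  "Ext1_reg N M =
     (Ext1 N M)\<lparr>carrier := ext_class N M ` {E \<in> extensions N M. regulated N M E}\<rparr>"

section \<open>The field \<open>\<complex>\<^sub>\<infinity>\<close> and the Galois group \<open>G\<^sub>\<infinity>\<close>\<close>

text \<open>For a field \<open>'c\<close> containing \<open>K\<^sub>\<infinity>\<close> via \<open>\<iota>\<close>: the elements algebraic and separable over \<open>K\<^sub>\<infinity>\<close>.\<close>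

definition sep_elements :: "('f::field fls \<Rightarrow> 'c::field) \<Rightarrow> 'c set" where
  "sep_elements \<iota> = {x. \<exists>p. coprime p (pderiv p) \<and> poly (map_poly \<iota> p) x = 0}"

text \<open>\<open>\<complex>\<^sub>\<infinity>\<close> is determined by \<open>K\<^sub>\<infinity>\<close> up to isometric isomorphism as a complete field with an
  ultrametric absolute value \<open>\<bar>x\<bar> = dist x 0\<close> extending the one of \<open>K\<^sub>\<infinity>\<close> (normalised by \<open>\<bar>\<theta>\<bar> = q\<close>), in
  which the separable elements over \<open>K\<^sub>\<infinity>\<close> are dense and form a separably closed field \<open>K\<^sub>\<infinity>\<^sup>s\<close>.\<close>

locale completed_separable_closure =
  fixes \<iota> :: "'f::{finite,field} fls \<Rightarrow> 'c::{field,complete_space}"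
  assumes emb_add: "\<iota> (x + y) = \<iota> x + \<iota> y"
    and emb_mult: "\<iota> (x * y) = \<iota> x * \<iota> y"
    and emb_one: "\<iota> 1 = 1"
    and dist_diff: "dist (a :: 'c) b = dist (a - b) 0"
    and abs_mult: "dist (a * b :: 'c) 0 = dist a 0 * dist b 0"
    and abs_add: "dist (a + b :: 'c) 0 \<le> max (dist a 0) (dist b 0)"
    and abs_emb: "(x :: 'f fls) \<noteq> 0 \<Longrightarrow> dist (\<iota> x) 0 = real CARD('f) powr - of_int (fls_subdegree x)"
    and sep_closed: "\<lbrakk>\<forall>i. coeff p i \<in> sep_elements \<iota>; degree p > 0; coprime p (pderiv p)\<rbrakk>
      \<Longrightarrow> \<exists>a \<in> sep_elements \<iota>. poly p a = 0"
    and sep_dense: "closure (sep_elements \<iota>) = UNIV"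

definition Gal :: "('f::field fls \<Rightarrow> 'c::field) \<Rightarrow> ('c \<Rightarrow> 'c) set" where
  "Gal \<iota> = {\<sigma> \<in> extensional (sep_elements \<iota>).
     bij_betw \<sigma> (sep_elements \<iota>) (sep_elements \<iota>) \<and>
     (\<forall>x \<in> sep_elements \<iota>. \<forall>y \<in> sep_elements \<iota>. \<sigma> (x + y) = \<sigma> x + \<sigma> y \<and> \<sigma> (x * y) = \<sigma> x * \<sigma> y) \<and>
     (\<forall>x. \<sigma> (\<iota> x) = \<iota> x)}"

text \<open>The Krull topology is the topology of pointwise convergence on the discrete set \<open>K\<^sub>\<infinity>\<^sup>s\<close>.\<close>

definition krull_topology :: "('f::field fls \<Rightarrow> 'c::field) \<Rightarrow> ('c \<Rightarrow> 'c) topology" where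
  "krull_topology \<iota> = subtopology
     (product_topology (\<lambda>_. discrete_topology (sep_elements \<iota>)) (sep_elements \<iota>)) (Gal \<iota>)"

text \<open>The extension of \<open>\<sigma> \<in> G\<^sub>\<infinity>\<close> to \<open>\<complex>\<^sub>\<infinity>\<close> by continuity.\<close>

definition gal_ext ::
  "('f::field fls \<Rightarrow> 'c::{field,complete_space}) \<Rightarrow> ('c \<Rightarrow> 'c) \<Rightarrow> 'c \<Rightarrow> 'c" where
  "gal_ext \<iota> \<sigma> x = (THE y. \<exists>s. range s \<subseteq> sep_elements \<iota> \<and> s \<longlonglongrightarrow> x \<and> (\<lambda>i. \<sigma> (s i)) \<longlonglongrightarrow> y)"

section \<open>The Tate algebra and Betti realizations\<close>

definition tate_algebra :: "'c::{field,complete_space} fps set" where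
  "tate_algebra = {f. (\<lambda>i. fps_nth f i) \<longlonglongrightarrow> 0}"

definition A_to_C :: "('f::field fls \<Rightarrow> 'c::field) \<Rightarrow> 'f poly \<Rightarrow> 'c" where
  "A_to_C \<iota> a = \<iota> (poly (map_poly fls_const a) fls_X_inv)"

definition At_to_tate :: "('f::field fls \<Rightarrow> 'c::field) \<Rightarrow> 'f poly poly \<Rightarrow> 'c fps" where
  "At_to_tate \<iota> a = fps_of_poly (map_poly (A_to_C \<iota>) a)"

text \<open>Since \<open>t - \<theta>\<close> is invertible in the Tate algebra, \<open>\<F>[\<theta>,t][1/(t-\<theta>)]\<close> maps to it.\<close>

definition loc_to_tate :: "('f::field fls \<Rightarrow> 'c::field) \<Rightarrow> 'f poly poly fract \<Rightarrow> 'c fps" where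
  "loc_to_tate \<iota> x = (THE y. \<exists>a k. x = Fract a (t_minus_theta ^ k) \<and>
     y * At_to_tate \<iota> t_minus_theta ^ k = At_to_tate \<iota> a)"

definition Ft_to_tate :: "('f::field fls \<Rightarrow> 'c::field) \<Rightarrow> 'f poly \<Rightarrow> 'c fps" where
  "Ft_to_tate \<iota> a = At_to_tate \<iota> (Ft_to_At a)"

definition tate_map :: "('c::field \<Rightarrow> 'c) \<Rightarrow> 'c fps \<Rightarrow> 'c fps" where
  "tate_map h f = Abs_fps (\<lambda>i. h (fps_nth f i))"

definition betti ::
  "('f::{finite,field} fls \<Rightarrow> 'c::{field,complete_space}) \<Rightarrow> 'f motive \<Rightarrow> 'c fps vec set" where
  "betti \<iota> M = {f \<in> carrier_vec (dim_row M). set\<^sub>v f \<subseteq> tate_algebra \<and>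
     map_mat (loc_to_tate \<iota>) M *\<^sub>v map_vec (tate_map (\<lambda>c. c ^ CARD('f))) f = f}"

definition gal_act ::
  "('f::field fls \<Rightarrow> 'c::{field,complete_space}) \<Rightarrow> ('c \<Rightarrow> 'c) \<Rightarrow> 'c fps vec \<Rightarrow> 'c fps vec" where
  "gal_act \<iota> \<sigma> f = map_vec (tate_map (gal_ext \<iota> \<sigma>)) f"

section \<open>Continuous cohomology of \<open>G\<^sub>\<infinity>\<close>\<close>

text \<open>\<open>V\<close> stands for a Betti realization, with its discrete topology.\<close>

definition cocycles ::
  "('f::field fls \<Rightarrow> 'c::{field,complete_space}) \<Rightarrow> 'c fps vec set \<Rightarrow> (('c \<Rightarrow> 'c) \<Rightarrow> 'c fps vec) set" where
  "cocycles \<iota> V = {c \<in> extensional (Gal \<iota>).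
     continuous_map (krull_topology \<iota>) (discrete_topology V) c \<and>
     (\<forall>\<sigma> \<in> Gal \<iota>. \<forall>\<rho> \<in> Gal \<iota>. c (compose (sep_elements \<iota>) \<sigma> \<rho>) = c \<sigma> + gal_act \<iota> \<sigma> (c \<rho>))}"

definition cohomology_class ::
  "('f::field fls \<Rightarrow> 'c::{field,complete_space}) \<Rightarrow> 'c fps vec set \<Rightarrow>
    (('c \<Rightarrow> 'c) \<Rightarrow> 'c fps vec) \<Rightarrow> (('c \<Rightarrow> 'c) \<Rightarrow> 'c fps vec) set" where
  "cohomology_class \<iota> V c = {d \<in> cocycles \<iota> V.
     \<exists>v\<in>V. \<forall>\<sigma> \<in> Gal \<iota>. d \<sigma> = c \<sigma> + (gal_act \<iota> \<sigma> v - v)}"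

definition H1 ::
  "('f::field fls \<Rightarrow> 'c::{field,complete_space}) \<Rightarrow> 'c fps vec set \<Rightarrow>
    ('f poly, (('c \<Rightarrow> 'c) \<Rightarrow> 'c fps vec) set) module" where
  "H1 \<iota> V = \<lparr>
     carrier = cohomology_class \<iota> V ` cocycles \<iota> V,
     monoid.mult = undefined,
     one = undefined,
     zero = {c \<in> cocycles \<iota> V. \<exists>v\<in>V. \<forall>\<sigma> \<in> Gal \<iota>. c \<sigma> = gal_act \<iota> \<sigma> v - v},
     add = (\<lambda>C D. \<Union>c\<in>C. \<Union>d\<in>D. cohomology_class \<iota> V (\<lambda>\<sigma>\<in>Gal \<iota>. c \<sigma> + d \<sigma>)),
     module.smult = (\<lambda>a C. \<Union>c\<in>C. cohomology_class \<iota> V (\<lambda>\<sigma>\<in>Gal \<iota>. Ft_to_tate \<iota> a \<cdot>\<^sub>v c \<sigma>))\<rparr>"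

section \<open>The map \<open>r\<^sub>B\<close>\<close>

text \<open>The class in \<open>H\<^sup>1(G\<^sub>\<infinity>, M\<^sub>B)\<close> of the extension \<open>0 \<rightarrow> M\<^sub>B \<rightarrow> E\<^sub>B \<rightarrow> \<one>\<^sub>B \<rightarrow> 0\<close>, as a set of cocycles: those of
  the form \<open>\<sigma> \<mapsto> \<sigma> e - e\<close> for a lift \<open>e \<in> E\<^sub>B\<close> of the generator \<open>1\<close> of \<open>\<one>\<^sub>B = \<F>[t]\<close>. Two lifts differ by an
  element of \<open>M\<^sub>B\<close>, hence their cocycles by a coboundary.\<close>

definition betti_ext_class ::
  "('f::{finite,field} fls \<Rightarrow> 'c::{field,complete_space}) \<Rightarrow> 'f motive \<Rightarrow> 'f ext \<Rightarrow>
    (('c \<Rightarrow> 'c) \<Rightarrow> 'c fps vec) set" where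
  "betti_ext_class \<iota> M E = {c \<in> cocycles \<iota> (betti \<iota> M).
     \<exists>e \<in> betti \<iota> (mid E).
       map_mat (At_to_tate \<iota>) (proj E) *\<^sub>v e = Matrix.vec 1 (\<lambda>_. 1) \<and>
       (\<forall>\<sigma> \<in> Gal \<iota>. map_mat (At_to_tate \<iota>) (incl E) *\<^sub>v c \<sigma> = gal_act \<iota> \<sigma> e - e)}"

text \<open>Equivalent extensions have the same Betti class, so the union is over equal sets.\<close>

definition r_B ::
  "('f::{finite,field} fls \<Rightarrow> 'c::{field,complete_space}) \<Rightarrow> 'f motive \<Rightarrow> 'f ext set \<Rightarrow>
    (('c \<Rightarrow> 'c) \<Rightarrow> 'c fps vec) set" where
  "r_B \<iota> M C = (\<Union>E\<in>C. betti_ext_class \<iota> M E)"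

section \<open>Isomorphisms of modules and digit sums\<close>

definition module_iso ::
  "('a, 'x) ring_scheme \<Rightarrow> ('a, 'b, 'y) module_scheme \<Rightarrow> ('a, 'd, 'z) module_scheme \<Rightarrow> ('b \<Rightarrow> 'd) \<Rightarrow> bool" where
  "module_iso R M N f \<longleftrightarrow>
     f \<in> LinearCombinations.module_hom R M N \<and> bij_betw f (carrier M) (carrier N)"

text \<open>For \<open>b \<ge> 2\<close> the digits of \<open>n\<close> at positions \<open>i > n\<close> vanish.\<close>

definition digit_sum :: "nat \<Rightarrow> nat \<Rightarrow> nat" where
  "digit_sum b n = (\<Sum>i\<le>n. n div b ^ i mod b)"

end

theory Submission
  imports
    Defs
    "Jordan_Normal_Form.Char_Poly"
    "Jordan_Normal_Form.Determinant"
    "HOL-Analysis.Elementary_Metric_Spaces"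
begin

text \<open>In a suitable basis an extension \<open>E\<close> of \<open>\<one>\<close> by \<open>A(-n)\<close> is given by one element \<open>u\<close> of
  \<open>\<F>[\<theta>,t][1/(t-\<theta>)]\<close>, unique up to the elements \<open>(t-\<theta>)\<^sup>n \<tau> h - h\<close> with \<open>h \<in> \<F>[\<theta>,t]\<close>; \<open>E\<close> is regulated
  iff \<open>u \<in> \<F>[\<theta>,t]\<close>. Put \<open>\<phi>(x) = x - (t-\<theta>)\<^sup>n \<tau> x\<close>. A lift of \<open>1\<close> to \<open>E\<^sub>B\<close> amounts to a solution \<open>x\<close> of
  \<open>\<phi>(x) = u\<close> in the Tate algebra, and the class of \<open>E\<close> is that of the cocycle \<open>\<sigma> \<mapsto> \<sigma> x - x\<close>. Since \<open>\<phi>\<close> is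
  surjective on series with separable coefficients, additive Hilbert 90 identifies \<open>H\<^sup>1\<close> with
  \<open>K\<^sub>\<infinity>\<langle>t\<rangle>/\<phi>(K\<^sub>\<infinity>\<langle>t\<rangle>)\<close>, so \<open>r\<^sub>B\<close> is bijective iff \<open>\<phi>\<close> is bijective on \<open>K\<^sub>\<infinity>\<langle>t\<rangle>/\<F>[\<theta>,t]\<close>. For that
  \<open>K\<^sub>\<infinity>\<langle>t\<rangle>\<close> is viewed as the Laurent series in \<open>1/\<theta>\<close> with coefficients in \<open>\<F>[t]\<close>, and the base \<open>p\<close>
  expansion \<open>(t-\<theta>)\<^sup>n = \<Prod>\<^sub>i (t\<^bsup>p^i\<^esup> - \<theta>\<^bsup>p^i\<^esup>)\<^bsup>n_i\<^esup>\<close> brings in the digit sum.\<close>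

section \<open>Frobenius difference operators on Laurent series\<close>

text \<open>The digit sum enters through a rotation. The Frobenius substitution raises theta to the
  p-th power and fixes t, and for additive maps A, B the operators 1 - A B and 1 - B A have
  isomorphic kernels and cokernels. So a factor of the multiplier that is a Frobenius twist can be
  untwisted, and the product of the (t^(p^i) - theta^(p^i))^(n_i) becomes that of the (t^(p^i) -
  theta)^(n_i), a polynomial in theta whose degree is the digit sum s. Then the coefficient of
  theta^(-k) in the image of x involves x only at the indices (k + j)/p with j <= s. For s < p - 1
  they are smaller than k, and one solves recursively. For s >= p - 1 the coefficients of index up
  to s/(p - 1) satisfy a closed square system over F[t], and the degrees in t show that it has no
  solution for one explicit right-hand side. The other burden is that the separable closure is known
  only by a few axioms inside an abstract complete field: that it is a field, that its Galois group
  has fixed field K_inf and that this group acts by isometries must all be derived.\<close>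

definition fls_polys :: "'a::zero fls set" where
  "fls_polys = {x. \<forall>k>0. fls_nth x k = 0}"

lemma fls_polys_add: "x \<in> fls_polys \<Longrightarrow> y \<in> fls_polys \<Longrightarrow> x + y \<in> fls_polys" for x y :: "'a::comm_ring_1 fls"
  by (simp add: fls_polys_def)

lemma fls_polys_mult:
  fixes x y :: "'a::comm_ring_1 fls"
  assumes "x \<in> fls_polys" "y \<in> fls_polys" shows "x * y \<in> fls_polys"
  unfolding fls_polys_def
proof (intro CollectI allI impI)
  fix k :: int assume "k > 0"
  show "fls_nth (x * y) k = 0"
    unfolding fls_times_nth(1)
  proof (rule sum.neutral, rule ballI)
    fix i assume "i \<in> {fls_subdegree x + fls_subdegree y..k}"
    show "fls_nth x (i - fls_subdegree y) * fls_nth y (fls_subdegree y + k - i) = 0"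
      using assms \<open>k > 0\<close> unfolding fls_polys_def
      by (cases "i - fls_subdegree y > 0") auto
  qed
qed

lemma fls_polys_power: "x \<in> fls_polys \<Longrightarrow> x ^ m \<in> fls_polys" for x :: "'a::comm_ring_1 fls"
proof (induction m)
  case (Suc m)
  thus ?case by (auto intro: fls_polys_mult)
qed (simp add: fls_polys_def)

lemma fls_polys_prod: "(\<And>i. i \<in> I \<Longrightarrow> f i \<in> fls_polys) \<Longrightarrow> (\<Prod>i\<in>I. f i) \<in> fls_polys"
  for f :: "'i \<Rightarrow> 'a::comm_ring_1 fls"
proof (induction I rule: infinite_finite_induct)
  case (insert i I)
  thus ?case by (auto intro: fls_polys_mult)
qed (simp_all add: fls_polys_def)

lemma fls_polys_compose_power:
  assumes "x \<in> fls_polys" "d > 0" shows "fls_compose_power x d \<in> fls_polys"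
  using assms by (auto simp: fls_polys_def fls_nth_compose_power zero_less_mult_iff elim!: dvdE)

lemma fls_compose_power_prod:
  fixes f :: "'i \<Rightarrow> 'a::idom fls"
  assumes "d > 0"
  shows "fls_compose_power (\<Prod>i\<in>I. f i) d = (\<Prod>i\<in>I. fls_compose_power (f i) d)"
  by (induction I rule: infinite_finite_induct) (use assms in auto)

text \<open>Surjectivity and injectivity of \<open>x \<mapsto> x - P x(\<theta>\<^sup>p)\<close> on Laurent series in \<open>1/\<theta>\<close> modulo
  polynomials in \<open>\<theta>\<close>.\<close>

definition frob_surj :: "nat \<Rightarrow> 'a::idom fls \<Rightarrow> bool" where
  "frob_surj p P \<longleftrightarrow> (\<forall>y. \<exists>x. y - (x - P * fls_compose_power x p) \<in> fls_polys)"

definition frob_inj :: "nat \<Rightarrow> 'a::idom fls \<Rightarrow> bool" where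
  "frob_inj p P \<longleftrightarrow> (\<forall>x. x - P * fls_compose_power x p \<in> fls_polys \<longrightarrow> x \<in> fls_polys)"

text \<open>With A x = R tau(x) and B x = g x this is the principle that 1 - A B is onto iff 1 - B A
  is. Both maps preserve the polynomials, because R and g are polynomials, and therefore act on the
  quotient.\<close>

lemma frob_surj_rotate:
  fixes g R :: "'a::idom fls"
  assumes p: "p > 0" and g: "g \<in> fls_polys" and R: "R \<in> fls_polys"
  shows "frob_surj p (R * fls_compose_power g p) \<longleftrightarrow> frob_surj p (R * g)"
proof
  assume S: "frob_surj p (R * g)"
  show "frob_surj p (R * fls_compose_power g p)"
    unfolding frob_surj_def
  proof
    fix y
    obtain z where z: "g * y - (z - R * g * fls_compose_power z p) \<in> fls_polys"
      using S unfolding frob_surj_def by blast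
    \<comment> \<open>From (1 - B A) z = B y one gets (1 - A B)(y + A z) = y. The converse direction
      below uses the same identity with A and B exchanged.\<close>
    let ?x = "y + R * fls_compose_power z p"
    have "y - (?x - R * fls_compose_power g p * fls_compose_power ?x p)
       = R * fls_compose_power (g * y - (z - R * g * fls_compose_power z p)) p"
      using p by (simp add: algebra_simps)
    also have "\<dots> \<in> fls_polys"
      using z p R by (intro fls_polys_mult fls_polys_compose_power)
    finally show "\<exists>x. y - (x - R * fls_compose_power g p * fls_compose_power x p) \<in> fls_polys" ..
  qed
next
  assume S: "frob_surj p (R * fls_compose_power g p)"
  show "frob_surj p (R * g)"
    unfolding frob_surj_def
  proof
    fix y
    obtain x where x: "R * fls_compose_power y p
        - (x - R * fls_compose_power g p * fls_compose_power x p) \<in> fls_polys"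
      using S unfolding frob_surj_def by blast
    let ?z = "y + g * x"
    have "y - (?z - R * g * fls_compose_power ?z p)
       = g * (R * fls_compose_power y p - (x - R * fls_compose_power g p * fls_compose_power x p))"
      using p by (simp add: algebra_simps)
    also have "\<dots> \<in> fls_polys"
      using x g by (intro fls_polys_mult)
    finally show "\<exists>x. y - (x - R * g * fls_compose_power x p) \<in> fls_polys" ..
  qed
qed

text \<open>If x = A B x modulo polynomials, then B x = g x is fixed by B A, so it is a polynomial;
  hence so is A (B x), and x with it.\<close>

lemma frob_inj_rotate:
  fixes g R :: "'a::idom fls"
  assumes p: "p > 0" and g: "g \<in> fls_polys" and R: "R \<in> fls_polys"
    and I: "frob_inj p (R * g)"
  shows "frob_inj p (R * fls_compose_power g p)"
  unfolding frob_inj_def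
proof (intro allI impI)
  fix x assume x: "x - R * fls_compose_power g p * fls_compose_power x p \<in> fls_polys"
  have "g * x - R * g * fls_compose_power (g * x) p
      = g * (x - R * fls_compose_power g p * fls_compose_power x p)"
    using p by (simp add: algebra_simps)
  also have "\<dots> \<in> fls_polys" using g x by (rule fls_polys_mult)
  finally have "g * x \<in> fls_polys" using I unfolding frob_inj_def by blast
  hence "R * fls_compose_power (g * x) p \<in> fls_polys"
    using R p by (intro fls_polys_mult[OF R] fls_polys_compose_power)
  from fls_polys_add[OF x this] show "x \<in> fls_polys" using p by (simp add: algebra_simps)
qed

text \<open>The substitution of theta, which is \<open>fls_X_inv\<close>, for the variable. It is
  used with coefficients in F[t] for the multipliers and with coefficients in F for the elements of
  A.\<close>

definition eval_X_inv :: "'a::comm_ring_1 poly \<Rightarrow> 'a fls" where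
  "eval_X_inv P = poly (map_poly fls_const P) fls_X_inv"

lemma fls_X_inv_power_times_nth: "fls_nth (fls_X_inv ^ j * x) k = fls_nth x (k + int j)" for x :: "'a::comm_ring_1 fls"
  by (simp add: fls_X_inv_power_times_conv_shift)

lemma eval_X_inv_altdef:
  "eval_X_inv P = (\<Sum>j\<le>degree P. fls_const (coeff P j) * fls_X_inv ^ j)"
proof -
  have "degree (map_poly fls_const P) = degree P"
    by (rule degree_map_poly) auto
  thus ?thesis by (simp add: eval_X_inv_def poly_altdef coeff_map_poly)
qed

lemma eval_X_inv_times_nth:
  "fls_nth (eval_X_inv P * x) k = (\<Sum>j\<le>degree P. coeff P j * fls_nth x (k + int j))"
  by (simp add: eval_X_inv_altdef sum_distrib_right fls_nth_sum mult.assoc fls_X_inv_power_times_nth)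

lemma eval_X_inv_nth: "fls_nth (eval_X_inv P) k = (if k \<le> 0 then coeff P (nat (- k)) else 0)"
proof -
  have "fls_nth (eval_X_inv P) k = (\<Sum>j\<le>degree P. if j = nat (- k) \<and> k \<le> 0 then coeff P j else 0)"
    using eval_X_inv_times_nth[of P 1 k] by (auto intro!: sum.cong)
  also have "\<dots> = (if k \<le> 0 then coeff P (nat (- k)) else 0)"
    by (auto simp: sum.delta coeff_eq_0 not_le)
  finally show ?thesis .
qed

lemma eval_X_inv_hom:
  fixes P Q :: "'a::comm_ring_1 poly"
  shows
  "eval_X_inv (P * Q) = eval_X_inv P * eval_X_inv Q"
  "eval_X_inv (P ^ m) = eval_X_inv P ^ m"
  "eval_X_inv (1 :: 'a poly) = 1"
proof -
  interpret h: map_poly_comm_ring_hom "fls_const :: 'a \<Rightarrow> 'a fls"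
    by unfold_locales (auto simp: fls_plus_const)
  show "eval_X_inv (P * Q) = eval_X_inv P * eval_X_inv Q" "eval_X_inv (P ^ m) = eval_X_inv P ^ m"
    "eval_X_inv (1 :: 'a poly) = 1"
    by (simp_all add: eval_X_inv_def h.hom_mult h.hom_power poly_power)
qed

lemma eval_X_inv_prod: "eval_X_inv (\<Prod>i\<in>I. f i) = (\<Prod>i\<in>I. eval_X_inv (f i))"
  by (induction I rule: infinite_finite_induct) (auto simp: eval_X_inv_hom)

lemma eval_X_inv_pCons: "eval_X_inv (pCons a P) = fls_const a + fls_X_inv * eval_X_inv P"
  by (cases "a = 0 \<and> P = 0") (auto simp: eval_X_inv_def map_poly_pCons)

text \<open>This describes the infinite matrix of x \<mapsto> P tau(x): row k meets column m in the
  coefficient of P of index p m - k.\<close>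

lemma frob_nth:
  fixes x :: "'a::idom fls"
  assumes "p > 0"
  shows "fls_nth (eval_X_inv P * fls_compose_power x p) k =
    (\<Sum>j\<le>degree P. if int p dvd k + int j then coeff P j * fls_nth x ((k + int j) div int p) else 0)"
  using assms by (auto simp: eval_X_inv_times_nth fls_nth_compose_power intro!: sum.cong)

section \<open>Newton polygons of polynomials with polynomial coefficients\<close>

lemma poly_sum_dominant:
  fixes f :: "'i \<Rightarrow> 'a::comm_ring_1 poly"
  assumes I: "finite I" "i0 \<in> I" and f0: "f i0 \<noteq> 0"
    and dom: "\<And>i. i \<in> I \<Longrightarrow> i \<noteq> i0 \<Longrightarrow> f i = 0 \<or> degree (f i) < degree (f i0)"
  shows "sum f I \<noteq> 0" "degree (sum f I) = degree (f i0)"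
proof -
  have c: "coeff (f i) k = 0" if "i \<in> I" "i \<noteq> i0" "k \<ge> degree (f i0)" for i k
    using dom[OF that(1,2)] that(3) by (auto intro: coeff_eq_0)
  have lead: "coeff (sum f I) (degree (f i0)) = lead_coeff (f i0)"
    using I c by (subst coeff_sum, subst sum.remove[of _ i0]) auto
  thus "sum f I \<noteq> 0" using f0 by auto
  have "coeff (sum f I) k = 0" if "k > degree (f i0)" for k
    unfolding coeff_sum
  proof (rule sum.neutral, rule ballI)
    fix i assume "i \<in> I"
    thus "coeff (f i) k = 0" using c[of i k] that by (cases "i = i0") (auto intro: coeff_eq_0)
  qed
  hence "degree (sum f I) \<le> degree (f i0)" by (intro degree_le) auto
  moreover have "degree (sum f I) \<ge> degree (f i0)"
    using lead f0 by (intro le_degree) auto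
  ultimately show "degree (sum f I) = degree (f i0)" by simp
qed

lemma sum_list_drop_split:
  fixes us :: "nat list"
  assumes "a + b \<le> length us"
  shows "sum_list (drop a us) = (\<Sum>i<b. us ! (a + i)) + sum_list (drop (a + b) us)"
  using assms
proof (induction b)
  case (Suc b)
  have "drop (a + b) us = us ! (a + b) # drop (Suc (a + b)) us"
    using Suc.prems by (intro Cons_nth_drop_Suc[symmetric]) simp
  with Suc show ?case by simp
qed simp

text \<open>For \<open>us\<close> in increasing order this says that the Newton polygon of \<open>P\<close> with respect to the degree
  of the coefficients has the slopes \<open>us\<close>, and that all coefficients lie on it.\<close>

definition newton_slopes :: "'a::zero poly poly \<Rightarrow> nat list \<Rightarrow> bool" where
  "newton_slopes P us \<longleftrightarrow> degree P = length us \<and>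
     (\<forall>j\<le>length us. coeff P j \<noteq> 0 \<and> degree (coeff P j) = sum_list (drop j us))"

text \<open>The dominating term in the coefficient of index j takes its powers of the variable from
  the block as far as possible, that is i = \<open>min a j\<close>: each of them costs degree v
  there, but a larger slope in P. The binomial condition keeps all coefficients of the block
  different from 0.\<close>

lemma newton_slopes_mult_block:
  fixes P :: "'a::idom poly poly"
  assumes P: "newton_slopes P us" and us: "\<forall>u\<in>set us. v < u"
    and binom: "\<And>i. i \<le> a \<Longrightarrow> of_nat (a choose i) \<noteq> (0 :: 'a)"
  shows "newton_slopes ([:monom 1 v, - 1:] ^ a * P) (replicate a v @ us)"
proof -
  let ?A = "[:monom 1 v, - 1:] ^ a :: 'a poly poly"
  let ?S = "\<lambda>j. sum_list (drop j us)"
  have degP: "degree P = length us" and P0: "P \<noteq> 0"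
    and coP: "\<And>j. j \<le> length us \<Longrightarrow> coeff P j \<noteq> 0 \<and> degree (coeff P j) = ?S j"
    using P by (auto simp: newton_slopes_def)
  have degA: "degree ?A = a" by (simp add: degree_power_eq)
  have coA: "coeff ?A i = smult (of_nat (a choose i) * (- 1) ^ i) (monom 1 (v * (a - i)))" if "i \<le> a" for i
    using that by (subst coeff_linear_poly_power)
      (auto simp: monom_power of_nat_poly minus_one_power_iff)
  have coA': "coeff ?A i \<noteq> 0 \<and> degree (coeff ?A i) = v * (a - i)" if "i \<le> a" for i
    using coA[OF that] binom[OF that] by (simp add: degree_monom_eq)
  have S: "?S k > v * m + ?S (k + m)" if "m > 0" "k + m \<le> length us" for k m
  proof -
    have "(\<Sum>i<m. us ! (k + i)) > (\<Sum>i<m. v)"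
      using that us by (intro sum_strict_mono) auto
    hence "(\<Sum>i<m. us ! (k + i)) > v * m" by (simp add: mult.commute)
    thus ?thesis using sum_list_drop_split[OF that(2)] by simp
  qed
  have degM: "degree (?A * P) = length (replicate a v @ us)"
    using P0 degA degP by (subst degree_mult_eq) auto
  have "coeff (?A * P) j \<noteq> 0 \<and> degree (coeff (?A * P) j) = sum_list (drop j (replicate a v @ us))"
    if j: "j \<le> length (replicate a v @ us)" for j
  proof -
    let ?f = "\<lambda>i. coeff ?A i * coeff P (j - i)"
    let ?m = "min a j"
    have le: "j - ?m \<le> length us" using j by auto
    have fm: "?f ?m \<noteq> 0" using coA'[of ?m] coP[OF le] by auto
    have dm: "degree (?f ?m) = v * (a - ?m) + ?S (j - ?m)"
      using coA'[of ?m] coP[OF le] by (subst degree_mult_eq) auto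
    have dom: "?f i = 0 \<or> degree (?f i) < degree (?f ?m)" if "i \<in> {..j}" "i \<noteq> ?m" for i
    proof (cases "i \<le> a \<and> j - i \<le> length us")
      case True
      hence "degree (?f i) = v * (a - i) + ?S (j - i)"
        using coA'[of i] coP[of "j - i"] by (subst degree_mult_eq) auto
      moreover have "?S (j - ?m) > v * (?m - i) + ?S (j - ?m + (?m - i))"
        using True that by (intro S) auto
      moreover have "j - ?m + (?m - i) = j - i" using True that by auto
      moreover have "v * (a - i) = v * (a - ?m) + v * (?m - i)"
        using True that by (auto simp flip: distrib_left)
      ultimately show ?thesis using dm by simp
    next
      case False
      hence "coeff ?A i = 0 \<or> coeff P (j - i) = 0"
        using degA degP by (auto intro!: coeff_eq_0)
      thus ?thesis by auto
    qed
    have eq: "coeff (?A * P) j = sum ?f {..j}" by (simp add: coeff_mult)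
    have "v * (a - ?m) + ?S (j - ?m) = sum_list (drop j (replicate a v @ us))"
      by (auto simp: sum_list_replicate min_def)
    with poly_sum_dominant[of "{..j}" ?m ?f, OF _ _ fm dom] dm show ?thesis
      unfolding eq by simp
  qed
  thus ?thesis unfolding newton_slopes_def using degM by simp
qed

text \<open>The substitution is k + j = p m. The bound on l makes the unknowns of index 1 to R a
  closed system: k <= R and j <= l give p m < p (R + 1).\<close>

lemma sum_reindex_frob:
  fixes c w :: "nat \<Rightarrow> 'a::comm_ring_1" and x :: "int \<Rightarrow> 'a"
  assumes p: "p \<ge> 2" and k: "k \<ge> 1" "k \<le> R" and R: "l < (p - 1) * (R + 1)"
    and c: "\<And>j. j > l \<Longrightarrow> c j = 0"
  shows "(\<Sum>j\<le>l. if int p dvd int k + int j then c j * x ((int k + int j) div int p) else 0) =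
    (\<Sum>m\<in>{1..R}. (if k \<le> p * m then c (p * m - k) else 0) * x (int m))"
proof -
  let ?S = "{j. j \<le> l \<and> p dvd k + j}" and ?T = "{m\<in>{1..R}. k \<le> p * m \<and> p * m - k \<le> l}"
  have dvd: "int p dvd int k + int j \<longleftrightarrow> p dvd k + j" for j by (metis of_nat_add of_nat_dvd_iff)
  have "(\<Sum>j\<le>l. if int p dvd int k + int j then c j * x ((int k + int j) div int p) else 0) =
     (\<Sum>j\<in>?S. c j * x (int ((k + j) div p)))"
    unfolding dvd by (rule sum.mono_neutral_cong_right) (auto simp: zdiv_int)
  also have "\<dots> = (\<Sum>m\<in>?T. c (p * m - k) * x (int m))"
  proof (rule sum.reindex_bij_witness[of _ "\<lambda>m. p * m - k" "\<lambda>j. (k + j) div p"])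
    fix j assume "j \<in> ?S"
    then obtain m where m: "k + j = p * m" and jl: "j \<le> l" by (auto elim: dvdE)
    have "p * m < p * (R + 1)"
    proof -
      have "p * m \<le> R + l" using m jl k by simp
      also have "\<dots> < R + (p - 1) * (R + 1)" using R by simp
      also have "\<dots> < p * (R + 1)" using p by (cases p) (auto simp: algebra_simps)
      finally show ?thesis .
    qed
    hence "m \<le> R" using p by (subst (asm) mult_less_cancel1) auto
    moreover have "m \<ge> 1" using m k by (cases m) auto
    moreover have "(k + j) div p = m" "p * m - k = j"
      using p by (subst m, simp) (simp flip: m)
    ultimately show "(k + j) div p \<in> ?T" "p * ((k + j) div p) - k = j"
        "c (p * ((k + j) div p) - k) * x (int ((k + j) div p)) = c j * x (int ((k + j) div p))"
      using m jl by simp_all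
  qed (use p in auto)
  also have "\<dots> = (\<Sum>m\<in>{1..R}. (if k \<le> p * m then c (p * m - k) else 0) * x (int m))"
    by (rule sum.mono_neutral_cong_left) (use c in \<open>auto simp: not_le[symmetric]\<close>)
  finally show ?thesis .
qed

text \<open>For j < p - 1 <= (p - 1) k the index (k + j)/p is smaller than k. Modulo polynomials the
  map x \<mapsto> P tau(x) is therefore strictly triangular, and the coefficients of positive index
  are determined one after the other.\<close>

lemma frob_contraction:
  fixes P :: "'a::idom poly"
  assumes p: "p \<ge> 2" and d: "degree P < p - 1"
  shows "frob_surj p (eval_X_inv P)" "frob_inj p (eval_X_inv P)"
proof -
  have lt: "(k + j) div p < k" if "j \<le> degree P" "k > 0" for j k
  proof -
    have "k + j < k + (p - 1)" using d that by simp
    also have "\<dots> \<le> p * k"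
      using p that by (cases p; cases k) (auto simp: algebra_simps)
    finally show ?thesis by (simp add: less_mult_imp_div_less mult.commute)
  qed
  have pos: "(k + j) div p > 0" if "p dvd k + j" "k > 0" for j k
    using that p by (auto elim!: dvdE intro: Nat.gr0I)
  have dvd: "int p dvd int k + int j \<longleftrightarrow> p dvd k + j" for j k by (metis of_nat_add of_nat_dvd_iff)
  have nth: "fls_nth (eval_X_inv P * fls_compose_power x p) (int k) =
      (\<Sum>j\<le>degree P. if p dvd k + j then coeff P j * fls_nth x (int ((k + j) div p)) else 0)" for x k
    using p by (subst frob_nth) (auto simp: dvd zdiv_int intro!: sum.cong)
  show "frob_inj p (eval_X_inv P)"
    unfolding frob_inj_def
  proof (intro allI impI)
    fix x assume x: "x - eval_X_inv P * fls_compose_power x p \<in> fls_polys"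
    have "k > 0 \<Longrightarrow> fls_nth x (int k) = 0" for k :: nat
    proof (induction k rule: less_induct)
      case (less k)
      have "fls_nth x (int k) = fls_nth (eval_X_inv P * fls_compose_power x p) (int k)"
        using x less.prems by (auto simp: fls_polys_def)
      also have "\<dots> = 0"
        unfolding nth using lt pos less by (intro sum.neutral) auto
      finally show ?case .
    qed
    thus "x \<in> fls_polys" by (auto simp: fls_polys_def) (metis of_nat_0_less_iff pos_int_cases)
  qed
  show "frob_surj p (eval_X_inv P)"
    unfolding frob_surj_def
  proof
    fix y :: "'a fls"
    define rec where "rec = (\<lambda>(f :: nat \<Rightarrow> 'a) k. fls_nth y (int k) +
       (\<Sum>j\<le>degree P. if p dvd k + j then coeff P j * f ((k + j) div p) else 0))"
    \<comment> \<open>Coefficients of nonpositive index are free, being absorbed by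
      \<open>fls_polys\<close>, and are chosen to be 0.\<close>
    define xs where "xs = wfrec less_than (\<lambda>f k. if k = 0 then 0 else rec f k)"
    have xs: "xs k = rec xs k" if "k > 0" for k
    proof -
      have "xs k = rec (cut xs less_than k) k"
        unfolding xs_def using that by (subst wfrec) auto
      also have "\<dots> = rec xs k"
        unfolding rec_def using lt that by (intro arg_cong2[where f = "(+)"] sum.cong) (auto simp: cut_def)
      finally show ?thesis .
    qed
    have xs0: "xs 0 = 0" unfolding xs_def by (subst wfrec) auto
    let ?x = "fps_to_fls (Abs_fps xs)"
    have x: "fls_nth ?x (int k) = xs k" for k by simp
    have "fls_nth (y - (?x - eval_X_inv P * fls_compose_power ?x p)) (int k) = 0" if "k > 0" for k
    proof -
      have "fls_nth (eval_X_inv P * fls_compose_power ?x p) (int k) =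
        (\<Sum>j\<le>degree P. if p dvd k + j then coeff P j * xs ((k + j) div p) else 0)"
        unfolding nth x ..
      thus ?thesis using xs[OF that] that by (simp add: rec_def)
    qed
    hence "y - (?x - eval_X_inv P * fls_compose_power ?x p) \<in> fls_polys"
      unfolding fls_polys_def mem_Collect_eq by (metis of_nat_0_less_iff pos_int_cases)
    thus "\<exists>x. y - (x - eval_X_inv P * fls_compose_power x p) \<in> fls_polys" ..
  qed
qed

text \<open>The weights \<open>\<alpha>\<close> make the matrix of \<open>x \<mapsto> P x(\<theta>\<^sup>p)\<close> triangular with respect to leading terms.\<close>

lemma not_frob_surj:
  fixes P :: "'a::idom poly poly"
  assumes p: "p \<ge> 2" and P: "newton_slopes P us" and srt: "sorted us"
    and pos: "\<forall>u\<in>set us. u > 0"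
    and gap: "\<And>i. i + (p - 1) < length us \<Longrightarrow> us ! i < us ! (i + (p - 1))"
    and len: "length us \<ge> p - 1"
    and lead: "(p - 1) dvd length us \<Longrightarrow> lead_coeff P = 1"
  shows "\<not> frob_surj p (eval_X_inv P)"
proof
  assume surj: "frob_surj p (eval_X_inv P)"
  define l where "l = length us"
  \<comment> \<open>R is the last index whose diagonal entry, the coefficient of P of index (p - 1)
    R, can be nonzero.\<close>
  define R where "R = l div (p - 1)"
  have R1: "R \<ge> 1" using len p by (simp add: R_def l_def Suc_leI div_greater_zero_iff)
  have Rl: "(p - 1) * R \<le> l" by (simp add: R_def)
  have lR: "l < (p - 1) * (R + 1)"
    using p dividend_less_times_div[of "p - 1" l] by (simp add: R_def)
  have deg: "degree P = l" and co: "\<And>j. j \<le> l \<Longrightarrow> coeff P j \<noteq> 0 \<and> degree (coeff P j) = sum_list (drop j us)"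
    using P by (auto simp: newton_slopes_def l_def)
  have co0: "coeff P j = 0" if "j > l" for j using that deg by (simp add: coeff_eq_0)
  \<comment> \<open>The element shown to be missed is theta^(-R): its coordinates form the last unit
    vector of the finite system.\<close>
  obtain x where x: "fls_X ^ R - (x - eval_X_inv P * fls_compose_power x p) \<in> fls_polys"
    using surj unfolding frob_surj_def by blast
  define c where "c = (\<lambda>k m. if k \<le> p * m then coeff P (p * m - k) else 0)"
  define w where "w = (\<lambda>m. fls_nth x (int m))"
  have eq: "w k - (\<Sum>m\<in>{1..R}. c k m * w m) = (if k = R then 1 else 0)" if k: "k \<in> {1..R}" for k
  proof -
    have "fls_nth (fls_X ^ R - (x - eval_X_inv P * fls_compose_power x p)) (int k) = 0"
      proof -
      have "int k > 0" using k by simp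
      thus ?thesis using x unfolding fls_polys_def by blast
    qed
    moreover have "fls_nth (eval_X_inv P * fls_compose_power x p) (int k) = (\<Sum>m\<in>{1..R}. c k m * w m)"
    proof -
      have p0: "p > 0" and k': "1 \<le> k" "k \<le> R" using p k by auto
      show ?thesis
        unfolding frob_nth[OF p0] deg c_def w_def
        by (rule sum_reindex_frob[OF p k' lR co0])
    qed
    moreover have "fls_nth (fls_X ^ R :: 'a poly fls) (int k) = (if k = R then 1 else 0)"
      by simp
    ultimately show ?thesis by (simp add: w_def algebra_simps split: if_splits)
  qed
  \<comment> \<open>If (p - 1) R = l, the diagonal entry in the last column is the leading
    coefficient 1 and the other entries there vanish, so the unknown of index R cancels from every
    equation and may be replaced by 0. All indices that then carry a nonzero unknown have a diagonal
    entry of positive degree.\<close>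
  define w' where "w' = (\<lambda>m. if (p - 1) * m = l then 0 else w m)"
  have w'R: "m = R" if "(p - 1) * m = l" for m
  proof -
    have "p - 1 \<noteq> 0" using p by simp
    thus ?thesis unfolding R_def that[symmetric] by (metis nonzero_mult_div_cancel_left)
  qed
  have eq': "w' k - (\<Sum>m\<in>{1..R}. c k m * w' m) = (if k = R then 1 else 0)" if k: "k \<in> {1..R}" for k
  proof (cases "(p - 1) * R = l")
    case False
    hence "w' = w" unfolding w'_def using w'R by (intro ext) metis
    thus ?thesis using eq[OF k] by simp
  next
    case True
    have ww: "w' m = (if m = R then 0 else w m)" for m
    proof (cases "m = R")
      case True
      thus ?thesis using \<open>(p - 1) * R = l\<close> by (simp add: w'_def)
    next
      case False
      thus ?thesis using w'R[of m] unfolding w'_def by presburger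
    qed
    have pR: "p * R = l + R" using p unfolding True[symmetric] by (cases p) auto
    have Pl: "coeff P l = 1"
      using lead dvdI[OF True[symmetric]] deg unfolding l_def by simp
    have cR: "c k R = (if k = R then 1 else 0)"
    proof (cases "k = R")
      case True
      thus ?thesis unfolding c_def pR using Pl by simp
    next
      case False
      hence "l + R - k > l" using k by auto
      thus ?thesis unfolding c_def pR using False co0 by simp
    qed
    have split: "(\<Sum>m\<in>{1..R}. c k m * v m) = c k R * v R + (\<Sum>m\<in>{1..R} - {R}. c k m * v m)" for v
      using R1 by (intro sum.remove) auto
    have "(\<Sum>m\<in>{1..R} - {R}. c k m * w' m) = (\<Sum>m\<in>{1..R} - {R}. c k m * w m)"
      by (intro sum.cong) (auto simp: ww)
    moreover have "w' R = 0" by (simp add: ww)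
    ultimately have *: "(\<Sum>m\<in>{1..R}. c k m * w' m) = (\<Sum>m\<in>{1..R}. c k m * w m) - c k R * w R"
      unfolding split by simp
    have wk: "w' k = (if k = R then 0 else w k)" by (rule ww)
    show ?thesis
      using eq[OF k] unfolding * cR wk by (cases "k = R") simp_all
  qed
  define S where "S = (\<lambda>j. int (sum_list (drop j us)))"
  \<comment> \<open>Comparing \<open>S (p * m - m0)\<close> with \<open>S ((p - 1) * m)\<close>
    leaves a run of |m - m0| consecutive slopes. The weight sets against it equally many slopes that
    are p - 1 places apart.\<close>
  define \<alpha> where "\<alpha> = (\<lambda>k. \<Sum>i<k. int (us ! ((p - 1) * i)))"
  define h where "h = (\<lambda>m. int (degree (w' m)) + S ((p - 1) * m) - \<alpha> m)"
  define I where "I = {m\<in>{1..R}. w' m \<noteq> 0}"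
  have "w' R - (\<Sum>m\<in>{1..R}. c R m * w' m) = 1" using eq'[of R] R1 by simp
  moreover have "(\<Sum>m\<in>{1..R}. c R m * w' m) = 0" "w' R = 0" if "I = {}"
    using that R1 by (auto simp: I_def)
  ultimately have "I \<noteq> {}" by auto
  moreover have finI: "finite I" by (simp add: I_def)
  ultimately have Hin: "Max (h ` I) \<in> h ` I" by (intro Max_in) auto
  \<comment> \<open>Among the unknowns of maximal weighted degree, the one of least index is taken.
    Larger indices lose strictly by the gap hypothesis; for smaller ones the slopes give only a weak
    inequality, and the minimality of \<open>m0\<close> supplies the strictness.\<close>
  define m0 where "m0 = Min {m \<in> I. h m = Max (h ` I)}"
  have "m0 \<in> {m \<in> I. h m = Max (h ` I)}" unfolding m0_def using Hin finI by (intro Min_in) auto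
  hence m0: "m0 \<in> I" and hm0: "h m0 = Max (h ` I)" by auto
  have hle: "h m \<le> h m0" if "m \<in> I" for m using that finI hm0 by simp
  have hlt: "h m < h m0" if "m \<in> I" "m < m0" for m
  proof (rule ccontr)
    assume "\<not> ?thesis"
    hence "m \<in> {m \<in> I. h m = Max (h ` I)}" using hle[OF that(1)] that hm0 by auto
    hence "m0 \<le> m" unfolding m0_def using finI by (intro Min_le) auto
    thus False using that by simp
  qed
  have IR: "1 \<le> m" "m \<le> R" "(p - 1) * m < l" if "m \<in> I" for m
  proof -
    show "1 \<le> m" "m \<le> R" using that by (auto simp: I_def)
    hence "(p - 1) * m \<le> l" using Rl by (meson le_trans mult_le_mono2)
    moreover have "(p - 1) * m \<noteq> l" using that by (auto simp: I_def w'_def)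
    ultimately show "(p - 1) * m < l" by simp
  qed
  have S_split: "S a = int (\<Sum>i<b. us ! (a + i)) + S (a + b)" if "a + b \<le> l" for a b
    unfolding S_def using sum_list_drop_split[of a b us] that by (simp add: l_def)
  have mono: "us ! i \<le> us ! j" if "i \<le> j" "j < l" for i j
    using srt that by (simp add: l_def sorted_nth_mono)
  have ineq1: "S (p * m - m0) < S ((p - 1) * m) + \<alpha> m0 - \<alpha> m"
    if m: "m \<in> I" "m0 < m" "p * m - m0 \<le> l" for m
  proof -
    define d where "d = m - m0"
    have d: "d > 0" "m = m0 + d" using m by (auto simp: d_def)
    have pm: "p * m - m0 = (p - 1) * m + d" using d p by (cases p) auto
    have "S ((p - 1) * m) = int (\<Sum>i<d. us ! ((p - 1) * m + i)) + S (p * m - m0)"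
      unfolding pm using m pm by (intro S_split) simp
    moreover have "\<alpha> m = \<alpha> m0 + int (\<Sum>i<d. us ! ((p - 1) * (m0 + i)))"
      unfolding \<alpha>_def d(2) by (induction d) auto
    moreover have "(\<Sum>i<d. us ! ((p - 1) * (m0 + i))) < (\<Sum>i<d. us ! ((p - 1) * m + i))"
    proof (rule sum_strict_mono)
      fix i assume i: "i \<in> {..<d}"
      have "m0 + i + 1 \<le> m" using i d by simp
      hence "(p - 1) * (m0 + i + 1) \<le> (p - 1) * m" by (rule mult_le_mono2)
      hence le: "(p - 1) * (m0 + i) + (p - 1) \<le> (p - 1) * m + i" by (simp add: algebra_simps)
      have lt: "(p - 1) * m + i < l" using i m pm by simp
      have "us ! ((p - 1) * (m0 + i)) < us ! ((p - 1) * (m0 + i) + (p - 1))"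
        using le lt by (intro gap) (simp add: l_def)
      also have "\<dots> \<le> us ! ((p - 1) * m + i)" using le lt by (rule mono)
      finally show "us ! ((p - 1) * (m0 + i)) < us ! ((p - 1) * m + i)" .
    qed (use d in auto)
    ultimately show ?thesis by linarith
  qed
  have ineq2: "S (p * m - m0) \<le> S ((p - 1) * m) + \<alpha> m0 - \<alpha> m"
    if m: "m \<in> I" "m < m0" "m0 \<le> p * m" for m
  proof -
    define d where "d = m0 - m"
    have d: "d > 0" "m0 = m + d" using m by (auto simp: d_def)
    have pm: "(p * m - m0) + d = (p - 1) * m" using d p m by (cases p) auto
    have "S (p * m - m0) = int (\<Sum>i<d. us ! ((p * m - m0) + i)) + S ((p - 1) * m)"
      unfolding pm[symmetric] using IR[OF m(1)] pm by (intro S_split) simp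
    moreover have "\<alpha> m0 = \<alpha> m + int (\<Sum>i<d. us ! ((p - 1) * (m + i)))"
      unfolding \<alpha>_def d(2) by (induction d) auto
    moreover have "(\<Sum>i<d. us ! ((p * m - m0) + i)) \<le> (\<Sum>i<d. us ! ((p - 1) * (m + i)))"
    proof (rule sum_mono)
      fix i assume i: "i \<in> {..<d}"
      have "(p * m - m0) + i \<le> (p - 1) * m" using pm i by simp
      also have "\<dots> \<le> (p - 1) * (m + i)" by simp
      finally have "(p * m - m0) + i \<le> (p - 1) * (m + i)" .
      moreover have "(p - 1) * (m + i) < l"
      proof -
        have "(p - 1) * (m + i) \<le> (p - 1) * m0" using i d by (intro mult_le_mono2) simp
        thus ?thesis using IR(3)[OF m0] by (rule le_less_trans)
      qed
      ultimately show "us ! ((p * m - m0) + i) \<le> us ! ((p - 1) * (m + i))"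
        by (intro mono)
    qed
    ultimately show ?thesis by linarith
  qed
  let ?f = "\<lambda>m. c m0 m * w' m"
  have c_diag: "c m0 m0 = coeff P ((p - 1) * m0)" using p by (simp add: c_def diff_mult_distrib)
  have f0: "?f m0 \<noteq> 0" using co[of "(p - 1) * m0"] IR[OF m0] m0 by (simp add: c_diag I_def)
  have df0: "int (degree (?f m0)) = h m0 + \<alpha> m0"
    using co[of "(p - 1) * m0"] IR[OF m0] m0
    by (subst degree_mult_eq) (auto simp: c_diag I_def h_def S_def)
  have dom: "?f m = 0 \<or> degree (?f m) < degree (?f m0)" if m: "m \<in> {1..R}" "m \<noteq> m0" for m
  proof (cases "m \<in> I \<and> m0 \<le> p * m \<and> p * m - m0 \<le> l")
    case False
    thus ?thesis using m co0 by (auto simp: I_def c_def not_le)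
  next
    case True
    hence mI: "m \<in> I" by simp
    have "int (degree (?f m)) = S (p * m - m0) + int (degree (w' m))"
      using co[of "p * m - m0"] True by (subst degree_mult_eq) (auto simp: c_def I_def S_def)
    also have "\<dots> < h m0 + \<alpha> m0"
    proof (cases "m0 < m")
      case True
      thus ?thesis using ineq1[OF mI] hle[OF mI] \<open>m \<in> I \<and> _\<close> by (auto simp: h_def)
    next
      case False
      hence "m < m0" using m by simp
      thus ?thesis using ineq2[OF mI] hlt[OF mI] \<open>m \<in> I \<and> _\<close> by (auto simp: h_def)
    qed
    finally show ?thesis using df0 by simp
  qed
  have m0in: "m0 \<in> {1..R}" using m0 by (simp add: I_def)
  note * = poly_sum_dominant[of "{1..R}" m0 ?f, OF _ m0in f0 dom]
  have "0 < sum_list (drop ((p - 1) * m0) us)"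
  proof -
    have "drop ((p - 1) * m0) us = us ! ((p - 1) * m0) # drop (Suc ((p - 1) * m0)) us"
      using IR[OF m0] by (intro Cons_nth_drop_Suc[symmetric]) (simp add: l_def)
    moreover have "us ! ((p - 1) * m0) > 0" using pos IR[OF m0] by (simp add: l_def)
    ultimately show ?thesis by simp
  qed
  hence S0: "S ((p - 1) * m0) > 0" by (simp add: S_def)
  \<comment> \<open>In row \<open>m0\<close> the diagonal term cannot be cancelled, so the sum has
    degree \<open>degree (w' m0)\<close> plus a positive number; by the equation it has degree at
    most \<open>degree (w' m0)\<close>.\<close>
  have "(\<Sum>m\<in>{1..R}. ?f m) = w' m0 - (if m0 = R then 1 else 0)"
    using eq'[OF m0in] by (simp add: algebra_simps)
  hence "degree (\<Sum>m\<in>{1..R}. ?f m) \<le> degree (w' m0)"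
    by (auto intro: degree_diff_le)
  hence "int (degree (?f m0)) \<le> int (degree (w' m0))" using * by simp
  thus False using df0 S0 by (simp add: h_def)
qed

section \<open>Digits in base p, finite fields and the slopes of the digit product\<close>

lemma sum_digits_lt: "(\<Sum>i<L. n div b ^ i mod b * b ^ i) = n mod b ^ L" for n b :: nat
proof (induction L)
  case (Suc L)
  have "n mod b ^ Suc L = b ^ L * (n div b ^ L mod b) + n mod b ^ L"
    by (simp only: power_Suc2 mod_mult2_eq)
  with Suc show ?case by (simp add: mult.commute)
qed simp

lemma sum_digits: "b \<ge> 2 \<Longrightarrow> (\<Sum>i\<le>n. n div b ^ i mod b * b ^ i) = n" for n b :: nat
proof -
  assume b: "b \<ge> 2"
  have "n < 2 ^ Suc n" by (meson less_exp lessI less_trans)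
  also have "2 ^ Suc n \<le> b ^ Suc n" using b by (rule power_mono) simp
  finally show ?thesis using sum_digits_lt[where b = b and n = n and L = "Suc n"] by (simp add: lessThan_Suc_atMost)
qed

text \<open>Multiplication by a nonzero x permutes the nonzero elements, so comparing their product
  before and after shows that x to the number of these elements is 1.\<close>

lemma finite_field_power_card: "x ^ CARD('f) = x" for x :: "'f::{finite,field}"
proof (cases "x = 0")
  case False
  have "bij_betw ((*) x) (UNIV - {0}) (UNIV - {0})"
    using False by (intro bij_betwI[of _ _ _ "\<lambda>y. y / x"]) auto
  hence "(\<Prod>y\<in>UNIV - {0}. x * y) = (\<Prod>y\<in>UNIV - {0}. y)"
    by (rule prod.reindex_bij_betw)
  moreover have "(\<Prod>y\<in>UNIV - {0 :: 'f}. y) \<noteq> 0" by simp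
  ultimately have *: "x ^ card (UNIV - {0 :: 'f}) = 1"
    unfolding prod.distrib prod_constant using mult_right_cancel[of _ "x ^ card (UNIV - {0 :: 'f})" 1]
    by (metis mult_1)
  have "CARD('f) = Suc (card (UNIV - {0 :: 'f}))"
    by (rule card.remove) auto
  thus ?thesis by (simp only: power_Suc * mult_1_right)
next
  case True
  have "CARD('f) > 0" by (simp add: card_gt_0_iff)
  thus ?thesis using True by simp
qed

text \<open>Translation by 1 permutes the field; the sum over all elements then shows that the
  cardinality is 0 in it.\<close>

lemma CHAR_of_prime_card:
  assumes "prime CARD('f::{finite,field})" shows "CHAR('f) = CARD('f)"
proof -
  have "(\<Sum>x\<in>UNIV. x + 1) = (\<Sum>x\<in>UNIV. x :: 'f)"
    by (rule sum.reindex_bij_witness[of _ "\<lambda>x. x - 1" "\<lambda>x. x + 1"]) auto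
  hence "of_nat CARD('f) = (0 :: 'f)" by (simp add: sum.distrib)
  hence "CHAR('f) dvd CARD('f)" by (simp add: of_nat_eq_0_iff_char_dvd)
  moreover have "CHAR('f) \<noteq> 1" by simp
  ultimately show ?thesis using assms by (auto simp: prime_nat_iff)
qed

text \<open>The binomial coefficient divides a!, which is prime to p because a < p. This is why the
  exponents of the blocks must be digits.\<close>

lemma of_nat_choose_nonzero:
  assumes "prime p" "CHAR('a::idom) = p" "a < p" "i \<le> a"
  shows "of_nat (a choose i) \<noteq> (0 :: 'a)"
proof
  assume "of_nat (a choose i) = (0 :: 'a)"
  hence "p dvd (a choose i)" using assms by (simp add: of_nat_eq_0_iff_char_dvd)
  hence "p dvd fact i * fact (a - i) * (a choose i)" by simp
  hence "p dvd fact a" using binomial_fact_lemma[OF assms(4)] by simp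
  thus False using assms prime_dvd_fact_iff[of p a] by simp
qed

text \<open>These are the Newton slopes of the product of the (t^(p^i) - theta)^(a i), regarded as a
  polynomial in theta.\<close>

definition digit_list :: "nat \<Rightarrow> (nat \<Rightarrow> nat) \<Rightarrow> nat \<Rightarrow> nat \<Rightarrow> nat list" where
  "digit_list p a m N = concat (map (\<lambda>i. replicate (a i) (p ^ i)) [m..<N])"

lemma digit_list_rec: "m < N \<Longrightarrow> digit_list p a m N = replicate (a m) (p ^ m) @ digit_list p a (Suc m) N"
  by (simp add: digit_list_def upt_conv_Cons)

lemma length_digit_list: "length (digit_list p a m N) = (\<Sum>i\<in>{m..<N}. a i)"
  by (simp add: digit_list_def length_concat o_def interv_sum_list_conv_sum_set_nat)

lemma set_digit_list: "p \<ge> 2 \<Longrightarrow> u \<in> set (digit_list p a (Suc m) N) \<Longrightarrow> p ^ m < u"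
  by (auto simp: digit_list_def intro!: power_strict_increasing)

text \<open>A slope is repeated at most p - 1 times, as often as a digit allows; hence two places at
  distance p - 1 carry different slopes.\<close>

lemma digit_list_props:
  assumes p: "p \<ge> 2" and a: "\<And>i. a i < p" and mN: "m \<le> N"
  shows "sorted (digit_list p a m N) \<and> (\<forall>i. i + (p - 1) < length (digit_list p a m N) \<longrightarrow>
    digit_list p a m N ! i < digit_list p a m N ! (i + (p - 1)))"
  using mN
proof (induction m rule: inc_induct)
  case base
  show ?case by (simp add: digit_list_def)
next
  case (step m)
  let ?us = "digit_list p a (Suc m) N" and ?v = "digit_list p a m N"
  have v: "?v = replicate (a m) (p ^ m) @ ?us" using step by (intro digit_list_rec)
  have lt: "p ^ m < u" if "u \<in> set ?us" for u using set_digit_list[OF p that] .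
  have "?v ! i < ?v ! (i + (p - 1))" if i: "i + (p - 1) < length ?v" for i
  proof (cases "i < a m")
    case True
    have ge: "i + (p - 1) \<ge> a m" using a[of m] by simp
    hence "?us ! (i + (p - 1) - a m) \<in> set ?us" using i by (intro nth_mem) (auto simp: v)
    hence "p ^ m < ?us ! (i + (p - 1) - a m)" by (rule lt)
    thus ?thesis using True ge by (simp add: v nth_append)
  next
    case False
    have "i - a m + (p - 1) < length ?us" using False i by (simp add: v)
    hence "?us ! (i - a m) < ?us ! (i - a m + (p - 1))" using step.IH by blast
    moreover have "i + (p - 1) - a m = i - a m + (p - 1)" using False by simp
    ultimately show ?thesis using False by (simp add: v nth_append)
  qed
  moreover have "sorted ?v"
    unfolding v using step lt by (auto simp: sorted_append less_imp_le)
  ultimately show ?case by blast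
qed

lemma newton_slopes_digit_prod:
  fixes a :: "nat \<Rightarrow> nat"
  assumes p: "prime p" "CHAR('a::idom) = p" and a: "\<And>i. a i < p" and mN: "m \<le> N"
  shows "newton_slopes (\<Prod>i\<in>{m..<N}. [:monom 1 (p ^ i), - 1:] ^ a i :: 'a poly poly) (digit_list p a m N)"
  using mN
proof (induction m rule: inc_induct)
  case base
  show ?case by (simp add: digit_list_def newton_slopes_def)
next
  case (step m)
  have "(\<Prod>i\<in>{m..<N}. [:monom 1 (p ^ i), - 1:] ^ a i :: 'a poly poly) =
     [:monom 1 (p ^ m), - 1:] ^ a m * (\<Prod>i\<in>{Suc m..<N}. [:monom 1 (p ^ i), - 1:] ^ a i)"
    using step by (subst prod.atLeast_Suc_lessThan) auto
  thus ?case
    using step p a[of m] set_digit_list[OF prime_ge_2_nat[OF p(1)]]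
    by (simp add: digit_list_rec) (intro newton_slopes_mult_block of_nat_choose_nonzero; auto)
qed

theorem frob_surj_power_iff:
  fixes n :: nat
  assumes prime: "prime CARD('f::{finite,field})"
  defines "p \<equiv> CARD('f)"
  defines "P \<equiv> (fls_const [:0, 1:] - fls_X_inv :: 'f poly fls) ^ n"
  shows "digit_sum p n < p - 1 \<Longrightarrow> frob_surj p P" "digit_sum p n < p - 1 \<Longrightarrow> frob_inj p P"
    "\<not> digit_sum p n < p - 1 \<Longrightarrow> \<not> frob_surj p P"
proof -
  have p: "prime p" "p \<ge> 2" "p > 0" using prime prime_ge_2_nat[of p] by (auto simp: p_def)
  have char: "CHAR('f) = p" using CHAR_of_prime_card[OF prime] by (simp add: p_def)
  define d where "d = (\<lambda>i. n div p ^ i mod p)"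
  have d: "d i < p" for i using p by (simp add: d_def)
  \<comment> \<open>\<open>B i j\<close> is t^(p^i) - theta^(p^j). The two exponents are kept apart
    because a rotation changes j and leaves i alone.\<close>
  define B :: "nat \<Rightarrow> nat \<Rightarrow> 'f poly fls" where
    "B = (\<lambda>i j. eval_X_inv [:monom 1 (p ^ i), 0:] - fls_X_inv ^ (p ^ j))"
  have B: "B i j = fls_const (monom 1 (p ^ i)) - fls_X_inv ^ (p ^ j)" for i j
    by (simp add: B_def eval_X_inv_pCons) (simp add: eval_X_inv_def)
  have Bpoly: "B i j \<in> fls_polys" for i j
    unfolding B by (auto simp: fls_polys_def)
  have Btau: "fls_compose_power (B i j) p = B i (Suc j)" for i j
    using p by (simp add: B power_mult[symmetric] fls_X_inv_power_conv_shift_1 mult.commute)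
  have "of_nat p = (0 :: 'f poly fls)"
    using char by (simp add: fls_of_nat of_nat_poly of_nat_eq_0_iff_char_dvd)
  hence "CHAR('f poly fls) dvd p" by (simp add: of_nat_eq_0_iff_char_dvd)
  hence char': "CHAR('f poly fls) = p" using p CHAR_not_1[where 'a = "'f poly fls"] by (auto simp: prime_nat_iff)
  have minus_pow: "(x - y) ^ (p ^ i) = x ^ (p ^ i) - y ^ (p ^ i)" for x y :: "'f poly fls" and i
  proof -
    have "((x - y) + y) ^ (p ^ i) = (x - y) ^ (p ^ i) + y ^ (p ^ i)"
      using p char' by (intro freshmans_dream') auto
    thus ?thesis by (simp add: algebra_simps)
  qed
  have P: "P = (\<Prod>i\<le>n. B i i ^ d i)"
  proof -
    have "P = (\<Prod>i\<le>n. (fls_const [:0, 1:] - fls_X_inv) ^ (p ^ i * d i))"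
      unfolding P_def power_sum[symmetric] d_def using sum_digits[OF p(2), of n] by (simp add: mult.commute)
    also have "\<dots> = (\<Prod>i\<le>n. B i i ^ d i)"
      by (simp add: power_mult minus_pow B fls_const_power[symmetric] monom_altdef)
    finally show ?thesis .
  qed
  \<comment> \<open>\<open>Q\<close> interpolates between the given multiplier, k = n, and the one
    with theta untwisted in every factor, k = 0. From \<open>Suc k\<close> to \<open>k\<close> the
    factors with i > k, collected in \<open>g k\<close>, lose one Frobenius twist, which is a single
    rotation.\<close>
  define Q where "Q = (\<lambda>k. \<Prod>i\<le>n. B i (min i k) ^ d i)"
  define R where "R = (\<lambda>k. \<Prod>i\<in>{..n} \<inter> {..k}. B i i ^ d i)"
  define g where "g = (\<lambda>k. \<Prod>i\<in>{..n} - {..k}. B i k ^ d i)"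
  have Q_split: "Q k = (\<Prod>i\<in>{..n} \<inter> {..j}. B i (min i k) ^ d i) * (\<Prod>i\<in>{..n} - {..j}. B i (min i k) ^ d i)" for j k
    unfolding Q_def by (rule prod.Int_Diff) simp
  have Q0: "Q k = R k * g k" for k
    unfolding Q_split[of k k] R_def g_def by (intro arg_cong2[where f = "(*)"] prod.cong) auto
  have tau_g: "fls_compose_power (g k) p = (\<Prod>i\<in>{..n} - {..k}. B i (Suc k) ^ d i)" for k
    unfolding g_def using p by (simp add: fls_compose_power_prod Btau)
  have Q1: "Q (Suc k) = R k * fls_compose_power (g k) p" for k
    unfolding Q_split[of "Suc k" k] R_def tau_g by (intro arg_cong2[where f = "(*)"] prod.cong) auto
  have R: "R k \<in> fls_polys" and g: "g k \<in> fls_polys" for k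
    unfolding R_def g_def by (intro fls_polys_prod fls_polys_power Bpoly)+
  have surj_iff: "frob_surj p (Q k) \<longleftrightarrow> frob_surj p (Q 0)" for k
    by (induction k) (use frob_surj_rotate[OF p(3) g R] Q0 Q1 in simp_all)
  have inj_imp: "frob_inj p (Q 0) \<Longrightarrow> frob_inj p (Q k)" for k
    by (induction k) (use frob_inj_rotate[OF p(3) g R] Q0 Q1 in simp_all)
  have Qn: "Q n = P" unfolding P Q_def by (intro prod.cong) auto
  define PP :: "'f poly poly" where "PP = (\<Prod>i\<in>{0..<Suc n}. [:monom 1 (p ^ i), - 1:] ^ d i)"
  have "eval_X_inv [:monom 1 (p ^ i), - 1 :: 'f poly:] = B i 0" for i
    by (simp add: B eval_X_inv_pCons) (simp add: eval_X_inv_def)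
  hence Q_PP: "Q 0 = eval_X_inv PP"
    by (simp add: Q_def PP_def eval_X_inv_prod eval_X_inv_hom atLeast0LessThan lessThan_Suc_atMost)
  let ?us = "digit_list p d 0 (Suc n)"
  have NP: "newton_slopes PP ?us"
    unfolding PP_def using p char d by (intro newton_slopes_digit_prod) auto
  have len: "length ?us = digit_sum p n"
    by (simp add: length_digit_list digit_sum_def d_def atLeast0LessThan lessThan_Suc_atMost)
  hence deg: "degree PP = digit_sum p n" using NP by (simp add: newton_slopes_def)
  show "frob_surj p P" "frob_inj p P" if "digit_sum p n < p - 1"
    using frob_contraction[of p PP] p deg that surj_iff[of n] inj_imp[of n] unfolding Q_PP Qn by auto
  show "\<not> frob_surj p P" if ge: "\<not> digit_sum p n < p - 1"
  proof -
    have lc: "lead_coeff PP = (- 1) ^ digit_sum p n"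
      unfolding PP_def lead_coeff_prod
      by (simp add: lead_coeff_power power_sum[symmetric] digit_sum_def d_def atLeast0LessThan lessThan_Suc_atMost)
    \<comment> \<open>The sign disappears: for odd p the number p - 1 is even, and for p = 2 one has
      -1 = 1.\<close>
    have "lead_coeff PP = 1" if dvd: "(p - 1) dvd digit_sum p n"
    proof (cases "p = 2")
      case True
      have "(2 :: 'f) = 0" using char True of_nat_eq_0_iff_char_dvd[of 2, where 'a='f] by simp
      hence "1 + 1 = (0 :: 'f)" by simp
      hence "- 1 = (1 :: 'f)" by (rule minus_unique)
      hence "(- 1 :: 'f poly) = 1" by (simp add: one_pCons)
      thus ?thesis unfolding lc by (simp only: power_one)
    next
      case False
      hence "even (p - 1)" using p prime_odd_nat[of p] by simp
      hence "even (digit_sum p n)" using dvd dvd_trans by blast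
      thus ?thesis using lc by simp
    qed
    moreover have "\<forall>u\<in>set ?us. u > 0" using p by (auto simp: digit_list_def)
    ultimately have "\<not> frob_surj p (eval_X_inv PP)"
      using p NP len ge digit_list_props[OF p(2) d, of 0 "Suc n"]
      by (intro not_frob_surj[of p PP ?us]) auto
    thus ?thesis using surj_iff[of n] unfolding Q_PP Qn by simp
  qed
qed

section \<open>Separable elements and Galois automorphisms\<close>

lemma poly_bezout:
  fixes f g :: "'a::field poly"
  obtains d u v where "d = u * f + v * g" "d dvd f" "d dvd g"
proof -
  have "\<exists>d u v. d = u * f + v * g \<and> d dvd f \<and> d dvd g"
  \<comment> \<open>In the measure the zero polynomial ranks below the nonzero constants, which have
    the same degree.\<close>
  proof (induction "if g = 0 then 0 else Suc (degree g)" arbitrary: f g rule: less_induct)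
    case less
    show ?case
    proof (cases "g = 0")
      case True
      thus ?thesis by (intro exI[of _ f] exI[of _ 1] exI[of _ 0]) auto
    next
      case False
      hence "(if f mod g = 0 then 0 else Suc (degree (f mod g))) < (if g = 0 then 0 else Suc (degree g))"
        by (auto intro: degree_mod_less')
      from less[OF this] obtain d u v where d: "d = u * g + v * (f mod g)" "d dvd g" "d dvd f mod g"
        by blast
      have "d = v * f + (u - v * (f div g)) * g"
        using d(1) by (simp add: minus_div_mult_eq_mod[symmetric] algebra_simps)
      moreover have "d dvd f" using d by (metis dvd_mod_iff)
      ultimately show ?thesis using d by blast
    qed
  qed
  thus ?thesis using that by blast
qed

text \<open>Written as an identity, coprimality passes along ring homomorphisms. That is how a
  separable polynomial over K_inf remains separable over the large field in
  \<open>sep_elementsE\<close>.\<close>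

lemma coprime_poly_bezout:
  fixes f g :: "'a::field poly"
  shows "coprime f g \<longleftrightarrow> (\<exists>u v. u * f + v * g = 1)"
proof
  assume "coprime f g"
  obtain d u v where d: "d = u * f + v * g" "d dvd f" "d dvd g" by (rule poly_bezout)
  have "d dvd 1" using d \<open>coprime f g\<close> coprime_common_divisor by blast
  then obtain e where "1 = d * e" unfolding dvd_def by blast
  hence "(e * u) * f + (e * v) * g = 1" using d(1) by (simp add: algebra_simps)
  thus "\<exists>u v. u * f + v * g = 1" by blast
next
  assume "\<exists>u v. u * f + v * g = 1"
  then obtain u v where uv: "u * f + v * g = 1" by blast
  show "coprime f g"
    by (rule coprimeI) (metis uv dvd_add dvd_mult)
qed

lemma dvd_coprime_pderiv:
  fixes f g :: "'a::field poly"
  assumes "coprime f (pderiv f)" "g dvd f" shows "coprime g (pderiv g)"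
proof -
  from assms(2) obtain h where h: "f = g * h" unfolding dvd_def by blast
  from assms(1) obtain u v where "u * f + v * pderiv f = 1" unfolding coprime_poly_bezout by blast
  hence "(u * h + v * pderiv h) * g + (v * h) * pderiv g = 1"
    by (simp add: h pderiv_mult algebra_simps)
  thus ?thesis unfolding coprime_poly_bezout by blast
qed

lemma coprime_pderiv_simple_root:
  fixes f :: "'a::field poly"
  assumes "coprime f (pderiv f)" "poly f a = 0" shows "poly (pderiv f) a \<noteq> 0"
proof
  assume "poly (pderiv f) a = 0"
  moreover obtain u v where "u * f + v * pderiv f = 1" using assms(1) unfolding coprime_poly_bezout by blast
  ultimately show False using assms(2) by (metis add_0 mult_zero_right poly_1 poly_add poly_mult zero_neq_one)
qed

section \<open>Polynomials with coefficients in a subring\<close>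

definition is_subring :: "'a::comm_ring_1 set \<Rightarrow> bool" where
  "is_subring L \<longleftrightarrow> 1 \<in> L \<and> (\<forall>x\<in>L. \<forall>y\<in>L. x - y \<in> L \<and> x * y \<in> L)"

lemma is_subringD:
  assumes "is_subring L"
  shows "0 \<in> L" "1 \<in> L" "x \<in> L \<Longrightarrow> y \<in> L \<Longrightarrow> x + y \<in> L" "x \<in> L \<Longrightarrow> y \<in> L \<Longrightarrow> x - y \<in> L"
    "x \<in> L \<Longrightarrow> y \<in> L \<Longrightarrow> x * y \<in> L" "x \<in> L \<Longrightarrow> - x \<in> L" "x \<in> L \<Longrightarrow> x ^ n \<in> L"
proof -
  have L: "1 \<in> L" "\<And>x y. x \<in> L \<Longrightarrow> y \<in> L \<Longrightarrow> x - y \<in> L" "\<And>x y. x \<in> L \<Longrightarrow> y \<in> L \<Longrightarrow> x * y \<in> L"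
    using assms by (auto simp: is_subring_def)
  show 0: "0 \<in> L" using L(2)[OF L(1) L(1)] by simp
  have neg: "- x \<in> L" if "x \<in> L" for x using L(2)[OF 0 that] by simp
  show "x \<in> L \<Longrightarrow> y \<in> L \<Longrightarrow> x + y \<in> L" using L(2)[of x "- y"] neg[of y] by simp
  show "x \<in> L \<Longrightarrow> x ^ n \<in> L" by (induction n) (auto intro: L)
qed (use assms in \<open>auto simp: is_subring_def\<close>, metis cancel_comm_monoid_add_class.diff_cancel diff_0)

lemma is_subring_sum: "is_subring L \<Longrightarrow> (\<And>i. i \<in> I \<Longrightarrow> f i \<in> L) \<Longrightarrow> sum f I \<in> L"
  by (induction I rule: infinite_finite_induct) (auto intro: is_subringD)

definition polys_over :: "'a::comm_ring_1 set \<Rightarrow> 'a poly set" where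
  "polys_over L = {f. \<forall>i. coeff f i \<in> L}"

lemma polys_over_subring:
  assumes "is_subring L" shows "is_subring (polys_over L)"
  using assms unfolding is_subring_def polys_over_def
  by (auto simp: coeff_mult intro!: is_subring_sum[OF assms] is_subringD(5)[OF assms])
     (auto intro: is_subringD[OF assms] simp: is_subring_def)

lemma polys_over_monom: "is_subring L \<Longrightarrow> c \<in> L \<Longrightarrow> monom c n \<in> polys_over L"
  by (auto simp: polys_over_def is_subringD)

lemma polys_over_poly: "is_subring L \<Longrightarrow> f \<in> polys_over L \<Longrightarrow> x \<in> L \<Longrightarrow> poly f x \<in> L"
  unfolding poly_altdef polys_over_def by (auto intro!: is_subring_sum is_subringD)

text \<open>Subfields occur as subsets of the large field, and coefficients have to be kept inside
  them. Dividing by a monic polynomial introduces no denominators, so the usual cancellation of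
  leading terms never leaves the subring.\<close>

lemma polys_over_division:
  fixes f g :: "'a::idom poly"
  assumes L: "is_subring L" and f: "f \<in> polys_over L" and g: "g \<in> polys_over L" "lead_coeff g = 1"
  obtains h r where "h \<in> polys_over L" "r \<in> polys_over L" "f = g * h + r" "r = 0 \<or> degree r < degree g"
proof -
  have "\<exists>h r. h \<in> polys_over L \<and> r \<in> polys_over L \<and> f = g * h + r \<and> (r = 0 \<or> degree r < degree g)"
    using f
  proof (induction "degree f" arbitrary: f rule: less_induct)
    case less
    note P = is_subringD[OF polys_over_subring[OF L]]
    show ?case
    proof (cases "f = 0 \<or> degree f < degree g")
      case True
      thus ?thesis using less.prems P by (intro exI[of _ 0] exI[of _ f]) auto
    next
      case False
      define t where "t = monom (lead_coeff f) (degree f - degree g)"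
      have t: "t \<in> polys_over L" using less.prems unfolding t_def
        by (intro polys_over_monom L) (auto simp: polys_over_def)
      have f1: "f - g * t \<in> polys_over L" using less.prems g t by (intro P)
      have g0: "g \<noteq> 0" using g(2) by auto
      have t0: "t \<noteq> 0" "degree t = degree f - degree g" "lead_coeff t = lead_coeff f"
        using False by (auto simp: t_def degree_monom_eq monom_eq_0_iff)
      have degt: "degree (g * t) = degree f" using False g0 t0 by (simp add: degree_mult_eq)
      have lc: "coeff (g * t) (degree f) = lead_coeff f"
        using g(2) lead_coeff_mult[of g t] t0(3) unfolding degt by simp
      show ?thesis
      proof (cases "f - g * t = 0")
        case True
        thus ?thesis using t P by (intro exI[of _ t] exI[of _ 0]) auto
      next
        case nz: False
        have "degree (f - g * t) \<le> degree f" using degt by (intro degree_diff_le) auto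
        moreover have "degree (f - g * t) \<noteq> degree f"
          using nz lc by (metis coeff_diff diff_self leading_coeff_0_iff)
        ultimately have "degree (f - g * t) < degree f" by simp
        from less.hyps[OF this f1] obtain h r where
          hr: "h \<in> polys_over L" "r \<in> polys_over L" "f - g * t = g * h + r" "r = 0 \<or> degree r < degree g"
          by blast
        have "f = g * (h + t) + r" using hr(3) by (simp add: algebra_simps)
        thus ?thesis using hr t P by (intro exI[of _ "h + t"] exI[of _ r]) auto
      qed
    qed
  qed
  thus ?thesis using that by blast
qed

section \<open>Algebraic elements and finite-dimensional subspaces over K_inf\<close>

context completed_separable_closure
begin

lemma emb_zero: "\<iota> 0 = 0"
  using emb_add[of 0 0] by (metis add_cancel_right_right)

lemma emb_eq_0_iff: "\<iota> x = 0 \<longleftrightarrow> x = 0"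
proof
  assume "\<iota> x = 0"
  show "x = 0"
  proof (rule ccontr)
    assume "x \<noteq> 0"
    hence "\<iota> (x * inverse x) = 1" using emb_one by simp
    thus False using \<open>\<iota> x = 0\<close> by (simp add: emb_mult)
  qed
qed (simp add: emb_zero)

lemma emb_inj': "\<iota> x = \<iota> y \<Longrightarrow> x = y"
  using emb_add[of "x - y" y] emb_eq_0_iff[of "x - y"] by simp

sublocale emb: map_poly_inj_comm_ring_hom \<iota>
  by unfold_locales (auto simp: emb_add emb_mult emb_one emb_zero emb_eq_0_iff dest: emb_inj')

lemmas emb_minus = emb.base.hom_minus and emb_uminus = emb.base.hom_uminus
  and emb_power = emb.base.hom_power and emb_sum = emb.base.hom_sum and emb_prod = emb.base.hom_prod

lemma emb_inverse: "\<iota> (inverse x) = inverse (\<iota> x)"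
proof (cases "x = 0")
  case False
  hence "\<iota> x * \<iota> (inverse x) = 1" using emb_mult[of x "inverse x"] by (simp add: emb_one)
  thus ?thesis by (simp add: inverse_unique)
qed (simp add: emb_zero)

definition ev :: "'f fls poly \<Rightarrow> 'c \<Rightarrow> 'c" where
  "ev q z = poly (map_poly \<iota> q) z"

lemma ev_simps:
  "ev 0 z = 0" "ev 1 z = 1" "ev (q + r) z = ev q z + ev r z" "ev (q - r) z = ev q z - ev r z"
  "ev (q * r) z = ev q z * ev r z" "ev (q ^ n) z = ev q z ^ n" "ev (smult a q) z = \<iota> a * ev q z"
  "ev (pCons a q) z = \<iota> a + z * ev q z" "ev (monom a n) z = \<iota> a * z ^ n"
  by (simp_all add: ev_def hom_distribs emb.map_poly_pCons_hom map_poly_monom poly_monom emb_zero)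

lemma ev_altdef: "ev q z = (\<Sum>i\<le>degree q. \<iota> (coeff q i) * z ^ i)"
  by (simp add: ev_def poly_altdef)

lemma ev_pderiv: "map_poly \<iota> (pderiv q) = pderiv (map_poly \<iota> q)"
  by (rule poly_eqI) (simp add: coeff_pderiv emb_mult emb.base.hom_of_nat del: of_nat_Suc)

sublocale V: vector_space "\<lambda>a x. \<iota> a * x"
  by unfold_locales (auto simp: emb_add emb_mult emb_one algebra_simps)

text \<open>The span of this set is the ring K_inf[x].\<close>

definition powers :: "'c \<Rightarrow> 'c set" where "powers x = range (\<lambda>i. x ^ i)"

lemma ev_in_span_powers: "ev q x \<in> V.span (powers x)"
  unfolding ev_altdef by (intro V.span_sum V.span_scale V.span_base) (auto simp: powers_def)

lemma span_powers_ev: "u \<in> V.span (powers x) \<Longrightarrow> \<exists>q. u = ev q x"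
proof (induction rule: V.span_induct_alt)
  case base
  show ?case by (intro exI[of _ 0]) (simp add: ev_simps)
next
  case (step c y z)
  then obtain i q where "y = x ^ i" "z = ev q x" by (auto simp: powers_def)
  thus ?case by (intro exI[of _ "monom c i + q"]) (simp add: ev_simps)
qed

lemma span_times:
  assumes "u \<in> V.span A" "v \<in> V.span C" shows "u * v \<in> V.span ((\<lambda>(a, c). a * c) ` (A \<times> C))"
  using assms(1)
proof (induction rule: V.span_induct_alt)
  case base
  show ?case by (simp add: V.span_zero)
next
  case (step k a z)
  have "a * v \<in> V.span ((\<lambda>(a, c). a * c) ` (A \<times> C))"
    using assms(2)
  proof (induction rule: V.span_induct_alt)
    case base
    show ?case by (simp add: V.span_zero)
  next
    case (step j c w)
    have "a * c \<in> V.span ((\<lambda>(a, c). a * c) ` (A \<times> C))"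
      using step \<open>a \<in> A\<close> by (intro V.span_base) auto
    from V.span_add[OF V.span_scale[OF this, of j] step(2)] show ?case by (simp add: algebra_simps)
  qed
  from V.span_add[OF V.span_scale[OF this, of k] step(2)] show ?case by (simp add: algebra_simps)
qed

lemma span_mult_closed:
  assumes "\<And>a c. a \<in> A \<Longrightarrow> c \<in> A \<Longrightarrow> a * c \<in> V.span A" "u \<in> V.span A" "v \<in> V.span A"
  shows "u * v \<in> V.span A"
proof -
  have "u * v \<in> V.span ((\<lambda>(a, c). a * c) ` (A \<times> A))" using assms by (intro span_times)
  also have "\<dots> \<subseteq> V.span A" using assms(1) by (intro V.span_minimal) auto
  finally show ?thesis .
qed

lemma span_subring:
  assumes "\<And>a c. a \<in> A \<Longrightarrow> c \<in> A \<Longrightarrow> a * c \<in> V.span A" "1 \<in> A"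
  shows "is_subring (V.span A)"
  using assms span_mult_closed[OF assms(1)] V.span_base[OF assms(2)] V.span_diff
  unfolding is_subring_def by blast

lemma span_powers_subring: "is_subring (V.span (powers x))"
proof (rule span_subring)
  show "a * c \<in> V.span (powers x)" if "a \<in> powers x" "c \<in> powers x" for a c
    using that by (intro V.span_base) (auto simp: powers_def simp flip: power_add)
  show "1 \<in> powers x" unfolding powers_def by (rule range_eqI[of _ _ 0]) simp
qed

definition alg :: "'c \<Rightarrow> bool" where "alg z \<longleftrightarrow> (\<exists>q. q \<noteq> 0 \<and> ev q z = 0)"

lemma alg_min_poly:
  assumes "alg z"
  obtains m where "m \<noteq> 0" "ev m z = 0" "\<And>q. ev q z = 0 \<Longrightarrow> m dvd q" "degree m > 0"
    "\<And>q. ev q z = 0 \<Longrightarrow> degree q < degree m \<Longrightarrow> q = 0"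
proof -
  let ?P = "\<lambda>q. q \<noteq> 0 \<and> ev q z = 0"
  obtain m where m: "?P m" and min: "\<And>q. ?P q \<Longrightarrow> degree m \<le> degree q"
    using assms ex_has_least_nat[of ?P _ degree] unfolding alg_def by metis
  have low: "q = 0" if "ev q z = 0" "degree q < degree m" for q
    using min[of q] that by auto
  have "m dvd q" if q: "ev q z = 0" for q
  proof -
    have "ev (q mod m) z = ev (q - q div m * m) z" by (simp add: minus_div_mult_eq_mod)
    also have "\<dots> = 0" using q m by (simp add: ev_simps)
    finally have "ev (q mod m) z = 0" .
    hence "q mod m = 0" using degree_mod_less[of m q] m low[of "q mod m"] by auto
    thus ?thesis by (simp add: mod_eq_0_iff_dvd)
  qed
  moreover have "degree m > 0"
  proof (rule ccontr)
    assume "\<not> ?thesis"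
    then obtain a where "m = [:a:]" by (auto elim: degree_eq_zeroE)
    thus False using m by (auto simp: ev_simps emb_zero emb_eq_0_iff)
  qed
  ultimately show ?thesis using that m low by blast
qed

text \<open>If a + X q is a polynomial of least degree that vanishes at z, then a is nonzero by
  minimality and -q(z)/a is the inverse.\<close>

lemma alg_inverse:
  assumes "alg z" shows "inverse z \<in> V.span (powers z)"
proof (cases "z = 0")
  case False
  obtain m where m: "m \<noteq> 0" "ev m z = 0" "degree m > 0"
    "\<And>q. ev q z = 0 \<Longrightarrow> degree q < degree m \<Longrightarrow> q = 0" using alg_min_poly[OF assms] by metis
  obtain a q where mq: "m = pCons a q" by (cases m)
  have q0: "q \<noteq> 0" using m(3) mq by auto
  have eq: "\<iota> a + z * ev q z = 0" using m(2) by (simp add: mq ev_simps)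
  have "a \<noteq> 0"
  proof
    assume "a = 0"
    hence "ev q z = 0" using eq False by (simp add: emb_zero)
    thus False using m(4)[of q] q0 by (simp add: mq)
  qed
  hence "z * (- inverse (\<iota> a) * ev q z) = 1"
    using eq emb_eq_0_iff[of a] by (simp add: field_simps) (metis add.commute add_eq_0_iff minus_minus)
  hence "inverse z = \<iota> (- inverse a) * ev q z"
    by (metis emb_inverse emb_uminus inverse_unique)
  thus ?thesis using V.span_scale[OF ev_in_span_powers] by metis
qed (simp add: V.span_zero)

text \<open>More powers than the dimension permits are linearly dependent. If two of them coincide,
  their difference already is a relation.\<close>

lemma fin_span_alg:
  assumes T: "finite T" and z: "\<And>i. z ^ i \<in> V.span T"
  shows "alg z"
proof -
  let ?f = "\<lambda>i. z ^ i"
  have "\<exists>q. q \<noteq> 0 \<and> ev q z = 0"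
  proof (cases "inj_on ?f {..card T}")
    case False
    then obtain i j where "i \<noteq> j" "z ^ i = z ^ j" by (auto simp: inj_on_def)
    hence "ev (monom 1 i - monom 1 j) z = 0" "monom 1 i - monom 1 j \<noteq> (0 :: 'f fls poly)"
      by (auto simp: ev_simps emb_one monom_eq_iff')
    thus ?thesis by blast
  next
    case True
    hence "card (?f ` {..card T}) = Suc (card T)" by (simp add: card_image)
    hence "V.dependent (?f ` {..card T})"
      using V.independent_span_bound[OF T, of "?f ` {..card T}"] z by force
    then obtain u v where u: "v \<in> ?f ` {..card T}" "u v \<noteq> 0" "(\<Sum>v\<in>?f ` {..card T}. \<iota> (u v) * v) = 0"
      by (auto simp: V.dependent_finite)
    let ?q = "\<Sum>i\<le>card T. monom (u (z ^ i)) i"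
    have evs: "ev (\<Sum>i\<in>I. f i) z = (\<Sum>i\<in>I. ev (f i) z)" for f :: "nat \<Rightarrow> 'f fls poly" and I
      by (induction I rule: infinite_finite_induct) (auto simp: ev_simps)
    have "ev ?q z = 0"
      using u(3) True by (simp add: evs ev_simps sum.reindex)
    moreover have "?q \<noteq> 0"
    proof
      assume "?q = 0"
      from u obtain i where i: "i \<le> card T" "u (z ^ i) \<noteq> 0" by auto
      have "coeff ?q i = (\<Sum>j\<le>card T. if j = i then u (z ^ j) else 0)" unfolding coeff_sum by (intro sum.cong) auto
      thus False using i \<open>?q = 0\<close> by simp
    qed
    ultimately show ?thesis by blast
  qed
  thus ?thesis by (simp add: alg_def)
qed

text \<open>An annihilating polynomial expresses each power by lower ones as soon as the exponent
  reaches its degree.\<close>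

lemma alg_powers_span:
  assumes "alg x" shows "\<exists>T. finite T \<and> T \<subseteq> powers x \<and> powers x \<subseteq> V.span T"
proof -
  obtain m where m: "m \<noteq> 0" "ev m x = 0" using assms by (auto simp: alg_def)
  let ?T = "(\<lambda>i. x ^ i) ` {..<degree m}"
  have "x ^ i \<in> V.span ?T" for i
  proof (induction i rule: less_induct)
    case (less i)
    show ?case
    proof (cases "i < degree m")
      case True
      thus ?thesis by (intro V.span_base) auto
    next
      case False
      define k where "k = i - degree m"
      have "0 = x ^ k * ev m x" using m by simp
      also have "\<dots> = (\<Sum>j\<le>degree m. \<iota> (coeff m j) * x ^ (k + j))"
        by (simp add: ev_altdef sum_distrib_left power_add mult_ac)
      also have "\<dots> = (\<Sum>j<degree m. \<iota> (coeff m j) * x ^ (k + j)) + \<iota> (lead_coeff m) * x ^ i"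
        using False by (simp add: lessThan_Suc_atMost[symmetric] k_def)
      finally have eq: "\<iota> (lead_coeff m) * x ^ i = - (\<Sum>j<degree m. \<iota> (coeff m j) * x ^ (k + j))"
        by (metis add.commute eq_neg_iff_add_eq_0)
      have "\<iota> (lead_coeff m) * x ^ i \<in> V.span ?T"
        unfolding eq using False by (intro V.span_neg V.span_sum V.span_scale less) (auto simp: k_def)
      from V.span_scale[OF this, of "inverse (lead_coeff m)"] show ?thesis
        using m(1) emb_eq_0_iff[of "lead_coeff m"] by (simp add: emb_inverse mult.assoc[symmetric])
    qed
  qed
  thus ?thesis by (intro exI[of _ ?T]) (auto simp: powers_def)
qed

end

lemma coprime_linear:
  fixes H :: "'a::field poly"
  assumes "poly H a \<noteq> 0" shows "coprime H [:- a, 1:]"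
proof -
  have "poly (H - [:poly H a:]) a = 0" by simp
  then obtain Q where "H - [:poly H a:] = [:- a, 1:] * Q" unfolding poly_eq_0_iff_dvd dvd_def by blast
  hence H: "H = [:- a, 1:] * Q + [:poly H a:]" by (simp only: diff_eq_eq)
  have *: "e * (Y * Q + b) + (- (e * Q)) * Y = e * b" for e Y b by (simp add: algebra_simps)
  from *[of "[:inverse (poly H a):]" "[:- a, 1:]" "[:poly H a:]"]
  have "[:inverse (poly H a):] * H + (- ([:inverse (poly H a):] * Q)) * [:- a, 1:]
      = [:inverse (poly H a):] * [:poly H a:]"
    unfolding H[symmetric] .
  also have "\<dots> = 1" using assms by (simp add: one_pCons)
  finally have "[:inverse (poly H a):] * H + (- ([:inverse (poly H a):] * Q)) * [:- a, 1:] = 1" .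
  thus ?thesis unfolding coprime_poly_bezout by blast
qed

lemma coprime_poly_power:
  fixes f g :: "'a::field poly"
  assumes "coprime f g" shows "coprime f (g ^ n)"
proof (induction n)
  case (Suc n)
  obtain u v w z where 1: "u * f + v * g = 1" "w * f + z * g ^ n = 1"
    using assms Suc unfolding coprime_poly_bezout by blast
  have "(u * f + v * g) * (w * f + z * g ^ n) = 1" unfolding 1 by simp
  hence "(u * (w * f + z * g ^ n) + v * g * w) * f + (v * z) * g ^ Suc n = 1"
    by (simp add: algebra_simps)
  thus ?case unfolding coprime_poly_bezout by blast
qed simp

section \<open>Separable elements form a field\<close>

context completed_separable_closure
begin

lemma char_c: "CHAR('c) = CHAR('f)"
proof (rule CHAR_eqI)
  have h: "of_nat n = (0 :: 'c) \<longleftrightarrow> of_nat n = (0 :: 'f)" for n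
  proof -
    have "of_nat n = (0 :: 'c) \<longleftrightarrow> \<iota> (of_nat n) = 0" by (simp add: emb.base.hom_of_nat)
    also have "\<dots> \<longleftrightarrow> of_nat n = (0 :: 'f fls)" by (rule emb_eq_0_iff)
    also have "\<dots> \<longleftrightarrow> of_nat n = (0 :: 'f)" by (simp add: fls_of_nat)
    finally show ?thesis .
  qed
  show "of_nat CHAR('f) = (0 :: 'c)" by (simp add: h)
  show "CHAR('f) dvd n" if "of_nat n = (0 :: 'c)" for n
    using that by (simp add: h of_nat_eq_0_iff_char_dvd)
qed

lemma prime_pc: "prime CHAR('c)"
  unfolding char_c by (intro prime_CHAR_semidom finite_imp_CHAR_pos) simp

lemma frob_add: "(x + y) ^ CHAR('c) = x ^ CHAR('c) + y ^ CHAR('c)" for x y :: 'c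
  using prime_pc by (rule freshmans_dream) simp

lemma sep_elementsI: "coprime f (pderiv f) \<Longrightarrow> ev f x = 0 \<Longrightarrow> x \<in> sep_elements \<iota>"
  by (auto simp: sep_elements_def ev_def)

lemma sep_elementsE:
  assumes "x \<in> sep_elements \<iota>"
  obtains f where "coprime f (pderiv f)" "ev f x = 0" "f \<noteq> 0"
    "coprime (map_poly \<iota> f) (pderiv (map_poly \<iota> f))"
proof -
  obtain f where f: "coprime f (pderiv f)" "ev f x = 0"
    using assms by (auto simp: sep_elements_def ev_def)
  have "f \<noteq> 0" using f(1) by auto
  obtain u v where "u * f + v * pderiv f = 1" using f(1) unfolding coprime_poly_bezout by blast
  hence "map_poly \<iota> (u * f + v * pderiv f) = 1" by simp
  hence "map_poly \<iota> u * map_poly \<iota> f + map_poly \<iota> v * pderiv (map_poly \<iota> f) = 1"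
    by (simp add: hom_distribs ev_pderiv)
  hence "coprime (map_poly \<iota> f) (pderiv (map_poly \<iota> f))" unfolding coprime_poly_bezout by blast
  thus ?thesis using that f \<open>f \<noteq> 0\<close> by blast
qed

lemma sep_alg: "x \<in> sep_elements \<iota> \<Longrightarrow> alg x"
  by (elim sep_elementsE) (auto simp: alg_def)

text \<open>In a ring of finite dimension every element is algebraic, so its inverse is a polynomial
  in it and stays in the ring.\<close>

lemma fin_span_inverse:
  assumes "is_subring (V.span A)" "finite T" "V.span A \<subseteq> V.span T" "z \<in> V.span A"
  shows "inverse z \<in> V.span A"
proof -
  have pw: "z ^ i \<in> V.span A" for i using assms by (auto intro: is_subringD)
  hence "alg z" using assms(2,3) by (intro fin_span_alg[of T]) auto
  hence "inverse z \<in> V.span (powers z)" by (rule alg_inverse)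
  also have "\<dots> \<subseteq> V.span A" using pw by (intro V.span_minimal) (auto simp: powers_def)
  finally show ?thesis .
qed

text \<open>This is a dimension count. T extends to a basis of the span of B, and by additivity of
  the p-th power the powers of that basis span B again; a spanning family of as many vectors as the
  dimension is independent. It is Mac Lane's criterion for separability in the form needed for
  minimal polynomials.\<close>

lemma frob_independent:
  assumes T0: "finite T0" "B \<subseteq> V.span T0" and B: "B \<subseteq> V.span ((\<lambda>x. x ^ CHAR('c)) ` B)"
    and T: "T \<subseteq> B" "V.independent T"
  shows "inj_on (\<lambda>x. x ^ CHAR('c)) T" "V.independent ((\<lambda>x. x ^ CHAR('c)) ` T)"
proof -
  let ?p = "\<lambda>x :: 'c. x ^ CHAR('c)"
  obtain T' where T': "T \<subseteq> T'" "T' \<subseteq> B" "V.independent T'" "B \<subseteq> V.span T'"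
    using V.maximal_independent_subset_extend[OF T] by blast
  have fin: "finite T'" using V.independent_span_bound[OF T0(1) T'(3)] T' T0 by blast
  have "?p b \<in> V.span (?p ` T')" if "b \<in> V.span T'" for b
    using that
  proof (induction rule: V.span_induct_alt)
    case base
    show ?case using prime_pc by (simp add: V.span_zero power_0_left prime_gt_0_nat)
  next
    case (step c x y)
    have "?p (\<iota> c * x + y) = \<iota> (c ^ CHAR('c)) * ?p x + ?p y"
      by (simp add: frob_add power_mult_distrib emb_power)
    also have "\<dots> \<in> V.span (?p ` T')"
      using step(1) by (intro V.span_add[OF V.span_scale[OF V.span_base] step(2)]) auto
    finally show ?case .
  qed
  hence "?p ` B \<subseteq> V.span (?p ` T')" using T'(4) by blast
  hence "V.span (?p ` B) \<subseteq> V.span (?p ` T')" by (intro V.span_minimal) auto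
  hence BT: "B \<subseteq> V.span (?p ` T')" using B by blast
  obtain B' where B': "B' \<subseteq> ?p ` T'" "V.independent B'" "?p ` T' \<subseteq> V.span B'"
    using V.maximal_independent_subset by blast
  have finB': "finite B'" using B'(1) fin finite_subset by blast
  have "V.span (?p ` T') \<subseteq> V.span B'" using B'(3) by (intro V.span_minimal) auto
  hence "T' \<subseteq> V.span B'" using BT T'(2) by blast
  hence "card T' \<le> card B'" using V.independent_span_bound[OF finB' T'(3)] by blast
  moreover have "card B' \<le> card (?p ` T')" using B'(1) fin by (intro card_mono) auto
  moreover have "card (?p ` T') \<le> card T'" using fin by (rule card_image_le)
  ultimately have eq: "card B' = card (?p ` T')" "card (?p ` T') = card T'" by auto
  hence "B' = ?p ` T'" using B'(1) fin by (intro card_subset_eq) auto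
  hence "V.independent (?p ` T')" using B'(2) by simp
  thus "V.independent (?p ` T)" by (rule V.independent_mono) (use T'(1) in auto)
  have "inj_on ?p T'" using fin eq(2) by (intro eq_card_imp_inj_on)
  thus "inj_on ?p T" using T'(1) by (rule inj_on_subset)
qed

text \<open>A separable \<open>x\<close> lies in \<open>K(x\<^sup>p)\<close>: its minimal polynomial over that field divides both \<open>(X - x)\<^sup>p\<close>
  and a separable polynomial.\<close>

lemma sep_in_span_powers_pc:
  assumes x: "x \<in> sep_elements \<iota>" shows "x \<in> V.span (powers (x ^ CHAR('c)))"
proof -
  define L where "L = V.span (powers (x ^ CHAR('c)))"
  obtain f where f: "f \<noteq> 0" "ev f x = 0" "coprime (map_poly \<iota> f) (pderiv (map_poly \<iota> f))"
    using x by (elim sep_elementsE)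
  have L: "is_subring L" unfolding L_def by (rule span_powers_subring)
  have xp: "x ^ CHAR('c) \<in> L" unfolding L_def powers_def by (rule V.span_base, rule range_eqI[of _ _ 1]) simp
  have algx: "alg x" using x by (rule sep_alg)
  obtain T where T: "finite T" "powers x \<subseteq> V.span T" using alg_powers_span[OF algx] by blast
  have "powers (x ^ CHAR('c)) \<subseteq> powers x" by (auto simp: powers_def simp flip: power_mult)
  hence LT: "L \<subseteq> V.span T" unfolding L_def using T by (intro V.span_minimal) auto
  have Linv: "inverse z \<in> L" if "z \<in> L" for z
    using fin_span_inverse[OF _ T(1), of "powers (x ^ CHAR('c))" z] L LT that by (simp add: L_def)
  have K: "\<iota> a \<in> L" for a
    unfolding L_def using V.span_scale[OF is_subringD(2)[OF span_powers_subring], of a] by simp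
  let ?W = "[:- x, 1:] ^ CHAR('c)"
  have "of_nat CHAR('c) = (0 :: 'c poly)" by (simp add: of_nat_poly)
  hence "CHAR('c poly) dvd CHAR('c)" by (simp add: of_nat_eq_0_iff_char_dvd)
  hence char: "CHAR('c poly) = CHAR('c)"
    using prime_pc CHAR_not_1[where 'a = "'c poly"] by (auto simp: prime_nat_iff)
  have "([:- x, 1:] + [:x:]) ^ CHAR('c) = ?W + [:x:] ^ CHAR('c)"
    using prime_pc char by (intro freshmans_dream) auto
  hence W: "?W = monom 1 CHAR('c) - [:x ^ CHAR('c):]"
    by (simp add: monom_altdef poly_const_pow algebra_simps)
  have WL: "?W \<in> polys_over L"
    unfolding W using L xp polys_over_monom[OF L, of 1 "CHAR('c)"] polys_over_monom[OF L, of "x ^ CHAR('c)" 0]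
    by (intro is_subringD[OF polys_over_subring[OF L]]) (auto simp: monom_0 is_subringD)
  let ?P = "\<lambda>r. r \<in> polys_over L \<and> r \<noteq> 0 \<and> poly r x = 0"
  have "?P ?W" using WL prime_pc by (auto simp: prime_gt_0_nat power_0_left)
  then obtain R where R: "?P R" and min: "\<And>r. ?P r \<Longrightarrow> degree R \<le> degree r"
    using ex_has_least_nat[of ?P _ degree] by metis
  define R0 where "R0 = smult (inverse (lead_coeff R)) R"
  have lc: "lead_coeff R \<in> L" using R by (auto simp: polys_over_def)
  have R0: "R0 \<in> polys_over L" "lead_coeff R0 = 1" "poly R0 x = 0" "degree R0 = degree R"
    using R Linv[OF lc] is_subringD(5)[OF L] by (auto simp: R0_def polys_over_def)
  have dvd: "R0 dvd g" if g: "g \<in> polys_over L" "poly g x = 0" for g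
  proof -
    obtain h r where hr: "r \<in> polys_over L" "g = R0 * h + r" "r = 0 \<or> degree r < degree R0"
      using polys_over_division[OF L g(1) R0(1,2)] by metis
    have "poly r x = 0" using hr(2) g(2) R0(3) by simp
    hence "r = 0" using min[of r] hr(1,3) R0(4) by (metis leD)
    thus ?thesis using hr(2) by simp
  qed
  have "map_poly \<iota> f \<in> polys_over L" using K by (simp add: polys_over_def coeff_map_poly emb_zero)
  hence "R0 dvd map_poly \<iota> f" using f(2) by (intro dvd) (auto simp: ev_def)
  hence cop: "coprime R0 (pderiv R0)" using f(3) dvd_coprime_pderiv by blast
  have simple: "poly (pderiv R0) x \<noteq> 0" using cop R0(3) by (rule coprime_pderiv_simple_root)
  from R0(3) obtain H where H: "R0 = [:- x, 1:] * H" by (auto simp: poly_eq_0_iff_dvd dvd_def)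
  have "poly H x \<noteq> 0"
    using simple unfolding H pderiv_mult by (simp add: pderiv_pCons)
  hence "coprime H [:- x, 1:]" by (rule coprime_linear)
  hence copH: "coprime H ([:- x, 1:] ^ (CHAR('c) - 1))" by (rule coprime_poly_power)
  have "H dvd [:- x, 1:] ^ (CHAR('c) - 1)"
  proof -
    have cancel: "B dvd C" if "A * B dvd A * C" "A \<noteq> 0" for A B C :: "'c poly" using that by simp
    have pow: "A ^ n = A * A ^ (n - 1)" if "n > 0" for A :: "'c poly" and n using that by (cases n) simp_all
    have "poly ?W x = 0" using prime_pc by (simp add: power_0_left prime_gt_0_nat)
    hence "R0 dvd ?W" by (rule dvd[OF WL])
    hence "[:- x, 1:] * H dvd [:- x, 1:] * [:- x, 1:] ^ (CHAR('c) - 1)"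
      unfolding H by (subst (asm) pow[OF prime_gt_0_nat[OF prime_pc]])
    thus ?thesis by (rule cancel) simp
  qed
  hence "is_unit H" by (rule coprime_common_divisor[OF copH dvd_refl])
  then obtain c where c: "H = [:c:]" unfolding is_unit_poly_iff by blast
  have "c = 1" using R0(2) unfolding H c by (simp split: if_splits)
  hence "coeff R0 0 = - x" by (simp add: H c)
  hence "- x \<in> L" using R0(1) by (metis (no_types, lifting) mem_Collect_eq polys_over_def)
  thus ?thesis using is_subringD(6)[OF L, of "- x"] by (simp add: L_def)
qed

text \<open>The span of these monomials is the ring K_inf[x, y].\<close>

definition monoms :: "'c \<Rightarrow> 'c \<Rightarrow> 'c set" where
  "monoms x y = (\<lambda>(a, c). a * c) ` (powers x \<times> powers y)"

lemma monomsI: "x ^ i * y ^ j \<in> monoms x y" by (auto simp: monoms_def powers_def)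

lemma monoms_props:
  fixes x y :: 'c
  shows "is_subring (V.span (monoms x y))" "x \<in> V.span (monoms x y)" "y \<in> V.span (monoms x y)"
proof -
  have "a * c \<in> monoms x y" if ac: "a \<in> monoms x y" "c \<in> monoms x y" for a c
  proof -
    obtain i j k l where "a = x ^ i * y ^ j" "c = x ^ k * y ^ l"
      using ac by (auto simp: monoms_def powers_def)
    hence "a * c = x ^ (i + k) * y ^ (j + l)" by (simp add: power_add mult_ac)
    thus ?thesis using monomsI by simp
  qed
  moreover have "1 \<in> monoms x y" using monomsI[of x 0 y 0] by simp
  ultimately show "is_subring (V.span (monoms x y))" by (intro span_subring V.span_base)
  show "x \<in> V.span (monoms x y)" "y \<in> V.span (monoms x y)"
    using monomsI[of x 1 y 0] monomsI[of x 0 y 1] by (auto intro: V.span_base)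
qed

text \<open>Since x and y are polynomials in their p-th powers, the ring K_inf[x, y] is spanned by
  p-th powers of its own elements. Suppose the minimal polynomial m of z had derivative 0. Then it
  would be a polynomial in X^p, hence a linear relation between the p-th powers of 1, z, ..., z^(deg
  m - 1); but these are independent along with their roots. So separability holds at once for sums,
  products and all other polynomial expressions in x and y.\<close>

lemma sep_span_monoms:
  assumes x: "x \<in> sep_elements \<iota>" and y: "y \<in> sep_elements \<iota>" and z: "z \<in> V.span (monoms x y)"
  shows "z \<in> sep_elements \<iota>" "inverse z \<in> V.span (monoms x y)"
proof -
  let ?B = "V.span (monoms x y)" and ?p = "\<lambda>x :: 'c. x ^ CHAR('c)"
  note B = monoms_props(1)[of x y]
  obtain T1 where T1: "finite T1" "powers x \<subseteq> V.span T1" using alg_powers_span[OF sep_alg[OF x]] by blast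
  obtain T2 where T2: "finite T2" "powers y \<subseteq> V.span T2" using alg_powers_span[OF sep_alg[OF y]] by blast
  define T where "T = (\<lambda>(a, c). a * c) ` (T1 \<times> T2)"
  have fT: "finite T" using T1 T2 by (simp add: T_def)
  have BT: "?B \<subseteq> V.span T"
  proof (rule V.span_minimal)
    show "monoms x y \<subseteq> V.span T"
    proof
      fix b assume "b \<in> monoms x y"
      then obtain a c where "b = a * c" "a \<in> V.span T1" "c \<in> V.span T2"
        using T1 T2 by (auto simp: monoms_def)
      thus "b \<in> V.span T" unfolding T_def by (simp only: span_times)
    qed
  qed auto
  show "inverse z \<in> ?B" using fin_span_inverse[OF B fT BT z] .
  have pw: "z ^ i \<in> ?B" for i using is_subringD(7)[OF B z] .
  have "alg z" using fT pw BT by (intro fin_span_alg[of T]) auto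
  then obtain m where m: "m \<noteq> 0" "ev m z = 0" "\<And>q. ev q z = 0 \<Longrightarrow> m dvd q" "degree m > 0"
    "\<And>q. ev q z = 0 \<Longrightarrow> degree q < degree m \<Longrightarrow> q = 0" by (rule alg_min_poly) blast
  have pB: "?B \<subseteq> V.span (?p ` ?B)"
  proof (rule V.span_minimal)
    show "monoms x y \<subseteq> V.span (?p ` ?B)"
    proof
      fix b assume "b \<in> monoms x y"
      then obtain i j where b: "b = x ^ i * y ^ j" by (auto simp: monoms_def powers_def)
      have "x ^ i \<in> V.span (powers (x ^ CHAR('c)))" "y ^ j \<in> V.span (powers (y ^ CHAR('c)))"
        using is_subringD(7)[OF span_powers_subring] sep_in_span_powers_pc x y by blast+
      hence "b \<in> V.span (monoms (x ^ CHAR('c)) (y ^ CHAR('c)))" unfolding b monoms_def by (rule span_times)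
      also have "\<dots> \<subseteq> V.span (?p ` ?B)"
      proof (intro V.span_mono subsetI)
        fix u assume "u \<in> monoms (x ^ CHAR('c)) (y ^ CHAR('c))"
        then obtain k l where "u = ?p x ^ k * ?p y ^ l" by (auto simp: monoms_def powers_def)
        hence "u = ?p (x ^ k * y ^ l)" by (simp add: power_mult_distrib mult.commute flip: power_mult)
        thus "u \<in> ?p ` ?B" using V.span_base[OF monomsI] by blast
      qed
      finally show "b \<in> V.span (?p ` ?B)" .
    qed
  qed auto
  define I where "I = (\<lambda>i. z ^ i) ` {..<degree m}"
  have evs: "ev (\<Sum>i\<in>J. f i) z = (\<Sum>i\<in>J. ev (f i) z)" for f :: "nat \<Rightarrow> 'f fls poly" and J
    by (induction J rule: infinite_finite_induct) (auto simp: ev_simps)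
  have injz: "inj_on (\<lambda>i. z ^ i) {..<degree m}"
  proof (rule inj_onI)
    fix i j assume ij: "i \<in> {..<degree m}" "j \<in> {..<degree m}" "z ^ i = z ^ j"
    have "ev (monom 1 i - monom 1 j) z = 0" using ij by (simp add: ev_simps)
    moreover have "degree (monom 1 i - monom 1 j :: 'f fls poly) < degree m"
      using ij by (intro degree_diff_less) (auto simp: degree_monom_eq)
    ultimately have "monom 1 i - monom 1 j = (0 :: 'f fls poly)" by (rule m(5))
    thus "i = j" by (simp add: monom_eq_iff')
  qed
  have rel0: "c i = 0" if rel: "(\<Sum>i<degree m. \<iota> (c i) * z ^ i) = 0" and i: "i < degree m" for c i
  proof -
    let ?q = "\<Sum>i<degree m. monom (c i) i"
    have "ev ?q z = 0" using rel by (simp add: evs ev_simps)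
    moreover have "degree ?q < degree m"
    proof -
      have "degree ?q \<le> degree m - 1"
        by (rule degree_sum_le) (auto intro: order.trans[OF degree_monom_le])
      thus ?thesis using m(4) by simp
    qed
    ultimately have "?q = 0" by (rule m(5))
    moreover have "coeff ?q i = (\<Sum>j<degree m. if j = i then c j else 0)"
      unfolding coeff_sum by (intro sum.cong) auto
    ultimately show ?thesis using i by simp
  qed
  have indI: "V.independent I"
    unfolding I_def V.dependent_finite[OF finite_imageI[OF finite_lessThan]]
    using rel0[of "\<lambda>i. _ (z ^ i)"] by (auto simp: sum.reindex[OF injz])
  have IB: "I \<subseteq> ?B" using pw by (auto simp: I_def)
  note ind = frob_independent[OF fT BT pB IB indI]
  have der: "pderiv m \<noteq> 0"
  proof
    assume d0: "pderiv m = 0"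
    have c0: "coeff m i = 0" if "\<not> CHAR('c) dvd i" for i
    proof -
      have "i \<noteq> 0" using that by (intro notI) simp
      then obtain j where j: "i = Suc j" by (cases i) auto
      have "of_nat i * coeff m i = 0" using coeff_pderiv[of m j] d0 by (simp add: j)
      moreover have "of_nat i \<noteq> (0 :: 'f fls)"
        using that emb_eq_0_iff[of "of_nat i"] by (simp add: emb.base.hom_of_nat of_nat_eq_0_iff_char_dvd)
      ultimately show ?thesis by simp
    qed
    have p2: "CHAR('c) \<ge> 2" using prime_pc by (rule prime_ge_2_nat)
    have dd: "CHAR('c) dvd degree m" using c0[of "degree m"] m(1) by auto
    \<comment> \<open>Independence speaks of coefficients attached to vectors. The two injections
      recover k from the vector z^(p k), which then receives the coefficient of m of index p
      k.\<close>
    define u where "u = (\<lambda>w. coeff m (CHAR('c) * the_inv_into {..<degree m} (\<lambda>i. z ^ i) (the_inv_into I ?p w)))"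
    have uz: "u (?p (z ^ k)) = coeff m (CHAR('c) * k)" if "k < degree m" for k
    proof -
      have "the_inv_into I ?p (?p (z ^ k)) = z ^ k"
        by (rule the_inv_into_f_f[OF ind(1)]) (use that in \<open>auto simp: I_def\<close>)
      moreover have "the_inv_into {..<degree m} (\<lambda>i. z ^ i) (z ^ k) = k"
        by (rule the_inv_into_f_f[OF injz]) (use that in auto)
      ultimately show ?thesis unfolding u_def by simp
    qed
    have "(\<Sum>w\<in>?p ` I. \<iota> (u w) * w) = (\<Sum>k<degree m. \<iota> (coeff m (CHAR('c) * k)) * ?p (z ^ k))"
    proof -
      have "inj_on (?p \<circ> (\<lambda>i. z ^ i)) {..<degree m}"
        using injz ind(1) unfolding I_def by (rule comp_inj_on)
      from sum.reindex[OF this, of "\<lambda>w. \<iota> (u w) * w"] show ?thesis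
        using uz by (simp add: I_def image_comp)
    qed
    also have "\<dots> = (\<Sum>i\<le>degree m. \<iota> (coeff m i) * z ^ i)"
    proof (rule sum.reindex_bij_witness_not_neutral[where S' = "{k\<in>{..<degree m}. degree m < CHAR('c) * k}"
          and T' = "{i\<in>{..degree m}. \<not> CHAR('c) dvd i}" and i = "\<lambda>i. i div CHAR('c)" and j = "\<lambda>k. CHAR('c) * k"])
      fix i assume "i \<in> {..degree m} - {i\<in>{..degree m}. \<not> CHAR('c) dvd i}"
      hence i: "i \<le> degree m" "CHAR('c) dvd i" by auto
      show "CHAR('c) * (i div CHAR('c)) = i" using i by simp
      have "i div CHAR('c) < degree m"
      proof (cases "i = 0")
        case False
        hence "i div CHAR('c) < i" using p2 by simp
        thus ?thesis using i by simp
      qed (use m in simp)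
      thus "i div CHAR('c) \<in> {..<degree m} - {k\<in>{..<degree m}. degree m < CHAR('c) * k}" using i by auto
    qed (use p2 in \<open>auto simp: c0 emb_zero coeff_eq_0 power_mult[symmetric] mult.commute\<close>)
    also have "\<dots> = 0" using m(2) by (simp add: ev_altdef)
    finally have sum0: "(\<Sum>w\<in>?p ` I. \<iota> (u w) * w) = 0" .
    define k where "k = degree m div CHAR('c)"
    have k: "k < degree m" "CHAR('c) * k = degree m" using p2 m(4) dd by (auto simp: k_def)
    have "u (?p (z ^ k)) = 0"
      using V.independentD[OF ind(2) _ _ sum0, of "?p (z ^ k)"] k by (auto simp: I_def)
    thus False using uz[OF k(1)] k(2) m(1) by simp
  qed
  \<comment> \<open>Let m = c e with c dividing the derivative. If c vanishes at z, then m divides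
    its own nonzero derivative, which has smaller degree; if e does, then m divides e and c is
    constant.\<close>
  have "coprime m (pderiv m)"
  proof (rule coprimeI)
    fix c assume c: "c dvd m" "c dvd pderiv m"
    from c(1) obtain e where e: "m = c * e" by (auto simp: dvd_def)
    have "ev c z * ev e z = 0" using m(2) by (simp add: e ev_simps)
    hence "ev c z = 0 \<or> ev e z = 0" by simp
    thus "is_unit c"
    proof
      assume "ev c z = 0"
      hence "m dvd pderiv m" using m(3) c(2) dvd_trans by blast
      hence "degree m \<le> degree (pderiv m)" using der by (intro dvd_imp_degree_le)
      also have "\<dots> \<le> degree m - 1" by (rule degree_pderiv_le)
      finally show ?thesis using m(4) by simp
    next
      assume "ev e z = 0"
      hence "m dvd e" by (rule m(3))
      moreover have ne: "c \<noteq> 0" "e \<noteq> 0" using m(1) e by auto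
      ultimately have "degree m \<le> degree e" by (intro dvd_imp_degree_le)
      hence "degree c = 0" using ne by (simp add: e degree_mult_eq)
      thus ?thesis using ne by (simp add: is_unit_iff_degree)
    qed
  qed
  thus "z \<in> sep_elements \<iota>" using m(2) by (rule sep_elementsI)
qed

lemma emb_sep: "\<iota> a \<in> sep_elements \<iota>"
proof (rule sep_elementsI)
  show "coprime [:- a, 1:] (pderiv [:- a, 1:])" by (simp add: pderiv_pCons flip: one_pCons)
  show "ev [:- a, 1:] (\<iota> a) = 0" by (simp add: ev_simps emb_uminus emb_one emb_zero)
qed

lemma sep_subring: "is_subring (sep_elements \<iota>)"
  unfolding is_subring_def
proof (intro conjI ballI)
  show "1 \<in> sep_elements \<iota>" using emb_sep[of 1] by (simp add: emb_one)
  fix x y assume xy: "x \<in> sep_elements \<iota>" "y \<in> sep_elements \<iota>"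
  note m = monoms_props[where x = x and y = y]
  show "x - y \<in> sep_elements \<iota>" "x * y \<in> sep_elements \<iota>"
    using sep_span_monoms(1)[OF xy] is_subringD(4,5)[OF m(1) m(2,3)] by blast+
qed

lemmas sep_ring = is_subringD[OF sep_subring]

lemma sep_inverse: "x \<in> sep_elements \<iota> \<Longrightarrow> inverse x \<in> sep_elements \<iota>"
  using sep_span_monoms[of x x] monoms_props(2)[of x x] by blast

text \<open>The closure contains one root of f. Dividing it off leaves a separable polynomial of
  smaller degree over the closure, so by induction no root lies outside.\<close>

lemma sep_roots:
  assumes "f \<in> polys_over (sep_elements \<iota>)" "coprime f (pderiv f)" "poly f a = 0"
  shows "a \<in> sep_elements \<iota>"
  using assms
proof (induction "degree f" arbitrary: f rule: less_induct)
  case less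
  have "degree f > 0"
  proof (rule ccontr)
    assume "\<not> ?thesis"
    then obtain c where "f = [:c:]" by (auto elim: degree_eq_zeroE)
    thus False using less.prems by auto
  qed
  then obtain s where s: "s \<in> sep_elements \<iota>" "poly f s = 0"
    using sep_closed[of f] less.prems by (auto simp: polys_over_def)
  have X: "[:- s, 1:] \<in> polys_over (sep_elements \<iota>)"
    using s sep_ring by (auto simp: polys_over_def coeff_pCons split: nat.splits)
  have "lead_coeff [:- s, 1:] = 1" by simp
  then obtain h r where hr: "h \<in> polys_over (sep_elements \<iota>)" "f = [:- s, 1:] * h + r"
      "r = 0 \<or> degree r < degree [:- s, 1:]"
    using polys_over_division[OF sep_subring less.prems(1) X] by metis
  have "poly r s = 0" using s hr(2) by simp
  hence "r = 0" using hr(3) by (auto elim!: degree_eq_zeroE)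
  hence f: "f = [:- s, 1:] * h" using hr by simp
  have "h \<noteq> 0" using \<open>degree f > 0\<close> f by auto
  hence deg: "degree h < degree f" unfolding f by (subst degree_mult_eq) auto
  have "h dvd f" unfolding f by (rule dvd_triv_right)
  hence cop: "coprime h (pderiv h)" by (rule dvd_coprime_pderiv[OF less.prems(2)])
  show ?case
  proof (cases "a = s")
    case False
    hence "poly h a = 0" using less.prems(3) by (simp add: f)
    thus ?thesis using less.hyps[OF deg hr(1) cop] by blast
  qed (use s in simp)
qed

end

section \<open>Extension of embeddings and the fixed field of the Galois group\<close>

context completed_separable_closure
begin

text \<open>Graphs of \<open>K\<^sub>\<infinity>\<close>-embeddings of subrings of \<open>K\<^sub>\<infinity>\<^sup>s\<close> into \<open>K\<^sub>\<infinity>\<^sup>s\<close>.\<close>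

definition emb_graph :: "('c \<times> 'c) set \<Rightarrow> bool" where
  "emb_graph G \<longleftrightarrow> G \<subseteq> sep_elements \<iota> \<times> sep_elements \<iota> \<and> (\<forall>a. (\<iota> a, \<iota> a) \<in> G) \<and>
     (\<forall>x y x' y'. (x, y) \<in> G \<longrightarrow> (x', y') \<in> G \<longrightarrow> (x - x', y - y') \<in> G \<and> (x * x', y * y') \<in> G) \<and>
     (\<forall>y. (0, y) \<in> G \<longrightarrow> y = 0)"

lemma emb_graphD:
  assumes "emb_graph G"
  shows "(x, y) \<in> G \<Longrightarrow> x \<in> sep_elements \<iota> \<and> y \<in> sep_elements \<iota>" "(\<iota> a, \<iota> a) \<in> G"
    "(x, y) \<in> G \<Longrightarrow> (x', y') \<in> G \<Longrightarrow> (x - x', y - y') \<in> G"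
    "(x, y) \<in> G \<Longrightarrow> (x', y') \<in> G \<Longrightarrow> (x + x', y + y') \<in> G"
    "(x, y) \<in> G \<Longrightarrow> (x', y') \<in> G \<Longrightarrow> (x * x', y * y') \<in> G"
    "(0, y) \<in> G \<Longrightarrow> y = 0" "(x, y) \<in> G \<Longrightarrow> (x, y') \<in> G \<Longrightarrow> y = y'"
    "(x, y) \<in> G \<Longrightarrow> (ev q x, ev q y) \<in> G"
proof -
  note G = assms[unfolded emb_graph_def]
  show sep: "(x, y) \<in> G \<Longrightarrow> x \<in> sep_elements \<iota> \<and> y \<in> sep_elements \<iota>" for x y using G by auto
  show K: "(\<iota> a, \<iota> a) \<in> G" for a using G by auto
  show diff: "(x, y) \<in> G \<Longrightarrow> (x', y') \<in> G \<Longrightarrow> (x - x', y - y') \<in> G" for x y x' y' using G by blast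
  show mult: "(x, y) \<in> G \<Longrightarrow> (x', y') \<in> G \<Longrightarrow> (x * x', y * y') \<in> G" for x y x' y' using G by blast
  show zero: "(0, y) \<in> G \<Longrightarrow> y = 0" for y using G by blast
  show add: "(x + x', y + y') \<in> G" if "(x, y) \<in> G" "(x', y') \<in> G" for x y x' y'
    using diff[OF that(1) diff[OF K[of 0] that(2)]] by (simp add: emb_zero)
  show "y = y'" if "(x, y) \<in> G" "(x, y') \<in> G"
    using zero[of "y - y'"] diff[OF that] by simp
  show "(ev q x, ev q y) \<in> G" if "(x, y) \<in> G"
  proof (induction q)
    case 0
    show ?case using K[of 0] by (simp add: ev_simps emb_zero)
  next
    case (pCons a q)
    thus ?case using add[OF K mult[OF that pCons(2)]] by (simp add: ev_simps)
  qed
qed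

text \<open>The inverse of an algebraic element is a polynomial in it, so a graph closed under the
  ring operations is also closed under inversion, and its domain is a field.\<close>

lemma emb_graph_inverse:
  assumes G: "emb_graph G" and xy: "(x, y) \<in> G" and x: "x \<noteq> 0"
  shows "y \<noteq> 0 \<and> (inverse x, inverse y) \<in> G"
proof -
  note D = emb_graphD[OF G]
  have "alg x" using D(1)[OF xy] sep_alg by blast
  then obtain h where h: "inverse x = ev h x" using alg_inverse span_powers_ev by blast
  have "(x * ev h x - \<iota> 1, y * ev h y - \<iota> 1) \<in> G" by (rule D(3)[OF D(5)[OF xy D(8)[OF xy]] D(2)])
  hence "(0, y * ev h y - 1) \<in> G" using x by (simp add: h[symmetric] emb_one)
  hence "y * ev h y - 1 = 0" by (rule D(6))
  hence "y * ev h y = 1" by simp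
  moreover from this have "ev h y = inverse y" by (metis inverse_unique)
  ultimately show ?thesis using D(8)[OF xy, of h] h by auto
qed

lemma emb_graph_domain:
  assumes G: "emb_graph G"
  shows "is_subring (fst ` G)" "\<forall>z\<in>fst ` G. inverse z \<in> fst ` G" "\<iota> a \<in> fst ` G"
proof -
  note D = emb_graphD[OF G]
  show "is_subring (fst ` G)"
    unfolding is_subring_def
  proof (intro conjI ballI)
    show "1 \<in> fst ` G" using D(2)[of 1] by (force simp: emb_one)
    fix x y assume "x \<in> fst ` G" "y \<in> fst ` G"
    then obtain x' y' where "(x, x') \<in> G" "(y, y') \<in> G" by auto
    from D(3)[OF this] D(5)[OF this] show "x - y \<in> fst ` G" "x * y \<in> fst ` G"
      by (force intro: rev_image_eqI)+
  qed
  show "\<iota> a \<in> fst ` G" using D(2)[of a] by force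
  show "\<forall>z\<in>fst ` G. inverse z \<in> fst ` G"
  proof
    fix z assume zG: "z \<in> fst ` G"
    show "inverse z \<in> fst ` G"
  proof (cases "z = 0")
    case False
    obtain w where "w \<in> G" "z = fst w" using zG unfolding image_iff by blast
    hence "(z, snd w) \<in> G" by simp
    thus ?thesis using emb_graph_inverse[OF G _ False] by (metis fst_conv imageI)
  qed (use zG in simp)
  qed
qed

text \<open>The extension sends q(y) to q'(y'), where q' is the image of q coefficient by
  coefficient. It is well defined because q(y) = 0 makes R divide q over the domain, whence R'
  divides q' and q'(y') = 0.\<close>

lemma emb_graph_extend:
  assumes G: "emb_graph G" and y: "y \<in> sep_elements \<iota>" and y': "y' \<in> sep_elements \<iota>"
    and R: "R \<in> polys_over (fst ` G)" "lead_coeff R = 1" "poly R y = 0"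
    and min: "\<And>r. r \<in> polys_over (fst ` G) \<Longrightarrow> poly r y = 0 \<Longrightarrow> degree r < degree R \<Longrightarrow> r = 0"
    and R': "\<And>i. (coeff R i, coeff R' i) \<in> G" "poly R' y' = 0"
  shows "\<exists>G'. G \<subseteq> G' \<and> emb_graph G' \<and> (y, y') \<in> G'"
proof -
  note D = emb_graphD[OF G]
  define rel where "rel = (\<lambda>q q'. \<forall>i. (coeff q i, coeff q' i) \<in> G)"
  define G' where "G' = {(poly q y, poly q' y') | q q'. rel q q'}"
  have D0: "(0, 0) \<in> G" using D(2)[of 0] by (simp add: emb_zero)
  have D1: "(1, 1) \<in> G" using D(2)[of 1] by (simp add: emb_one)
  have sum: "(\<Sum>i\<in>I. f i, \<Sum>i\<in>I. g i) \<in> G" if "\<And>i. i \<in> I \<Longrightarrow> (f i, g i) \<in> G" for I :: "nat set" and f g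
    using that by (induction I rule: infinite_finite_induct) (auto intro: D D0)
  have rel_diff: "rel (q - r) (q' - r')" if "rel q q'" "rel r r'" for q q' r r'
    using that D(3) by (auto simp: rel_def)
  have rel_mult: "rel (q * r) (q' * r')" if "rel q q'" "rel r r'" for q q' r r'
    using that D(5) by (auto simp: rel_def coeff_mult intro!: sum)
  have rel_const: "rel [:a:] [:b:]" if "(a, b) \<in> G" for a b
    using that D0 by (auto simp: rel_def coeff_pCons split: nat.splits)
  have rel_X: "rel [:0, 1:] [:0, 1:]"
    using D0 D1 by (auto simp: rel_def coeff_pCons split: nat.splits)
  have Dsub: "is_subring (fst ` G)"
    by (rule emb_graph_domain(1)[OF G])
  have ex: "\<exists>q'. rel q q'" if q: "q \<in> polys_over (fst ` G)" for q
  proof -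
    have "\<forall>i. \<exists>b. (coeff q i, b) \<in> G" using q by (force simp: polys_over_def)
    then obtain b where b: "\<And>i. (coeff q i, b i) \<in> G" by metis
    have "b i = 0" if "i > degree q" for i using b[of i] D(6) that by (simp add: coeff_eq_0)
    hence "coeff (Abs_poly b) = b" by (intro coeff_Abs_poly) auto
    thus ?thesis using b by (intro exI[of _ "Abs_poly b"]) (simp add: rel_def)
  qed
  have unique: "q' = q''" if "rel q q'" "rel q q''" for q q' q''
    using that D(7) unfolding rel_def poly_eq_iff by blast
  have relR: "rel R R'" using R' by (simp add: rel_def)
  have single: "poly q' y' = 0" if q: "rel q q'" "poly q y = 0" for q q'
  proof -
    have qD: "q \<in> polys_over (fst ` G)" using q(1) by (force simp: rel_def polys_over_def)
    obtain h r where hr: "h \<in> polys_over (fst ` G)" "r \<in> polys_over (fst ` G)" "q = R * h + r"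
        "r = 0 \<or> degree r < degree R"
      using polys_over_division[OF Dsub qD R(1,2)] by metis
    have "poly r y = 0" using hr(3) q(2) R(3) by simp
    hence "r = 0" using min hr by blast
    hence qRh: "q = R * h" using hr by simp
    obtain h' where "rel h h'" using ex hr(1) by blast
    hence "rel q (R' * h')" unfolding qRh using relR rel_mult by blast
    hence "q' = R' * h'" using q(1) unique by blast
    thus ?thesis using R'(2) by simp
  qed
  have S: "poly q x \<in> sep_elements \<iota>" if "\<And>i. coeff q i \<in> sep_elements \<iota>" "x \<in> sep_elements \<iota>" for q x
    using polys_over_poly[OF sep_subring, of q x] that by (simp add: polys_over_def)
  have "emb_graph G'"
    unfolding emb_graph_def
  proof (intro conjI allI impI)
    show "G' \<subseteq> sep_elements \<iota> \<times> sep_elements \<iota>"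
      using D(1) y y' by (auto simp: G'_def rel_def intro!: S)
    show "(\<iota> a, \<iota> a) \<in> G'" for a
      unfolding G'_def using rel_const[OF D(2)[of a]] by force
    show "b = 0" if "(0, b) \<in> G'" for b using that single by (auto simp: G'_def)
    fix a b c d assume "(a, b) \<in> G'" "(c, d) \<in> G'"
    then obtain q q' r r' where q: "rel q q'" "rel r r'" "a = poly q y" "b = poly q' y'" "c = poly r y" "d = poly r' y'"
      by (auto simp: G'_def)
    show "(a - c, b - d) \<in> G'" unfolding G'_def
      using rel_diff[OF q(1,2)] q(3-6) by (intro CollectI exI[of _ "q - r"] exI[of _ "q' - r'"]) simp
    show "(a * c, b * d) \<in> G'" unfolding G'_def
      using rel_mult[OF q(1,2)] q(3-6) by (intro CollectI exI[of _ "q * r"] exI[of _ "q' * r'"]) simp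
  qed
  moreover have "G \<subseteq> G'"
  proof (rule subrelI)
    fix a b assume "(a, b) \<in> G"
    thus "(a, b) \<in> G'" unfolding G'_def
      by (intro CollectI exI[of _ "[:a:]"] exI[of _ "[:b:]"]) (simp add: rel_const)
  qed
  moreover have "(y, y') \<in> G'"
    unfolding G'_def by (intro CollectI exI[of _ "[:0, 1:]"]) (simp add: rel_X)
  ultimately show ?thesis by blast
qed

text \<open>The monic polynomial over L of least degree that vanishes at y divides all others, in
  particular the separable one over K_inf. From that one it inherits being coprime to its
  derivative.\<close>

lemma min_poly_over:
  assumes L: "is_subring L" and inv: "\<forall>z\<in>L. inverse z \<in> L" and K: "\<And>a. \<iota> a \<in> L"
    and y: "y \<in> sep_elements \<iota>"
  shows "\<exists>R\<in>polys_over L. lead_coeff R = 1 \<and> poly R y = 0 \<and> coprime R (pderiv R) \<and>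
    (\<forall>r\<in>polys_over L. poly r y = 0 \<longrightarrow> degree r < degree R \<longrightarrow> r = 0) \<and>
    (\<forall>f\<in>polys_over L. poly f y = 0 \<longrightarrow> (\<exists>h\<in>polys_over L. f = R * h))"
proof -
  obtain f where f: "f \<noteq> 0" "ev f y = 0" "coprime (map_poly \<iota> f) (pderiv (map_poly \<iota> f))"
    using y by (elim sep_elementsE)
  have fL: "map_poly \<iota> f \<in> polys_over L" using K by (simp add: polys_over_def coeff_map_poly emb_zero)
  let ?P = "\<lambda>r. r \<in> polys_over L \<and> r \<noteq> 0 \<and> poly r y = 0"
  have "?P (map_poly \<iota> f)" using f fL by (auto simp: ev_def)
  then obtain R where R: "?P R" and min: "\<And>r. ?P r \<Longrightarrow> degree R \<le> degree r"
    using ex_has_least_nat[of ?P _ degree] by metis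
  define R0 where "R0 = smult (inverse (lead_coeff R)) R"
  have lc: "lead_coeff R \<in> L" using R by (auto simp: polys_over_def)
  have R0: "R0 \<in> polys_over L" "lead_coeff R0 = 1" "poly R0 y = 0" "degree R0 = degree R"
    using R inv[rule_format, OF lc] is_subringD(5)[OF L] by (auto simp: R0_def polys_over_def)
  have min0: "r = 0" if "r \<in> polys_over L" "poly r y = 0" "degree r < degree R0" for r
    using min[of r] that R0(4) by (metis leD)
  have dvd: "\<exists>h\<in>polys_over L. g = R0 * h" if g: "g \<in> polys_over L" "poly g y = 0" for g
  proof -
    obtain h r where hr: "h \<in> polys_over L" "r \<in> polys_over L" "g = R0 * h + r" "r = 0 \<or> degree r < degree R0"
      using polys_over_division[OF L g(1) R0(1,2)] by metis
    have "poly r y = 0" using hr(3) g(2) R0(3) by simp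
    hence "r = 0" using min0[of r] hr(2,4) by blast
    thus ?thesis using hr(1,3) by auto
  qed
  have "R0 dvd map_poly \<iota> f" using dvd[OF fL] f(2) unfolding ev_def by (metis dvd_triv_left)
  hence cop: "coprime R0 (pderiv R0)" by (rule dvd_coprime_pderiv[OF f(3)])
  have "\<forall>r\<in>polys_over L. poly r y = 0 \<longrightarrow> degree r < degree R0 \<longrightarrow> r = 0"
    "\<forall>f\<in>polys_over L. poly f y = 0 \<longrightarrow> (\<exists>h\<in>polys_over L. f = R0 * h)"
    using min0 dvd by blast+
  thus ?thesis using cop R0(1-3) by (intro bexI[of _ R0] conjI)
qed

text \<open>The embedding fixes the separable polynomial of y over K_inf, so the image of R divides
  it as R does. The image is therefore separable and has a root in the closure, to which y can be
  sent.\<close>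

lemma emb_graph_extend_to:
  assumes G: "emb_graph G" and y: "y \<in> sep_elements \<iota>"
  shows "\<exists>G'. G \<subseteq> G' \<and> emb_graph G' \<and> y \<in> fst ` G'"
proof -
  note D = emb_graphD[OF G]
  from min_poly_over[OF emb_graph_domain(1,2,3)[OF G] y]
  obtain R where R: "R \<in> polys_over (fst ` G)" "lead_coeff R = 1" "poly R y = 0" "coprime R (pderiv R)"
    "\<forall>r\<in>polys_over (fst ` G). poly r y = 0 \<longrightarrow> degree r < degree R \<longrightarrow> r = 0"
    "\<forall>f\<in>polys_over (fst ` G). poly f y = 0 \<longrightarrow> (\<exists>h\<in>polys_over (fst ` G). f = R * h)"
    by (elim bexE conjE)
  obtain f where f: "f \<noteq> 0" "ev f y = 0" "coprime (map_poly \<iota> f) (pderiv (map_poly \<iota> f))"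
    using y by (elim sep_elementsE)
  have fD: "map_poly \<iota> f \<in> polys_over (fst ` G)"
    using emb_graph_domain(3)[OF G] by (simp add: polys_over_def coeff_map_poly emb_zero)
  obtain h where h: "h \<in> polys_over (fst ` G)" "map_poly \<iota> f = R * h" using R(6)[rule_format, OF fD] f(2) by (auto simp: ev_def)
  define \<sigma> where "\<sigma> = (\<lambda>x. THE b. (x, b) \<in> G)"
  have \<sigma>: "\<sigma> x = b" if "(x, b) \<in> G" for x b
    unfolding \<sigma>_def using that D(7) by blast
  have \<sigma>G: "(x, \<sigma> x) \<in> G" if "x \<in> fst ` G" for x using that \<sigma> by force
  have \<sigma>0: "\<sigma> 0 = 0" using \<sigma>[of 0 0] D(2)[of 0] by (simp add: emb_zero)
  have co: "(coeff q i, coeff (map_poly \<sigma> q) i) \<in> G" if "q \<in> polys_over (fst ` G)" for q i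
    using that \<sigma>G by (auto simp: coeff_map_poly \<sigma>0 polys_over_def)
  let ?R = "map_poly \<sigma> R"
  have sumG: "(\<Sum>i\<in>I. f i, \<Sum>i\<in>I. g i) \<in> G" if "\<And>i. i \<in> I \<Longrightarrow> (f i, g i) \<in> G" for I :: "nat set" and f g
    using that D(2)[of 0] by (induction I rule: infinite_finite_induct) (auto intro: D simp: emb_zero)
  have "map_poly \<iota> f = ?R * map_poly \<sigma> h"
  proof (rule poly_eqI)
    fix i
    have "(coeff (R * h) i, coeff (?R * map_poly \<sigma> h) i) \<in> G"
      unfolding coeff_mult by (intro sumG D(5) co R h)
    moreover have "(coeff (R * h) i, coeff (R * h) i) \<in> G"
      unfolding h(2)[symmetric] using D(2) by (simp add: coeff_map_poly emb_zero)
    ultimately show "coeff (map_poly \<iota> f) i = coeff (?R * map_poly \<sigma> h) i"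
      unfolding h(2) using D(7) by blast
  qed
  hence cop: "coprime ?R (pderiv ?R)" by (metis dvd_coprime_pderiv dvd_triv_left f(3))
  have S: "\<forall>i. coeff ?R i \<in> sep_elements \<iota>" using co[OF R(1)] D(1) by blast
  have lcR: "coeff ?R (degree R) = 1"
    using \<sigma>[of 1 1] D(2)[of 1] R(2) by (simp add: coeff_map_poly \<sigma>0 emb_one)
  have "degree R > 0"
  proof (rule ccontr)
    assume "\<not> ?thesis"
    then obtain c where "R = [:c:]" by (auto elim: degree_eq_zeroE)
    thus False using R(2,3) by auto
  qed
  hence "degree ?R > 0" using lcR by (metis le_degree less_le_trans zero_neq_one)
  then obtain y' where y': "y' \<in> sep_elements \<iota>" "poly ?R y' = 0"
    using sep_closed[OF S _ cop] by blast
  obtain G' where "G \<subseteq> G'" "emb_graph G'" "(y, y') \<in> G'"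
    using emb_graph_extend[OF G y y'(1) R(1-3) R(5)[rule_format] co[OF R(1)] y'(2)] by blast
  moreover from this have "y \<in> fst ` G'" by (metis fst_conv imageI)
  ultimately show ?thesis by blast
qed

text \<open>By Zorn's lemma, graphs being closed under unions of chains; a maximal graph with a
  smaller domain could be extended by one more element.\<close>

lemma emb_graph_maximal:
  assumes G: "emb_graph G"
  obtains M where "G \<subseteq> M" "emb_graph M" "fst ` M = sep_elements \<iota>"
proof -
  define A where "A = {G'. G \<subseteq> G' \<and> emb_graph G'}"
  have "\<exists>M\<in>A. \<forall>Y\<in>A. M \<subseteq> Y \<longrightarrow> Y = M"
  proof (rule subset_Zorn_nonempty)
    show "A \<noteq> {}" using G by (auto simp: A_def)
    fix C assume C: "C \<noteq> {}" "(subset.chain) A C"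
    then obtain G1 where G1: "G1 \<in> C" by blast
    have CA: "\<And>H. H \<in> C \<Longrightarrow> emb_graph H" "\<And>H. H \<in> C \<Longrightarrow> G \<subseteq> H"
      using C unfolding subset.chain_def A_def by blast+
    have ch: "H \<subseteq> H' \<or> H' \<subseteq> H" if "H \<in> C" "H' \<in> C" for H H'
      using C that unfolding subset.chain_def by blast
    have two: "\<exists>H\<in>C. u \<in> H \<and> v \<in> H" if "u \<in> \<Union>C" "v \<in> \<Union>C" for u v
      using that ch by blast
    have "emb_graph (\<Union>C)"
      unfolding emb_graph_def
    proof (intro conjI allI impI)
      show "\<Union>C \<subseteq> sep_elements \<iota> \<times> sep_elements \<iota>" using CA(1) unfolding emb_graph_def by blast
      show "(\<iota> a, \<iota> a) \<in> \<Union>C" for a using CA(1)[OF G1] G1 unfolding emb_graph_def by blast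
      show "b = 0" if "(0, b) \<in> \<Union>C" for b using that CA(1) unfolding emb_graph_def by blast
      fix a b c d assume "(a, b) \<in> \<Union>C" "(c, d) \<in> \<Union>C"
      then obtain H where H: "H \<in> C" "(a, b) \<in> H" "(c, d) \<in> H" using two by blast
      note D = emb_graphD[OF CA(1)[OF H(1)]]
      show "(a - c, b - d) \<in> \<Union>C" using D(3)[OF H(2,3)] H(1) by blast
      show "(a * c, b * d) \<in> \<Union>C" using D(5)[OF H(2,3)] H(1) by blast
    qed
    moreover have "G \<subseteq> \<Union>C" using CA(2)[OF G1] G1 by blast
    ultimately show "\<Union>C \<in> A" unfolding A_def by blast
  qed
  then obtain M where MA: "M \<in> A" and max: "\<forall>Y\<in>A. M \<subseteq> Y \<longrightarrow> Y = M" by (rule bexE)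
  have M: "G \<subseteq> M" "emb_graph M" using MA by (simp_all add: A_def)
  have "fst ` M = sep_elements \<iota>"
  proof
    show "fst ` M \<subseteq> sep_elements \<iota>" using emb_graphD(1)[OF M(2)] by force
    show "sep_elements \<iota> \<subseteq> fst ` M"
    proof
      fix y assume "y \<in> sep_elements \<iota>"
      then obtain G' where "M \<subseteq> G'" "emb_graph G'" "y \<in> fst ` G'" using emb_graph_extend_to[OF M(2)] by blast
      moreover from this have "G' \<in> A" using M(1) by (simp add: A_def)
      ultimately show "y \<in> fst ` M" using max by metis
    qed
  qed
  thus ?thesis using that M by blast
qed

text \<open>Injectivity comes from inverses. For surjectivity, the map sends the finite root set of
  a polynomial over K_inf injectively into itself, hence onto, and every separable element is such a
  root.\<close>

lemma emb_graph_Gal: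
  assumes M: "emb_graph M" "fst ` M = sep_elements \<iota>"
  obtains \<sigma> where "\<sigma> \<in> Gal \<iota>" "\<And>x y. (x, y) \<in> M \<Longrightarrow> \<sigma> x = y"
proof -
  note D = emb_graphD[OF M(1)]
  define \<sigma> where "\<sigma> = (\<lambda>x\<in>sep_elements \<iota>. THE b. (x, b) \<in> M)"
  have \<sigma>: "\<sigma> x = b" if "(x, b) \<in> M" for x b
  proof -
    have "(THE b. (x, b) \<in> M) = b" using that D(7) by blast
    thus ?thesis using D(1)[OF that] by (simp add: \<sigma>_def)
  qed
  have \<sigma>M: "(x, \<sigma> x) \<in> M" if "x \<in> sep_elements \<iota>" for x using that M(2) \<sigma> by force
  have emb: "\<sigma> (\<iota> a) = \<iota> a" for a using D(2) by (rule \<sigma>)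
  have inj: "inj_on \<sigma> (sep_elements \<iota>)"
  proof (rule inj_onI)
    fix x y assume xy: "x \<in> sep_elements \<iota>" "y \<in> sep_elements \<iota>" "\<sigma> x = \<sigma> y"
    have "(x - y, \<sigma> x - \<sigma> y) \<in> M" using D(3)[OF \<sigma>M \<sigma>M] xy by blast
    thus "x = y" using emb_graph_inverse[OF M(1), of "x - y" "\<sigma> x - \<sigma> y"] xy(3) by auto
  qed
  have "\<sigma> ` sep_elements \<iota> = sep_elements \<iota>"
  proof
    show "\<sigma> ` sep_elements \<iota> \<subseteq> sep_elements \<iota>" using D(1)[OF \<sigma>M] by auto
    show "sep_elements \<iota> \<subseteq> \<sigma> ` sep_elements \<iota>"
    proof
      fix s assume s: "s \<in> sep_elements \<iota>"
      then obtain f where f: "f \<noteq> 0" "ev f s = 0" "coprime (map_poly \<iota> f) (pderiv (map_poly \<iota> f))"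
        by (elim sep_elementsE)
      define Z where "Z = {z. ev f z = 0}"
      have "map_poly \<iota> f \<noteq> 0" using f(1) by simp
      hence fin: "finite Z" unfolding Z_def ev_def by (rule poly_roots_finite)
      have "map_poly \<iota> f \<in> polys_over (sep_elements \<iota>)"
        by (simp add: polys_over_def coeff_map_poly emb_zero emb_sep)
      hence ZS: "Z \<subseteq> sep_elements \<iota>" using sep_roots[OF _ f(3)] by (auto simp: Z_def ev_def)
      have "\<sigma> ` Z \<subseteq> Z"
      proof
        fix w assume "w \<in> \<sigma> ` Z"
        then obtain z where z: "z \<in> Z" "w = \<sigma> z" by blast
        have "(ev f z, ev f w) \<in> M" using D(8)[OF \<sigma>M] z ZS by blast
        thus "w \<in> Z" using z D(6) by (simp add: Z_def)
      qed
      hence "\<sigma> ` Z = Z" using fin inj_on_subset[OF inj ZS] by (intro endo_inj_surj)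
      thus "s \<in> \<sigma> ` sep_elements \<iota>" using ZS f(2) by (auto simp: Z_def)
    qed
  qed
  hence "bij_betw \<sigma> (sep_elements \<iota>) (sep_elements \<iota>)" using inj by (simp add: bij_betw_def)
  moreover have "\<sigma> (x + y) = \<sigma> x + \<sigma> y" "\<sigma> (x * y) = \<sigma> x * \<sigma> y"
    if "x \<in> sep_elements \<iota>" "y \<in> sep_elements \<iota>" for x y
    using D(4,5)[OF \<sigma>M \<sigma>M] that by (auto intro!: \<sigma>)
  ultimately have "\<sigma> \<in> Gal \<iota>" using emb by (auto simp: Gal_def \<sigma>_def)
  thus ?thesis using that \<sigma> by blast
qed

text \<open>The minimal polynomial of an element x outside K_inf has degree at least 2 and, being
  separable, a root in the closure different from x. The embedding that sends x to this root extends
  to an automorphism moving x.\<close>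

theorem Gal_fixed_field:
  assumes x: "x \<in> sep_elements \<iota>" and fixed: "\<And>\<sigma>. \<sigma> \<in> Gal \<iota> \<Longrightarrow> \<sigma> x = x"
  shows "x \<in> range \<iota>"
proof (rule ccontr)
  assume xK: "x \<notin> range \<iota>"
  define G where "G = range (\<lambda>a. (\<iota> a, \<iota> a))"
  have G: "emb_graph G"
    unfolding emb_graph_def
  proof (intro conjI allI impI)
    show "G \<subseteq> sep_elements \<iota> \<times> sep_elements \<iota>" using emb_sep by (auto simp: G_def)
    show "(\<iota> a, \<iota> a) \<in> G" for a by (simp add: G_def)
    show "b = 0" if "(0, b) \<in> G" for b using that by (auto simp: G_def)
    fix a b c d assume "(a, b) \<in> G" "(c, d) \<in> G"
    then obtain u v where uv: "a = \<iota> u" "b = \<iota> u" "c = \<iota> v" "d = \<iota> v" by (auto simp: G_def)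
    show "(a - c, b - d) \<in> G" unfolding G_def uv by (rule range_eqI[of _ _ "u - v"]) (simp add: emb_minus)
    show "(a * c, b * d) \<in> G" unfolding G_def uv by (rule range_eqI[of _ _ "u * v"]) (simp add: emb_mult)
  qed
  have fG: "fst ` G = range \<iota>" by (simp add: G_def image_image)
  from min_poly_over[OF emb_graph_domain(1,2,3)[OF G] x]
  obtain R where R: "R \<in> polys_over (fst ` G)" "lead_coeff R = 1" "poly R x = 0" "coprime R (pderiv R)"
    "\<forall>r\<in>polys_over (fst ` G). poly r x = 0 \<longrightarrow> degree r < degree R \<longrightarrow> r = 0"
    "\<forall>f\<in>polys_over (fst ` G). poly f x = 0 \<longrightarrow> (\<exists>h\<in>polys_over (fst ` G). f = R * h)"
    by (elim bexE conjE)
  have RS: "R \<in> polys_over (sep_elements \<iota>)" using R(1) unfolding polys_over_def fG mem_Collect_eq by (metis emb_sep rangeE)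
  obtain H where RH: "R = [:- x, 1:] * H" using R(3) unfolding poly_eq_0_iff_dvd dvd_def by blast
  have "degree H \<noteq> 0"
  proof
    assume "degree H = 0"
    then obtain c where c: "H = [:c:]" by (auto elim: degree_eq_zeroE)
    have "c = 1" using R(2) by (simp add: RH c split: if_splits)
    hence "coeff R 0 = - x" by (simp add: RH c)
    hence "- x \<in> range \<iota>" using R(1) by (metis (no_types, lifting) fG mem_Collect_eq polys_over_def)
    hence "x \<in> range \<iota>" by (metis emb_uminus minus_minus rangeE rangeI)
    thus False using xK by simp
  qed
  have HR: "H dvd R" unfolding RH by (rule dvd_triv_right)
  have X: "[:- x, 1:] \<in> polys_over (sep_elements \<iota>)"
    using x sep_ring by (auto simp: polys_over_def coeff_pCons split: nat.splits)
  have "lead_coeff [:- x, 1:] = 1" by simp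
  then obtain h r where hr: "h \<in> polys_over (sep_elements \<iota>)" "R = [:- x, 1:] * h + r"
      "r = 0 \<or> degree r < degree [:- x, 1:]"
    using polys_over_division[OF sep_subring RS X] by metis
  have "poly r x = 0" using R(3) hr(2) by simp
  hence "r = 0" using hr(3) by (auto elim!: degree_eq_zeroE)
  hence "[:- x, 1:] * h = [:- x, 1:] * H" using hr(2) RH by (metis add.right_neutral)
  hence "h = H" by (metis mult_left_cancel one_neq_zero pCons_eq_0_iff)
  hence "\<forall>i. coeff H i \<in> sep_elements \<iota>" using hr(1) by (simp add: polys_over_def)
  then obtain x' where x': "x' \<in> sep_elements \<iota>" "poly H x' = 0"
    using sep_closed[of H] \<open>degree H \<noteq> 0\<close> dvd_coprime_pderiv[OF R(4) HR] by blast
  have "poly (pderiv R) x = poly H x" unfolding RH pderiv_mult by (simp add: pderiv_pCons)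
  hence "poly H x \<noteq> 0" using coprime_pderiv_simple_root[OF R(4,3)] by metis
  hence neq: "x' \<noteq> x" using x'(2) by auto
  have coG: "(coeff R i, coeff R i) \<in> G" for i
  proof -
    have "coeff R i \<in> range \<iota>" using R(1) unfolding polys_over_def fG by blast
    thus ?thesis unfolding G_def by blast
  qed
  have "poly R x' = 0" using x'(2) by (simp add: RH)
  from emb_graph_extend[OF G x x'(1) R(1-3) R(5)[rule_format] coG this] obtain G' where
    G': "emb_graph G'" "(x, x') \<in> G'" by blast
  obtain M where M: "G' \<subseteq> M" "emb_graph M" "fst ` M = sep_elements \<iota>" using emb_graph_maximal[OF G'(1)] .
  obtain \<sigma> where "\<sigma> \<in> Gal \<iota>" "\<sigma> x = x'" using emb_graph_Gal[OF M(2,3)] G'(2) M(1) by (metis subsetD)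
  thus False using fixed neq by auto
qed

end

section \<open>The absolute value, and Galois automorphisms as isometries\<close>

context completed_separable_closure
begin

abbreviation nrm :: "'c \<Rightarrow> real" where "nrm x \<equiv> dist x 0"

lemma nrm_diff_le: "nrm (a - b) \<le> max (nrm a) (nrm b)"
proof -
  have "nrm (- b) = nrm b" by (metis diff_0 dist_commute dist_diff)
  thus ?thesis using abs_add[of a "- b"] by simp
qed

lemma nrm_minus_commute: "nrm (a - b) = nrm (b - a)"
  by (metis dist_commute dist_diff)

lemma nrm_uminus: "nrm (- b) = nrm b"
  by (metis diff_0 dist_commute dist_diff)

lemma nrm_one: "nrm 1 = 1"
proof -
  have "nrm 1 * nrm 1 = nrm 1 * 1" using abs_mult[of 1 1] by simp
  moreover have "nrm 1 \<noteq> 0" by simp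
  ultimately show ?thesis by (metis mult_left_cancel)
qed

lemma nrm_power: "nrm (x ^ k) = nrm x ^ k"
  by (induction k) (simp_all add: nrm_one abs_mult)

lemma nrm_inverse: "nrm (inverse x) = inverse (nrm x)"
proof (cases "x = 0")
  case False
  hence "nrm x * nrm (inverse x) = 1" using abs_mult[of x "inverse x"] nrm_one by simp
  thus ?thesis by (simp add: inverse_unique)
qed simp

lemma nrm_sum_le:
  assumes "\<And>i. i \<in> I \<Longrightarrow> nrm (f i) \<le> B" "B \<ge> 0"
  shows "nrm (\<Sum>i\<in>I. f i) \<le> B"
  using assms(1)
proof (induction I rule: infinite_finite_induct)
  case (insert i I)
  have "nrm (f i + sum f I) \<le> max (nrm (f i)) (nrm (sum f I))" by (rule abs_add)
  also have "\<dots> \<le> B" using insert by simp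
  finally show ?case using insert by simp
qed (use assms(2) in simp_all)

lemma card_f_ge_2: "CARD('f) \<ge> 2"
proof -
  have "card {0, 1 :: 'f} \<le> CARD('f)" by (rule card_mono) auto
  thus ?thesis by simp
qed

lemma qf_gt_1: "real CARD('f) > 1" using card_f_ge_2 by simp

lemma tendsto_nrm_iff: "(f \<longlonglongrightarrow> (l :: 'c)) \<longleftrightarrow> (\<lambda>i. nrm (f i - l)) \<longlonglongrightarrow> 0"
  by (subst tendsto_dist_iff) (subst dist_diff, rule refl)

lemma LIMSEQ_nrm_add: "f \<longlonglongrightarrow> a \<Longrightarrow> g \<longlonglongrightarrow> b \<Longrightarrow> (\<lambda>i. f i + g i) \<longlonglongrightarrow> a + (b :: 'c)"
proof -
  assume f: "f \<longlonglongrightarrow> a" and g: "g \<longlonglongrightarrow> b"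
  have lim: "(\<lambda>i. max (nrm (f i - a)) (nrm (g i - b))) \<longlonglongrightarrow> 0"
    using tendsto_max[OF f[unfolded tendsto_nrm_iff] g[unfolded tendsto_nrm_iff]] by simp
  have "(\<lambda>i. nrm ((f i + g i) - (a + b))) \<longlonglongrightarrow> 0"
  proof (rule tendsto_sandwich[OF _ _ tendsto_const lim])
    show "\<forall>\<^sub>F i in sequentially. nrm ((f i + g i) - (a + b)) \<le> max (nrm (f i - a)) (nrm (g i - b))"
      unfolding add_diff_add by (intro always_eventually allI abs_add)
  qed simp
  thus ?thesis unfolding tendsto_nrm_iff .
qed

lemma LIMSEQ_nrm_cmult: "f \<longlonglongrightarrow> a \<Longrightarrow> (\<lambda>i. c * f i) \<longlonglongrightarrow> c * (a :: 'c)"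
proof -
  assume f: "f \<longlonglongrightarrow> a"
  have "(\<lambda>i. nrm c * nrm (f i - a)) \<longlonglongrightarrow> nrm c * 0"
    using f unfolding tendsto_nrm_iff by (intro tendsto_mult tendsto_const)
  thus ?thesis unfolding tendsto_nrm_iff by (simp add: abs_mult[symmetric] right_diff_distrib)
qed

lemma LIMSEQ_nrm_diff: "f \<longlonglongrightarrow> a \<Longrightarrow> g \<longlonglongrightarrow> b \<Longrightarrow> (\<lambda>i. f i - g i) \<longlonglongrightarrow> a - (b :: 'c)"
  using LIMSEQ_nrm_add[of f a "\<lambda>i. - 1 * g i" "- 1 * b"] LIMSEQ_nrm_cmult[of g b "- 1"] by simp

text \<open>The absolute value of K_inf takes only powers of q as nonzero values, so smallness can
  be read as the vanishing of Laurent coefficients.\<close>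

lemma nrm_emb_less_iff:
  "nrm (\<iota> a) < (real CARD('f)) powr - of_int k \<longleftrightarrow> (\<forall>j\<le>k. fls_nth a j = 0)"
proof (cases "a = 0")
  case True
  thus ?thesis using qf_gt_1 by (simp add: emb_zero)
next
  case False
  have "nrm (\<iota> a) < (real CARD('f)) powr - of_int k \<longleftrightarrow> k < fls_subdegree a"
    unfolding abs_emb[OF False] using qf_gt_1 by simp
  also have "\<dots> \<longleftrightarrow> (\<forall>j\<le>k. fls_nth a j = 0)"
    using False by (auto intro: fls_eq0_below_subdegree dest: nth_fls_subdegree_nonzero)
      (meson False not_le nth_fls_subdegree_nonzero)
  finally show ?thesis .
qed

lemma small_power: "\<epsilon> > 0 \<Longrightarrow> \<exists>k::int. k \<ge> 0 \<and> (real CARD('f)) powr - of_int k < \<epsilon>"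
proof -
  assume e: "\<epsilon> > 0"
  obtain m where m: "(inverse (real CARD('f))) ^ m < \<epsilon>"
    using real_arch_pow_inv[OF e, of "inverse (real CARD('f))"] qf_gt_1 by (auto simp: field_simps)
  have "(real CARD('f)) powr - of_int (int m) = inverse (real CARD('f)) ^ m"
    using qf_gt_1 by (simp add: powr_minus powr_realpow power_inverse)
  thus ?thesis using m by (intro exI[of _ "int m"]) simp
qed

text \<open>K_inf is complete: along a convergent sequence each Laurent coefficient becomes
  constant, and the series of the eventual values is the limit.\<close>

lemma emb_range_closed:
  assumes lim: "(\<lambda>i. \<iota> (a i)) \<longlonglongrightarrow> y" shows "y \<in> range \<iota>"
proof -
  have "\<exists>N. \<forall>m\<ge>N. \<forall>m'\<ge>N. \<forall>j\<le>k. fls_nth (a m) j = fls_nth (a m') j" for k :: int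
  proof -
    have "0 < (real CARD('f)) powr - of_int k" using qf_gt_1 by simp
    then obtain N where N: "\<forall>m\<ge>N. \<forall>m'\<ge>N. dist (\<iota> (a m)) (\<iota> (a m')) < (real CARD('f)) powr - of_int k"
      using LIMSEQ_imp_Cauchy[OF lim] unfolding Cauchy_def by blast
    have "fls_nth (a m) j = fls_nth (a m') j" if "m \<ge> N" "m' \<ge> N" "j \<le> k" for m m' j
    proof -
      have "dist (\<iota> (a m)) (\<iota> (a m')) < (real CARD('f)) powr - of_int k" using N that by blast
      hence "nrm (\<iota> (a m - a m')) < (real CARD('f)) powr - of_int k"
        by (simp add: dist_diff[of "\<iota> (a m)"] emb_minus)
      thus ?thesis using that(3) unfolding nrm_emb_less_iff by simp
    qed
    thus ?thesis by blast
  qed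
  then obtain N where N: "\<And>k m m' j. m \<ge> N k \<Longrightarrow> m' \<ge> N k \<Longrightarrow> j \<le> k \<Longrightarrow> fls_nth (a m) j = fls_nth (a m') j"
    by metis
  define z where "z = Abs_fls (\<lambda>k. fls_nth (a (N k)) k)"
  \<comment> \<open>A Laurent series needs a lower bound for its support. From index
    \<open>N 0\<close> on, all members agree up to exponent 0, so a single one of them provides the
    bound.\<close>
  have low: "fls_nth (a (N k)) k = 0" if "k < min 0 (fls_subdegree (a (N 0)))" for k
  proof -
    have "fls_nth (a (N k)) k = fls_nth (a (max (N k) (N 0))) k" by (rule N[of k]) auto
    also have "\<dots> = fls_nth (a (N 0)) k" using that by (intro N[of 0]) auto
    also have "\<dots> = 0" using that by (intro fls_eq0_below_subdegree) auto
    finally show ?thesis .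
  qed
  have z: "fls_nth z k = fls_nth (a (N k)) k" for k
    unfolding z_def using low by (intro nth_Abs_fls_lower_bound[of "min 0 (fls_subdegree (a (N 0)))"]) auto
  have agree: "fls_nth (a m) j = fls_nth z j" if "m \<ge> N k" "j \<le> k" for m j k
  proof -
    have "fls_nth z j = fls_nth (a (max (N j) m)) j" unfolding z by (rule N[of j]) auto
    also have "\<dots> = fls_nth (a m) j" using that by (intro N[of k]) auto
    finally show ?thesis by simp
  qed
  have "(\<lambda>i. \<iota> (a i)) \<longlonglongrightarrow> \<iota> z"
  proof (rule metric_LIMSEQ_I)
    fix r :: real assume "r > 0"
    then obtain k :: int where k: "(real CARD('f)) powr - of_int k < r" using small_power by blast
    have "dist (\<iota> (a m)) (\<iota> z) < r" if "m \<ge> N k" for m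
    proof -
      have "nrm (\<iota> (a m - z)) < (real CARD('f)) powr - of_int k"
        unfolding nrm_emb_less_iff using agree[OF that] by simp
      thus ?thesis using k by (simp add: dist_diff[of "\<iota> (a m)"] emb_minus)
    qed
    thus "\<exists>no. \<forall>n\<ge>no. dist (\<iota> (a n)) (\<iota> z) < r" by blast
  qed
  thus ?thesis using lim LIMSEQ_unique by blast
qed

definition lin_on :: "'c set \<Rightarrow> ('c \<Rightarrow> 'c) \<Rightarrow> bool" where
  "lin_on A u \<longleftrightarrow> (\<forall>x\<in>A. \<forall>y\<in>A. u (x + y) = u x + u y) \<and> (\<forall>a. \<forall>x\<in>A. u (\<iota> a * x) = \<iota> a * u x)"

text \<open>On a finite-dimensional \<open>K\<^sub>\<infinity>\<close>-space every linear map is bounded; closedness of the space is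
  needed for the induction on the dimension.\<close>

lemma span_closed_bounded:
  assumes "finite T"
  shows "(\<forall>w y. (\<forall>i. w i \<in> V.span T) \<longrightarrow> w \<longlonglongrightarrow> y \<longrightarrow> y \<in> V.span T) \<and>
    (\<forall>u. lin_on (V.span T) u \<longrightarrow> (\<exists>C>0. \<forall>x\<in>V.span T. nrm (u x) \<le> C * nrm x))"
  using assms
proof (induction T rule: finite_induct)
  case empty
  have "y = 0" if "\<forall>i. w i = 0" "w \<longlonglongrightarrow> y" for w :: "nat \<Rightarrow> 'c" and y
  proof -
    have "w = (\<lambda>_. 0)" using that(1) by auto
    thus ?thesis using that(2) LIMSEQ_unique[OF tendsto_const] by metis
  qed
  moreover have "u 0 = 0" if "lin_on {0} u" for u
    using that unfolding lin_on_def by (metis add_cancel_right_right add.right_neutral singletonI)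
  ultimately show ?case by (auto intro!: exI[of _ 1])
next
  case (insert b T)
  show ?case
  proof (cases "b \<in> V.span T")
    case True
    hence "V.span (insert b T) = V.span T" by (rule V.span_redundant)
    thus ?thesis using insert.IH by simp
  next
    case False
    \<comment> \<open>Here the closedness of the smaller space is used: b keeps a positive distance
      from it, which bounds the coordinate along b by the size of the vector.\<close>
    have "\<exists>\<delta>>0. \<forall>v\<in>V.span T. \<delta> \<le> nrm (b - v)"
    proof (rule ccontr)
      assume neg: "\<not> ?thesis"
      have "\<exists>v\<in>V.span T. nrm (b - v) < inverse (real (Suc i))" for i
        using neg by (metis inverse_positive_iff_positive not_le of_nat_0_less_iff zero_less_Suc)
      then obtain v where v: "\<And>i. v i \<in> V.span T" "\<And>i. nrm (b - v i) < inverse (real (Suc i))"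
        by metis
      have "(\<lambda>i. nrm (v i - b)) \<longlonglongrightarrow> 0"
      proof (rule tendsto_sandwich[OF _ _ tendsto_const LIMSEQ_inverse_real_of_nat])
        show "\<forall>\<^sub>F i in sequentially. nrm (v i - b) \<le> inverse (real (Suc i))"
          using v(2) by (intro always_eventually allI) (metis less_imp_le nrm_minus_commute)
      qed simp
      hence "v \<longlonglongrightarrow> b" unfolding tendsto_nrm_iff .
      thus False using False insert.IH v(1) by blast
    qed
    then obtain \<delta> where \<delta>: "\<delta> > 0" "\<And>v. v \<in> V.span T \<Longrightarrow> \<delta> \<le> nrm (b - v)" by blast
    have lower: "nrm (\<iota> a) * \<delta> \<le> nrm (\<iota> a * b + v)" if "v \<in> V.span T" for a v
    proof (cases "a = 0")
      case False
      have "\<iota> (- inverse a) * v \<in> V.span T" using that by (rule V.span_scale)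
      hence "\<delta> \<le> nrm (b - \<iota> (- inverse a) * v)" by (rule \<delta>(2))
      hence "nrm (\<iota> a) * \<delta> \<le> nrm (\<iota> a * (b - \<iota> (- inverse a) * v))"
        unfolding abs_mult by (rule mult_left_mono) simp
      also have "\<iota> a * (b - \<iota> (- inverse a) * v) = \<iota> a * b + v"
        using False emb_eq_0_iff[of a] by (simp add: emb_uminus emb_inverse algebra_simps)
      finally show ?thesis .
    qed (simp add: emb_zero)
    have decomp: "\<exists>a v. x = \<iota> a * b + v \<and> v \<in> V.span T" if "x \<in> V.span (insert b T)" for x
    proof -
      from that obtain k where "x - \<iota> k * b \<in> V.span T" unfolding V.span_insert by blast
      thus ?thesis by (intro exI[of _ k] exI[of _ "x - \<iota> k * b"]) simp
    qed
    have sub: "v \<in> V.span (insert b T)" if "v \<in> V.span T" for v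
      using that V.span_mono[of T "insert b T"] by blast
    have bin: "b \<in> V.span (insert b T)" by (rule V.span_base) simp
    have "y \<in> V.span (insert b T)" if w: "\<forall>i. w i \<in> V.span (insert b T)" "w \<longlonglongrightarrow> y" for w y
    proof -
      have "\<forall>i. \<exists>a v. w i = \<iota> a * b + v \<and> v \<in> V.span T" using w(1) decomp by blast
      from choice[OF this] obtain a where "\<forall>i. \<exists>v. w i = \<iota> (a i) * b + v \<and> v \<in> V.span T" ..
      from choice[OF this] obtain v where v: "\<forall>i. w i = \<iota> (a i) * b + v i \<and> v i \<in> V.span T" ..
      hence av: "\<And>i. w i = \<iota> (a i) * b + v i" "\<And>i. v i \<in> V.span T" by blast+
      have "Cauchy (\<lambda>i. \<iota> (a i))"
      proof (rule metric_CauchyI)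
        fix e :: real assume "e > 0"
        hence "e * \<delta> > 0" using \<delta> by simp
        then obtain N where N: "\<forall>m\<ge>N. \<forall>m'\<ge>N. dist (w m) (w m') < e * \<delta>"
          using LIMSEQ_imp_Cauchy[OF w(2)] unfolding Cauchy_def by blast
        have "dist (\<iota> (a m)) (\<iota> (a m')) < e" if "m \<ge> N" "m' \<ge> N" for m m'
        proof -
          have "nrm (\<iota> (a m - a m')) * \<delta> \<le> nrm (\<iota> (a m - a m') * b + (v m - v m'))"
            using av(2) by (intro lower V.span_diff)
          also have "\<iota> (a m - a m') * b + (v m - v m') = w m - w m'"
            by (simp add: av(1) emb_minus algebra_simps)
          also have "nrm (w m - w m') < e * \<delta>" using N that unfolding dist_diff[of "w m" "w m'", symmetric] by blast
          finally have "nrm (\<iota> (a m - a m')) < e" using \<delta>(1) by simp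
          thus ?thesis by (simp add: dist_diff[of "\<iota> (a m)"] emb_minus)
        qed
        thus "\<exists>M. \<forall>m\<ge>M. \<forall>n\<ge>M. dist (\<iota> (a m)) (\<iota> (a n)) < e" by blast
      qed
      then obtain z where z: "(\<lambda>i. \<iota> (a i)) \<longlonglongrightarrow> z" using Cauchy_convergent convergent_def by blast
      then obtain a0 where a0: "z = \<iota> a0" using emb_range_closed by blast
      have "(\<lambda>i. w i - b * \<iota> (a i)) \<longlonglongrightarrow> y - b * \<iota> a0"
        using w(2) LIMSEQ_nrm_cmult[OF z[unfolded a0]] by (rule LIMSEQ_nrm_diff)
      hence "v \<longlonglongrightarrow> y - b * \<iota> a0" by (simp add: av(1) mult.commute)
      hence "y - b * \<iota> a0 \<in> V.span T" using av(2) insert.IH by blast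
      hence "(y - b * \<iota> a0) + \<iota> a0 * b \<in> V.span (insert b T)"
        by (rule V.span_add[OF sub V.span_scale[OF bin]])
      thus ?thesis by (simp add: mult.commute)
    qed
    moreover have "\<exists>C>0. \<forall>x\<in>V.span (insert b T). nrm (u x) \<le> C * nrm x"
      if u: "lin_on (V.span (insert b T)) u" for u
    proof -
      have "lin_on (V.span T) u" using u sub unfolding lin_on_def by blast
      then obtain C where C: "C > 0" "\<And>x. x \<in> V.span T \<Longrightarrow> nrm (u x) \<le> C * nrm x" using insert.IH by blast
      \<comment> \<open>Write x = a b + v. Then |a| <= |x| / delta and |v| <= |x| (1 + |b| / delta),
        and D adds the resulting bounds for the images of the two components.\<close>
      define D where "D = nrm (u b) / \<delta> + C * (1 + nrm b / \<delta>)"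
      have D0: "D > 0" unfolding D_def using C(1) \<delta>(1)
        by (intro add_nonneg_pos mult_pos_pos add_pos_nonneg divide_nonneg_pos) auto
      have "nrm (u x) \<le> D * nrm x" if x: "x \<in> V.span (insert b T)" for x
      proof -
        obtain a v where av: "x = \<iota> a * b + v" "v \<in> V.span T" using decomp[OF x] by blast
        have na: "nrm (\<iota> a) \<le> nrm x / \<delta>" using lower[OF av(2), of a] \<delta>(1) by (simp add: av(1) field_simps)
        have "v = x - \<iota> a * b" by (simp add: av(1))
        hence "nrm v \<le> max (nrm x) (nrm (\<iota> a * b))" using nrm_diff_le by simp
        also have "\<dots> \<le> nrm x + nrm (\<iota> a * b)" by simp
        also have "\<dots> \<le> nrm x + nrm x / \<delta> * nrm b"
          unfolding abs_mult by (intro add_left_mono mult_right_mono na) simp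
        finally have nv: "nrm v \<le> nrm x * (1 + nrm b / \<delta>)" by (simp add: algebra_simps)
        have "u x = u (\<iota> a * b) + u v"
          using u av sub bin V.span_scale[OF bin] unfolding lin_on_def by blast
        also have "u (\<iota> a * b) = \<iota> a * u b" using u bin unfolding lin_on_def by blast
        finally have "nrm (u x) \<le> max (nrm (\<iota> a * u b)) (nrm (u v))" using abs_add by metis
        also have "\<dots> \<le> nrm (\<iota> a) * nrm (u b) + nrm (u v)" by (simp add: abs_mult)
        also have "\<dots> \<le> nrm x / \<delta> * nrm (u b) + C * (nrm x * (1 + nrm b / \<delta>))"
        proof (rule add_mono)
          show "nrm (\<iota> a) * nrm (u b) \<le> nrm x / \<delta> * nrm (u b)" using na by (rule mult_right_mono) simp
          have "nrm (u v) \<le> C * nrm v" by (rule C(2)[OF av(2)])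
          also have "\<dots> \<le> C * (nrm x * (1 + nrm b / \<delta>))" using nv C(1) by (intro mult_left_mono) auto
          finally show "nrm (u v) \<le> C * (nrm x * (1 + nrm b / \<delta>))" .
        qed
        also have "\<dots> = D * nrm x" by (simp add: D_def algebra_simps)
        finally show ?thesis .
      qed
      thus ?thesis using D0 by blast
    qed
    ultimately show ?thesis by blast
  qed
qed

lemma GalD:
  assumes "\<sigma> \<in> Gal \<iota>"
  shows "x \<in> sep_elements \<iota> \<Longrightarrow> \<sigma> x \<in> sep_elements \<iota>"
    "x \<in> sep_elements \<iota> \<Longrightarrow> y \<in> sep_elements \<iota> \<Longrightarrow> \<sigma> (x + y) = \<sigma> x + \<sigma> y"
    "x \<in> sep_elements \<iota> \<Longrightarrow> y \<in> sep_elements \<iota> \<Longrightarrow> \<sigma> (x * y) = \<sigma> x * \<sigma> y"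
    "\<sigma> (\<iota> a) = \<iota> a" "\<sigma> 0 = 0" "\<sigma> 1 = 1"
    "x \<in> sep_elements \<iota> \<Longrightarrow> y \<in> sep_elements \<iota> \<Longrightarrow> \<sigma> (x - y) = \<sigma> x - \<sigma> y"
    "x \<in> sep_elements \<iota> \<Longrightarrow> \<sigma> (x ^ k) = \<sigma> x ^ k"
    "x \<in> sep_elements \<iota> \<Longrightarrow> \<sigma> (inverse x) = inverse (\<sigma> x)"
    "x \<in> sep_elements \<iota> \<Longrightarrow> \<sigma> x = 0 \<longleftrightarrow> x = 0"
    "bij_betw \<sigma> (sep_elements \<iota>) (sep_elements \<iota>)" "\<sigma> \<in> extensional (sep_elements \<iota>)"
proof -
  note G = assms[unfolded Gal_def mem_Collect_eq]
  show bij: "bij_betw \<sigma> (sep_elements \<iota>) (sep_elements \<iota>)" and "\<sigma> \<in> extensional (sep_elements \<iota>)"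
    using G by blast+
  show add: "\<sigma> (x + y) = \<sigma> x + \<sigma> y" if "x \<in> sep_elements \<iota>" "y \<in> sep_elements \<iota>" for x y
    using G that by blast
  show mult: "\<sigma> (x * y) = \<sigma> x * \<sigma> y" if "x \<in> sep_elements \<iota>" "y \<in> sep_elements \<iota>" for x y
    using G that by blast
  show emb: "\<sigma> (\<iota> a) = \<iota> a" for a using G by blast
  show 0: "\<sigma> 0 = 0" using emb[of 0] by (simp add: emb_zero)
  show 1: "\<sigma> 1 = 1" using emb[of 1] by (simp add: emb_one)
  show "x \<in> sep_elements \<iota> \<Longrightarrow> \<sigma> x \<in> sep_elements \<iota>" using bij by (rule bij_betwE[THEN bspec])
  show "\<sigma> (x - y) = \<sigma> x - \<sigma> y" if "x \<in> sep_elements \<iota>" "y \<in> sep_elements \<iota>"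
    using add[OF sep_ring(4)[OF that] that(2)] by simp
  show "\<sigma> (x ^ k) = \<sigma> x ^ k" if "x \<in> sep_elements \<iota>"
    by (induction k) (use that 1 mult sep_ring(7) in auto)
  show z: "\<sigma> x = 0 \<longleftrightarrow> x = 0" if "x \<in> sep_elements \<iota>" for x
    using inj_onD[OF bij_betw_imp_inj_on[OF bij], of x 0] 0 that sep_ring(1) by auto
  show "\<sigma> (inverse x) = inverse (\<sigma> x)" if x: "x \<in> sep_elements \<iota>"
  proof (cases "x = 0")
    case False
    have "\<sigma> x * \<sigma> (inverse x) = 1" using mult[OF x sep_inverse[OF x]] False 1 by simp
    thus ?thesis by (simp add: inverse_unique)
  qed (simp add: 0)
qed

text \<open>On the finite-dimensional space K_inf[x] the automorphism is bounded by some constant C.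
  Applied to all powers of x this gives (|sigma x| / |x|)^i <= C for every i, so the quotient is at
  most 1. The argument takes the place of the uniqueness of extensions of absolute values.\<close>

lemma Gal_nrm_le:
  assumes \<sigma>: "\<sigma> \<in> Gal \<iota>" and x: "x \<in> sep_elements \<iota>" and x0: "x \<noteq> 0"
  shows "nrm (\<sigma> x) \<le> nrm x"
proof (rule ccontr)
  assume less: "\<not> ?thesis"
  note \<sigma>D = GalD[OF \<sigma>]
  obtain T where T: "finite T" "T \<subseteq> powers x" "powers x \<subseteq> V.span T" using alg_powers_span[OF sep_alg[OF x]] by blast
  have TS: "V.span T \<subseteq> sep_elements \<iota>"
  proof
    fix y assume "y \<in> V.span T"
    thus "y \<in> sep_elements \<iota>"
    proof (induction rule: V.span_induct_alt)
      case (step c b y)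
      obtain i where "b = x ^ i" using step(1) T(2) by (auto simp: powers_def)
      thus ?case using step(2) x by (auto intro!: sep_ring emb_sep)
    qed (rule sep_ring(1))
  qed
  have "lin_on (V.span T) \<sigma>"
    unfolding lin_on_def
  proof (intro conjI ballI allI)
    fix a y z assume "y \<in> V.span T"
    hence y: "y \<in> sep_elements \<iota>" using TS by blast
    show "\<sigma> (\<iota> a * y) = \<iota> a * \<sigma> y" using \<sigma>D(3)[OF emb_sep y] \<sigma>D(4) by simp
    assume "z \<in> V.span T"
    hence z: "z \<in> sep_elements \<iota>" using TS by blast
    show "\<sigma> (y + z) = \<sigma> y + \<sigma> z" using y z by (rule \<sigma>D(2))
  qed
  then obtain C where C: "\<And>y. y \<in> V.span T \<Longrightarrow> nrm (\<sigma> y) \<le> C * nrm y"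
    using span_closed_bounded[OF T(1)] by blast
  have "(nrm (\<sigma> x) / nrm x) ^ i \<le> C" for i
  proof -
    have "x ^ i \<in> V.span T" using T(3) by (auto simp: powers_def)
    hence "nrm (\<sigma> x) ^ i \<le> C * nrm x ^ i" using C \<sigma>D(8)[OF x] by (metis nrm_power)
    thus ?thesis using x0 by (simp add: power_divide divide_le_eq)
  qed
  moreover obtain i where "C < (nrm (\<sigma> x) / nrm x) ^ i"
    using real_arch_pow[of "nrm (\<sigma> x) / nrm x" C] less x0 by (auto simp: less_divide_eq)
  ultimately show False by (metis not_less)
qed

lemma Gal_nrm:
  assumes \<sigma>: "\<sigma> \<in> Gal \<iota>" and x: "x \<in> sep_elements \<iota>" shows "nrm (\<sigma> x) = nrm x"
proof (cases "x = 0")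
  case False
  have "nrm (\<sigma> (inverse x)) \<le> nrm (inverse x)"
    using False by (intro Gal_nrm_le[OF \<sigma>] sep_inverse x) auto
  hence "inverse (nrm (\<sigma> x)) \<le> inverse (nrm x)" by (simp add: GalD(9)[OF \<sigma> x] nrm_inverse)
  moreover have "\<sigma> x \<noteq> 0" using False GalD(10)[OF \<sigma> x] by simp
  ultimately have "nrm x \<le> nrm (\<sigma> x)" using False by simp
  thus ?thesis using Gal_nrm_le[OF \<sigma> x False] by simp
qed (simp add: GalD(5)[OF \<sigma>])

text \<open>As the automorphism is an isometry, every approximating sequence has the same limit of
  images. Since elements of the Betti realization have separable coefficients
  (\<open>W_scoef\<close>), this determines the Galois action on them.\<close>

lemma gal_ext_eq:
  assumes \<sigma>: "\<sigma> \<in> Gal \<iota>" and x: "x \<in> sep_elements \<iota>" shows "gal_ext \<iota> \<sigma> x = \<sigma> x"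
  unfolding gal_ext_def
proof (rule the_equality)
  show "\<exists>s. range s \<subseteq> sep_elements \<iota> \<and> s \<longlonglongrightarrow> x \<and> (\<lambda>i. \<sigma> (s i)) \<longlonglongrightarrow> \<sigma> x"
    using x by (intro exI[of _ "\<lambda>_. x"]) auto
  fix y assume "\<exists>s. range s \<subseteq> sep_elements \<iota> \<and> s \<longlonglongrightarrow> x \<and> (\<lambda>i. \<sigma> (s i)) \<longlonglongrightarrow> y"
  then obtain s where s: "range s \<subseteq> sep_elements \<iota>" "s \<longlonglongrightarrow> x" "(\<lambda>i. \<sigma> (s i)) \<longlonglongrightarrow> y" by blast
  have sS: "s i \<in> sep_elements \<iota>" for i using s(1) by blast
  have "nrm (\<sigma> (s i) - \<sigma> x) = nrm (s i - x)" for i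
    using Gal_nrm[OF \<sigma> sep_ring(4)[OF sS x]] GalD(7)[OF \<sigma> sS x] by metis
  hence "(\<lambda>i. \<sigma> (s i)) \<longlonglongrightarrow> \<sigma> x" using s(2) unfolding tendsto_nrm_iff by simp
  thus "y = \<sigma> x" using s(3) LIMSEQ_unique by blast
qed

abbreviation gcomp :: "('c \<Rightarrow> 'c) \<Rightarrow> ('c \<Rightarrow> 'c) \<Rightarrow> 'c \<Rightarrow> 'c" where
  "gcomp \<sigma> \<rho> \<equiv> compose (sep_elements \<iota>) \<sigma> \<rho>"

lemma gcomp_apply: "x \<in> sep_elements \<iota> \<Longrightarrow> gcomp \<sigma> \<rho> x = \<sigma> (\<rho> x)"
  by (simp add: compose_def)

lemma gcomp_Gal:
  assumes \<sigma>: "\<sigma> \<in> Gal \<iota>" and \<rho>: "\<rho> \<in> Gal \<iota>" shows "gcomp \<sigma> \<rho> \<in> Gal \<iota>"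
proof -
  note s = GalD[OF \<sigma>] and r = GalD[OF \<rho>]
  have "bij_betw (gcomp \<sigma> \<rho>) (sep_elements \<iota>) (sep_elements \<iota>)"
    using r(11) s(11) by (rule bij_betw_compose)
  moreover have "gcomp \<sigma> \<rho> (\<iota> a) = \<iota> a" for a using emb_sep by (simp add: gcomp_apply r(4) s(4))
  moreover have "gcomp \<sigma> \<rho> (x + y) = gcomp \<sigma> \<rho> x + gcomp \<sigma> \<rho> y" "gcomp \<sigma> \<rho> (x * y) = gcomp \<sigma> \<rho> x * gcomp \<sigma> \<rho> y"
    if "x \<in> sep_elements \<iota>" "y \<in> sep_elements \<iota>" for x y
    using that sep_ring(3,5)[OF that] r s by (simp_all add: gcomp_apply)
  ultimately show ?thesis unfolding Gal_def by (auto simp: compose_extensional)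
qed

text \<open>The identity has to be cut down to the separable elements in order to be extensional, as
  members of \<open>Gal\<close> are.\<close>

definition gid :: "'c \<Rightarrow> 'c" where "gid = (\<lambda>x\<in>sep_elements \<iota>. x)"

lemma gid_Gal: "gid \<in> Gal \<iota>"
  unfolding Gal_def gid_def using emb_sep sep_ring(3,5) by (auto simp: bij_betw_def inj_on_def)

lemma Gal_inverse:
  assumes \<sigma>: "\<sigma> \<in> Gal \<iota>"
  obtains \<rho> where "\<rho> \<in> Gal \<iota>" "\<And>x. x \<in> sep_elements \<iota> \<Longrightarrow> \<sigma> (\<rho> x) = x"
    "\<And>x. x \<in> sep_elements \<iota> \<Longrightarrow> \<rho> (\<sigma> x) = x"
proof -
  note s = GalD[OF \<sigma>]
  define \<rho> where "\<rho> = (\<lambda>x\<in>sep_elements \<iota>. inv_into (sep_elements \<iota>) \<sigma> x)"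
  have \<rho>S: "\<rho> x \<in> sep_elements \<iota>" and \<sigma>\<rho>: "\<sigma> (\<rho> x) = x" if "x \<in> sep_elements \<iota>" for x
    using that bij_betwE[OF bij_betw_inv_into[OF s(11)]] bij_betw_inv_into_right[OF s(11)]
    by (auto simp: \<rho>_def)
  have \<rho>\<sigma>: "\<rho> (\<sigma> x) = x" if "x \<in> sep_elements \<iota>" for x
    using that s(1) bij_betw_inv_into_left[OF s(11)] by (simp add: \<rho>_def)
  have "bij_betw \<rho> (sep_elements \<iota>) (sep_elements \<iota>)"
    by (rule bij_betwI[of _ _ _ \<sigma>]) (use \<rho>S s(1) \<sigma>\<rho> \<rho>\<sigma> in auto)
  moreover have "\<rho> (\<iota> a) = \<iota> a" for a using \<rho>\<sigma>[OF emb_sep[of a]] s(4) by simp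
  moreover have "\<rho> (x + y) = \<rho> x + \<rho> y" "\<rho> (x * y) = \<rho> x * \<rho> y"
    if "x \<in> sep_elements \<iota>" "y \<in> sep_elements \<iota>" for x y
  proof -
    have "\<sigma> (\<rho> x + \<rho> y) = x + y" "\<sigma> (\<rho> x * \<rho> y) = x * y"
      using that \<rho>S \<sigma>\<rho> s(2,3) by simp_all
    thus "\<rho> (x + y) = \<rho> x + \<rho> y" "\<rho> (x * y) = \<rho> x * \<rho> y"
      using \<rho>\<sigma> sep_ring(3,5)[OF \<rho>S \<rho>S] that by metis+
  qed
  ultimately have "\<rho> \<in> Gal \<iota>" unfolding Gal_def by (auto simp: \<rho>_def)
  thus ?thesis using that \<sigma>\<rho> \<rho>\<sigma> by blast
qed

end

section \<open>The operator \<open>x \<mapsto> x - (t - \<theta>)\<^sup>n \<tau> x\<close> on the Tate algebra\<close>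

text \<open>A value above the level is at most gamma times one that lies at most n places earlier,
  so after each further n places the bound for such values shrinks by gamma. In
  \<open>phi_surj\<close> this serves twice: to reach the critical radius, and to go from there to
  any smaller one.\<close>

lemma eventually_le_of_contraction:
  fixes a :: "nat \<Rightarrow> real"
  assumes \<gamma>: "0 \<le> \<gamma>" "\<gamma> < 1" and \<rho>: "\<rho> > 0"
    and step: "\<And>i. i \<ge> N \<Longrightarrow> a i \<le> \<rho> \<or> (\<exists>j\<in>{1..n}. j \<le> i \<and> a i \<le> \<gamma> * a (i - j))"
  shows "\<exists>M. \<forall>i\<ge>M. a i \<le> \<rho>"
proof -
  define A where "A = Max (insert \<rho> (a ` {..N}))"
  have A: "\<rho> \<le> A" "\<And>i. i \<le> N \<Longrightarrow> a i \<le> A"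
    unfolding A_def by (rule Max_ge; simp)+
  have bnd: "a i \<le> A" for i
  proof (induction i rule: less_induct)
    case (less i)
    show ?case
    proof (cases "i \<le> N \<or> a i \<le> \<rho>")
      case False
      then obtain j where j: "j \<in> {1..n}" "j \<le> i" "a i \<le> \<gamma> * a (i - j)" using step[of i] by auto
      have "\<gamma> * a (i - j) \<le> \<gamma> * A" using less.IH[of "i - j"] j \<gamma> by (intro mult_left_mono) auto
      also have "\<dots> \<le> 1 * A" using \<gamma> A(1) \<rho> by (intro mult_right_mono) auto
      finally show ?thesis using j(3) by simp
    qed (use A in force)
  qed
  have "\<forall>i\<ge>N + k * n. a i \<le> max \<rho> (\<gamma> ^ k * A)" for k
  proof (induction k)
    case 0
    thus ?case using bnd by (simp add: le_max_iff_disj)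
  next
    case (Suc k)
    show ?case
    proof (intro allI impI)
      fix i assume i: "N + Suc k * n \<le> i"
      show "a i \<le> max \<rho> (\<gamma> ^ Suc k * A)"
      proof (cases "a i \<le> \<rho>")
        case False
        then obtain j where j: "j \<in> {1..n}" "j \<le> i" "a i \<le> \<gamma> * a (i - j)" using step[of i] i by auto
        have "a (i - j) \<le> max \<rho> (\<gamma> ^ k * A)" using j i by (intro Suc.IH[rule_format]) auto
        hence "\<gamma> * a (i - j) \<le> \<gamma> * max \<rho> (\<gamma> ^ k * A)" using \<gamma> by (intro mult_left_mono) auto
        also have "\<dots> = max (\<gamma> * \<rho>) (\<gamma> ^ Suc k * A)" using \<gamma> by (simp add: max_mult_distrib_left mult.assoc)
        also have "\<dots> \<le> max \<rho> (\<gamma> ^ Suc k * A)" using \<gamma> \<rho> by (intro max.mono) (auto simp: mult_le_cancel_right1)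
        finally show ?thesis using j(3) by simp
      qed simp
    qed
  qed
  moreover have "\<exists>k. \<gamma> ^ k * A \<le> \<rho>"
  proof -
    have "(\<lambda>k. \<gamma> ^ k * A) \<longlonglongrightarrow> 0 * A" using \<gamma> by (intro tendsto_mult LIMSEQ_realpow_zero tendsto_const)
    hence "\<forall>\<^sub>F k in sequentially. \<gamma> ^ k * A < \<rho>" using \<rho> by (simp add: order_tendstoD)
    thus ?thesis by (meson eventually_sequentially less_imp_le order_refl)
  qed
  ultimately show ?thesis by (metis max.absorb1)
qed

lemma CHAR_neq_prime_imp:
  assumes "prime p" "of_nat p = (0 :: 'a::idom)" shows "CHAR('a) = p"
proof -
  have "CHAR('a) dvd p" using assms(2) by (simp add: of_nat_eq_0_iff_char_dvd)
  thus ?thesis using assms(1) CHAR_not_1[where 'a = 'a] by (auto simp: prime_nat_iff)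
qed

locale carlitz_betti = completed_separable_closure \<iota>
  for \<iota> :: "'f::{finite,field} fls \<Rightarrow> 'c::{field,complete_space}" +
  fixes n :: nat
  assumes prime_card: "prime CARD('f)"
begin

lemma char_card: "CHAR('c) = CARD('f)"
  unfolding char_c using prime_card by (rule CHAR_of_prime_card)

lemma pow_add: "(x + y) ^ CARD('f) = x ^ CARD('f) + y ^ CARD('f)" for x y :: 'c
  using frob_add[of x y] unfolding char_card .

lemma pow_diff: "(x - y) ^ CARD('f) = x ^ CARD('f) - y ^ CARD('f)" for x y :: 'c
  using pow_add[of "x - y" y] by simp

lemma card_pos: "CARD('f) > 0" "CARD('f) - 1 > 0" using card_f_ge_2 by auto

lemma pow_0: "(0 :: 'c) ^ CARD('f) = 0" using card_pos by (simp add: power_0_left)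

lemma pow_sum: "(\<Sum>i\<in>I. f i :: 'c) ^ CARD('f) = (\<Sum>i\<in>I. f i ^ CARD('f))"
  by (induction I rule: infinite_finite_induct) (simp_all add: pow_0 pow_add)

definition \<theta> :: 'c where "\<theta> = \<iota> fls_X_inv"

lemma nrm_theta: "nrm \<theta> = real CARD('f)"
  using qf_gt_1 by (simp add: \<theta>_def abs_emb)

abbreviation scoef :: "'c fps \<Rightarrow> bool" where "scoef f \<equiv> \<forall>i. fps_nth f i \<in> sep_elements \<iota>"

definition fr :: "'c fps \<Rightarrow> 'c fps" where "fr f = tate_map (\<lambda>c. c ^ CARD('f)) f"

definition t_th :: "'c fps" where "t_th = fps_X - fps_const \<theta>"

definition phi :: "'c fps \<Rightarrow> 'c fps" where "phi f = f - t_th ^ n * fr f"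

lemma fr_nth: "fps_nth (fr f) i = fps_nth f i ^ CARD('f)"
  by (simp add: fr_def tate_map_def)

lemma fr_diff: "fr (f - g) = fr f - fr g"
  by (rule fps_ext) (simp add: fr_nth pow_diff)

lemma fr_add: "fr (f + g) = fr f + fr g"
  by (rule fps_ext) (simp add: fr_nth pow_add)

lemma fr_mult: "fr (f * g) = fr f * fr g"
  by (rule fps_ext) (simp add: fr_nth fps_mult_nth pow_sum power_mult_distrib)

lemma fr_one: "fr 1 = 1"
  by (rule fps_ext) (simp add: fr_nth pow_0)

lemma phi_diff: "phi (f - g) = phi f - phi g"
  by (simp add: phi_def fr_diff algebra_simps)

lemma phi_add: "phi (f + g) = phi f + phi g"
  by (simp add: phi_def fr_add algebra_simps)

definition cf :: "nat \<Rightarrow> 'c" where "cf j = fps_nth (t_th ^ n) j"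

lemma t_th_mult_nth: "fps_nth (t_th * f) i = (if i = 0 then 0 else fps_nth f (i - 1)) - \<theta> * fps_nth f i"
  by (simp add: t_th_def algebra_simps)

lemma theta_sep: "\<theta> \<in> sep_elements \<iota>" unfolding \<theta>_def by (rule emb_sep)

text \<open>The constant term has the full size q^m. A coefficient of positive index contains at
  most m - 1 factors theta, and the factor q gained in this way is what drives the convergence in
  \<open>phi_surj\<close>.\<close>

lemma t_th_power:
  shows "scoef (t_th ^ m)" "nrm (fps_nth (t_th ^ m) j) \<le> real CARD('f) ^ m"
    "j \<ge> 1 \<Longrightarrow> nrm (fps_nth (t_th ^ m) j) * real CARD('f) \<le> real CARD('f) ^ m"
    "fps_nth (t_th ^ m) 0 = (- \<theta>) ^ m" "j > m \<Longrightarrow> fps_nth (t_th ^ m) j = 0"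
proof -
  have "scoef (t_th ^ m) \<and> (\<forall>j. nrm (fps_nth (t_th ^ m) j) \<le> real CARD('f) ^ m) \<and>
    (\<forall>j\<ge>1. nrm (fps_nth (t_th ^ m) j) * real CARD('f) \<le> real CARD('f) ^ m) \<and>
    fps_nth (t_th ^ m) 0 = (- \<theta>) ^ m \<and> (\<forall>j>m. fps_nth (t_th ^ m) j = 0)"
  proof (induction m)
    case 0
    show ?case using sep_ring(1,2) by (auto simp: nrm_one)
  next
    case (Suc m)
    have 1: "fps_nth (t_th ^ Suc m) j \<in> sep_elements \<iota>" for j
      using Suc theta_sep by (auto simp: t_th_mult_nth intro!: sep_ring)
    have q1: "real CARD('f) ^ m \<le> real CARD('f) ^ Suc m" using qf_gt_1 by simp
    have 2: "nrm (fps_nth (t_th ^ Suc m) j) \<le> real CARD('f) ^ Suc m" for j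
    proof -
      have "nrm (fps_nth (t_th ^ Suc m) j) \<le> max (nrm (if j = 0 then 0 else fps_nth (t_th ^ m) (j - 1))) (nrm (\<theta> * fps_nth (t_th ^ m) j))"
        unfolding power_Suc t_th_mult_nth by (rule nrm_diff_le)
      also have "\<dots> \<le> real CARD('f) ^ Suc m"
      proof (rule max.boundedI)
        show "nrm (if j = 0 then 0 else fps_nth (t_th ^ m) (j - 1)) \<le> real CARD('f) ^ Suc m"
        proof (cases "j = 0")
          case False
          have "nrm (fps_nth (t_th ^ m) (j - 1)) \<le> real CARD('f) ^ m" using Suc by blast
          also note q1
          finally show ?thesis using False by simp
        qed simp
        show "nrm (\<theta> * fps_nth (t_th ^ m) j) \<le> real CARD('f) ^ Suc m"
          using Suc by (simp add: abs_mult nrm_theta mult_left_mono)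
      qed
      finally show ?thesis .
    qed
    have 3: "nrm (fps_nth (t_th ^ Suc m) j) * real CARD('f) \<le> real CARD('f) ^ Suc m" if "j \<ge> 1" for j
    proof -
      have "nrm (fps_nth (t_th ^ Suc m) j) \<le> max (nrm (if j = 0 then 0 else fps_nth (t_th ^ m) (j - 1))) (nrm (\<theta> * fps_nth (t_th ^ m) j))"
        unfolding power_Suc t_th_mult_nth by (rule nrm_diff_le)
      also have "\<dots> \<le> real CARD('f) ^ m"
      proof (rule max.boundedI)
        show "nrm (if j = 0 then 0 else fps_nth (t_th ^ m) (j - 1)) \<le> real CARD('f) ^ m"
          using Suc by auto
        show "nrm (\<theta> * fps_nth (t_th ^ m) j) \<le> real CARD('f) ^ m"
          using Suc that by (simp add: abs_mult nrm_theta mult.commute)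
      qed
      finally show ?thesis by (simp add: mult.commute mult_left_mono)
    qed
    have 4: "fps_nth (t_th ^ Suc m) 0 = (- \<theta>) ^ Suc m" using Suc unfolding power_Suc t_th_mult_nth by simp
    have 5: "fps_nth (t_th ^ Suc m) j = 0" if "j > Suc m" for j
      using Suc that unfolding power_Suc t_th_mult_nth by auto
    show ?case using 1 2 3 4 5 by blast
  qed
  thus "scoef (t_th ^ m)" "nrm (fps_nth (t_th ^ m) j) \<le> real CARD('f) ^ m"
    "j \<ge> 1 \<Longrightarrow> nrm (fps_nth (t_th ^ m) j) * real CARD('f) \<le> real CARD('f) ^ m"
    "fps_nth (t_th ^ m) 0 = (- \<theta>) ^ m" "j > m \<Longrightarrow> fps_nth (t_th ^ m) j = 0" by blast+
qed

lemma cf_props: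
  shows "cf j \<in> sep_elements \<iota>" "nrm (cf j) \<le> real CARD('f) ^ n"
    "j \<ge> 1 \<Longrightarrow> nrm (cf j) * real CARD('f) \<le> real CARD('f) ^ n"
    "nrm (cf 0) = real CARD('f) ^ n" "j > n \<Longrightarrow> cf j = 0"
  using t_th_power by (auto simp: cf_def nrm_power nrm_uminus nrm_theta)

text \<open>In the equation phi f = u the coefficient of t^i leaves an Artin-Schreier equation for
  the i-th coefficient of f. This is its right-hand side, which involves only earlier coefficients
  of f.\<close>

definition lower :: "'c fps \<Rightarrow> 'c fps \<Rightarrow> nat \<Rightarrow> 'c" where
  "lower u f i = fps_nth u i + (\<Sum>j\<in>{1..i}. cf j * fps_nth f (i - j) ^ CARD('f))"

lemma phi_eq_iff:
  "phi f = u \<longleftrightarrow> (\<forall>i. fps_nth f i - cf 0 * fps_nth f i ^ CARD('f) = lower u f i)"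
proof -
  have "fps_nth (phi f) i = fps_nth f i - cf 0 * fps_nth f i ^ CARD('f) -
      (\<Sum>j\<in>{1..i}. cf j * fps_nth f (i - j) ^ CARD('f))" for i
  proof -
    have "fps_nth (t_th ^ n * fr f) i = (\<Sum>j=0..i. cf j * fps_nth f (i - j) ^ CARD('f))"
      by (simp only: fps_mult_nth fr_nth cf_def)
    also have "\<dots> = cf 0 * fps_nth f i ^ CARD('f) + (\<Sum>j\<in>{1..i}. cf j * fps_nth f (i - j) ^ CARD('f))"
      by (subst sum.atLeast_Suc_atMost) auto
    finally show ?thesis by (simp add: phi_def)
  qed
  thus ?thesis unfolding fps_eq_iff lower_def by (simp add: diff_eq_eq add.commute)
qed

text \<open>In characteristic p the polynomial X - b - a X^p has derivative 1, so it is separable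
  whatever a and b are.\<close>

lemma artin_schreier_sep:
  assumes "a \<in> sep_elements \<iota>" "b \<in> sep_elements \<iota>"
  shows "x - a * x ^ CARD('f) = b \<Longrightarrow> x \<in> sep_elements \<iota>"
    and "\<exists>x\<in>sep_elements \<iota>. x - a * x ^ CARD('f) = b"
proof -
  define P where "P = [:- b, 1:] - monom a CARD('f)"
  have "of_nat CARD('f) = (0 :: 'c)" using char_card of_nat_CHAR[where 'a = 'c] by simp
  hence "pderiv (monom a CARD('f)) = 0" by (simp add: pderiv_monom)
  hence "pderiv P = 1" by (simp add: P_def pderiv_diff pderiv_pCons one_pCons)
  hence cop: "coprime P (pderiv P)" by simp
  have PS: "P \<in> polys_over (sep_elements \<iota>)"
    using assms(1,2) sep_ring by (auto simp: polys_over_def P_def coeff_pCons split: nat.splits)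
  have poly: "poly P z = z - b - a * z ^ CARD('f)" for z by (simp add: P_def poly_monom)
  have root: "poly P z = 0 \<longleftrightarrow> z - a * z ^ CARD('f) = b" for z unfolding poly by (auto simp: algebra_simps)
  show "x \<in> sep_elements \<iota>" if "x - a * x ^ CARD('f) = b" using sep_roots[OF PS cop] that root by blast
  have "degree P > 0"
  proof (rule ccontr)
    assume "\<not> ?thesis"
    then obtain c where "P = [:c:]" by (auto elim: degree_eq_zeroE)
    thus False using \<open>pderiv P = 1\<close> by simp
  qed
  thus "\<exists>x\<in>sep_elements \<iota>. x - a * x ^ CARD('f) = b"
    using sep_closed[of P] PS cop root by (auto simp: polys_over_def)
qed

text \<open>Under the smallness condition the map x \<mapsto> b + \<open>cf 0\<close> x^p contracts
  the ball of radius |b|: p-th powers are additive, so its Lipschitz constant there is q^n |b|^(p -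
  1). The fixed point exists by completeness of the large field and is separable as a root of a
  separable polynomial.\<close>

lemma artin_schreier_exists:
  assumes b: "b \<in> sep_elements \<iota>"
  shows "\<exists>x\<in>sep_elements \<iota>. x - cf 0 * x ^ CARD('f) = b \<and>
    (real CARD('f) ^ n * nrm b ^ (CARD('f) - 1) < 1 \<longrightarrow> nrm x \<le> nrm b)"
proof (cases "real CARD('f) ^ n * nrm b ^ (CARD('f) - 1) < 1")
  case False
  obtain r where "r \<in> sep_elements \<iota>" "r - cf 0 * r ^ CARD('f) = b"
    using artin_schreier_sep(2)[OF cf_props(1) b] by blast
  thus ?thesis using False by blast
next
  case True
  define \<kappa> where "\<kappa> = real CARD('f) ^ n * nrm b ^ (CARD('f) - 1)"
  have \<kappa>: "0 \<le> \<kappa>" "\<kappa> < 1" using True by (simp_all add: \<kappa>_def)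
  let ?g = "\<lambda>x. b + cf 0 * x ^ CARD('f)"
  have pw: "r ^ CARD('f) = r ^ (CARD('f) - 1) * r" for r :: real
    using power_minus_mult[OF card_pos(1), of r] by simp
  have "\<exists>!x :: 'c. x \<in> cball 0 (nrm b) \<and> ?g x = x"
  proof (rule Banach_fix[where c = \<kappa>])
    show "complete (cball 0 (nrm b) :: 'c set)" by (simp add: complete_eq_closed)
    show "cball (0::'c) (nrm b) \<noteq> {}" by simp
    show "?g ` cball 0 (nrm b) \<subseteq> cball 0 (nrm b)"
    proof
      fix y assume "y \<in> ?g ` cball 0 (nrm b)"
      then obtain x where x': "x \<in> cball 0 (nrm b)" and x2: "y = ?g x" by blast
      have x: "nrm x \<le> nrm b" "y = ?g x" using x' x2 by (simp_all add: dist_commute)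
      have "nrm (cf 0 * x ^ CARD('f)) = real CARD('f) ^ n * nrm x ^ CARD('f)"
        by (simp add: abs_mult cf_props nrm_power)
      also have "\<dots> \<le> real CARD('f) ^ n * nrm b ^ CARD('f)"
        using x(1) by (intro mult_left_mono power_mono) auto
      also have "\<dots> = \<kappa> * nrm b" unfolding pw[of "nrm b"] \<kappa>_def by simp
      also have "\<dots> \<le> 1 * nrm b" using \<kappa> by (intro mult_right_mono) auto
      finally have "nrm (cf 0 * x ^ CARD('f)) \<le> nrm b" by simp
      hence "nrm y \<le> nrm b" unfolding x(2) using abs_add[of b "cf 0 * x ^ CARD('f)"] by simp
      thus "y \<in> cball 0 (nrm b)" by (simp add: dist_commute)
    qed
    fix x y :: 'c assume "x \<in> cball 0 (nrm b)" "y \<in> cball 0 (nrm b)"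
    hence "nrm (x - y) \<le> nrm b" using nrm_diff_le[of x y] by (simp add: dist_commute)
    hence "nrm (x - y) ^ (CARD('f) - 1) \<le> nrm b ^ (CARD('f) - 1)" by (intro power_mono) auto
    hence "real CARD('f) ^ n * nrm (x - y) ^ (CARD('f) - 1) * nrm (x - y) \<le> \<kappa> * nrm (x - y)"
      unfolding \<kappa>_def by (intro mult_right_mono mult_left_mono) auto
    moreover have "?g x - ?g y = cf 0 * (x - y) ^ CARD('f)" by (simp add: pow_diff algebra_simps)
    hence "dist (?g x) (?g y) = real CARD('f) ^ n * nrm (x - y) ^ CARD('f)"
      by (subst dist_diff) (simp add: abs_mult cf_props nrm_power)
    ultimately show "dist (?g x) (?g y) \<le> \<kappa> * dist x y"
      by (simp only: pw[of "nrm (x - y)"] dist_diff[of x y] mult.assoc)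
  qed (use \<kappa> in auto)
  then obtain x where x: "x \<in> cball 0 (nrm b)" "?g x = x" by blast
  have eq: "x - cf 0 * x ^ CARD('f) = b" using x(2) by (metis add_diff_cancel_right')
  have "x \<in> sep_elements \<iota>" using artin_schreier_sep(1)[OF cf_props(1) b eq] .
  thus ?thesis using eq x(1) by (intro bexI[of _ x]) (auto simp: dist_commute)
qed

text \<open>One coefficient after the other solves an Artin-Schreier equation with separable
  data.\<close>

lemma phi_scoef:
  assumes "scoef (phi f)" shows "scoef f"
proof
  fix i show "fps_nth f i \<in> sep_elements \<iota>"
  proof (induction i rule: less_induct)
    case (less i)
    have "lower (phi f) f i \<in> sep_elements \<iota>"
      unfolding lower_def using assms less cf_props(1)
      by (auto intro!: sep_ring is_subring_sum[OF sep_subring])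
    moreover have "fps_nth f i - cf 0 * fps_nth f i ^ CARD('f) = lower (phi f) f i"
      using phi_eq_iff[of f "phi f"] by simp
    ultimately show ?case using artin_schreier_sep(1)[OF cf_props(1)] by blast
  qed
qed


section \<open>Ring operations on the Tate algebra\<close>

lemma tate_nrm_iff: "(f :: 'c fps) \<in> tate_algebra \<longleftrightarrow> (\<forall>e>0. \<exists>N. \<forall>i\<ge>N. nrm (fps_nth f i) \<le> e)"
proof -
  have "f \<in> tate_algebra \<longleftrightarrow> (\<forall>e>0. \<exists>N. \<forall>i\<ge>N. nrm (fps_nth f i) < e)"
    unfolding tate_algebra_def LIMSEQ_def by simp
  thus ?thesis by (meson dense less_imp_le le_less_trans)
qed

lemma tate_bounded:
  assumes "(f :: 'c fps) \<in> tate_algebra" obtains B where "B > 0" "\<And>i. nrm (fps_nth f i) \<le> B"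
proof -
  obtain N where N: "\<forall>i\<ge>N. nrm (fps_nth f i) \<le> 1" using spec[OF assms[unfolded tate_nrm_iff], of 1] by auto
  define B where "B = Max (insert 1 ((\<lambda>i. nrm (fps_nth f i)) ` {..N}))"
  have "1 \<le> B" and B: "\<And>i. i \<le> N \<Longrightarrow> nrm (fps_nth f i) \<le> B" unfolding B_def by (rule Max_ge; simp)+
  have "nrm (fps_nth f i) \<le> B" for i
  proof (cases "i \<le> N")
    case False
    hence "nrm (fps_nth f i) \<le> 1" using N by simp
    thus ?thesis using \<open>1 \<le> B\<close> by simp
  qed (rule B)
  thus ?thesis using that[of B] \<open>1 \<le> B\<close> by simp
qed

lemma tate_diff:
  assumes "(f :: 'c fps) \<in> tate_algebra" "g \<in> tate_algebra" shows "f - g \<in> tate_algebra"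
proof -
  have "fps_nth (f - g) = (\<lambda>i. fps_nth f i - fps_nth g i)" by (rule ext) simp
  thus ?thesis using LIMSEQ_nrm_diff[of "fps_nth f" 0 "fps_nth g" 0] assms by (simp add: tate_algebra_def)
qed

lemma tate_add:
  assumes "(f :: 'c fps) \<in> tate_algebra" "g \<in> tate_algebra" shows "f + g \<in> tate_algebra"
proof -
  have "fps_nth (f + g) = (\<lambda>i. fps_nth f i + fps_nth g i)" by (rule ext) simp
  thus ?thesis using LIMSEQ_nrm_add[of "fps_nth f" 0 "fps_nth g" 0] assms by (simp add: tate_algebra_def)
qed

lemma tate_mult:
  assumes f: "(f :: 'c fps) \<in> tate_algebra" and g: "g \<in> tate_algebra" shows "f * g \<in> tate_algebra"
  unfolding tate_nrm_iff
proof (intro allI impI)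
  fix e :: real assume e: "e > 0"
  obtain B where B: "B > 0" "\<And>i. nrm (fps_nth f i) \<le> B" using tate_bounded[OF f] by blast
  obtain C where C: "C > 0" "\<And>i. nrm (fps_nth g i) \<le> C" using tate_bounded[OF g] by blast
  have "e / C > 0" "e / B > 0" using e B(1) C(1) by auto
  then obtain N M where N: "\<forall>i\<ge>N. nrm (fps_nth f i) \<le> e / C" and M: "\<forall>i\<ge>M. nrm (fps_nth g i) \<le> e / B"
    using f g unfolding tate_nrm_iff by meson
  have "nrm (fps_nth (f * g) i) \<le> e" if i: "i \<ge> N + M" for i
    unfolding fps_mult_nth
  proof (rule nrm_sum_le)
    fix j assume "j \<in> {0..i}"
    show "nrm (fps_nth f j * fps_nth g (i - j)) \<le> e"
    proof (cases "j \<ge> N")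
      case True
      have "nrm (fps_nth f j) * nrm (fps_nth g (i - j)) \<le> e / C * C"
        using N True C(2) e C(1) by (intro mult_mono) auto
      thus ?thesis using C(1) by (simp add: abs_mult)
    next
      case False
      have "nrm (fps_nth f j) * nrm (fps_nth g (i - j)) \<le> B * (e / B)"
        using M i False B e by (intro mult_mono) auto
      thus ?thesis using B(1) by (simp add: abs_mult)
    qed
  qed (use e in simp)
  thus "\<exists>N. \<forall>i\<ge>N. nrm (fps_nth (f * g) i) \<le> e" by blast
qed

lemma tate_zero: "(0 :: 'c fps) \<in> tate_algebra" by (auto simp: tate_nrm_iff)

lemma tate_const: "fps_const (a :: 'c) \<in> tate_algebra"
  unfolding tate_nrm_iff by (auto intro!: exI[of _ 1])

lemma tate_sum: "(\<And>i. i \<in> I \<Longrightarrow> h i \<in> tate_algebra) \<Longrightarrow> (\<Sum>i\<in>I. h i :: 'c fps) \<in> tate_algebra"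
  by (induction I rule: infinite_finite_induct) (auto intro: tate_add tate_zero)

text \<open>\<open>\<rho>\<close> is the absolute value of the nonzero solutions of \<open>x = (-\<theta>)\<^sup>n x\<^sup>p\<close>. Below it, an
  Artin-Schreier equation has a small solution; iterating from above, the coefficients of any solution fall
  to at most \<open>\<rho>\<close>.\<close>

lemma phi_surj:
  assumes u: "u \<in> tate_algebra" and uS: "scoef u"
  shows "\<exists>f\<in>tate_algebra. phi f = u"
proof -
  define q where "q = real CARD('f)"
  define p where "p = CARD('f)"
  have q: "q > 1" using qf_gt_1 by (simp add: q_def)
  have p: "p \<ge> 2" "p - 1 > 0" "p > 0" using card_f_ge_2 by (auto simp: p_def)
  define \<rho> where "\<rho> = q powr (- (real n / real (p - 1)))"
  have \<rho>0: "\<rho> > 0" using q by (simp add: \<rho>_def)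
  have "\<rho> ^ (p - 1) = q powr (- real n)"
    using q p by (simp add: \<rho>_def powr_powr flip: powr_realpow)
  hence \<rho>1: "q ^ n * \<rho> ^ (p - 1) = 1" using q by (simp add: powr_minus powr_realpow)
  have pw: "r ^ p = r ^ (p - 1) * r" for r :: real using power_minus_mult[OF p(3), of r] by simp
  have \<rho>p: "q ^ n * \<rho> ^ p = \<rho>" unfolding pw[of \<rho>] using \<rho>1 by (simp add: mult.assoc[symmetric])
  obtain rt where rt: "\<And>b. b \<in> sep_elements \<iota> \<Longrightarrow> rt b \<in> sep_elements \<iota>"
    "\<And>b. b \<in> sep_elements \<iota> \<Longrightarrow> rt b - cf 0 * rt b ^ p = b"
    "\<And>b. b \<in> sep_elements \<iota> \<Longrightarrow> q ^ n * nrm b ^ (p - 1) < 1 \<Longrightarrow> nrm (rt b) \<le> nrm b"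
    using artin_schreier_exists unfolding p_def q_def by metis
  \<comment> \<open>The coefficients are chosen one by one; \<open>rt b\<close> is a root of the
    Artin-Schreier equation for b, and the small one whenever b lies below the critical
    radius.\<close>
  define F where "F = wfrec less_than (\<lambda>g i. rt (fps_nth u i + (\<Sum>j\<in>{1..i}. cf j * g (i - j) ^ p)))"
  have F: "F i = rt (fps_nth u i + (\<Sum>j\<in>{1..i}. cf j * F (i - j) ^ p))" for i
    unfolding F_def by (subst wfrec, simp) (intro arg_cong[where f = rt] arg_cong2[where f = "(+)"] sum.cong, auto simp: cut_def)
  define f where "f = Abs_fps F"
  define b where "b = lower u f"
  have b: "b i = fps_nth u i + (\<Sum>j\<in>{1..i}. cf j * F (i - j) ^ p)" for i
    by (simp add: b_def lower_def f_def p_def)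
  have Fb: "F i = rt (b i)" for i unfolding b by (rule F)
  have S: "F i \<in> sep_elements \<iota> \<and> b i \<in> sep_elements \<iota>" for i
  proof (induction i rule: less_induct)
    case (less i)
    have "b i \<in> sep_elements \<iota>"
      unfolding b using less uS cf_props(1) by (auto intro!: sep_ring is_subring_sum[OF sep_subring])
    thus ?case using rt(1) Fb by metis
  qed
  have Feq: "F i - cf 0 * F i ^ p = b i" for i using rt(2) S Fb by metis
  have phi_f: "phi f = u"
    unfolding phi_eq_iff using Feq by (simp add: f_def b_def p_def)
  have b_le: "nrm (b i) \<le> B"
    if "B \<ge> 0" "nrm (fps_nth u i) \<le> B" "\<And>j. j \<in> {1..n} \<Longrightarrow> j \<le> i \<Longrightarrow> q ^ n * nrm (F (i - j)) ^ p \<le> q * B" for i B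
  proof -
    have "nrm (\<Sum>j\<in>{1..i}. cf j * F (i - j) ^ p) \<le> B"
    proof (rule nrm_sum_le)
      fix j assume j: "j \<in> {1..i}"
      show "nrm (cf j * F (i - j) ^ p) \<le> B"
      proof (cases "j \<le> n")
        case True
        have "nrm (cf j) * q * nrm (F (i - j)) ^ p \<le> q ^ n * nrm (F (i - j)) ^ p"
          using cf_props(3)[of j] j unfolding q_def by (intro mult_right_mono) auto
        also have "\<dots> \<le> q * B" using that(3)[of j] True j by simp
        finally have "q * (nrm (cf j) * nrm (F (i - j)) ^ p) \<le> q * B" by (simp add: mult_ac)
        thus ?thesis using q by (simp add: abs_mult nrm_power)
      qed (use cf_props(5) that(1) in auto)
    qed (rule that(1))
    thus ?thesis using that(2) abs_add unfolding b by (meson max.boundedI order.trans)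
  qed
  define a where "a = (\<lambda>i. nrm (F i))"
  have a0: "a i \<ge> 0" for i by (simp add: a_def)
  \<comment> \<open>For j >= 1 the coefficient \<open>cf j\<close> is smaller than q^n by a factor q
    and multiplies a p-th power of an earlier value; so in terms of the values themselves the gain
    is the p-th root of q.\<close>
  define \<gamma> where "\<gamma> = root p (1 / q)"
  have \<gamma>: "0 \<le> \<gamma>" "\<gamma> < 1" "\<gamma> ^ p = 1 / q"
    using q p real_root_lt_1_iff[of p "1 / q"] by (auto simp: \<gamma>_def real_root_pow_pos2)
  have u_small: "\<exists>N. \<forall>i\<ge>N. nrm (fps_nth u i) \<le> e" if "e > 0" for e
    using u that unfolding tate_nrm_iff by blast
  have "\<rho> / q > 0" using \<rho>0 q by simp
  then obtain N where N: "\<forall>i\<ge>N. nrm (fps_nth u i) \<le> \<rho> / q" using u_small by blast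
  have "\<exists>M. \<forall>i\<ge>M. a i \<le> \<rho>"
  proof (rule eventually_le_of_contraction[OF \<gamma>(1,2) \<rho>0, of N _ n])
    fix i assume i: "i \<ge> N"
    show "a i \<le> \<rho> \<or> (\<exists>j\<in>{1..n}. j \<le> i \<and> a i \<le> \<gamma> * a (i - j))"
    proof (rule ccontr)
      \<comment> \<open>Above the critical radius the term \<open>cf 0\<close> times the p-th power
        exceeds F i itself, so the ultrametric inequality forces b i to be as large. But with all
        the earlier values smaller than a i / gamma, b i is strictly smaller.\<close>
      assume neg: "\<not> ?thesis"
      hence big: "a i > \<rho>" and aj: "\<And>j. j \<in> {1..n} \<Longrightarrow> j \<le> i \<Longrightarrow> \<gamma> * a (i - j) < a i"
        by (auto simp: not_le) (metis One_nat_def atLeastAtMost_iff not_le)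
      have big': "q ^ n * a i ^ p > a i"
      proof -
        have "q ^ n * a i ^ (p - 1) > q ^ n * \<rho> ^ (p - 1)"
          using big \<rho>0 p q by (intro mult_strict_left_mono power_strict_mono) auto
        hence "1 * a i < q ^ n * a i ^ (p - 1) * a i"
          using big \<rho>0 unfolding \<rho>1 by (intro mult_strict_right_mono) auto
        thus ?thesis unfolding pw[of "a i"] by (simp add: mult.assoc)
      qed
      have "nrm (b i) < q ^ n * a i ^ p"
      proof -
        define B where "B = Max (insert (\<rho> / q) ((\<lambda>j. q ^ n * a (i - j) ^ p / q) ` {j\<in>{1..n}. j \<le> i}))"
        have B: "\<rho> / q \<le> B" "\<And>j. j \<in> {1..n} \<Longrightarrow> j \<le> i \<Longrightarrow> q ^ n * a (i - j) ^ p / q \<le> B"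
          unfolding B_def by (rule Max_ge, simp, simp) (rule Max_ge, simp, rule insertI2, rule imageI, simp)
        have "B \<ge> 0" using B(1) \<rho>0 q by (meson divide_nonneg_nonneg less_imp_le order.trans zero_le_one)
        moreover have "q ^ n * nrm (F (i - j)) ^ p \<le> q * B" if "j \<in> {1..n}" "j \<le> i" for j
          using B(2)[OF that] q by (simp add: a_def divide_le_eq mult.commute)
        ultimately have "nrm (b i) \<le> B" using N i B(1) by (intro b_le) auto
        also have "B < q ^ n * a i ^ p"
        proof -
          have "\<rho> / q \<le> \<rho>" using q \<rho>0 by (simp add: divide_le_eq)
          hence "\<rho> / q < q ^ n * a i ^ p" using big big' by simp
          moreover have "q ^ n * a (i - j) ^ p / q < q ^ n * a i ^ p" if "j \<in> {1..n}" "j \<le> i" for j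
          proof -
            have "(\<gamma> * a (i - j)) ^ p < a i ^ p" using aj[OF that] \<gamma>(1) a0 p by (intro power_strict_mono) auto
            hence "a (i - j) ^ p / q < a i ^ p" by (simp add: power_mult_distrib \<gamma>(3))
            thus ?thesis using q by (simp add: mult_strict_left_mono flip: times_divide_eq_right)
          qed
          ultimately show ?thesis unfolding B_def by (subst Max_less_iff) auto
        qed
        finally show ?thesis .
      qed
      moreover have "q ^ n * a i ^ p \<le> max (a i) (nrm (b i))"
      proof -
        have "cf 0 * F i ^ p = F i - b i" using Feq[of i] by (simp add: algebra_simps)
        hence "nrm (cf 0 * F i ^ p) \<le> max (nrm (F i)) (nrm (b i))" using nrm_diff_le by simp
        thus ?thesis by (simp add: abs_mult cf_props nrm_power a_def q_def)
      qed
      ultimately show False using big' by auto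
    qed
  qed
  then obtain M where M: "\<And>i. i \<ge> M \<Longrightarrow> a i \<le> \<rho>" by blast
  have "f \<in> tate_algebra"
    unfolding tate_nrm_iff
  proof (intro allI impI)
    fix e0 :: real assume e0: "e0 > 0"
    \<comment> \<open>The cap at \<rho> / q keeps the right-hand sides b i strictly below the
      critical radius, so that \<open>rt\<close> returns the small root.\<close>
    define e where "e = min e0 (\<rho> / q)"
    have e: "e > 0" "e \<le> \<rho> / q" "e \<le> e0" using e0 \<rho>0 q by (auto simp: e_def)
    obtain N' where N': "\<forall>i\<ge>N'. nrm (fps_nth u i) \<le> e" using u_small[OF e(1)] by blast
    have "\<exists>M. \<forall>i\<ge>M. a i \<le> e"
    proof (rule eventually_le_of_contraction[of "1 / q" e "max N' (M + n)" a n])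
      fix i assume i: "i \<ge> max N' (M + n)"
      define B where "B = Max (insert e ((\<lambda>j. a (i - j) / q) ` {j\<in>{1..n}. j \<le> i}))"
      have B: "e \<le> B" "\<And>j. j \<in> {1..n} \<Longrightarrow> j \<le> i \<Longrightarrow> a (i - j) / q \<le> B"
        unfolding B_def by (rule Max_ge, simp, simp) (rule Max_ge, simp, rule insertI2, rule imageI, simp)
      have aM: "a (i - j) \<le> \<rho>" if "j \<in> {1..n}" for j using M[of "i - j"] i that by auto
      have "nrm (b i) \<le> B"
      proof (rule b_le)
        show "B \<ge> 0" using B(1) e(1) by simp
        show "nrm (fps_nth u i) \<le> B" using N' i B(1) by (meson max.boundedE order.trans)
        fix j assume j: "j \<in> {1..n}" "j \<le> i"
        have "q ^ n * a (i - j) ^ (p - 1) \<le> q ^ n * \<rho> ^ (p - 1)"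
          using aM[OF j(1)] a0 q by (intro mult_left_mono power_mono) auto
        hence "q ^ n * a (i - j) ^ (p - 1) * a (i - j) \<le> 1 * a (i - j)"
          unfolding \<rho>1 using a0 by (intro mult_right_mono) auto
        also have "\<dots> \<le> q * B" using B(2)[OF j] q by (simp add: divide_le_eq mult.commute)
        finally show "q ^ n * nrm (F (i - j)) ^ p \<le> q * B" unfolding pw by (simp add: a_def mult.assoc)
      qed
      moreover have "B \<le> \<rho> / q"
        unfolding B_def using e(2) aM q by (subst Max_le_iff) (auto simp: divide_right_mono)
      moreover have "\<rho> / q < \<rho>" using q \<rho>0 by (simp add: divide_less_eq)
      ultimately have "nrm (b i) < \<rho>" by simp
      hence "nrm (b i) ^ (p - 1) < \<rho> ^ (p - 1)" using p by (intro power_strict_mono) auto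
      hence "q ^ n * nrm (b i) ^ (p - 1) < q ^ n * \<rho> ^ (p - 1)" using q by (intro mult_strict_left_mono) auto
      hence "a i \<le> nrm (b i)" unfolding \<rho>1 a_def Fb[of i] using rt(3) S by blast
      hence "a i \<le> B" using \<open>nrm (b i) \<le> B\<close> by simp
      moreover have "B \<in> insert e ((\<lambda>j. a (i - j) / q) ` {j\<in>{1..n}. j \<le> i})"
        unfolding B_def by (rule Max_in) auto
      ultimately show "a i \<le> e \<or> (\<exists>j\<in>{1..n}. j \<le> i \<and> a i \<le> 1 / q * a (i - j))" by auto
    qed (use q e in auto)
    thus "\<exists>N. \<forall>i\<ge>N. nrm (fps_nth f i) \<le> e0" using e(3) by (auto simp: f_def a_def intro: order.trans)
  qed
  thus ?thesis using phi_f by blast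
qed

end

section \<open>The Tate algebra over K_inf as Laurent series in 1/theta over F[t]\<close>

lemma fps_power_card:
  fixes g :: "'f::{finite,field} fps"
  assumes "prime CARD('f)"
  shows "g ^ CARD('f) = fps_compose g (fps_X ^ CARD('f))"
proof -
  define p where "p = CARD('f)"
  have p0: "p > 0" using assms prime_gt_0_nat p_def by blast
  have char: "CHAR('f) = p" using CHAR_of_prime_card[OF assms] by (simp add: p_def)
  have "of_nat p = (0 :: 'f fps)" using char by (simp add: fps_of_nat[symmetric] of_nat_eq_0_iff_char_dvd)
  hence char': "CHAR('f fps) = p" using assms unfolding p_def by (intro CHAR_neq_prime_imp)
  have nth: "fps_nth (fps_const a + fps_X ^ p * h) k = (if k = 0 then a else if k < p then 0 else fps_nth h (k - p))"
    for a :: 'f and h k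
    using p0 by (auto simp: fps_X_power_mult_nth)
  have "fps_nth (g ^ p) k = fps_nth (fps_compose g (fps_X ^ p)) k" for k
  proof (induction k arbitrary: g rule: less_induct)
    case (less k g)
    \<comment> \<open>Splitting off the constant term turns the coefficient of index k into the
      coefficient of index k - p of the same identity for the shifted series.\<close>
    define h where "h = fps_shift 1 g"
    have g: "g = fps_const (fps_nth g 0) + fps_X * h"
      unfolding h_def by (rule fps_ext) (auto simp: fps_X_mult_nth)
    have "g ^ p = fps_const (fps_nth g 0) ^ p + (fps_X * h) ^ p"
      using assms char' by (subst g, subst freshmans_dream) (auto simp: p_def)
    also have "fps_const (fps_nth g 0) ^ p = fps_const (fps_nth g 0)"
      using finite_field_power_card[of "fps_nth g 0"] by (simp add: fps_const_power p_def)
    finally have 1: "g ^ p = fps_const (fps_nth g 0) + fps_X ^ p * h ^ p" by (simp add: power_mult_distrib)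
    have "fps_compose g (fps_X ^ p) = fps_compose (fps_const (fps_nth g 0) + fps_X * h) (fps_X ^ p)"
      by (subst g) simp
    also have "\<dots> = fps_const (fps_nth g 0) + fps_X ^ p * fps_compose h (fps_X ^ p)"
      using p0 by (simp add: fps_compose_add_distrib fps_compose_mult_distrib)
    finally have 2: "fps_compose g (fps_X ^ p) = fps_const (fps_nth g 0) + fps_X ^ p * fps_compose h (fps_X ^ p)" .
    show ?case
      unfolding 1 2 nth using less[of "k - p" h] p0 by (cases "k = 0") auto
  qed
  thus ?thesis by (simp add: fps_eq_iff p_def)
qed

text \<open>Because q = p, the q-th power is additive and fixes the coefficients in F, so it is the
  substitution of X^q for X. This makes the Frobenius on coefficients of the Tate algebra the
  operation \<open>fls_compose_power\<close> of the first part.\<close>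

lemma fls_power_card:
  fixes g :: "'f::{finite,field} fls"
  assumes "prime CARD('f)"
  shows "g ^ CARD('f) = fls_compose_power g CARD('f)"
proof -
  have p0: "CARD('f) > 0" using assms prime_gt_0_nat by blast
  obtain h where g: "g = fls_shift (- fls_subdegree g) (fps_to_fls h)"
    by (rule fls_as_fps[of g "- fls_subdegree g"]) auto
  show ?thesis
    by (subst (1 2) g) (simp add: fls_shifted_pow fls_compose_power_shift[OF p0]
      fls_compose_power_fps_to_fls[OF p0] fps_power_card[OF assms, symmetric] fps_to_fls_power)
qed

text \<open>The coefficient of t^i in an element of F[t]((1/theta)), as a Laurent series over
  F.\<close>

definition slice :: "'a::zero poly fls \<Rightarrow> nat \<Rightarrow> 'a fls" where
  "slice y i = Abs_fls (\<lambda>k. coeff (fls_nth y k) i)"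

lemma slice_nth: "fls_nth (slice y i) k = coeff (fls_nth y k) i"
  unfolding slice_def
  by (rule nth_Abs_fls_lower_bound[of "fls_subdegree y"]) (simp add: fls_eq0_below_subdegree)

abbreviation tm_th :: "'a::field poly fls" where "tm_th \<equiv> fls_const [:0, 1:] - fls_X_inv"

context carlitz_betti
begin

text \<open>The identification of F[t]((1/theta)) with the Tate algebra over K_inf: the same double
  series, ordered by powers of t instead of powers of 1/theta.\<close>

definition J :: "'f poly fls \<Rightarrow> 'c fps" where "J y = Abs_fps (\<lambda>i. \<iota> (slice y i))"

lemma J_nth: "fps_nth (J y) i = \<iota> (slice y i)" by (simp add: J_def)

lemma J_diff: "J (x - y) = J x - J y"
proof (rule fps_ext)
  fix i
  have "slice (x - y) i = slice x i - slice y i" by (rule fls_eqI) (simp add: slice_nth)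
  thus "fps_nth (J (x - y)) i = fps_nth (J x - J y) i" by (simp add: J_nth emb_minus)
qed

lemma J_inj: "J x = J y \<Longrightarrow> x = y"
proof -
  assume "J x = J y"
  hence "slice x i = slice y i" for i using emb_inj' by (metis J_nth)
  hence "coeff (fls_nth x k) i = coeff (fls_nth y k) i" for k i by (metis slice_nth)
  thus "x = y" by (intro fls_eqI poly_eqI)
qed

lemma J_tau: "J (fls_compose_power y CARD('f)) = fr (J y)"
proof (rule fps_ext)
  fix i
  have "slice (fls_compose_power y CARD('f)) i = fls_compose_power (slice y i) CARD('f)"
    using card_pos by (intro fls_eqI) (simp add: slice_nth fls_nth_compose_power)
  thus "fps_nth (J (fls_compose_power y CARD('f))) i = fps_nth (fr (J y)) i"
    by (simp add: J_nth fr_nth fls_power_card[OF prime_card, symmetric] emb_power)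
qed

lemma J_tm: "J (tm_th * y) = t_th * J y"
proof (rule fps_ext)
  fix i
  have "slice (tm_th * y) i = (if i = 0 then 0 else slice y (i - 1)) - fls_X_inv * slice y i"
    by (intro fls_eqI) (auto simp: slice_nth left_diff_distrib fls_X_inv_times_conv_shift coeff_pCons split: nat.splits)
  thus "fps_nth (J (tm_th * y)) i = fps_nth (t_th * J y) i"
    by (simp add: J_nth t_th_mult_nth emb_minus emb_mult emb_zero \<theta>_def)
qed

lemma J_phi: "J (y - tm_th ^ n * fls_compose_power y CARD('f)) = phi (J y)"
proof -
  have "J (tm_th ^ m * x) = t_th ^ m * J x" for m x
    by (induction m) (simp_all add: mult.assoc J_tm)
  thus ?thesis by (simp add: J_diff J_tau phi_def)
qed

text \<open>Up to a given power of 1/theta only finitely many polynomials in t occur. Beyond the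
  largest of their degrees, a slice starts at a higher power of 1/theta, which makes it
  small.\<close>

lemma J_tate: "J y \<in> tate_algebra"
  unfolding tate_nrm_iff
proof (intro allI impI)
  fix e :: real assume "e > 0"
  then obtain k :: int where k: "real CARD('f) powr - of_int k < e" using small_power by blast
  define N where "N = Suc (Max (insert 0 ((\<lambda>j. degree (fls_nth y j)) ` {fls_subdegree y..k})))"
  have "nrm (fps_nth (J y) i) \<le> e" if i: "i \<ge> N" for i
  proof -
    have "fls_nth (slice y i) j = 0" if "j \<le> k" for j
    proof (cases "j < fls_subdegree y")
      case True
      thus ?thesis by (simp add: slice_nth fls_eq0_below_subdegree)
    next
      case False
      hence "degree (fls_nth y j) \<le> Max (insert 0 ((\<lambda>j. degree (fls_nth y j)) ` {fls_subdegree y..k}))"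
        using that by (intro Max_ge) auto
      hence "degree (fls_nth y j) < i" using i by (simp add: N_def)
      thus ?thesis by (simp add: slice_nth coeff_eq_0)
    qed
    hence "nrm (\<iota> (slice y i)) < real CARD('f) powr - of_int k" unfolding nrm_emb_less_iff by blast
    thus ?thesis using k by (simp add: J_nth)
  qed
  thus "\<exists>N. \<forall>i\<ge>N. nrm (fps_nth (J y) i) \<le> e" by blast
qed

text \<open>Convergence to 0 says that a given power of 1/theta occurs in only finitely many
  coefficients, so its own coefficients form a polynomial in t. A common lower bound for the
  exponents exists because only the first \<open>N 0\<close> coefficients can contain nonpositive
  powers.\<close>

lemma J_surj:
  assumes f: "f \<in> tate_algebra" and K: "\<And>i. fps_nth f i \<in> range \<iota>"
  obtains y where "f = J y"
proof -
  have "\<forall>i. \<exists>g. fps_nth f i = \<iota> g" using K by blast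
  from choice[OF this] obtain g where g: "\<And>i. fps_nth f i = \<iota> (g i)" by blast
  have "\<forall>k :: int. \<exists>N. \<forall>i\<ge>N. \<forall>j\<le>k. fls_nth (g i) j = 0"
  proof
    fix k :: int
    have "real CARD('f) powr - of_int (k + 1) > 0" using qf_gt_1 by simp
    then obtain N where N: "\<forall>i\<ge>N. nrm (fps_nth f i) \<le> real CARD('f) powr - of_int (k + 1)"
      using f unfolding tate_nrm_iff by blast
    have "real CARD('f) powr - of_int (k + 1) < real CARD('f) powr - of_int k" using qf_gt_1 by simp
    hence "\<forall>i\<ge>N. nrm (\<iota> (g i)) < real CARD('f) powr - of_int k" using N g by (metis le_less_trans)
    thus "\<exists>N. \<forall>i\<ge>N. \<forall>j\<le>k. fls_nth (g i) j = 0" unfolding nrm_emb_less_iff by blast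
  qed
  from choice[OF this] obtain N where N: "\<And>k i j. i \<ge> N k \<Longrightarrow> j \<le> k \<Longrightarrow> fls_nth (g i) j = 0"
    by blast
  define L where "L = Min (insert 0 ((\<lambda>i. fls_subdegree (g i)) ` {..N 0}))"
  have L: "L \<le> 0" "\<And>i. i \<le> N 0 \<Longrightarrow> L \<le> fls_subdegree (g i)" unfolding L_def
    by (rule Min_le, simp, simp) (rule Min_le, simp, rule insertI2, rule imageI, simp)
  have low: "fls_nth (g i) k = 0" if "k < L" for i k
  proof (cases "i \<le> N 0")
    case True
    thus ?thesis using L(2)[OF True] that by (intro fls_eq0_below_subdegree) simp
  next
    case False
    thus ?thesis using N[of 0 i k] L(1) that by simp
  qed
  define y where "y = Abs_fls (\<lambda>k. Abs_poly (\<lambda>i. fls_nth (g i) k))"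
  have co: "coeff (Abs_poly (\<lambda>i. fls_nth (g i) k)) i = fls_nth (g i) k" for k i
    using N[of k _ k] by (subst coeff_Abs_poly[of "N k"]) auto
  have "fls_nth y k = Abs_poly (\<lambda>i. fls_nth (g i) k)" for k
    unfolding y_def
  proof (rule nth_Abs_fls_lower_bound[of L], intro allI impI)
    fix k assume "k < L"
    thus "Abs_poly (\<lambda>i. fls_nth (g i) k) = 0" by (intro poly_eqI, unfold co) (simp add: low)
  qed
  hence "slice y i = g i" for i by (intro fls_eqI) (simp add: slice_nth co)
  hence "f = J y" by (intro fps_ext) (simp add: J_nth g)
  thus ?thesis using that by blast
qed

lemma At_to_tate_nth: "fps_nth (At_to_tate \<iota> a) i = \<iota> (eval_X_inv (coeff a i))"
  by (simp add: At_to_tate_def coeff_map_poly A_to_C_def eval_X_inv_def emb_zero)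

lemma At_to_tate_hom:
  "At_to_tate \<iota> (a + b) = At_to_tate \<iota> a + At_to_tate \<iota> b"
  "At_to_tate \<iota> (a - b) = At_to_tate \<iota> a - At_to_tate \<iota> b"
  "At_to_tate \<iota> (a * b) = At_to_tate \<iota> a * At_to_tate \<iota> b"
  "At_to_tate \<iota> 0 = 0" "At_to_tate \<iota> 1 = 1"
proof -
  have add: "eval_X_inv (x + y) = eval_X_inv x + eval_X_inv y"
    and diff: "eval_X_inv (x - y) = eval_X_inv x - eval_X_inv y" and zero: "eval_X_inv 0 = 0" for x y :: "'f poly"
    by (rule fls_eqI, simp add: eval_X_inv_nth)+
  have sum: "eval_X_inv (\<Sum>i\<in>I. f i) = (\<Sum>i\<in>I. eval_X_inv (f i))" for I and f :: "nat \<Rightarrow> 'f poly"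
    by (induction I rule: infinite_finite_induct) (simp_all add: add zero)
  show "At_to_tate \<iota> (a + b) = At_to_tate \<iota> a + At_to_tate \<iota> b"
    "At_to_tate \<iota> (a - b) = At_to_tate \<iota> a - At_to_tate \<iota> b" "At_to_tate \<iota> 0 = 0"
    by (rule fps_ext, simp add: At_to_tate_nth add diff zero emb_add emb_minus emb_zero)+
  show "At_to_tate \<iota> 1 = 1"
    by (rule fps_ext) (auto simp: At_to_tate_nth coeff_1 zero emb_zero emb_one eval_X_inv_hom)
  show "At_to_tate \<iota> (a * b) = At_to_tate \<iota> a * At_to_tate \<iota> b"
    by (rule fps_ext) (simp add: At_to_tate_nth coeff_mult fps_mult_nth sum emb_sum eval_X_inv_hom emb_mult atMost_atLeast0)
qed

lemma At_to_tate_power: "At_to_tate \<iota> (a ^ m) = At_to_tate \<iota> a ^ m"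
  by (induction m) (simp_all add: At_to_tate_hom)

lemma At_to_tate_tm: "At_to_tate \<iota> t_minus_theta = t_th"
proof (rule fps_ext)
  fix i
  have "eval_X_inv (- [:0, 1 :: 'f:]) = - fls_X_inv" "eval_X_inv (0 :: 'f poly) = 0"
    by (rule fls_eqI, auto simp: eval_X_inv_nth coeff_pCons split: nat.splits)+
  thus "fps_nth (At_to_tate \<iota> t_minus_theta) i = fps_nth t_th i"
    by (auto simp: At_to_tate_nth t_minus_theta_def t_th_def coeff_pCons emb_zero emb_one emb_uminus \<theta>_def
        eval_X_inv_hom split: nat.splits)
qed

lemma At_to_tate_frob: "At_to_tate \<iota> (frob_At a) = fr (At_to_tate \<iota> a)"
proof (rule fps_ext)
  fix i
  have 0: "pcompose 0 r = 0" for r :: "'f poly" by simp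
  have "eval_X_inv (pcompose c ([:0, 1:] ^ CARD('f))) = fls_compose_power (eval_X_inv c) CARD('f)" for c :: "'f poly"
  proof (induction c)
    case 0
    show ?case by (simp add: eval_X_inv_def)
  next
    case (pCons a c)
    have e0: "eval_X_inv (0 :: 'f poly) = 0" by (simp add: eval_X_inv_def)
    have add: "eval_X_inv (x + y) = eval_X_inv x + eval_X_inv y" for x y :: "'f poly"
      by (rule fls_eqI) (simp add: eval_X_inv_nth)
    have x1: "eval_X_inv [:0, 1 :: 'f:] = fls_X_inv"
      by (simp add: eval_X_inv_pCons e0)
    have "fls_compose_power fls_X_inv CARD('f) = (fls_X_inv ^ CARD('f) :: 'f fls)"
      by (rule fls_power_card[OF prime_card, symmetric])
    thus ?case using pCons card_pos
      by (simp add: pcompose_pCons add eval_X_inv_hom eval_X_inv_pCons e0 x1)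
  qed
  thus "fps_nth (At_to_tate \<iota> (frob_At a)) i = fps_nth (fr (At_to_tate \<iota> a)) i"
    by (simp add: At_to_tate_nth frob_At_def coeff_map_poly fr_nth fls_power_card[OF prime_card, symmetric] emb_power)
qed

lemma At_to_tate_tate: "At_to_tate \<iota> a \<in> tate_algebra"
  unfolding tate_nrm_iff
proof (intro allI impI exI[of _ "Suc (degree a)"])
  fix e :: real and i assume "e > 0" "i \<ge> Suc (degree a)"
  moreover have "eval_X_inv (0 :: 'f poly) = 0" by (simp add: eval_X_inv_def)
  ultimately show "nrm (fps_nth (At_to_tate \<iota> a) i) \<le> e"
    by (simp add: At_to_tate_nth coeff_eq_0 emb_zero)
qed

lemma At_to_tate_scoef: "scoef (At_to_tate \<iota> a)" by (simp add: At_to_tate_nth emb_sep)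

text \<open>This lemma and \<open>J_polys\<close> together match the image of F[theta, t] in the
  Tate algebra with \<open>fls_polys\<close>.\<close>

lemma At_to_tate_J:
  obtains y where "y \<in> fls_polys" "At_to_tate \<iota> a = J y"
proof -
  obtain y where y: "At_to_tate \<iota> a = J y"
    by (rule J_surj[OF At_to_tate_tate, of a]) (auto simp: At_to_tate_nth)
  have "slice y i = eval_X_inv (coeff a i)" for i
    using emb_inj' y by (metis At_to_tate_nth J_nth)
  hence "coeff (fls_nth y k) i = 0" if "k > 0" for k i
    using slice_nth[of y i k] that by (simp add: eval_X_inv_nth)
  hence "y \<in> fls_polys" by (auto simp: fls_polys_def poly_eq_iff)
  thus ?thesis using that y by blast
qed

lemma J_polys:
  assumes y: "y \<in> fls_polys" obtains a where "At_to_tate \<iota> a = J y"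
proof -
  have "\<exists>c. eval_X_inv c = z" if z: "z \<in> fls_polys" for z :: "'f fls"
  proof -
    define c where "c = Abs_poly (\<lambda>j. fls_nth z (- int j))"
    have c: "coeff c j = fls_nth z (- int j)" for j
      unfolding c_def
      by (subst coeff_Abs_poly[of "nat (- fls_subdegree z)"]) (auto intro: fls_eq0_below_subdegree)
    have "eval_X_inv c = z"
      using z by (intro fls_eqI) (auto simp: eval_X_inv_nth c fls_polys_def)
    thus ?thesis by blast
  qed
  moreover have "slice y i \<in> fls_polys" for i using y by (simp add: fls_polys_def slice_nth)
  ultimately have "\<forall>i. \<exists>c. eval_X_inv c = slice y i" by blast
  from choice[OF this] obtain c where c: "\<And>i. eval_X_inv (c i) = slice y i" by blast
  define N where "N = Max (insert 0 ((\<lambda>j. degree (fls_nth y j)) ` {fls_subdegree y..0}))"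
  have c0: "c i = 0" if "i > N" for i
  proof (rule poly_eqI)
    fix j
    have "coeff (c i) j = fls_nth (slice y i) (- int j)"
      using eval_X_inv_nth[of "c i" "- int j"] by (simp add: c)
    also have "\<dots> = 0"
    proof (cases "- int j < fls_subdegree y")
      case True
      thus ?thesis by (simp add: slice_nth fls_eq0_below_subdegree)
    next
      case False
      hence "degree (fls_nth y (- int j)) \<le> N" unfolding N_def by (intro Max_ge) auto
      thus ?thesis using that by (simp add: slice_nth coeff_eq_0)
    qed
    finally show "coeff (c i) j = coeff 0 j" by simp
  qed
  have "coeff (Abs_poly c) = c" using c0 by (intro coeff_Abs_poly) auto
  hence "At_to_tate \<iota> (Abs_poly c) = J y" by (intro fps_ext) (simp add: At_to_tate_nth c J_nth)
  thus ?thesis using that by blast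
qed

text \<open>Here and in the following two lemmas the theorem \<open>frob_surj_power_iff\<close> is
  carried along \<open>J\<close> to the operator \<open>phi\<close> on series over K_inf modulo
  F[theta, t].\<close>

lemma J_frob_surj:
  assumes "digit_sum CARD('f) n < CARD('f) - 1" "f \<in> tate_algebra" "\<And>i. fps_nth f i \<in> range \<iota>"
  obtains a g where "g \<in> tate_algebra" "\<And>i. fps_nth g i \<in> range \<iota>" "f - phi g = At_to_tate \<iota> a"
proof -
  obtain y where y: "f = J y" using assms(2,3) by (rule J_surj)
  obtain x where "y - (x - tm_th ^ n * fls_compose_power x CARD('f)) \<in> fls_polys"
    using frob_surj_power_iff(1)[OF prime_card assms(1)] unfolding frob_surj_def by blast
  then obtain a where "At_to_tate \<iota> a = J (y - (x - tm_th ^ n * fls_compose_power x CARD('f)))"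
    by (rule J_polys)
  hence "f - phi (J x) = At_to_tate \<iota> a" by (simp add: J_diff[of y] J_phi y)
  thus ?thesis using that J_tate by (metis J_nth rangeI)
qed

lemma J_frob_inj:
  assumes "digit_sum CARD('f) n < CARD('f) - 1" "f \<in> tate_algebra" "\<And>i. fps_nth f i \<in> range \<iota>"
    "phi f = At_to_tate \<iota> a"
  obtains h where "f = At_to_tate \<iota> h"
proof -
  obtain x where x: "f = J x" using assms(2,3) by (rule J_surj)
  obtain y where y: "y \<in> fls_polys" "At_to_tate \<iota> a = J y" by (rule At_to_tate_J)
  have "x - tm_th ^ n * fls_compose_power x CARD('f) = y"
    using assms(4) unfolding x J_phi[symmetric] y(2) by (rule J_inj)
  hence "x \<in> fls_polys"
    using frob_surj_power_iff(2)[OF prime_card assms(1)] y(1) unfolding frob_inj_def by blast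
  thus ?thesis using J_polys[of x] that x by metis
qed

lemma J_not_frob_surj:
  assumes "\<not> digit_sum CARD('f) n < CARD('f) - 1"
  obtains v where "v \<in> tate_algebra" "\<And>i. fps_nth v i \<in> range \<iota>"
    "\<And>g a. g \<in> tate_algebra \<Longrightarrow> (\<And>i. fps_nth g i \<in> range \<iota>) \<Longrightarrow> v - phi g \<noteq> At_to_tate \<iota> a"
proof -
  obtain y :: "'f poly fls" where y: "\<forall>x. y - (x - tm_th ^ n * fls_compose_power x CARD('f)) \<notin> fls_polys"
    using frob_surj_power_iff(3)[OF prime_card assms] unfolding frob_surj_def by blast
  have "J y - phi g \<noteq> At_to_tate \<iota> a" if g: "g \<in> tate_algebra" "\<And>i. fps_nth g i \<in> range \<iota>" for g a
  proof
    assume eq: "J y - phi g = At_to_tate \<iota> a"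
    obtain x where x: "g = J x" using g by (rule J_surj)
    obtain z where z: "z \<in> fls_polys" "At_to_tate \<iota> a = J z" by (rule At_to_tate_J)
    have "J (y - (x - tm_th ^ n * fls_compose_power x CARD('f))) = J z"
      using eq by (simp add: J_diff[of y] J_phi x z(2))
    hence "y - (x - tm_th ^ n * fls_compose_power x CARD('f)) = z" by (rule J_inj)
    thus False using y z(1) by metis
  qed
  thus ?thesis using that[of "J y"] J_tate by (auto simp: J_nth)
qed

end

section \<open>Cohomology of the Betti realization\<close>

text \<open>Artin's argument on characters: comparing the relation at x y with
  \<open>\<chi> k y\<close> times the relation at x eliminates the character of index k.
  Multiplicativity is asked for on L only, because the embeddings in Hilbert 90 are told apart on a
  subring of the separable closure.\<close>

lemma monoid_hom_independent:
  fixes \<chi> :: "'i \<Rightarrow> 'm::comm_monoid_mult \<Rightarrow> 'c::field"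
  assumes fin: "finite I" and L: "1 \<in> L" "\<And>x y. x \<in> L \<Longrightarrow> y \<in> L \<Longrightarrow> x * y \<in> L"
    and one: "\<And>i. i \<in> I \<Longrightarrow> \<chi> i 1 = 1"
    and mult: "\<And>i x y. i \<in> I \<Longrightarrow> x \<in> L \<Longrightarrow> y \<in> L \<Longrightarrow> \<chi> i (x * y) = \<chi> i x * \<chi> i y"
    and dist: "\<And>i j. i \<in> I \<Longrightarrow> j \<in> I \<Longrightarrow> i \<noteq> j \<Longrightarrow> \<exists>x\<in>L. \<chi> i x \<noteq> \<chi> j x"
    and zero: "\<And>x. x \<in> L \<Longrightarrow> (\<Sum>i\<in>I. a i * \<chi> i x) = 0"
  shows "\<forall>i\<in>I. a i = 0"
  using fin one mult dist zero
proof (induction I arbitrary: a rule: finite_induct)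
  case (insert k I)
  have "\<forall>j\<in>I. a j = 0"
  proof
    fix j assume j: "j \<in> I"
    then obtain y where y: "y \<in> L" "\<chi> k y \<noteq> \<chi> j y" using insert.prems(3)[of k j] insert.hyps(2) by auto
    have "\<forall>i\<in>I. a i * (\<chi> i y - \<chi> k y) = 0"
    proof (rule insert.IH)
      fix x assume x: "x \<in> L"
      have "0 = (\<Sum>i\<in>insert k I. a i * \<chi> i (x * y)) - \<chi> k y * (\<Sum>i\<in>insert k I. a i * \<chi> i x)"
        using insert.prems(4)[of "x * y"] insert.prems(4)[of x] x y L by simp
      also have "\<dots> = (\<Sum>i\<in>insert k I. a i * (\<chi> i y - \<chi> k y) * \<chi> i x)"
        using insert.prems(2) x y
        by (simp only: sum_distrib_left sum_subtractf[symmetric]) (intro sum.cong; simp add: algebra_simps)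
      also have "\<dots> = (\<Sum>i\<in>I. a i * (\<chi> i y - \<chi> k y) * \<chi> i x)"
        using insert.hyps by simp
      finally show "(\<Sum>i\<in>I. a i * (\<chi> i y - \<chi> k y) * \<chi> i x) = 0" by simp
    qed (use insert.prems in auto)
    thus "a j = 0" using j y(2) by force
  qed
  moreover from this have "a k = 0"
    using insert.prems(4)[OF L(1)] insert.prems(1)[of k] insert.hyps by simp
  ultimately show ?case by simp
qed simp

definition vec1 :: "'a \<Rightarrow> 'a vec" where "vec1 f = Matrix.vec 1 (\<lambda>_. f)"

lemma vec1_simps:
  "vec1 f = vec1 g \<longleftrightarrow> f = g" "vec1 a + vec1 b = vec1 (a + b :: 'b::ring_1)" "vec1 a - vec1 b = vec1 (a - b)"
  "b \<cdot>\<^sub>v vec1 a = vec1 (b * a)" "vec1 f $ 0 = f" "dim_vec (vec1 f) = 1" "map_vec h (vec1 f) = vec1 (h f)"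
  by (auto simp: vec1_def vec_eq_iff)

lemma vec1_exhaust: "v \<in> carrier_vec 1 \<Longrightarrow> v = vec1 (v $ 0)"
  by (auto simp: vec1_def)

context carlitz_betti
begin

text \<open>Up to \<open>vec1\<close> this is the Betti realization of A(-n), see
  \<open>betti_A\<close>.\<close>

definition W :: "'c fps set" where "W = {f \<in> tate_algebra. phi f = 0}"

abbreviation Kcoef :: "'c fps \<Rightarrow> bool" where "Kcoef f \<equiv> \<forall>i. fps_nth f i \<in> range \<iota>"

lemma Kcoef_scoef: "Kcoef f \<Longrightarrow> scoef f" using emb_sep by (metis rangeE)

lemma W_scoef: "f \<in> W \<Longrightarrow> scoef f"
  using phi_scoef[of f] sep_ring(1) by (simp add: W_def)

lemma W_diff: "f \<in> W \<Longrightarrow> g \<in> W \<Longrightarrow> f - g \<in> W" by (auto simp: W_def tate_diff phi_diff)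

lemma zero_W: "0 \<in> W" using phi_diff[of 0 0] by (simp add: W_def tate_zero)

lemma phi_eq_scoef: "phi x = u \<Longrightarrow> Kcoef u \<Longrightarrow> scoef x"
  using phi_scoef[of x] Kcoef_scoef[of u] by blast

text \<open>A nonzero element of \<open>W\<close> has a lowest coefficient of fixed absolute value.\<close>

lemma W_discrete:
  assumes w: "w \<in> W" and small: "\<And>i. nrm (fps_nth w i) < inverse (real CARD('f) ^ n)"
  shows "w = 0"
proof (rule fps_ext)
  fix i
  show "fps_nth w i = fps_nth 0 i"
  proof (induction i rule: less_induct)
    case (less i)
    let ?x = "fps_nth w i" and ?q = "real CARD('f)"
    have "phi w = 0" using w by (simp add: W_def)
    hence "?x - cf 0 * ?x ^ CARD('f) = lower 0 w i" unfolding phi_eq_iff by blast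
    moreover have "lower 0 w i = 0"
      unfolding lower_def using less by (simp add: pow_0)
    ultimately have eq: "cf 0 * ?x ^ CARD('f) = ?x" by simp
    show ?case
    proof (rule ccontr)
      assume "fps_nth w i \<noteq> fps_nth 0 i"
      hence pos: "nrm ?x > 0" by simp
      have "?q ^ n * nrm ?x ^ CARD('f) = nrm ?x" using arg_cong[OF eq, of nrm] by (simp add: abs_mult cf_props nrm_power)
      moreover have "nrm ?x ^ CARD('f) \<le> nrm ?x ^ 2"
      proof (rule power_decreasing)
        have "inverse (?q ^ n) \<le> 1" using qf_gt_1 by (simp add: inverse_le_1_iff)
        thus "nrm ?x \<le> 1" using small[of i] by simp
      qed (use card_f_ge_2 in auto)
      ultimately have "nrm ?x \<le> ?q ^ n * nrm ?x ^ 2" using qf_gt_1 by (metis mult_left_mono of_nat_0_le_iff zero_le_power)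
      hence "1 * nrm ?x \<le> (?q ^ n * nrm ?x) * nrm ?x" by (simp add: power2_eq_square mult.assoc)
      hence "1 \<le> ?q ^ n * nrm ?x" using pos by (simp only: mult_le_cancel_right_pos)
      moreover have "?q ^ n * nrm ?x < ?q ^ n * inverse (?q ^ n)"
        using small[of i] qf_gt_1 by (intro mult_strict_left_mono) auto
      ultimately show False using qf_gt_1 by simp
    qed
  qed
qed

text \<open>The definite description in \<open>loc_to_tate\<close> ranges over all representations
  of the fraction; they give the same value because t - theta maps to a nonzero, hence cancellable,
  power series.\<close>

lemma loc_to_tate_to_fract: "loc_to_tate \<iota> (to_fract a) = At_to_tate \<iota> a"
  unfolding loc_to_tate_def
proof (rule the_equality)
  show "\<exists>b k. to_fract a = Fract b (t_minus_theta ^ k) \<and>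
      At_to_tate \<iota> a * At_to_tate \<iota> t_minus_theta ^ k = At_to_tate \<iota> b"
    by (intro exI[of _ a] exI[of _ 0]) (simp add: to_fract_def)
  fix y assume "\<exists>b k. to_fract a = Fract b (t_minus_theta ^ k) \<and>
      y * At_to_tate \<iota> t_minus_theta ^ k = At_to_tate \<iota> b"
  then obtain b k where bk: "to_fract a = Fract b (t_minus_theta ^ k)"
    "y * At_to_tate \<iota> t_minus_theta ^ k = At_to_tate \<iota> b" by blast
  have "t_minus_theta ^ k \<noteq> (0 :: 'f poly poly)" by (simp add: t_minus_theta_def)
  hence "b = a * t_minus_theta ^ k" using bk(1) by (simp add: to_fract_def eq_fract)
  hence "y * t_th ^ k = At_to_tate \<iota> a * t_th ^ k"
    using bk(2) by (simp add: At_to_tate_hom At_to_tate_power At_to_tate_tm)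
  moreover have "fps_nth t_th 1 = 1" by (simp add: t_th_def)
  hence "t_th ^ k \<noteq> 0" by (metis fps_zero_nth power_not_zero zero_neq_one)
  ultimately show "y = At_to_tate \<iota> a" by (metis mult_right_cancel)
qed

lemma to_fract_power: "to_fract (a ^ m :: 'a::idom) = to_fract a ^ m"
proof (induction m)
  case (Suc m)
  have "to_fract (a ^ Suc m) = to_fract a * to_fract (a ^ m)" by (simp add: to_fract_def)
  thus ?case using Suc by simp
qed (simp add: to_fract_def One_fract_def)

lemma A_motive_eq: "A_motive (- int n) = Matrix.mat 1 1 (\<lambda>_. to_fract (t_minus_theta ^ n) :: 'f poly poly fract)"
  by (simp add: A_motive_def to_fract_power)

lemma betti_A: "betti \<iota> (A_motive (- int n)) = vec1 ` W"
proof -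
  have eq: "map_mat (loc_to_tate \<iota>) (A_motive (- int n)) *\<^sub>v map_vec (tate_map (\<lambda>c. c ^ CARD('f))) (vec1 f) = vec1 f
      \<longleftrightarrow> phi f = 0" for f
    unfolding A_motive_eq
    by (auto simp: vec1_def vec_eq_iff scalar_prod_def loc_to_tate_to_fract At_to_tate_power At_to_tate_tm phi_def fr_def)
  have dim: "dim_row (A_motive (- int n) :: 'f motive) = 1" by (simp add: A_motive_eq)
  show ?thesis
  proof (intro equalityI subsetI)
    fix v assume v: "v \<in> betti \<iota> (A_motive (- int n))"
    hence vc: "v \<in> carrier_vec 1" by (simp add: betti_def dim)
    have v1: "v = vec1 (v $ 0)" using vec1_exhaust[OF vc] .
    have "v $ 0 \<in> tate_algebra" using v vc by (auto simp: betti_def vec_set_def)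
    moreover have "phi (v $ 0) = 0" using v v1 eq[of "v $ 0"] unfolding betti_def by auto
    ultimately show "v \<in> vec1 ` W" using v1 by (auto simp: W_def)
  next
    fix v assume "v \<in> vec1 ` W"
    then obtain f where f: "v = vec1 f" "f \<in> tate_algebra" "phi f = 0" by (auto simp: W_def)
    have "set\<^sub>v v \<subseteq> tate_algebra" using f(1,2) by (auto simp: vec_set_def vec1_def)
    thus "v \<in> betti \<iota> (A_motive (- int n))"
      using f eq[of f] unfolding betti_def dim by (auto simp: vec1_def)
  qed
qed

text \<open>The action through the automorphism itself. On series with separable coefficients it
  agrees with the one through \<open>gal_ext\<close>, and it can be computed with directly.\<close>

definition gs :: "('c \<Rightarrow> 'c) \<Rightarrow> 'c fps \<Rightarrow> 'c fps" where "gs \<sigma> f = tate_map \<sigma> f"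

lemma gs_nth: "fps_nth (gs \<sigma> f) i = \<sigma> (fps_nth f i)" by (simp add: gs_def tate_map_def)

lemma tate_map_gal_ext: "\<sigma> \<in> Gal \<iota> \<Longrightarrow> scoef f \<Longrightarrow> tate_map (gal_ext \<iota> \<sigma>) f = gs \<sigma> f"
  by (rule fps_ext) (simp add: gs_nth tate_map_def gal_ext_eq)

lemma gal_act_vec1: "\<sigma> \<in> Gal \<iota> \<Longrightarrow> scoef f \<Longrightarrow> gal_act \<iota> \<sigma> (vec1 f) = vec1 (gs \<sigma> f)"
  by (simp add: gal_act_def vec1_simps tate_map_gal_ext)

lemma gs_scoef: "\<sigma> \<in> Gal \<iota> \<Longrightarrow> scoef f \<Longrightarrow> scoef (gs \<sigma> f)" by (simp add: gs_nth GalD)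

lemma gs_add: "\<sigma> \<in> Gal \<iota> \<Longrightarrow> scoef f \<Longrightarrow> scoef g \<Longrightarrow> gs \<sigma> (f + g) = gs \<sigma> f + gs \<sigma> g"
  by (rule fps_ext) (simp add: gs_nth GalD)

lemma gs_diff: "\<sigma> \<in> Gal \<iota> \<Longrightarrow> scoef f \<Longrightarrow> scoef g \<Longrightarrow> gs \<sigma> (f - g) = gs \<sigma> f - gs \<sigma> g"
  by (rule fps_ext) (simp add: gs_nth GalD)

lemma Gal_sum:
  assumes "\<sigma> \<in> Gal \<iota>" "\<And>i. i \<in> I \<Longrightarrow> f i \<in> sep_elements \<iota>"
  shows "\<sigma> (\<Sum>i\<in>I. f i) = (\<Sum>i\<in>I. \<sigma> (f i))"
  using assms(2)
proof (induction I rule: infinite_finite_induct)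
  case (insert i I)
  have "sum f I \<in> sep_elements \<iota>" using insert by (intro is_subring_sum[OF sep_subring]) auto
  thus ?case using insert GalD(2)[OF assms(1)] by simp
qed (simp_all add: GalD(5)[OF assms(1)])

lemma gs_mult:
  assumes "\<sigma> \<in> Gal \<iota>" "scoef f" "scoef g" shows "gs \<sigma> (f * g) = gs \<sigma> f * gs \<sigma> g"
proof (rule fps_ext)
  fix i
  have "fps_nth f j * fps_nth g (i - j) \<in> sep_elements \<iota>" for j using assms sep_ring(5) by blast
  hence "\<sigma> (\<Sum>j=0..i. fps_nth f j * fps_nth g (i - j)) = (\<Sum>j=0..i. \<sigma> (fps_nth f j * fps_nth g (i - j)))"
    by (intro Gal_sum[OF assms(1)])
  also have "\<dots> = (\<Sum>j=0..i. \<sigma> (fps_nth f j) * \<sigma> (fps_nth g (i - j)))"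
    using assms(2,3) by (intro sum.cong refl GalD(3)[OF assms(1)]) blast+
  finally show "fps_nth (gs \<sigma> (f * g)) i = fps_nth (gs \<sigma> f * gs \<sigma> g) i"
    by (simp add: gs_nth fps_mult_nth)
qed

lemma gs_Kcoef: "\<sigma> \<in> Gal \<iota> \<Longrightarrow> Kcoef f \<Longrightarrow> gs \<sigma> f = f"
  by (rule fps_ext) (metis GalD(4) gs_nth rangeE)

lemma gs_tate: "\<sigma> \<in> Gal \<iota> \<Longrightarrow> scoef f \<Longrightarrow> f \<in> tate_algebra \<Longrightarrow> gs \<sigma> f \<in> tate_algebra"
  unfolding tate_nrm_iff by (simp add: gs_nth Gal_nrm)

lemma t_th_power_Kcoef: "Kcoef (t_th ^ m)"
  by (metis At_to_tate_nth At_to_tate_power At_to_tate_tm rangeI)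

lemma scoef_mult: "scoef f \<Longrightarrow> scoef g \<Longrightarrow> scoef (f * g)"
  by (auto simp: fps_mult_nth intro!: is_subring_sum[OF sep_subring] sep_ring)

lemma Kcoef_subring: "is_subring (range \<iota>)"
  unfolding is_subring_def
proof (intro conjI ballI)
  show "1 \<in> range \<iota>" by (rule range_eqI[of _ _ 1]) (simp add: emb_one)
  fix x y assume "x \<in> range \<iota>" "y \<in> range \<iota>"
  then obtain a b where ab: "x = \<iota> a" "y = \<iota> b" by blast
  show "x - y \<in> range \<iota>" by (rule range_eqI[of _ _ "a - b"]) (simp add: ab emb_minus)
  show "x * y \<in> range \<iota>" by (rule range_eqI[of _ _ "a * b"]) (simp add: ab emb_mult)
qed

lemma Kcoef_mult: "Kcoef f \<Longrightarrow> Kcoef g \<Longrightarrow> Kcoef (f * g)"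
  by (auto simp only: fps_mult_nth intro!: is_subring_sum[OF Kcoef_subring] is_subringD(5)[OF Kcoef_subring])

lemma fr_scoef: "scoef f \<Longrightarrow> scoef (fr f)" by (simp add: fr_nth sep_ring)

lemma phi_scoef_iff: "scoef f \<Longrightarrow> scoef (phi f)"
  unfolding phi_def using scoef_mult[OF Kcoef_scoef[OF t_th_power_Kcoef] fr_scoef] sep_ring(4) by simp

lemma phi_gs:
  assumes \<sigma>: "\<sigma> \<in> Gal \<iota>" and f: "scoef f" shows "phi (gs \<sigma> f) = gs \<sigma> (phi f)"
proof -
  have K: "scoef (t_th ^ n)" by (rule Kcoef_scoef[OF t_th_power_Kcoef])
  have fr: "fr (gs \<sigma> f) = gs \<sigma> (fr f)" by (rule fps_ext) (use f in \<open>simp add: fr_nth gs_nth GalD(8)[OF \<sigma>]\<close>)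
  show ?thesis
    unfolding phi_def gs_diff[OF \<sigma> f scoef_mult[OF K fr_scoef[OF f]]] gs_mult[OF \<sigma> K fr_scoef[OF f]]
      gs_Kcoef[OF \<sigma> t_th_power_Kcoef] fr ..
qed

lemma phi_tate: "f \<in> tate_algebra \<Longrightarrow> phi f \<in> tate_algebra"
proof -
  assume f: "f \<in> tate_algebra"
  have "fr f \<in> tate_algebra"
    unfolding tate_nrm_iff
  proof (intro allI impI)
    fix e :: real assume e: "e > 0"
    hence "min e 1 > 0" by simp
    then obtain N where N: "\<forall>i\<ge>N. nrm (fps_nth f i) \<le> min e 1" using f unfolding tate_nrm_iff by blast
    have "nrm (fps_nth (fr f) i) \<le> e" if "i \<ge> N" for i
    proof -
      have "nrm (fps_nth f i) ^ CARD('f) \<le> nrm (fps_nth f i) ^ 1"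
        using N that card_pos(1) by (intro power_decreasing) auto
      thus ?thesis using N that by (auto simp: fr_nth nrm_power intro: order.trans)
    qed
    thus "\<exists>N. \<forall>i\<ge>N. nrm (fps_nth (fr f) i) \<le> e" by blast
  qed
  moreover have "t_th ^ n \<in> tate_algebra" by (metis At_to_tate_power At_to_tate_tate At_to_tate_tm)
  ultimately show ?thesis unfolding phi_def by (intro tate_diff f tate_mult)
qed

text \<open>The cocycle of a lift x, cut down to \<open>Gal\<close> because cocycles are
  extensional.\<close>

definition cc :: "'c fps \<Rightarrow> ('c \<Rightarrow> 'c) \<Rightarrow> 'c fps vec" where
  "cc x = (\<lambda>\<sigma>\<in>Gal \<iota>. vec1 (gs \<sigma> x - x))"

lemma topspace_krull: "topspace (krull_topology \<iota>) = Gal \<iota>"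
proof -
  have "Gal \<iota> \<subseteq> PiE (sep_elements \<iota>) (\<lambda>_. sep_elements \<iota>)"
    using GalD(1,12) by (auto simp: PiE_def)
  thus ?thesis by (auto simp: krull_topology_def)
qed

lemma openin_krull_eval:
  assumes x: "x \<in> sep_elements \<iota>" shows "openin (krull_topology \<iota>) {\<sigma> \<in> Gal \<iota>. \<sigma> x = y}"
proof -
  have "continuous_map (krull_topology \<iota>) (discrete_topology (sep_elements \<iota>)) (\<lambda>\<sigma>. \<sigma> x)"
    unfolding krull_topology_def
    by (intro continuous_map_from_subtopology continuous_map_product_projection x)
  hence "openin (krull_topology \<iota>) {\<sigma> \<in> topspace (krull_topology \<iota>). \<sigma> x \<in> {y} \<inter> sep_elements \<iota>}"
    by (rule openin_continuous_map_preimage) auto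
  moreover have "{\<sigma> \<in> topspace (krull_topology \<iota>). \<sigma> x \<in> {y} \<inter> sep_elements \<iota>} = {\<sigma> \<in> Gal \<iota>. \<sigma> x = y}"
    using GalD(1) x by (auto simp: topspace_krull)
  ultimately show ?thesis by simp
qed

lemma openin_krull_agree:
  assumes "\<sigma>0 \<in> Gal \<iota>" "finite F" "F \<subseteq> sep_elements \<iota>"
  shows "openin (krull_topology \<iota>) {\<sigma> \<in> Gal \<iota>. \<forall>x\<in>F. \<sigma> x = \<sigma>0 x}"
  using assms(2,3)
proof (induction F rule: finite_induct)
  case empty
  show ?case using openin_topspace[of "krull_topology \<iota>"] by (simp add: topspace_krull)
next
  case (insert x F)
  have "{\<sigma> \<in> Gal \<iota>. \<forall>x\<in>insert x F. \<sigma> x = \<sigma>0 x} = {\<sigma> \<in> Gal \<iota>. \<sigma> x = \<sigma>0 x} \<inter> {\<sigma> \<in> Gal \<iota>. \<forall>x\<in>F. \<sigma> x = \<sigma>0 x}"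
    by auto
  moreover have "openin (krull_topology \<iota>) \<dots>"
    using insert by (intro openin_Int openin_krull_eval) auto
  ultimately show ?case by simp
qed

text \<open>The operator commutes with the Galois action, and phi x is invariant; so it kills the
  difference.\<close>

lemma gs_diff_W:
  assumes "x \<in> tate_algebra" "Kcoef (phi x)" "\<sigma> \<in> Gal \<iota>" shows "gs \<sigma> x - x \<in> W"
proof -
  have x: "scoef x" using assms(2) by (rule phi_eq_scoef[OF refl])
  have "phi (gs \<sigma> x - x) = 0"
    unfolding phi_diff phi_gs[OF assms(3) x] gs_Kcoef[OF assms(3,2)] by simp
  thus ?thesis using assms(1) gs_tate[OF assms(3) x assms(1)] by (simp add: W_def tate_diff)
qed

text \<open>Continuity rests on the discreteness of \<open>W\<close>. If two automorphisms agree on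
  the first N coefficients of x, their cocycle values differ by an element of \<open>W\<close> whose
  early coefficients vanish and whose later ones are small, as those of x are; by
  \<open>W_discrete\<close> it is 0.\<close>

lemma cc_cocycle:
  assumes x: "x \<in> tate_algebra" "Kcoef (phi x)" shows "cc x \<in> cocycles \<iota> (vec1 ` W)"
proof -
  have xs: "scoef x" using x(2) by (rule phi_eq_scoef[OF refl])
  have cW: "cc x \<sigma> \<in> vec1 ` W" if "\<sigma> \<in> Gal \<iota>" for \<sigma> using that gs_diff_W[OF x] by (simp add: cc_def)
  \<comment> \<open>Halving the bound makes the strict inequality of \<open>W_discrete\<close>
    available later.\<close>
  have "inverse (real CARD('f) ^ n) / 2 > 0" using qf_gt_1 by simp
  then obtain N where N: "\<forall>i\<ge>N. nrm (fps_nth x i) \<le> inverse (real CARD('f) ^ n) / 2"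
    using x(1) unfolding tate_nrm_iff by blast
  have const: "cc x \<sigma> = cc x \<sigma>0"
    if \<sigma>: "\<sigma> \<in> Gal \<iota>" "\<sigma>0 \<in> Gal \<iota>" and agree: "\<forall>y\<in>fps_nth x ` {..<N}. \<sigma> y = \<sigma>0 y" for \<sigma> \<sigma>0
  proof -
    have "(gs \<sigma> x - x) - (gs \<sigma>0 x - x) \<in> W" by (rule W_diff[OF gs_diff_W[OF x \<sigma>(1)] gs_diff_W[OF x \<sigma>(2)]])
    hence w: "gs \<sigma> x - gs \<sigma>0 x \<in> W" by simp
    have "gs \<sigma> x - gs \<sigma>0 x = 0"
    proof (rule W_discrete[OF w])
      fix i
      have pos: "inverse (real CARD('f) ^ n) > 0" using qf_gt_1 by simp
      show "nrm (fps_nth (gs \<sigma> x - gs \<sigma>0 x) i) < inverse (real CARD('f) ^ n)"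
      proof (cases "i < N")
        case True
        thus ?thesis using agree pos by (simp add: gs_nth)
      next
        case False
        have "nrm (fps_nth (gs \<sigma> x - gs \<sigma>0 x) i) \<le> max (nrm (fps_nth x i)) (nrm (fps_nth x i))"
          using nrm_diff_le[of "\<sigma> (fps_nth x i)" "\<sigma>0 (fps_nth x i)"] \<sigma> xs by (simp add: gs_nth Gal_nrm)
        also have "\<dots> \<le> inverse (real CARD('f) ^ n) / 2" using N False by simp
        also have "\<dots> < inverse (real CARD('f) ^ n)" using pos by linarith
        finally show ?thesis .
      qed
    qed
    thus ?thesis using \<sigma> by (simp add: cc_def)
  qed
  have "continuous_map (krull_topology \<iota>) (discrete_topology (vec1 ` W)) (cc x)"
    unfolding continuous_map_def topspace_krull topspace_discrete_topology openin_discrete_topology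
  proof (intro conjI allI impI)
    show "cc x \<in> Gal \<iota> \<rightarrow> vec1 ` W" using cW by blast
    fix U assume "U \<subseteq> vec1 ` W"
    show "openin (krull_topology \<iota>) {\<sigma> \<in> Gal \<iota>. cc x \<sigma> \<in> U}"
    proof (subst openin_subopen, intro ballI)
      fix \<sigma>0 assume \<sigma>0: "\<sigma>0 \<in> {\<sigma> \<in> Gal \<iota>. cc x \<sigma> \<in> U}"
      let ?T = "{\<sigma> \<in> Gal \<iota>. \<forall>y\<in>fps_nth x ` {..<N}. \<sigma> y = \<sigma>0 y}"
      have "openin (krull_topology \<iota>) ?T" using \<sigma>0 xs by (intro openin_krull_agree) auto
      moreover have "\<sigma>0 \<in> ?T" using \<sigma>0 by simp
      moreover have "?T \<subseteq> {\<sigma> \<in> Gal \<iota>. cc x \<sigma> \<in> U}"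
      proof
        fix \<sigma> assume "\<sigma> \<in> ?T"
        hence "\<sigma> \<in> Gal \<iota>" "cc x \<sigma> = cc x \<sigma>0" using const[of \<sigma> \<sigma>0] \<sigma>0 by simp_all
        thus "\<sigma> \<in> {\<sigma> \<in> Gal \<iota>. cc x \<sigma> \<in> U}" using \<sigma>0 by simp
      qed
      ultimately show "\<exists>T. openin (krull_topology \<iota>) T \<and> \<sigma>0 \<in> T \<and> T \<subseteq> {\<sigma> \<in> Gal \<iota>. cc x \<sigma> \<in> U}" by blast
    qed
  qed
  moreover have "cc x (gcomp \<sigma> \<rho>) = cc x \<sigma> + gal_act \<iota> \<sigma> (cc x \<rho>)" if g: "\<sigma> \<in> Gal \<iota>" "\<rho> \<in> Gal \<iota>" for \<sigma> \<rho>
  proof -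
    have "gs (gcomp \<sigma> \<rho>) x = gs \<sigma> (gs \<rho> x)" using xs by (intro fps_ext) (simp add: gs_nth gcomp_apply)
    moreover have "gal_act \<iota> \<sigma> (cc x \<rho>) = vec1 (gs \<sigma> (gs \<rho> x) - gs \<sigma> x)"
      using g W_scoef[OF gs_diff_W[OF x g(2)]] gs_diff[OF g(1) gs_scoef[OF g(2) xs] xs]
      by (simp add: cc_def gal_act_vec1)
    ultimately show ?thesis using g gcomp_Gal[OF g] by (simp add: cc_def vec1_simps)
  qed
  ultimately show ?thesis unfolding cocycles_def by (auto simp: cc_def)
qed

end

section \<open>Hilbert 90 and the description of H^1\<close>

context carlitz_betti
begin

lemma gs_gid: "scoef f \<Longrightarrow> gs gid f = f"
  by (rule fps_ext) (simp add: gs_nth gid_def)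

lemma gs_sum:
  assumes "\<sigma> \<in> Gal \<iota>" "\<And>i. i \<in> I \<Longrightarrow> scoef (h i)"
  shows "gs \<sigma> (\<Sum>i\<in>I. h i) = (\<Sum>i\<in>I. gs \<sigma> (h i))"
proof (rule fps_ext)
  fix k
  have "\<sigma> (\<Sum>i\<in>I. fps_nth (h i) k) = (\<Sum>i\<in>I. \<sigma> (fps_nth (h i) k))"
    using assms(2) by (intro Gal_sum[OF assms(1)]) blast
  thus "fps_nth (gs \<sigma> (\<Sum>i\<in>I. h i)) k = fps_nth (\<Sum>i\<in>I. gs \<sigma> (h i)) k"
    by (simp add: gs_nth fps_sum_nth)
qed

lemma Gal_inverse_ex:
  assumes "\<sigma> \<in> Gal \<iota>"
  shows "\<exists>\<rho>\<in>Gal \<iota>. (\<forall>x\<in>sep_elements \<iota>. \<sigma> (\<rho> x) = x) \<and> (\<forall>x\<in>sep_elements \<iota>. \<rho> (\<sigma> x) = x)"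
proof (rule Gal_inverse[OF assms])
  fix \<rho> assume "\<rho> \<in> Gal \<iota>" "\<And>x. x \<in> sep_elements \<iota> \<Longrightarrow> \<sigma> (\<rho> x) = x" "\<And>x. x \<in> sep_elements \<iota> \<Longrightarrow> \<rho> (\<sigma> x) = x"
  thus ?thesis by blast
qed

text \<open>Additive Hilbert 90: a continuous cocycle factors through finitely many embeddings of a subfield
  \<open>L\<close>; by independence of characters some \<open>y\<close> in \<open>L\<close> has nonzero trace, and averaging the cocycle
  against the conjugates of \<open>y\<close> exhibits it as a coboundary.\<close>

lemma hilbert90:
  assumes c: "c \<in> cocycles \<iota> (vec1 ` W)"
  obtains x where "x \<in> tate_algebra" "Kcoef (phi x)" "c = cc x"
proof -
  define d where "d = (\<lambda>\<sigma>. c \<sigma> $ 0)"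
  have cont: "continuous_map (krull_topology \<iota>) (discrete_topology (vec1 ` W)) c"
    and ext: "c \<in> extensional (Gal \<iota>)"
    and coc: "\<And>\<sigma> \<rho>. \<sigma> \<in> Gal \<iota> \<Longrightarrow> \<rho> \<in> Gal \<iota> \<Longrightarrow> c (gcomp \<sigma> \<rho>) = c \<sigma> + gal_act \<iota> \<sigma> (c \<rho>)"
    using c by (auto simp: cocycles_def)
  have cW: "c \<sigma> \<in> vec1 ` W" if "\<sigma> \<in> Gal \<iota>" for \<sigma>
    using continuous_map_image_subset_topspace[OF cont] that by (auto simp: topspace_krull)
  have cd: "c \<sigma> = vec1 (d \<sigma>)" and dW: "d \<sigma> \<in> W" if "\<sigma> \<in> Gal \<iota>" for \<sigma>
    using cW[OF that] by (auto simp: d_def vec1_simps)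
  have dS: "scoef (d \<sigma>)" if "\<sigma> \<in> Gal \<iota>" for \<sigma> using W_scoef[OF dW[OF that]] .
  have dcoc: "d (gcomp \<sigma> \<rho>) = d \<sigma> + gs \<sigma> (d \<rho>)" if g: "\<sigma> \<in> Gal \<iota>" "\<rho> \<in> Gal \<iota>" for \<sigma> \<rho>
    using coc[OF g] cd[OF g(1)] cd[OF g(2)] cd[OF gcomp_Gal[OF g]] gal_act_vec1[OF g(1) dS[OF g(2)]]
    by (simp add: vec1_simps)
  have gidgid: "gcomp gid gid = gid"
    by (auto simp: gid_def compose_def restrict_def)
  have "d gid + 0 = d gid + d gid"
    using dcoc[OF gid_Gal gid_Gal] unfolding gidgid gs_gid[OF dS[OF gid_Gal]] by (simp only: add_0_right)
  hence d_gid: "d gid = 0" by (metis add_left_cancel)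
  \<comment> \<open>Continuity is used near the identity: the cocycle vanishes on all automorphisms
    that fix some finite set F. The cocycle identity spreads this to every coset in
    \<open>agree\<close>.\<close>
  have "openin (krull_topology \<iota>) {\<sigma> \<in> topspace (krull_topology \<iota>). c \<sigma> \<in> {vec1 0}}"
    using zero_W by (intro openin_continuous_map_preimage[OF cont]) auto
  then obtain T where T: "openin (product_topology (\<lambda>_. discrete_topology (sep_elements \<iota>)) (sep_elements \<iota>)) T"
    "{\<sigma> \<in> Gal \<iota>. c \<sigma> = vec1 0} = T \<inter> Gal \<iota>"
    unfolding topspace_krull unfolding krull_topology_def openin_subtopology by auto
  have "gid \<in> T" using T(2) gid_Gal cd[OF gid_Gal] d_gid by auto
  from bspec[OF T(1)[unfolded openin_product_topology_alt] this] obtain U where U: "finite {i \<in> sep_elements \<iota>. U i \<noteq> topspace (discrete_topology (sep_elements \<iota>))}"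
      "gid \<in> PiE (sep_elements \<iota>) U" "PiE (sep_elements \<iota>) U \<subseteq> T"
    by (elim exE conjE)
  define F where "F = {i \<in> sep_elements \<iota>. U i \<noteq> sep_elements \<iota>}"
  have F: "finite F" "F \<subseteq> sep_elements \<iota>" using U(1) by (auto simp: F_def)
  have d_fix: "d \<rho> = 0" if \<rho>: "\<rho> \<in> Gal \<iota>" "\<forall>y\<in>F. \<rho> y = y" for \<rho>
  proof -
    have "\<rho> \<in> PiE (sep_elements \<iota>) U"
    proof (rule PiE_I)
      fix i assume i: "i \<in> sep_elements \<iota>"
      show "\<rho> i \<in> U i"
      proof (cases "i \<in> F")
        case True
        have "gid i \<in> U i" using U(2) i by (rule PiE_mem)
        thus ?thesis using \<rho>(2) True i by (simp add: gid_def)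
      next
        case False
        thus ?thesis using i GalD(1)[OF \<rho>(1) i] by (simp add: F_def)
      qed
    next
      fix i assume "i \<notin> sep_elements \<iota>"
      thus "\<rho> i = undefined" using GalD(12)[OF \<rho>(1)] by (rule extensional_arb[rotated])
    qed
    hence "\<rho> \<in> {\<sigma> \<in> Gal \<iota>. c \<sigma> = vec1 0}" using U(3) \<rho>(1) unfolding T(2) by blast
    thus ?thesis using cd[OF \<rho>(1)] by (simp add: vec1_simps)
  qed
  \<comment> \<open>L consists of the elements fixed by all automorphisms that fix F. Automorphisms
    agreeing on F agree on L and have equal cocycle values, so both depend only on the restriction
    to F.\<close>
  define L where "L = {x \<in> sep_elements \<iota>. \<forall>\<rho>\<in>Gal \<iota>. (\<forall>y\<in>F. \<rho> y = y) \<longrightarrow> \<rho> x = x}"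
  have LS: "L \<subseteq> sep_elements \<iota>" by (auto simp: L_def)
  have L1: "1 \<in> L" using sep_ring(2) GalD(6) by (auto simp: L_def)
  have Lm: "x * y \<in> L" if "x \<in> L" "y \<in> L" for x y
    unfolding L_def mem_Collect_eq
  proof (intro conjI ballI impI)
    have xy: "x \<in> sep_elements \<iota>" "y \<in> sep_elements \<iota>" using that LS by auto
    show "x * y \<in> sep_elements \<iota>" using xy by (rule sep_ring(5))
    fix \<rho> assume \<rho>: "\<rho> \<in> Gal \<iota>" "\<forall>y\<in>F. \<rho> y = y"
    hence "\<rho> x = x" "\<rho> y = y" using that unfolding L_def by blast+
    thus "\<rho> (x * y) = x * y" using GalD(3)[OF \<rho>(1) xy] by simp
  qed
  have FL: "F \<subseteq> L" using F(2) by (auto simp: L_def)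
  have agree: "d \<sigma> = d \<sigma>' \<and> (\<forall>x\<in>L. \<sigma> x = \<sigma>' x)"
    if g: "\<sigma> \<in> Gal \<iota>" "\<sigma>' \<in> Gal \<iota>" and eq: "\<forall>y\<in>F. \<sigma> y = \<sigma>' y" for \<sigma> \<sigma>'
  proof -
    obtain \<tau> where \<tau>': "\<tau> \<in> Gal \<iota>" "\<forall>x\<in>sep_elements \<iota>. \<sigma> (\<tau> x) = x" "\<forall>x\<in>sep_elements \<iota>. \<tau> (\<sigma> x) = x"
      using Gal_inverse_ex[OF g(1)] by (elim bexE conjE)
    note \<tau> = \<tau>'(1) \<tau>'(2)[rule_format] \<tau>'(3)[rule_format]
    let ?r = "gcomp \<tau> \<sigma>'"
    have r: "?r \<in> Gal \<iota>" using \<tau>(1) g(2) by (rule gcomp_Gal)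
    have rF: "\<forall>y\<in>F. ?r y = y"
    proof
      fix y assume y: "y \<in> F"
      hence yS: "y \<in> sep_elements \<iota>" using F(2) by blast
      have "?r y = \<tau> (\<sigma> y)" using eq y yS by (simp add: gcomp_apply)
      thus "?r y = y" using \<tau>(3)[OF yS] by simp
    qed
    have sr: "gcomp \<sigma> ?r = \<sigma>'"
    proof (rule extensionalityI[of _ "sep_elements \<iota>"])
      show "\<sigma>' \<in> extensional (sep_elements \<iota>)" by (rule GalD(12)[OF g(2)])
      fix x assume x: "x \<in> sep_elements \<iota>"
      show "gcomp \<sigma> ?r x = \<sigma>' x" using x \<tau>(2)[OF GalD(1)[OF g(2) x]] by (simp add: gcomp_apply)
    qed (rule compose_extensional)
    have "d \<sigma>' = d \<sigma> + gs \<sigma> (d ?r)" using dcoc[OF g(1) r] unfolding sr .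
    moreover have "gs \<sigma> 0 = 0" by (rule fps_ext) (simp add: gs_nth GalD(5)[OF g(1)])
    ultimately have "d \<sigma>' = d \<sigma>" using d_fix[OF r rF] by simp
    moreover have "\<sigma> x = \<sigma>' x" if "x \<in> L" for x
    proof -
      have "?r x = x" using that r rF by (auto simp: L_def)
      thus ?thesis using sr gcomp_apply[of x \<sigma> ?r] that LS by auto
    qed
    ultimately show ?thesis by auto
  qed
  \<comment> \<open>Restrictions to F stand for the embeddings of L. There are finitely many, as
    each element of F can only go to a root of a fixed polynomial over K_inf.\<close>
  define I where "I = (\<lambda>\<sigma>. restrict \<sigma> F) ` Gal \<iota>"
  have "finite I"
  proof (rule finite_subset)
    show "I \<subseteq> PiE F (\<lambda>y. {z. \<exists>\<sigma>\<in>Gal \<iota>. z = \<sigma> y})" by (auto simp: I_def)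
    have "finite {z. \<exists>\<sigma>\<in>Gal \<iota>. z = \<sigma> y}" if y: "y \<in> F" for y
    proof -
      have yS: "y \<in> sep_elements \<iota>" using y F(2) by blast
      then obtain f where f: "f \<noteq> 0" "ev f y = 0" by (elim sep_elementsE)
      have "ev f (\<sigma> y) = 0" if \<sigma>: "\<sigma> \<in> Gal \<iota>" for \<sigma>
      proof -
        have "ev f (\<sigma> y) = (\<Sum>i\<le>degree f. \<sigma> (\<iota> (coeff f i) * y ^ i))"
          unfolding ev_altdef using yS emb_sep sep_ring(7) by (simp add: GalD[OF \<sigma>])
        also have "\<dots> = \<sigma> (\<Sum>i\<le>degree f. \<iota> (coeff f i) * y ^ i)"
          using yS emb_sep by (intro Gal_sum[OF \<sigma>, symmetric] sep_ring)
        also have "\<dots> = 0" using f(2) by (simp add: ev_altdef[symmetric] GalD(5)[OF \<sigma>])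
        finally show ?thesis .
      qed
      hence "{z. \<exists>\<sigma>\<in>Gal \<iota>. z = \<sigma> y} \<subseteq> {z. poly (map_poly \<iota> f) z = 0}" by (auto simp: ev_def)
      moreover have "map_poly \<iota> f \<noteq> 0" using f(1) by simp
      ultimately show ?thesis using poly_roots_finite finite_subset by blast
    qed
    thus "finite (PiE F (\<lambda>y. {z. \<exists>\<sigma>\<in>Gal \<iota>. z = \<sigma> y}))" using F(1) by (intro finite_PiE)
  qed
  define rep where "rep = (\<lambda>r. SOME \<sigma>. \<sigma> \<in> Gal \<iota> \<and> restrict \<sigma> F = r)"
  have rep: "rep r \<in> Gal \<iota>" "restrict (rep r) F = r" if "r \<in> I" for r
  proof -
    have "\<exists>\<sigma>. \<sigma> \<in> Gal \<iota> \<and> restrict \<sigma> F = r" using that by (auto simp: I_def)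
    from someI_ex[OF this] show "rep r \<in> Gal \<iota>" "restrict (rep r) F = r" by (auto simp: rep_def)
  qed
  have rep_res: "d (rep (restrict \<sigma> F)) = d \<sigma>" "\<And>x. x \<in> L \<Longrightarrow> rep (restrict \<sigma> F) x = \<sigma> x"
    if "\<sigma> \<in> Gal \<iota>" for \<sigma>
  proof -
    have rI: "restrict \<sigma> F \<in> I" using that by (simp add: I_def)
    have "rep (restrict \<sigma> F) y = \<sigma> y" if "y \<in> F" for y
      using fun_cong[OF rep(2)[OF rI], of y] that by simp
    hence "d (rep (restrict \<sigma> F)) = d \<sigma> \<and> (\<forall>x\<in>L. rep (restrict \<sigma> F) x = \<sigma> x)"
      using that by (intro agree[OF rep(1)[OF rI]]) auto
    thus "d (rep (restrict \<sigma> F)) = d \<sigma>" "\<And>x. x \<in> L \<Longrightarrow> rep (restrict \<sigma> F) x = \<sigma> x" by auto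
  qed
  have "\<exists>y\<in>L. (\<Sum>r\<in>I. rep r y) \<noteq> 0"
  proof (rule ccontr)
    assume neg: "\<not> ?thesis"
    have "\<forall>r\<in>I. (1 :: 'c) = 0"
    proof (rule monoid_hom_independent[OF \<open>finite I\<close> L1 Lm, where \<chi> = rep])
      show "rep r 1 = 1" if "r \<in> I" for r using GalD(6)[OF rep(1)[OF that]] .
      show "rep r (x * y) = rep r x * rep r y" if "r \<in> I" "x \<in> L" "y \<in> L" for r x y
        using GalD(3)[OF rep(1)[OF that(1)]] that(2,3) LS by blast
      show "\<exists>x\<in>L. rep i x \<noteq> rep j x" if ij: "i \<in> I" "j \<in> I" "i \<noteq> j" for i j
      proof (rule ccontr)
        assume "\<not> ?thesis"
        hence "restrict (rep i) F = restrict (rep j) F" using FL by (intro restrict_ext) auto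
        thus False using ij rep(2) by metis
      qed
      show "(\<Sum>i\<in>I. 1 * rep i x) = 0" if "x \<in> L" for x using neg that by simp
    qed
    moreover have "restrict gid F \<in> I" using gid_Gal by (simp add: I_def)
    ultimately show False by auto
  qed
  then obtain y where y: "y \<in> L" "(\<Sum>r\<in>I. rep r y) \<noteq> 0" by blast
  define t where "t = (\<Sum>r\<in>I. rep r y)"
  have yS: "y \<in> sep_elements \<iota>" using y(1) LS by blast
  have ryS: "rep r y \<in> sep_elements \<iota>" if "r \<in> I" for r using GalD(1)[OF rep(1)[OF that] yS] .
  have tS: "t \<in> sep_elements \<iota>" unfolding t_def using ryS by (rule is_subring_sum[OF sep_subring])
  \<comment> \<open>The weights \<open>rep r y * inverse t\<close> add up to 1 because t is the
    trace of y. Applying \<tau> replaces \<open>d (rep r)\<close> by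
    \<open>d (rep (\<pi> r)) - d \<tau>\<close>, and the sum of the weights turns this into \<tau> x
    = x + d \<tau>.\<close>
  define x where "x = 0 - (\<Sum>r\<in>I. fps_const (rep r y * inverse t) * d (rep r))"
  have constS: "scoef (fps_const a)" if "a \<in> sep_elements \<iota>" for a using that sep_ring(1) by simp
  have termS: "scoef (fps_const (rep r y * inverse t) * d (rep r))" if "r \<in> I" for r
    using ryS[OF that] sep_inverse[OF tS] dS[OF rep(1)[OF that]]
    by (intro scoef_mult constS sep_ring(5))
  have sumS: "scoef (\<Sum>r\<in>I. fps_const (rep r y * inverse t) * d (rep r))"
    using termS by (auto simp only: fps_sum_nth intro!: is_subring_sum[OF sep_subring])
  have xS: "scoef x" using sumS sep_ring(1,4) by (simp add: x_def sep_ring(6))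
  have xT: "x \<in> tate_algebra"
    unfolding x_def using dW[OF rep(1)]
    by (intro tate_diff tate_zero tate_sum tate_mult tate_const) (auto simp: W_def)
  have main: "gs \<tau> x - x = d \<tau>" if \<tau>: "\<tau> \<in> Gal \<iota>" for \<tau>
  proof -
    \<comment> \<open>Composition with \<tau> permutes the finitely many embeddings; both the trace
      and the averaged sum are reindexed by this permutation.\<close>
    define \<pi> where "\<pi> = (\<lambda>r. restrict (gcomp \<tau> (rep r)) F)"
    have gI: "gcomp \<tau> (rep r) \<in> Gal \<iota>" if "r \<in> I" for r using gcomp_Gal[OF \<tau> rep(1)[OF that]] .
    have \<pi>I: "\<pi> r \<in> I" if "r \<in> I" for r using gI[OF that] by (simp add: \<pi>_def I_def)
    have rep\<pi>: "rep (\<pi> r) y = \<tau> (rep r y)" "d (rep (\<pi> r)) = d \<tau> + gs \<tau> (d (rep r))" if "r \<in> I" for r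
      using rep_res[OF gI[OF that]] y(1) yS dcoc[OF \<tau> rep(1)[OF that]] by (simp_all add: \<pi>_def gcomp_apply)
    have "inj_on \<pi> I"
    proof (rule inj_onI)
      fix r s assume rs: "r \<in> I" "s \<in> I" "\<pi> r = \<pi> s"
      have "rep r z = rep s z" if z: "z \<in> F" for z
      proof -
        have zS: "z \<in> sep_elements \<iota>" using z F(2) by blast
        have "\<tau> (rep r z) = \<tau> (rep s z)"
          using fun_cong[OF rs(3), of z] z zS by (simp add: \<pi>_def gcomp_apply)
        thus ?thesis
          using inj_onD[OF bij_betw_imp_inj_on[OF GalD(11)[OF \<tau>]]] GalD(1)[OF rep(1)] rs(1,2) zS by blast
      qed
      hence "restrict (rep r) F = restrict (rep s) F" by (intro restrict_ext)
      thus "r = s" using rep(2)[OF rs(1)] rep(2)[OF rs(2)] by simp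
    qed
    moreover have "\<pi> ` I = I" using \<pi>I calculation \<open>finite I\<close> by (intro endo_inj_surj) auto
    ultimately have bij: "bij_betw \<pi> I I" by (simp add: bij_betw_def)
    have \<tau>t: "\<tau> t = t"
    proof -
      have "\<tau> t = (\<Sum>r\<in>I. rep (\<pi> r) y)"
        unfolding t_def using rep\<pi>(1) ryS by (simp add: Gal_sum[OF \<tau>])
      also have "\<dots> = t" unfolding t_def by (rule sum.reindex_bij_betw[OF bij])
      finally show ?thesis .
    qed
    have t0: "t \<noteq> 0" using y(2) by (simp add: t_def)
    have gs_const: "gs \<tau> (fps_const a) = fps_const (\<tau> a)" for a
      by (rule fps_ext) (simp add: gs_nth GalD(5)[OF \<tau>])
    have "gs \<tau> (\<Sum>r\<in>I. fps_const (rep r y * inverse t) * d (rep r))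
        = (\<Sum>r\<in>I. gs \<tau> (fps_const (rep r y * inverse t) * d (rep r)))"
      using termS by (intro gs_sum[OF \<tau>])
    also have "\<dots> = (\<Sum>r\<in>I. fps_const (rep (\<pi> r) y * inverse t) * (d (rep (\<pi> r)) - d \<tau>))"
    proof (rule sum.cong[OF refl])
      fix r assume r: "r \<in> I"
      have "gs \<tau> (fps_const (rep r y * inverse t) * d (rep r))
          = gs \<tau> (fps_const (rep r y * inverse t)) * gs \<tau> (d (rep r))"
        using ryS[OF r] sep_inverse[OF tS] dS[OF rep(1)[OF r]]
        by (intro gs_mult[OF \<tau>] constS sep_ring(5))
      also have "gs \<tau> (fps_const (rep r y * inverse t)) = fps_const (rep (\<pi> r) y * inverse t)"
        unfolding gs_const GalD(3)[OF \<tau> ryS[OF r] sep_inverse[OF tS]] GalD(9)[OF \<tau> tS] \<tau>t rep\<pi>(1)[OF r] ..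
      also have "gs \<tau> (d (rep r)) = d (rep (\<pi> r)) - d \<tau>" using rep\<pi>(2)[OF r] by simp
      finally show "gs \<tau> (fps_const (rep r y * inverse t) * d (rep r)) =
        fps_const (rep (\<pi> r) y * inverse t) * (d (rep (\<pi> r)) - d \<tau>)" .
    qed
    also have "\<dots> = (\<Sum>r\<in>I. fps_const (rep r y * inverse t) * (d (rep r) - d \<tau>))"
      by (rule sum.reindex_bij_betw[OF bij])
    also have "\<dots> = (\<Sum>r\<in>I. fps_const (rep r y * inverse t) * d (rep r)) - (\<Sum>r\<in>I. fps_const (rep r y * inverse t)) * d \<tau>"
      by (simp add: right_diff_distrib sum_subtractf sum_distrib_right)
    also have "(\<Sum>r\<in>I. fps_const (rep r y * inverse t)) = fps_const (t * inverse t)"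
      unfolding t_def sum_distrib_right by (rule fps_ext) (simp add: fps_sum_nth sum.neutral)
    also have "t * inverse t = 1" using t0 by simp
    finally have "gs \<tau> (\<Sum>r\<in>I. fps_const (rep r y * inverse t) * d (rep r)) =
      (\<Sum>r\<in>I. fps_const (rep r y * inverse t) * d (rep r)) - d \<tau>" by simp
    moreover have "gs \<tau> x = gs \<tau> 0 - gs \<tau> (\<Sum>r\<in>I. fps_const (rep r y * inverse t) * d (rep r))"
      unfolding x_def using sumS sep_ring(1) by (intro gs_diff[OF \<tau>]) auto
    moreover have "gs \<tau> 0 = 0" by (rule fps_ext) (simp add: gs_nth GalD(5)[OF \<tau>])
    ultimately show ?thesis by (simp add: x_def)
  qed
  \<comment> \<open>The values of the cocycle are killed by the operator, so phi x is Galois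
    invariant, and \<open>Gal_fixed_field\<close> applies to each coefficient.\<close>
  have "Kcoef (phi x)"
  proof
    fix i
    show "fps_nth (phi x) i \<in> range \<iota>"
    proof (rule Gal_fixed_field)
      show "fps_nth (phi x) i \<in> sep_elements \<iota>" using phi_scoef_iff[OF xS] by blast
      fix \<sigma> assume \<sigma>: "\<sigma> \<in> Gal \<iota>"
      have "gs \<sigma> (phi x) - phi x = phi (gs \<sigma> x - x)" by (simp add: phi_diff phi_gs[OF \<sigma> xS])
      also have "\<dots> = 0" using main[OF \<sigma>] dW[OF \<sigma>] by (simp add: W_def)
      finally have "gs \<sigma> (phi x) = phi x" by simp
      thus "\<sigma> (fps_nth (phi x) i) = fps_nth (phi x) i" by (metis gs_nth)
    qed
  qed
  moreover have "c = cc x"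
  proof (rule extensionalityI[OF ext])
    show "cc x \<in> extensional (Gal \<iota>)" by (simp add: cc_def)
    show "c \<sigma> = cc x \<sigma>" if "\<sigma> \<in> Gal \<iota>" for \<sigma> using that main cd by (simp add: cc_def)
  qed
  ultimately show ?thesis using that xT by blast
qed

text \<open>The image of u under the connecting homomorphism attached to the operator, as a set of
  cocycles: one for each solution x in the Tate algebra.\<close>

definition H1_of :: "'c fps \<Rightarrow> (('c \<Rightarrow> 'c) \<Rightarrow> 'c fps vec) set" where
  "H1_of u = {cc x |x. x \<in> tate_algebra \<and> phi x = u}"

text \<open>Equality of the cocycles says that x - y is Galois invariant, and the fixed field is
  K_inf.\<close>

lemma cc_eq_iff:
  assumes "scoef x" "scoef y"
  shows "cc x = cc y \<longleftrightarrow> Kcoef (x - y)"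
proof
  assume eq: "cc x = cc y"
  show "Kcoef (x - y)"
  proof
    fix i
    show "fps_nth (x - y) i \<in> range \<iota>"
    proof (rule Gal_fixed_field)
      show "fps_nth (x - y) i \<in> sep_elements \<iota>" using assms sep_ring(4) by simp
      fix \<sigma> assume \<sigma>: "\<sigma> \<in> Gal \<iota>"
      have "gs \<sigma> x - x = gs \<sigma> y - y" using fun_cong[OF eq, of \<sigma>] \<sigma> by (simp add: cc_def vec1_simps)
      hence "gs \<sigma> (x - y) = x - y" unfolding gs_diff[OF \<sigma> assms] by (simp add: algebra_simps)
      thus "\<sigma> (fps_nth (x - y) i) = fps_nth (x - y) i" by (metis gs_nth)
    qed
  qed
next
  assume K: "Kcoef (x - y)"
  have "gs \<sigma> x - x = gs \<sigma> y - y" if \<sigma>: "\<sigma> \<in> Gal \<iota>" for \<sigma>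
    using gs_Kcoef[OF \<sigma> K] gs_diff[OF \<sigma> assms] by (simp add: algebra_simps)
  thus "cc x = cc y" by (auto simp: cc_def intro!: restrict_ext)
qed

lemma H1_of_nonempty: "u \<in> tate_algebra \<Longrightarrow> Kcoef u \<Longrightarrow> \<exists>x. x \<in> tate_algebra \<and> phi x = u"
  using phi_surj[of u] Kcoef_scoef[of u] by blast

text \<open>If one cocycle comes from a solution x for u and from a solution y for v, then g = x - y
  has coefficients in K_inf. Conversely, translation by such a g carries the solutions for u to
  those for v without changing their cocycles.\<close>

lemma H1_of_eq_iff:
  assumes u: "u \<in> tate_algebra" "Kcoef u" and v: "v \<in> tate_algebra" "Kcoef v"
  shows "H1_of u = H1_of v \<longleftrightarrow> (\<exists>g\<in>tate_algebra. Kcoef g \<and> u - v = phi g)"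
proof
  assume eq: "H1_of u = H1_of v"
  obtain x where x: "x \<in> tate_algebra" "phi x = u" using H1_of_nonempty[OF u] by blast
  hence "cc x \<in> H1_of u" unfolding H1_of_def by blast
  hence "cc x \<in> H1_of v" unfolding eq .
  then obtain y where y: "y \<in> tate_algebra" "phi y = v" "cc x = cc y" unfolding H1_of_def by blast
  have "scoef x" "scoef y" using phi_eq_scoef[OF x(2) u(2)] phi_eq_scoef[OF y(2) v(2)] by auto
  hence "Kcoef (x - y)" using y(3) cc_eq_iff by blast
  moreover have "u - v = phi (x - y)" using x y by (simp add: phi_diff)
  ultimately show "\<exists>g\<in>tate_algebra. Kcoef g \<and> u - v = phi g" using tate_diff[OF x(1) y(1)] by blast
next
  assume "\<exists>g\<in>tate_algebra. Kcoef g \<and> u - v = phi g"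
  then obtain g where g: "g \<in> tate_algebra" "Kcoef g" "u - v = phi g" by blast
  have sub: "H1_of u \<subseteq> H1_of v" if "g \<in> tate_algebra" "Kcoef g" "u - v = phi g" "Kcoef u" for g u v
  proof
    fix c assume "c \<in> H1_of u"
    then obtain x where x: "x \<in> tate_algebra" "phi x = u" "c = cc x" by (auto simp: H1_of_def)
    have xS: "scoef x" by (rule phi_eq_scoef[OF x(2) that(4)])
    have "scoef (x - g)" using xS Kcoef_scoef[OF that(2)] sep_ring(4) by simp
    hence "c = cc (x - g)" using cc_eq_iff[OF xS] that(2) x(3) by simp
    moreover have "phi (x - g) = v" using x that(3) by (simp add: phi_diff algebra_simps)
    ultimately show "c \<in> H1_of v" using tate_diff[OF x(1) that(1)] by (auto simp: H1_of_def)
  qed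
  have K0: "Kcoef (0 - g)"
    using g(2) is_subringD(1,4)[OF Kcoef_subring] by simp (metis diff_0 is_subringD(1,4)[OF Kcoef_subring])
  have p0: "phi 0 = 0" using phi_diff[of 0 0] by (simp only: diff_self)
  have "v - u = phi (0 - g)" unfolding phi_diff p0 g(3)[symmetric] by simp
  from sub[OF g u(2)] sub[OF tate_diff[OF tate_zero g(1)] K0 this v(2)] show "H1_of u = H1_of v" by blast
qed

text \<open>Adding an element w of \<open>W\<close> to x changes the cocycle by the coboundary of w
  and leaves phi x alone. So the class consists of the cocycles of all solutions with the same
  right-hand side.\<close>

lemma cohomology_class_cc:
  assumes x: "x \<in> tate_algebra" "Kcoef (phi x)"
  shows "cohomology_class \<iota> (vec1 ` W) (cc x) = H1_of (phi x)"
proof -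
  have xS: "scoef x" using x(2) by (rule phi_eq_scoef[OF refl])
  have key: "cc (x + w) \<sigma> = cc x \<sigma> + (gal_act \<iota> \<sigma> (vec1 w) - vec1 w)" if "w \<in> W" "\<sigma> \<in> Gal \<iota>" for w \<sigma>
    using that W_scoef[OF that(1)] xS by (simp add: cc_def gal_act_vec1 vec1_simps gs_add)
  show ?thesis
  proof (intro equalityI subsetI)
    fix e assume "e \<in> cohomology_class \<iota> (vec1 ` W) (cc x)"
    then obtain w where e: "e \<in> cocycles \<iota> (vec1 ` W)" and w: "w \<in> W"
      "\<forall>\<sigma>\<in>Gal \<iota>. e \<sigma> = cc x \<sigma> + (gal_act \<iota> \<sigma> (vec1 w) - vec1 w)" by (auto simp: cohomology_class_def)
    have "e = cc (x + w)"
    proof (rule extensionalityI)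
      show "e \<in> extensional (Gal \<iota>)" using e by (simp add: cocycles_def)
      show "cc (x + w) \<in> extensional (Gal \<iota>)" by (simp add: cc_def)
      show "e \<sigma> = cc (x + w) \<sigma>" if "\<sigma> \<in> Gal \<iota>" for \<sigma> using w that key by simp
    qed
    moreover have "phi (x + w) = phi x" "x + w \<in> tate_algebra"
      using w(1) x(1) by (simp_all add: W_def phi_add tate_add)
    ultimately show "e \<in> H1_of (phi x)" by (auto simp: H1_of_def)
  next
    fix e assume "e \<in> H1_of (phi x)"
    then obtain z where z: "z \<in> tate_algebra" "phi z = phi x" "e = cc z" by (auto simp: H1_of_def)
    have w: "z - x \<in> W" using z x by (simp add: W_def phi_diff tate_diff)
    have "e \<in> cocycles \<iota> (vec1 ` W)" unfolding z(3) using z(1,2) x(2) by (intro cc_cocycle) auto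
    moreover have "\<forall>\<sigma>\<in>Gal \<iota>. e \<sigma> = cc x \<sigma> + (gal_act \<iota> \<sigma> (vec1 (z - x)) - vec1 (z - x))"
      using key[OF w] z(3) by simp
    ultimately show "e \<in> cohomology_class \<iota> (vec1 ` W) (cc x)" using w by (auto simp: cohomology_class_def)
  qed
qed

lemma carrier_H1: "carrier (H1 \<iota> (vec1 ` W)) = {H1_of u |u. u \<in> tate_algebra \<and> Kcoef u}"
proof (intro equalityI subsetI)
  fix C assume "C \<in> carrier (H1 \<iota> (vec1 ` W))"
  then obtain c where c: "c \<in> cocycles \<iota> (vec1 ` W)" "C = cohomology_class \<iota> (vec1 ` W) c" by (auto simp: H1_def)
  obtain x where x: "x \<in> tate_algebra" "Kcoef (phi x)" "c = cc x" using c(1) by (rule hilbert90)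
  have "C = H1_of (phi x)" unfolding c(2) x(3) using x(1,2) by (rule cohomology_class_cc)
  thus "C \<in> {H1_of u |u. u \<in> tate_algebra \<and> Kcoef u}" using phi_tate[OF x(1)] x(2) by blast
next
  fix C assume "C \<in> {H1_of u |u. u \<in> tate_algebra \<and> Kcoef u}"
  then obtain u where u: "C = H1_of u" "u \<in> tate_algebra" "Kcoef u" by blast
  obtain x where x: "x \<in> tate_algebra" "phi x = u" using H1_of_nonempty[OF u(2,3)] by blast
  have "C = cohomology_class \<iota> (vec1 ` W) (cc x)" using cohomology_class_cc[OF x(1)] x(2) u by simp
  moreover have "cc x \<in> cocycles \<iota> (vec1 ` W)" using cc_cocycle[OF x(1)] x(2) u(3) by simp
  ultimately show "C \<in> carrier (H1 \<iota> (vec1 ` W))" by (auto simp: H1_def)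
qed

lemma H1_add:
  assumes u: "u \<in> tate_algebra" "Kcoef u" and v: "v \<in> tate_algebra" "Kcoef v"
  shows "H1_of u \<oplus>\<^bsub>H1 \<iota> (vec1 ` W)\<^esub> H1_of v = H1_of (u + v)"
proof -
  have K: "Kcoef (u + v)" using u v is_subringD(3)[OF Kcoef_subring] by simp
  have cls: "cohomology_class \<iota> (vec1 ` W) (\<lambda>\<sigma>\<in>Gal \<iota>. c \<sigma> + d \<sigma>) = H1_of (u + v)"
    if cd: "c \<in> H1_of u" "d \<in> H1_of v" for c d
  proof -
    obtain x y where xy: "c = cc x" "x \<in> tate_algebra" "phi x = u" "d = cc y" "y \<in> tate_algebra" "phi y = v"
      using cd unfolding H1_of_def by blast
    have "scoef x" "scoef y" using phi_eq_scoef[OF xy(3) u(2)] phi_eq_scoef[OF xy(6) v(2)] by auto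
    hence "(\<lambda>\<sigma>\<in>Gal \<iota>. c \<sigma> + d \<sigma>) = cc (x + y)"
      unfolding xy cc_def by (intro restrict_ext) (simp add: vec1_simps gs_add)
    thus ?thesis using cohomology_class_cc[OF tate_add[OF xy(2,5)]] K xy(3,6) by (simp add: phi_add)
  qed
  obtain x y where "x \<in> tate_algebra" "phi x = u" "y \<in> tate_algebra" "phi y = v"
    using H1_of_nonempty u v by metis
  hence "cc x \<in> H1_of u" "cc y \<in> H1_of v" by (auto simp: H1_of_def)
  thus ?thesis using cls by (auto simp: H1_def)
qed

lemma Ft_to_At_frob: "frob_At (Ft_to_At a) = Ft_to_At a"
  unfolding frob_At_def Ft_to_At_def by (intro poly_eqI) (simp add: coeff_map_poly)

text \<open>Elements of F[t] are fixed by the Frobenius, so the operator is F[t]-linear.\<close>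

lemma phi_Ft_mult: "phi (Ft_to_tate \<iota> a * x) = Ft_to_tate \<iota> a * phi x"
proof -
  have "fr (Ft_to_tate \<iota> a) = Ft_to_tate \<iota> a"
    unfolding Ft_to_tate_def At_to_tate_frob[symmetric] Ft_to_At_frob ..
  thus ?thesis by (simp add: phi_def fr_mult algebra_simps)
qed

lemma At_to_tate_Kcoef: "Kcoef (At_to_tate \<iota> a)" by (simp add: At_to_tate_nth)

lemma H1_smult:
  assumes u: "u \<in> tate_algebra" "Kcoef u"
  shows "a \<odot>\<^bsub>H1 \<iota> (vec1 ` W)\<^esub> H1_of u = H1_of (Ft_to_tate \<iota> a * u)"
proof -
  have A: "Kcoef (Ft_to_tate \<iota> a)" "Ft_to_tate \<iota> a \<in> tate_algebra"
    unfolding Ft_to_tate_def by (rule At_to_tate_Kcoef, rule At_to_tate_tate)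
  have cls: "cohomology_class \<iota> (vec1 ` W) (\<lambda>\<sigma>\<in>Gal \<iota>. Ft_to_tate \<iota> a \<cdot>\<^sub>v c \<sigma>) = H1_of (Ft_to_tate \<iota> a * u)"
    if c: "c \<in> H1_of u" for c
  proof -
    obtain x where x: "c = cc x" "x \<in> tate_algebra" "phi x = u" using c unfolding H1_of_def by blast
    have xS: "scoef x" by (rule phi_eq_scoef[OF x(3) u(2)])
    have "(\<lambda>\<sigma>\<in>Gal \<iota>. Ft_to_tate \<iota> a \<cdot>\<^sub>v c \<sigma>) = cc (Ft_to_tate \<iota> a * x)"
      unfolding x cc_def using xS A(1) Kcoef_scoef[OF A(1)]
      by (intro restrict_ext) (simp add: vec1_simps gs_mult gs_Kcoef right_diff_distrib)
    thus ?thesis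
      using cohomology_class_cc[OF tate_mult[OF A(2) x(2)]] Kcoef_mult[OF A(1) u(2)] x(3) by (simp add: phi_Ft_mult)
  qed
  obtain x where "x \<in> tate_algebra" "phi x = u" using H1_of_nonempty u by metis
  hence "cc x \<in> H1_of u" by (auto simp: H1_of_def)
  thus ?thesis using cls by (auto simp: H1_def)
qed

end

section \<open>Extensions of the unit motive\<close>

lemma map_mat_mult_hom:
  assumes h: "\<And>x y. h (x + y) = h x + h y" "\<And>x y. h (x * y) = h x * h y" "h 0 = 0"
    and AB: "dim_col A = dim_row B"
  shows "map_mat h (A * B) = map_mat h A * map_mat h (B :: 'a::comm_ring_1 mat)"
proof (rule eq_matI)
  fix i j assume ij: "i < dim_row (map_mat h A * map_mat h B)" "j < dim_col (map_mat h A * map_mat h B)"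
  have s: "h (sum f I) = (\<Sum>i\<in>I. h (f i))" for f :: "nat \<Rightarrow> 'a" and I
    by (induction I rule: infinite_finite_induct) (simp_all add: h)
  show "map_mat h (A * B) $$ (i, j) = (map_mat h A * map_mat h B) $$ (i, j)"
    using ij AB by (simp add: scalar_prod_def s h)
qed simp_all

lemma mult_mat_cancel_left:
  fixes i :: "'a::comm_ring_1 mat"
  assumes inj: "inj_on ((*\<^sub>v) i) (carrier_vec m)" and i: "i \<in> carrier_mat e m"
    and AB: "A \<in> carrier_mat m k" "B \<in> carrier_mat m k" "i * A = i * B"
  shows "A = B"
proof (rule mat_col_eqI)
  fix j assume j: "j < dim_col B"
  have "i *\<^sub>v col A j = i *\<^sub>v col B j"
    using arg_cong[OF AB(3), of "\<lambda>M. col M j"] AB(1,2) i j by (simp add: col_mult2[of _ e m _ k])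
  thus "col A j = col B j" using inj AB(1,2) j by (auto dest: inj_onD)
qed (use AB in auto)

lemma short_exact_section:
  fixes p :: "'a::comm_ring_1 mat"
  assumes "short_exact m e 1 i p"
  obtains s where "s \<in> carrier_mat e 1" "p * s = 1\<^sub>m 1"
proof -
  have p: "p \<in> carrier_mat 1 e" "(*\<^sub>v) p ` carrier_vec e = carrier_vec 1"
    using assms by (auto simp: short_exact_def)
  have "unit_vec 1 0 \<in> (*\<^sub>v) p ` carrier_vec e" unfolding p(2) by simp
  then obtain v where v: "v \<in> carrier_vec e" "p *\<^sub>v v = unit_vec 1 0" by (metis imageE)
  define s where "s = Matrix.mat e 1 (\<lambda>(k, _). v $ k)"
  have s: "s \<in> carrier_mat e 1" "col s 0 = v" using v(1) by (auto simp: s_def)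
  have "p * s = 1\<^sub>m 1"
  proof (rule mat_col_eqI)
    fix j assume "j < dim_col (1\<^sub>m 1 :: 'a mat)"
    hence j: "j = 0" by simp
    show "col (p * s) j = col (1\<^sub>m 1) j" unfolding j using col_mult2[OF p(1) s(1), of 0] s(2) v(2) by simp
  qed (use p s in auto)
  thus ?thesis using that s(1) by blast
qed

text \<open>The columns of 1 - s p lie in the kernel of p, hence in the image of i; their preimages
  form the retraction r. The identities for r follow by cancelling the injective i.\<close>

lemma short_exact_split:
  fixes p :: "'a::comm_ring_1 mat"
  assumes ex: "short_exact m e 1 i p" and s: "s \<in> carrier_mat e 1" "p * s = 1\<^sub>m 1"
  obtains r where "r \<in> carrier_mat m e" "i * r + s * p = 1\<^sub>m e" "r * i = 1\<^sub>m m" "r * s = 0\<^sub>m m 1" "p * i = 0\<^sub>m 1 m"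
proof -
  have ip: "i \<in> carrier_mat e m" "p \<in> carrier_mat 1 e" and inj: "inj_on ((*\<^sub>v) i) (carrier_vec m)"
    and ker: "(*\<^sub>v) i ` carrier_vec m = {v \<in> carrier_vec e. p *\<^sub>v v = 0\<^sub>v 1}"
    using ex by (auto simp: short_exact_def)
  let ?D = "1\<^sub>m e - s * p"
  have D: "?D \<in> carrier_mat e e" using s ip by auto
  have "p * ?D = p - p * (s * p)" using ip s by (simp add: mult_minus_distrib_mat[of _ 1 e _ e])
  also have "p * (s * p) = p" using ip s by (simp flip: assoc_mult_mat[of p 1 e s 1 p e])
  finally have pD: "p * ?D = 0\<^sub>m 1 e" using ip by simp
  have "\<exists>x\<in>carrier_vec m. i *\<^sub>v x = col ?D k" if k: "k < e" for k
  proof -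
    have "p *\<^sub>v col ?D k = col (p * ?D) k" using col_mult2[OF ip(2) D k] by simp
    also have "\<dots> = 0\<^sub>v 1" unfolding pD using k by simp
    finally have "col ?D k \<in> {v \<in> carrier_vec e. p *\<^sub>v v = 0\<^sub>v 1}" using col_carrier_vec[OF k D] by simp
    thus ?thesis unfolding ker[symmetric] by force
  qed
  then obtain x where x: "\<And>k. k < e \<Longrightarrow> x k \<in> carrier_vec m" "\<And>k. k < e \<Longrightarrow> i *\<^sub>v x k = col ?D k" by metis
  define r where "r = Matrix.mat m e (\<lambda>(a, k). x k $ a)"
  have r: "r \<in> carrier_mat m e" by (simp add: r_def)
  have rc: "col r k = x k" if "k < e" for k using x(1)[OF that] that by (auto simp: r_def)
  have ir: "i * r = ?D"
  proof (rule mat_col_eqI)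
    fix k assume "k < dim_col ?D"
    hence k: "k < e" using ip(2) by simp
    show "col (i * r) k = col ?D k" using col_mult2[OF ip(1) r k] rc[OF k] x(2)[OF k] by simp
  qed (use ip r D in auto)
  have pi: "p * i = 0\<^sub>m 1 m"
  proof (rule mat_col_eqI)
    fix k assume "k < dim_col (0\<^sub>m 1 m :: 'a mat)"
    hence k: "k < m" by simp
    have "i *\<^sub>v unit_vec m k \<in> {v \<in> carrier_vec e. p *\<^sub>v v = 0\<^sub>v 1}" unfolding ker[symmetric] by (intro imageI) simp
    moreover have "i *\<^sub>v unit_vec m k = col i k" using col_mult2[OF ip(1) one_carrier_mat k] ip k by simp
    ultimately have "p *\<^sub>v col i k = 0\<^sub>v 1" by simp
    thus "col (p * i) k = col (0\<^sub>m 1 m) k" using col_mult2[OF ip(2,1) k] k by simp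
  qed (use ip in auto)
  have sum: "i * r + s * p = 1\<^sub>m e" unfolding ir using s ip by (intro eq_matI) auto
  have "i * (r * i) = ?D * i" unfolding ir[symmetric] using ip r by (simp add: assoc_mult_mat[of _ e m _ e _ m])
  also have "\<dots> = i - s * (p * i)"
    using ip s by (simp add: minus_mult_distrib_mat[of _ e e _ _ m] assoc_mult_mat[of _ e 1 _ e _ m])
  also have "\<dots> = i * 1\<^sub>m m" unfolding pi using ip s by (intro eq_matI) (auto simp: scalar_prod_def)
  finally have "i * (r * i) = i * 1\<^sub>m m" .
  note ri = mult_mat_cancel_left[OF inj ip(1) mult_carrier_mat[OF r ip(1)] one_carrier_mat this]
  have "i * (r * s) = ?D * s" unfolding ir[symmetric] using ip r s by (simp add: assoc_mult_mat[of _ e m _ e _ 1])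
  also have "\<dots> = s - s * (p * s)"
    using ip s by (simp add: minus_mult_distrib_mat[of _ e e _ _ 1] assoc_mult_mat[of _ e 1 _ e _ 1])
  also have "\<dots> = i * 0\<^sub>m m 1" unfolding s(2) using ip s by (intro eq_matI) (auto simp: scalar_prod_def)
  finally have "i * (r * s) = i * 0\<^sub>m m 1" .
  note rs = mult_mat_cancel_left[OF inj ip(1) mult_carrier_mat[OF r s(1)] zero_carrier_mat this]
  show ?thesis by (rule that[OF r sum ri rs pi])
qed

text \<open>If m < n, padding both matrices with zeros to size n keeps the product 1, but gives the
  first one a zero column and thus determinant 0.\<close>

lemma mat_right_inverse_dim:
  fixes A :: "'a::comm_ring_1 mat"
  assumes A: "A \<in> carrier_mat n m" and B: "B \<in> carrier_mat m n" and AB: "A * B = 1\<^sub>m n"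
  shows "n \<le> m"
proof (rule ccontr)
  assume "\<not> n \<le> m"
  hence lt: "m < n" by simp
  define A' where "A' = Matrix.mat n n (\<lambda>(i, j). if j < m then A $$ (i, j) else 0)"
  define B' where "B' = Matrix.mat n n (\<lambda>(i, j). if i < m then B $$ (i, j) else 0)"
  have c: "A' \<in> carrier_mat n n" "B' \<in> carrier_mat n n" by (simp_all add: A'_def B'_def)
  have "A' * B' = 1\<^sub>m n"
  proof (rule eq_matI)
    fix i j assume ij: "i < dim_row (1\<^sub>m n :: 'a mat)" "j < dim_col (1\<^sub>m n :: 'a mat)"
    have "(A' * B') $$ (i, j) = (\<Sum>k<n. if k < m then A $$ (i, k) * B $$ (k, j) else 0)"
      using ij by (auto simp: scalar_prod_def A'_def B'_def atLeast0LessThan intro!: sum.cong)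
    also have "\<dots> = (\<Sum>k<m. A $$ (i, k) * B $$ (k, j))"
      by (rule sum.mono_neutral_cong_right) (use lt in auto)
    also have "\<dots> = (A * B) $$ (i, j)" using ij A B by (simp add: scalar_prod_def atLeast0LessThan)
    finally show "(A' * B') $$ (i, j) = 1\<^sub>m n $$ (i, j)" unfolding AB .
  qed (use c in auto)
  hence "det A' * det B' = 1" using det_mult[OF c] by simp
  moreover have "det A' = 0"
  proof -
    have e: "A'\<^sup>T = mat\<^sub>r n n (\<lambda>i. if i = m then 0\<^sub>v n else row A'\<^sup>T i)"
      by (intro eq_matI) (use lt in \<open>auto simp: A'_def\<close>)
    have "det (mat\<^sub>r n n (\<lambda>i. if i = m then 0\<^sub>v n else row A'\<^sup>T i)) = 0"
      by (rule det_row_0[OF lt]) (use c in auto)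
    hence "det A'\<^sup>T = 0" using arg_cong[OF e, of det] by (rule trans[rotated])
    thus ?thesis using det_transpose[OF c(1)] by simp
  qed
  ultimately show False by simp
qed

lemma two_by_two_eqI:
  assumes "A \<in> carrier_mat 2 2" "B \<in> carrier_mat 2 2" "A $$ (0,0) = B $$ (0,0)" "A $$ (0,1) = B $$ (0,1)"
    "A $$ (1,0) = B $$ (1,0)" "A $$ (1,1) = B $$ (1,1)"
  shows "A = B"
  by (rule eq_matI) (use assms in \<open>auto simp: less_2_cases_iff\<close>)

definition m2 :: "'a \<Rightarrow> 'a \<Rightarrow> 'a \<Rightarrow> 'a \<Rightarrow> 'a mat" where
  "m2 a b c d = Matrix.mat 2 2 (\<lambda>(i, j). if i = 0 then (if j = 0 then a else b) else (if j = 0 then c else d))"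

lemma m2_carrier: "m2 a b c d \<in> carrier_mat 2 2" by (simp add: m2_def)

lemma m2_entries: "m2 a b c d $$ (0,0) = a" "m2 a b c d $$ (0,1) = b" "m2 a b c d $$ (1,0) = c" "m2 a b c d $$ (1,1) = d"
  by (simp_all add: m2_def)

lemma m2_exhaust: "A \<in> carrier_mat 2 2 \<Longrightarrow> A = m2 (A $$ (0,0)) (A $$ (0,1)) (A $$ (1,0)) (A $$ (1,1))"
  by (rule eq_matI) (auto simp: m2_def less_2_cases_iff)

lemma m2_eq_iff: "m2 a b c d = m2 a' b' c' d' \<longleftrightarrow> a = a' \<and> b = b' \<and> c = c' \<and> d = d'"
  by (metis m2_entries)

lemma m2_mult: "m2 a b c d * m2 a' b' c' d' = m2 (a * a' + b * c') (a * b' + b * d') (c * a' + d * c') (c * b' + d * d' :: 'a::comm_ring_1)"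
  by (rule two_by_two_eqI) (auto simp: m2_def scalar_prod_def sum.atLeast0_lessThan_Suc numeral_2_eq_2)

lemma m2_one: "1\<^sub>m 2 = m2 1 0 0 (1 :: 'a::comm_ring_1)"
  by (rule two_by_two_eqI) (auto simp: m2_def)

lemma m2_map: "map_mat h (m2 a b c d) = m2 (h a) (h b) (h c) (h d)"
  by (rule two_by_two_eqI) (auto simp: m2_def)

text \<open>The inclusion of the first coordinate axis; its companion \<open>e12\<close> is the
  projection to the second coordinate.\<close>

definition e21 :: "'a::comm_ring_1 mat" where "e21 = Matrix.mat 2 1 (\<lambda>(i, j). if i = 0 then 1 else 0)"
definition e12 :: "'a::comm_ring_1 mat" where "e12 = Matrix.mat 1 2 (\<lambda>(i, j). if j = 1 then 1 else 0)"

lemma e21_carrier: "e21 \<in> carrier_mat 2 1" and e12_carrier: "e12 \<in> carrier_mat 1 2"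
  by (simp_all add: e21_def e12_def)

lemma m2_e21: "m2 a b c d * e21 = Matrix.mat 2 1 (\<lambda>(i, j). if i = 0 then a else (c :: 'a::comm_ring_1))"
  by (rule eq_matI) (auto simp: m2_def e21_def scalar_prod_def sum.atLeast0_lessThan_Suc numeral_2_eq_2)

lemma e12_m2: "e12 * m2 a b c d = Matrix.mat 1 2 (\<lambda>(i, j). if j = 0 then c else (d :: 'a::comm_ring_1))"
  by (rule eq_matI) (auto simp: m2_def e12_def scalar_prod_def sum.atLeast0_lessThan_Suc numeral_2_eq_2)

lemma frob_At_hom:
  fixes a b :: "'f::{finite,field} poly poly"
  shows "frob_At (a + b) = frob_At a + frob_At b" "frob_At (a * b) = frob_At a * frob_At b"
    "frob_At (0 :: 'f poly poly) = 0" "frob_At (1 :: 'f poly poly) = 1" "frob_At (a - b) = frob_At a - frob_At b"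
proof -
  let ?h = "\<lambda>a. pcompose a ([:0, 1:] ^ CARD('f))"
  have co: "coeff (frob_At c) i = ?h (coeff c i)" for c :: "'f poly poly" and i
    unfolding frob_At_def by (rule coeff_map_poly) simp
  have h1: "?h 1 = 1" by (simp add: one_pCons)
  show "frob_At (a + b) = frob_At a + frob_At b" "frob_At (a - b) = frob_At a - frob_At b"
    by (rule poly_eqI, simp add: co pcompose_add pcompose_diff)+
  show "frob_At (a * b) = frob_At a * frob_At b"
    by (rule poly_eqI) (simp add: co coeff_mult pcompose_sum pcompose_mult)
  show "frob_At (0 :: 'f poly poly) = 0" by (simp add: frob_At_def)
  show "frob_At (1 :: 'f poly poly) = 1" by (rule poly_eqI) (simp add: co coeff_1 h1)
qed

lemma to_fract_hom':
  fixes a b :: "'a::idom"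
  shows "to_fract (a + b) = to_fract a + to_fract b" "to_fract (a * b) = to_fract a * to_fract b"
    "to_fract (0 :: 'a) = 0" "to_fract (1 :: 'a) = 1" "to_fract (a - b) = to_fract a - to_fract b"
    "to_fract a = to_fract b \<longleftrightarrow> a = b"
  by (simp_all add: to_fract_def Zero_fract_def One_fract_def eq_fract)

abbreviation Fm :: "'a::idom mat \<Rightarrow> 'a fract mat" where "Fm A \<equiv> map_mat to_fract A"
abbreviation Tm :: "'f::{finite,field} poly poly mat \<Rightarrow> 'f poly poly mat" where "Tm A \<equiv> map_mat frob_At A"

lemma Fm_mult: "dim_col A = dim_row B \<Longrightarrow> Fm (A * B) = Fm A * Fm B"
  by (rule map_mat_mult_hom) (simp_all add: to_fract_hom')

lemma Tm_mult: "dim_col A = dim_row B \<Longrightarrow> Tm (A * B) = Tm A * Tm B"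
  by (rule map_mat_mult_hom) (simp_all add: frob_At_hom)

lemma Fm_one: "Fm (1\<^sub>m k) = 1\<^sub>m k" and Tm_one: "Tm (1\<^sub>m k) = 1\<^sub>m k"
  by (rule eq_matI; auto simp: to_fract_hom' frob_At_hom)+

lemma t_power_nonzero: "t_minus_theta ^ k \<noteq> (0 :: 'f::field poly poly)" by (simp add: t_minus_theta_def)

lemma At_loc_closed:
  shows "to_fract a \<in> At_loc" "x \<in> At_loc \<Longrightarrow> y \<in> At_loc \<Longrightarrow> x + y \<in> At_loc"
    "x \<in> At_loc \<Longrightarrow> y \<in> At_loc \<Longrightarrow> x * y \<in> At_loc" "inverse (to_fract (t_minus_theta ^ k)) \<in> At_loc"
    "x \<in> At_loc \<Longrightarrow> - x \<in> At_loc"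
proof -
  show "to_fract a \<in> At_loc" unfolding At_loc_def
    by (intro CollectI exI[of _ a] exI[of _ 0]) (simp add: to_fract_def)
  show "inverse (to_fract (t_minus_theta ^ k)) \<in> At_loc" unfolding At_loc_def
    by (intro CollectI exI[of _ 1] exI[of _ k]) (simp add: to_fract_def)
  show "- x \<in> At_loc" if x: "x \<in> At_loc"
  proof -
    obtain a k where "x = Fract a (t_minus_theta ^ k)" using x unfolding At_loc_def by blast
    hence "- x = Fract (- a) (t_minus_theta ^ k)" by simp
    thus ?thesis unfolding At_loc_def by blast
  qed
  show "x + y \<in> At_loc" "x * y \<in> At_loc" if xy: "x \<in> At_loc" "y \<in> At_loc"
  proof -
    obtain a k where a: "x = Fract a (t_minus_theta ^ k)" using xy(1) unfolding At_loc_def by blast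
    obtain b l where b: "y = Fract b (t_minus_theta ^ l)" using xy(2) unfolding At_loc_def by blast
    have "x * y = Fract (a * b) (t_minus_theta ^ (k + l))" by (simp add: a b power_add)
    thus "x * y \<in> At_loc" unfolding At_loc_def by blast
    have "x + y = Fract (a * t_minus_theta ^ l + b * t_minus_theta ^ k) (t_minus_theta ^ (k + l))"
      unfolding a b power_add by (rule add_fract[OF t_power_nonzero t_power_nonzero])
    thus "x + y \<in> At_loc" unfolding At_loc_def by blast
  qed
qed

lemma At_loc_diff: "x \<in> At_loc \<Longrightarrow> y \<in> At_loc \<Longrightarrow> x - y \<in> At_loc"
  using At_loc_closed(2)[of x "- y"] At_loc_closed(5)[of y] by simp

lemma At_loc_sum: "(\<And>i. i \<in> I \<Longrightarrow> f i \<in> At_loc) \<Longrightarrow> sum f I \<in> At_loc"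
  using At_loc_closed(1)[of 0] by (induction I rule: infinite_finite_induct) (auto intro: At_loc_closed simp: to_fract_hom')

lemmas assoc2 = assoc_mult_mat[of _ 2 2 _ 2 _ 2]
lemmas carr2 = mult_carrier_mat[of _ 2 2 _ 2]

text \<open>Change of basis for morphisms of motives: B and B' are bases of the two modules, C' and
  \<open>Ct\<close> undo them, and the letters with t stand for Frobenius twists.\<close>

lemma conj_intertwine:
  fixes g :: "'a::comm_ring_1 mat"
  assumes c: "g \<in> carrier_mat 2 2" "B \<in> carrier_mat 2 2" "U \<in> carrier_mat 2 2" "Ct \<in> carrier_mat 2 2"
      "Bt \<in> carrier_mat 2 2" "B' \<in> carrier_mat 2 2" "C' \<in> carrier_mat 2 2" "U' \<in> carrier_mat 2 2"
      "Ct' \<in> carrier_mat 2 2" "gt \<in> carrier_mat 2 2"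
    and inv: "C' * B' = 1\<^sub>m 2" "Ct * Bt = 1\<^sub>m 2" and eq: "g * (B * U * Ct) = (B' * U' * Ct') * gt"
  shows "(C' * g * B) * U = U' * (Ct' * gt * Bt)"
proof -
  have cancel: "C' * (B' * Y) = Y" if "Y \<in> carrier_mat 2 2" for Y
    using that c inv(1) by (simp flip: assoc2)
  have "(C' * g * B) * U = C' * (g * (B * U * Ct)) * Bt"
    using c inv(2) by (simp add: assoc2 carr2)
  also have "\<dots> = C' * (B' * (U' * (Ct' * gt * Bt)))"
    unfolding eq using c by (simp add: assoc2 carr2)
  also have "\<dots> = U' * (Ct' * gt * Bt)" using c by (intro cancel) (simp add: carr2)
  finally show ?thesis .
qed

lemma map_mat_carr: "A \<in> carrier_mat a b \<Longrightarrow> map_mat h A \<in> carrier_mat a b" by simp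

lemma sum_lessThan_add: "(\<Sum>l<b + d. f l) = (\<Sum>l<b. f l) + (\<Sum>l<d. f (b + l) :: 'a::comm_monoid_add)" for b d :: nat
  by (induction d) (simp_all add: add.assoc)

lemma dsum_mult_append:
  fixes A :: "'a::comm_ring_1 mat"
  assumes "A \<in> carrier_mat a b" "B \<in> carrier_mat c d" "x \<in> carrier_mat b k" "y \<in> carrier_mat d k"
  shows "(A \<oplus>\<^sub>m B) * (x @\<^sub>r y) = (A * x) @\<^sub>r (B * y)"
proof (rule eq_matI)
  fix i j assume "i < dim_row ((A * x) @\<^sub>r (B * y))" "j < dim_col ((A * x) @\<^sub>r (B * y))"
  hence ij: "i < a + c" "j < k" using assms by (auto simp: append_rows_def)
  have "((A \<oplus>\<^sub>m B) * (x @\<^sub>r y)) $$ (i, j) = (\<Sum>l<b + d. (A \<oplus>\<^sub>m B) $$ (i, l) * (x @\<^sub>r y) $$ (l, j))"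
    using ij assms by (simp add: scalar_prod_def mat_dsum_def append_rows_def atLeast0LessThan)
  also have "\<dots> = (\<Sum>l<b. (A \<oplus>\<^sub>m B) $$ (i, l) * (x @\<^sub>r y) $$ (l, j)) + (\<Sum>l<d. (A \<oplus>\<^sub>m B) $$ (i, b + l) * (x @\<^sub>r y) $$ (b + l, j))"
    by (rule sum_lessThan_add)
  also have "\<dots> = ((A * x) @\<^sub>r (B * y)) $$ (i, j)"
    using ij assms by (auto simp: scalar_prod_def mat_dsum_def append_rows_def atLeast0LessThan)
  finally show "((A \<oplus>\<^sub>m B) * (x @\<^sub>r y)) $$ (i, j) = ((A * x) @\<^sub>r (B * y)) $$ (i, j)" .
qed (use assms in \<open>auto simp: append_rows_def mat_dsum_def\<close>)

lemma append_rows_inject: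
  assumes "A \<in> carrier_mat a k" "A' \<in> carrier_mat a k" "B \<in> carrier_mat b k" "B' \<in> carrier_mat b k"
    and eq: "A @\<^sub>r B = A' @\<^sub>r B'"
  shows "A = A'" "B = B'"
proof -
  have e: "(A @\<^sub>r B) $$ (i, j) = (A' @\<^sub>r B') $$ (i, j)" for i j using eq by simp
  show "A = A'"
  proof (rule eq_matI)
    fix i j assume "i < dim_row A'" "j < dim_col A'"
    thus "A $$ (i, j) = A' $$ (i, j)" using e[of i j] assms(1-4) by (auto simp: append_rows_def)
  qed (use assms in auto)
  show "B = B'"
  proof (rule eq_matI)
    fix i j assume "i < dim_row B'" "j < dim_col B'"
    thus "B $$ (i, j) = B' $$ (i, j)" using e[of "a + i" j] assms(1-4) by (auto simp: append_rows_def)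
  qed (use assms in auto)
qed

lemma map_append_rows:
  "A \<in> carrier_mat a k \<Longrightarrow> B \<in> carrier_mat b k \<Longrightarrow> map_mat h (A @\<^sub>r B) = map_mat h A @\<^sub>r map_mat h B"
  by (rule eq_matI) (auto simp: append_rows_def)

lemma map_dsum: "h 0 = 0 \<Longrightarrow> map_mat h (A \<oplus>\<^sub>m B) = map_mat h A \<oplus>\<^sub>m map_mat h B"
  by (rule eq_matI) (auto simp: mat_dsum_def)

definition m1 :: "'a \<Rightarrow> 'a mat" where "m1 a = Matrix.mat 1 1 (\<lambda>_. a)"

lemma m1_carrier: "m1 a \<in> carrier_mat 1 1" by (simp add: m1_def)

lemma m1_exhaust: "A \<in> carrier_mat 1 1 \<Longrightarrow> A = m1 (A $$ (0, 0))"
  by (rule eq_matI) (auto simp: m1_def)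

lemma split_rows:
  assumes "z \<in> carrier_mat (a + b) k"
  obtains x y where "x \<in> carrier_mat a k" "y \<in> carrier_mat b k" "z = x @\<^sub>r y"
proof
  show "Matrix.mat a k (\<lambda>(i, j). z $$ (i, j)) \<in> carrier_mat a k" "Matrix.mat b k (\<lambda>(i, j). z $$ (a + i, j)) \<in> carrier_mat b k"
    by simp_all
  show "z = Matrix.mat a k (\<lambda>(i, j). z $$ (i, j)) @\<^sub>r Matrix.mat b k (\<lambda>(i, j). z $$ (a + i, j))"
    by (rule eq_matI) (use assms in \<open>auto simp: append_rows_def\<close>)
qed

lemma append_rows_add:
  "A \<in> carrier_mat a k \<Longrightarrow> A' \<in> carrier_mat a k \<Longrightarrow> B \<in> carrier_mat b k \<Longrightarrow> B' \<in> carrier_mat b k \<Longrightarrow>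
   (A @\<^sub>r B) + (A' @\<^sub>r B') = (A + A') @\<^sub>r (B + B')"
  by (rule eq_matI) (auto simp: append_rows_def)

section \<open>Extensions of the unit motive in coordinates\<close>

context carlitz_betti
begin

abbreviation (input) MM :: "'f motive" where "MM \<equiv> A_motive (- int n)"

definition pn :: "'f poly poly" where "pn = t_minus_theta ^ n"

lemma MM_eq: "MM = m1 (to_fract pn)" by (simp add: A_motive_eq m1_def pn_def)

lemma MM_carrier: "MM \<in> carrier_mat 1 1" "dim_row MM = 1" "dim_row (unit_motive :: 'f motive) = 1"
  by (simp_all add: MM_eq m1_def unit_motive_def)

text \<open>The matrix of the Frobenius in a basis adapted to the sequence: the subobject and the
  quotient contribute the diagonal, and u is what the extension adds.\<close>

definition Um :: "'f poly poly fract \<Rightarrow> 'f motive" where "Um u = m2 (to_fract pn) u 0 1"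

lemma Um_carrier: "Um u \<in> carrier_mat 2 2" by (simp add: Um_def m2_carrier)

text \<open>Every extension is, in a suitable basis \<open>B\<close> adapted to the exact sequence (with inverse \<open>C\<close>), given by
  a single element \<open>u\<close>.\<close>

definition frame :: "'f ext \<Rightarrow> 'f poly poly mat \<Rightarrow> 'f poly poly mat \<Rightarrow> 'f poly poly fract \<Rightarrow> bool" where
  "frame E B C u \<longleftrightarrow> B \<in> carrier_mat 2 2 \<and> C \<in> carrier_mat 2 2 \<and> B * C = 1\<^sub>m 2 \<and> C * B = 1\<^sub>m 2 \<and>
     incl E = B * e21 \<and> proj E = e12 * C \<and> mid E = Fm B * Um u * Fm (Tm C)"

lemma frameD:
  assumes "frame E B C u"
  shows "B \<in> carrier_mat 2 2" "C \<in> carrier_mat 2 2" "B * C = 1\<^sub>m 2" "C * B = 1\<^sub>m 2"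
     "incl E = B * e21" "proj E = e12 * C" "mid E = Fm B * Um u * Fm (Tm C)"
     "mid E \<in> carrier_mat 2 2" "Fm B * Fm C = 1\<^sub>m 2" "Fm C * Fm B = 1\<^sub>m 2"
     "Fm (Tm B) * Fm (Tm C) = 1\<^sub>m 2" "Fm (Tm C) * Fm (Tm B) = 1\<^sub>m 2"
proof -
  show *: "B \<in> carrier_mat 2 2" "C \<in> carrier_mat 2 2" "B * C = 1\<^sub>m 2" "C * B = 1\<^sub>m 2"
     "incl E = B * e21" "proj E = e12 * C" "mid E = Fm B * Um u * Fm (Tm C)"
    using assms by (simp_all add: frame_def)
  show "mid E \<in> carrier_mat 2 2" unfolding *(7) using *(1,2) Um_carrier by (simp add: carr2)
  show "Fm B * Fm C = 1\<^sub>m 2" "Fm C * Fm B = 1\<^sub>m 2"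
    using arg_cong[OF *(3), of Fm] arg_cong[OF *(4), of Fm] *(1,2) by (simp_all add: Fm_mult Fm_one)
  show "Fm (Tm B) * Fm (Tm C) = 1\<^sub>m 2" "Fm (Tm C) * Fm (Tm B) = 1\<^sub>m 2"
    using arg_cong[OF *(3), of "\<lambda>A. Fm (Tm A)"] arg_cong[OF *(4), of "\<lambda>A. Fm (Tm A)"] *(1,2)
    by (simp_all add: Fm_mult Fm_one Tm_mult Tm_one)
qed

lemma extensionsD:
  assumes "E \<in> extensions unit_motive MM"
  shows "mid E \<in> carrier_mat (dim_row (mid E)) (dim_row (mid E))" "elements_mat (mid E) \<subseteq> At_loc"
    "incl E \<in> carrier_mat (dim_row (mid E)) 1" "proj E \<in> carrier_mat 1 (dim_row (mid E))"
    "Fm (incl E) * MM = mid E * Fm (Tm (incl E))" "Fm (proj E) * mid E = Fm (Tm (proj E))"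
    "short_exact 1 (dim_row (mid E)) 1 (incl E) (proj E)"
proof -
  show "mid E \<in> carrier_mat (dim_row (mid E)) (dim_row (mid E))" "elements_mat (mid E) \<subseteq> At_loc"
    using assms by (auto simp: extensions_def t_motive_def GL_over_def)
  show i: "incl E \<in> carrier_mat (dim_row (mid E)) 1" and p: "proj E \<in> carrier_mat 1 (dim_row (mid E))"
    and "short_exact 1 (dim_row (mid E)) 1 (incl E) (proj E)"
    using assms MM_carrier by (auto simp: extensions_def motive_hom_def)
  show "Fm (incl E) * MM = mid E * Fm (Tm (incl E))"
    using assms by (auto simp: extensions_def motive_hom_def)
  have "Fm (proj E) * mid E = unit_motive * Fm (Tm (proj E))"
    using assms by (auto simp: extensions_def motive_hom_def)
  thus "Fm (proj E) * mid E = Fm (Tm (proj E))" using p by (simp add: unit_motive_def)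
qed

text \<open>The inclusion and the section s are the columns of B, the retraction and the projection
  the rows of its inverse C. That the middle module has rank 2 is a consequence of B and C being
  inverse to each other, by \<open>mat_right_inverse_dim\<close> in both directions.\<close>

lemma frame_of_section:
  assumes E: "E \<in> extensions unit_motive MM" and s: "s \<in> carrier_mat (dim_row (mid E)) 1" "proj E * s = 1\<^sub>m 1"
    and eq: "mid E * Fm (Tm s) = Fm s + Fm (incl E) * m1 u"
  shows "\<exists>B C. frame E B C u"
proof -
  define e where "e = dim_row (mid E)"
  note D = extensionsD[OF E, folded e_def]
  note s = s[folded e_def]
  let ?i = "incl E" and ?p = "proj E" and ?D = "mid E"
  obtain r where r: "r \<in> carrier_mat 1 e" "?i * r + s * ?p = 1\<^sub>m e" "r * ?i = 1\<^sub>m 1" "r * s = 0\<^sub>m 1 1" "?p * ?i = 0\<^sub>m 1 1"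
    using short_exact_split[OF D(7) s] by metis
  define B where "B = Matrix.mat e 2 (\<lambda>(a, j). if j = 0 then ?i $$ (a, 0) else s $$ (a, 0))"
  define C where "C = Matrix.mat 2 e (\<lambda>(j, b). if j = 0 then r $$ (0, b) else ?p $$ (0, b))"
  have BC: "B * C = 1\<^sub>m e"
  proof (rule eq_matI)
    fix a b assume ab: "a < dim_row (1\<^sub>m e :: 'f poly poly mat)" "b < dim_col (1\<^sub>m e :: 'f poly poly mat)"
    have "(B * C) $$ (a, b) = (?i * r + s * ?p) $$ (a, b)"
      using ab D(3,4) r(1) s(1)
      by (simp add: B_def C_def scalar_prod_def numeral_2_eq_2 sum.atLeast0_lessThan_Suc)
    thus "(B * C) $$ (a, b) = 1\<^sub>m e $$ (a, b)" unfolding r(2) .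
  qed (simp_all add: B_def C_def)
  have CB: "C * B = 1\<^sub>m 2"
  proof (rule two_by_two_eqI)
    have sp: "(A * A') $$ (0, 0) = (\<Sum>k<e. A $$ (0, k) * A' $$ (k, 0))"
      if "A \<in> carrier_mat 1 e" "A' \<in> carrier_mat e 1" for A A' :: "'f poly poly mat"
      using that by (simp add: scalar_prod_def atLeast0LessThan)
    have CBe: "(C * B) $$ (a, b) = (\<Sum>k<e. C $$ (a, k) * B $$ (k, b))" if "a < 2" "b < 2" for a b
      using that by (simp add: scalar_prod_def atLeast0LessThan B_def C_def)
    show "(C * B) $$ (0, 0) = 1\<^sub>m 2 $$ (0, 0)" using sp[OF r(1) D(3)] by (simp add: CBe r(3)) (simp add: B_def C_def)
    show "(C * B) $$ (0, 1) = 1\<^sub>m 2 $$ (0, 1)" using sp[OF r(1) s(1)] by (simp add: CBe r(4)) (simp add: B_def C_def)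
    show "(C * B) $$ (1, 0) = 1\<^sub>m 2 $$ (1, 0)" using sp[OF D(4,3)] by (simp add: CBe r(5)) (simp add: B_def C_def)
    show "(C * B) $$ (1, 1) = 1\<^sub>m 2 $$ (1, 1)" using sp[OF D(4) s(1)] by (simp add: CBe s(2)) (simp add: B_def C_def)
  qed (simp_all add: B_def C_def mult_carrier_mat[of _ 2 e _ 2])
  have "e \<le> 2" by (rule mat_right_inverse_dim[OF _ _ BC]) (simp_all add: B_def C_def)
  moreover have "2 \<le> e" by (rule mat_right_inverse_dim[OF _ _ CB]) (simp_all add: B_def C_def)
  ultimately have e2: "e = 2" by simp
  have Bc: "B \<in> carrier_mat 2 2" and Cc: "C \<in> carrier_mat 2 2" by (simp_all add: B_def C_def e2)
  have "?D * Fm (Tm B) = Fm B * Um u"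
  proof -
    have c1: "(?D * Fm (Tm ?i)) $$ (a, 0) = to_fract (?i $$ (a, 0)) * to_fract pn" if "a < 2" for a
      unfolding D(5)[symmetric] MM_eq using that D(3) by (simp add: scalar_prod_def m1_def e2)
    have c2: "(?D * Fm (Tm s)) $$ (a, 0) = to_fract (s $$ (a, 0)) + to_fract (?i $$ (a, 0)) * u" if "a < 2" for a
      unfolding eq using that D(3) s(1) by (simp add: scalar_prod_def m1_def e2)
    have k: "(?D * Fm (Tm B)) $$ (a, j) = (?D * Fm (Tm (if j = 0 then ?i else s))) $$ (a, 0)" if "a < 2" "j < 2" for a j
      using that D(1,3) s(1) by (auto simp: scalar_prod_def e2 B_def intro!: sum.cong)
    have r: "(Fm B * Um u) $$ (a, j) = (if j = 0 then to_fract (B $$ (a, 0)) * to_fract pn else to_fract (B $$ (a, 0)) * u + to_fract (B $$ (a, 1)))"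
      if "a < 2" "j < 2" for a j
      using that Bc by (auto simp: Um_def m2_def scalar_prod_def numeral_2_eq_2 sum.atLeast0_lessThan_Suc)
    show ?thesis
    proof (rule eq_matI)
      fix a j assume aj: "a < dim_row (Fm B * Um u)" "j < dim_col (Fm B * Um u)"
      hence a: "a < 2" "j < 2" using Bc Um_carrier[of u] by auto
      show "(?D * Fm (Tm B)) $$ (a, j) = (Fm B * Um u) $$ (a, j)"
        unfolding k[OF a] r[OF a] using c1[OF a(1)] c2[OF a(1)] a by (auto simp: B_def e2)
    qed (use Bc Um_carrier[of u] D(1) e2 in auto)
  qed
  hence "Fm B * Um u * Fm (Tm C) = ?D * Fm (Tm B) * Fm (Tm C)" by simp
  also have "\<dots> = ?D * (Fm (Tm B) * Fm (Tm C))" using D(1) Bc Cc unfolding e2 by (simp add: assoc2)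
  also have "Fm (Tm B) * Fm (Tm C) = 1\<^sub>m 2"
    using arg_cong[OF BC, of "\<lambda>A. Fm (Tm A)"] Bc Cc by (simp add: Fm_mult Fm_one Tm_mult Tm_one e2)
  finally have mid: "mid E = Fm B * Um u * Fm (Tm C)" using D(1) by (simp add: e2)
  have "?i = B * e21"
    by (rule eq_matI) (use D(3) in \<open>auto simp: e2 B_def e21_def scalar_prod_def numeral_2_eq_2 sum.atLeast0_lessThan_Suc\<close>)
  moreover have "?p = e12 * C"
    by (rule eq_matI) (use D(4) in \<open>auto simp: e2 C_def e12_def scalar_prod_def numeral_2_eq_2 sum.atLeast0_lessThan_Suc\<close>)
  ultimately have "frame E B C u" unfolding frame_def using Bc Cc BC CB mid e2 by simp
  thus ?thesis by blast
qed

text \<open>As p is a morphism to the unit motive, it maps D tau(s) and s alike to 1, so their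
  difference comes from the subobject, where r reads off its coordinates. The rank m of the
  subobject is left open because Baer sums require m = 2.\<close>

lemma section_defect:
  fixes i :: "'f poly poly mat"
  assumes i: "i \<in> carrier_mat e m" and p: "p \<in> carrier_mat 1 e" and D: "D \<in> carrier_mat e e"
    and pD: "Fm p * D = Fm (Tm p)" and s: "s \<in> carrier_mat e 1" "p * s = 1\<^sub>m 1"
    and r: "r \<in> carrier_mat m e" "i * r + s * p = 1\<^sub>m e"
  shows "D * Fm (Tm s) = Fm s + Fm i * (Fm r * (D * Fm (Tm s) - Fm s))"
proof -
  let ?w = "D * Fm (Tm s) - Fm s"
  have w: "?w \<in> carrier_mat e 1" by (intro minus_carrier_mat map_mat_carr s(1))
  have "Fm p * ?w = Fm p * (D * Fm (Tm s)) - Fm p * Fm s"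
    using p D s by (intro mult_minus_distrib_mat[of _ 1 e _ 1]) auto
  also have "Fm p * (D * Fm (Tm s)) = Fm (Tm p) * Fm (Tm s)"
    unfolding pD[symmetric] using p D s by (simp add: assoc_mult_mat[of _ 1 e _ e _ 1])
  also have "\<dots> = 1\<^sub>m 1"
    using arg_cong[OF s(2), of "\<lambda>A. Fm (Tm A)"] p s(1) by (simp add: Fm_mult Tm_mult Fm_one Tm_one)
  also have "Fm p * Fm s = 1\<^sub>m 1" using arg_cong[OF s(2), of Fm] p s(1) by (simp add: Fm_mult Fm_one)
  finally have pw: "Fm p * ?w = 0\<^sub>m 1 1" by simp
  have Fsum: "Fm (i * r + s * p) = Fm i * Fm r + Fm s * Fm p"
  proof -
    have "Fm (i * r + s * p) = Fm (i * r) + Fm (s * p)"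
      by (rule eq_matI) (use i r(1) s(1) p in \<open>auto simp: to_fract_hom'\<close>)
    thus ?thesis using i r(1) s(1) p by (simp add: Fm_mult)
  qed
  have "?w = Fm (i * r + s * p) * ?w" unfolding r(2) Fm_one by (rule left_mult_one_mat[OF w, symmetric])
  also have "\<dots> = Fm i * Fm r * ?w + Fm s * Fm p * ?w"
    unfolding Fsum using i r(1) s p w by (intro add_mult_distrib_mat[of _ e e _ _ 1]) auto
  also have "Fm s * Fm p * ?w = Fm s * (Fm p * ?w)"
    using s p w by (intro assoc_mult_mat[of _ e 1 _ e _ 1]) auto
  also have "Fm i * Fm r * ?w = Fm i * (Fm r * ?w)"
    using i r w by (intro assoc_mult_mat[of _ e m _ e _ 1]) auto
  finally have fw: "?w = Fm i * (Fm r * ?w) + Fm s * (Fm p * ?w)" .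
  have z: "Fm s * (Fm p * ?w) = 0\<^sub>m e 1" unfolding pw by (rule right_mult_zero_mat[OF map_mat_carr[OF s(1)]])
  have "?w = Fm i * (Fm r * ?w)"
    by (rule trans[OF fw[unfolded z] right_add_zero_mat[OF mult_carrier_mat[OF map_mat_carr[OF i]
      mult_carrier_mat[OF map_mat_carr[OF r(1)] w]]]])
  moreover have "D * Fm (Tm s) = Fm s + ?w" using D s by (intro eq_matI) auto
  ultimately show ?thesis by simp
qed

lemma frame_exists:
  assumes E: "E \<in> extensions unit_motive MM"
  obtains B C u where "frame E B C u" "u \<in> At_loc"
proof -
  define e where "e = dim_row (mid E)"
  note D = extensionsD[OF E, folded e_def]
  obtain s where s: "s \<in> carrier_mat e 1" "proj E * s = 1\<^sub>m 1" using short_exact_section[OF D(7)] .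
  obtain r where r: "r \<in> carrier_mat 1 e" "incl E * r + s * proj E = 1\<^sub>m e"
    using short_exact_split[OF D(7) s] by metis
  let ?w = "mid E * Fm (Tm s) - Fm s"
  define u where "u = (Fm r * ?w) $$ (0, 0)"
  have um: "Fm r * ?w = m1 u" unfolding u_def using r(1) D(1) s(1) by (intro m1_exhaust) auto
  have "mid E * Fm (Tm s) = Fm s + Fm (incl E) * m1 u"
    using section_defect[OF D(3,4,1,6) s r] unfolding um .
  then obtain B C where f: "frame E B C u" using frame_of_section[OF E _ s(2), folded e_def] s(1) by blast
  have ent: "mid E $$ (a, b) \<in> At_loc" if "a < e" "b < e" for a b
    using D(2) elements_matI[OF D(1) that refl] by blast
  have w: "?w $$ (a, 0) \<in> At_loc" if "a < e" for a
  proof -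
    have "?w $$ (a, 0) = (\<Sum>k<e. mid E $$ (a, k) * to_fract (frob_At (s $$ (k, 0)))) + - to_fract (s $$ (a, 0))"
      using that D(1) s(1) by (simp add: scalar_prod_def atLeast0LessThan)
    thus ?thesis using that ent by (auto intro!: At_loc_diff At_loc_closed(1,3) At_loc_sum)
  qed
  have "u = (\<Sum>k<e. to_fract (r $$ (0, k)) * ?w $$ (k, 0))"
    unfolding u_def using r(1) D(1) s(1) by (simp add: scalar_prod_def atLeast0LessThan)
  hence "u \<in> At_loc" using w by (auto intro!: At_loc_closed(3) At_loc_closed(1) At_loc_sum)
  thus ?thesis using that f by blast
qed

text \<open>In adapted bases a morphism that is multiplication by \<alpha> on the subobject and the
  identity on the quotient is \<open>m2 \<alpha> h 0 1\<close>. Commuting with the Frobenius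
  matrices then is a single equation, in the upper right entry.\<close>

lemma morphism_frame_iff:
  assumes f: "frame E B C u" and f': "frame E' B' C' u'" and \<alpha>: "frob_At \<alpha> = \<alpha>"
  shows "ext_morphism (\<alpha> \<cdot>\<^sub>m 1\<^sub>m 1) (1\<^sub>m 1) E E' \<longleftrightarrow>
    (\<exists>h. to_fract \<alpha> * u + to_fract h = to_fract pn * to_fract (frob_At h) + u')"
proof
  note D = frameD[OF f] and D' = frameD[OF f']
  assume "ext_morphism (\<alpha> \<cdot>\<^sub>m 1\<^sub>m 1) (1\<^sub>m 1) E E'"
  then obtain g where g: "motive_hom (mid E) (mid E') g" "g * incl E = incl E' * (\<alpha> \<cdot>\<^sub>m 1\<^sub>m 1)"
    "proj E' * g = 1\<^sub>m 1 * proj E" by (auto simp: ext_morphism_def)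
  have gc: "g \<in> carrier_mat 2 2" and geq: "Fm g * mid E = mid E' * Fm (Tm g)"
    using g(1) D(8) D'(8) by (auto simp: motive_hom_def)
  define G where "G = C' * g * B"
  have Gc: "G \<in> carrier_mat 2 2" unfolding G_def using gc D D' by (simp add: carr2)
  have FG: "Fm G = Fm C' * Fm g * Fm B" "Fm (Tm G) = Fm (Tm C') * Fm (Tm g) * Fm (Tm B)"
    unfolding G_def using gc D(1) D'(2) by (simp_all add: Fm_mult Tm_mult)
  have comm: "Fm G * Um u = Um u' * Fm (Tm G)"
    unfolding FG by (rule conj_intertwine[of _ _ _ "Fm (Tm C)" _ "Fm B'"])
      (use gc D(1,2) D'(1,2) Um_carrier D(12) D'(10) geq in \<open>simp_all add: D(7) D'(7)\<close>)
  have "G * e21 = C' * (g * incl E)"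
    unfolding G_def D(5) using gc D(1) D'(2) e21_carrier[where 'a = "'f poly poly"]
    by (simp add: assoc_mult_mat[of _ 2 2 _ 2 _ 1] assoc2 carr2)
  also have "\<dots> = C' * B' * (e21 * (\<alpha> \<cdot>\<^sub>m 1\<^sub>m 1))"
    unfolding g(2) D'(5) using D'(1,2) e21_carrier[where 'a = "'f poly poly"]
    by (simp add: assoc_mult_mat[of _ 2 2 _ 1 _ 1] assoc_mult_mat[of _ 2 2 _ 2 _ 1] carr2
      mult_carrier_mat[of _ 2 1 _ 1])
  finally have Ge: "G * e21 = e21 * (\<alpha> \<cdot>\<^sub>m 1\<^sub>m 1)"
    unfolding D'(4) using e21_carrier[where 'a = "'f poly poly"] by (simp add: mult_carrier_mat[of _ 2 1 _ 1])
  have "e12 * G = (proj E' * g) * B"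
    unfolding G_def D'(6) using gc D(1) D'(2) e12_carrier[where 'b = "'f poly poly"]
    by (simp add: assoc_mult_mat[of _ 1 2 _ 2 _ 2] assoc2 carr2)
  also have "\<dots> = e12 * (C * B)"
    unfolding g(3) D(6) using D(1,2) e12_carrier[where 'b = "'f poly poly"]
    by (simp add: assoc_mult_mat[of _ 1 2 _ 2 _ 2] mult_carrier_mat[of _ 1 2 _ 2])
  finally have eG: "e12 * G = e12" unfolding D(4) using e12_carrier[where 'b = "'f poly poly"] by simp
  define h where "h = G $$ (0, 1)"
  obtain a c d where G: "G = m2 a h c d" unfolding h_def using m2_exhaust[OF Gc] by blast
  have "a = \<alpha>"
    using arg_cong[OF Ge[unfolded G m2_e21], of "\<lambda>A. A $$ (0, 0)"] by (simp add: e21_def scalar_prod_def)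
  moreover have "c = 0" "d = 1"
    using arg_cong[OF eG[unfolded G e12_m2], of "\<lambda>A. A $$ (0, 0)"]
      arg_cong[OF eG[unfolded G e12_m2], of "\<lambda>A. A $$ (0, 1)"] by (simp_all add: e12_def)
  ultimately have G: "G = m2 \<alpha> h 0 1" using G by simp
  have "to_fract \<alpha> * u + to_fract h = to_fract pn * to_fract (frob_At h) + u'"
    using comm by (simp add: G m2_map Um_def m2_mult m2_eq_iff to_fract_hom' frob_At_hom)
  thus "\<exists>h. to_fract \<alpha> * u + to_fract h = to_fract pn * to_fract (frob_At h) + u'" by blast
next
  note D = frameD[OF f] and D' = frameD[OF f']
  assume "\<exists>h. to_fract \<alpha> * u + to_fract h = to_fract pn * to_fract (frob_At h) + u'"
  then obtain h where h: "to_fract \<alpha> * u + to_fract h = to_fract pn * to_fract (frob_At h) + u'" by blast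
  define G where "G = m2 \<alpha> h 0 1"
  have Gc: "G \<in> carrier_mat 2 2" by (simp add: G_def m2_carrier)
  have comm: "Fm G * Um u = Um u' * Fm (Tm G)"
    using h by (simp add: G_def m2_map Um_def m2_mult m2_eq_iff to_fract_hom' frob_At_hom \<alpha> mult.commute)
  define g where "g = B' * G * C"
  have gc: "g \<in> carrier_mat 2 2" unfolding g_def using Gc D(2) D'(1) by (simp add: carr2)
  have Fg: "Fm g = Fm B' * Fm G * Fm C" "Fm (Tm g) = Fm (Tm B') * Fm (Tm G) * Fm (Tm C)"
    unfolding g_def using Gc D(2) D'(1) by (simp_all add: Fm_mult Tm_mult)
  note c = map_mat_carr[OF Gc, of to_fract] map_mat_carr[OF map_mat_carr[OF Gc, of frob_At], of to_fract]
    map_mat_carr[OF D(1), of to_fract] map_mat_carr[OF D(2), of to_fract] map_mat_carr[OF D'(1), of to_fract]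
    map_mat_carr[OF map_mat_carr[OF D(2), of frob_At], of to_fract]
    map_mat_carr[OF map_mat_carr[OF D'(2), of frob_At], of to_fract]
    map_mat_carr[OF map_mat_carr[OF D'(1), of frob_At], of to_fract] Um_carrier
  have "Fm g * mid E = Fm B' * (Fm G * ((Fm C * Fm B) * Um u)) * Fm (Tm C)"
    unfolding Fg D(7) using c by (simp add: assoc2 carr2)
  also have "\<dots> = Fm B' * (Fm G * Um u) * Fm (Tm C)" 
    by (simp only: D(10) left_mult_one_mat[OF Um_carrier])
  also have "\<dots> = Fm B' * Um u' * (1\<^sub>m 2 * (Fm (Tm G) * Fm (Tm C)))"
    unfolding comm using c by (simp add: assoc2 carr2 Um_carrier left_mult_one_mat[of _ 2 2])
  also have "\<dots> = mid E' * Fm (Tm g)"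
    unfolding Fg D'(7) D'(12)[symmetric] using c by (simp add: assoc2 carr2 Um_carrier)
  finally have "motive_hom (mid E) (mid E') g" using gc D(8) D'(8) by (auto simp: motive_hom_def)
  moreover have "g * incl E = incl E' * (\<alpha> \<cdot>\<^sub>m 1\<^sub>m 1)"
  proof -
    have "g * incl E = B' * (G * ((C * B) * e21))"
      unfolding g_def D(5) using Gc D(1,2) D'(1) e21_carrier[where 'a = "'f poly poly"]
      by (simp add: assoc_mult_mat[of _ 2 2 _ 2 _ 1] carr2 mult_carrier_mat[of _ 2 2 _ 1])
    also have "\<dots> = B' * (G * e21)" by (simp only: D(4) left_mult_one_mat[OF e21_carrier])
    also have "G * e21 = e21 * (\<alpha> \<cdot>\<^sub>m 1\<^sub>m 1)"
      unfolding G_def m2_e21 by (rule eq_matI) (auto simp: e21_def scalar_prod_def)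
    also have "B' * (e21 * (\<alpha> \<cdot>\<^sub>m 1\<^sub>m 1)) = incl E' * (\<alpha> \<cdot>\<^sub>m 1\<^sub>m 1)"
      unfolding D'(5) using D'(1) e21_carrier[where 'a = "'f poly poly"]
      by (simp add: assoc_mult_mat[of _ 2 2 _ 1 _ 1])
    finally show ?thesis .
  qed
  moreover have "proj E' * g = 1\<^sub>m 1 * proj E"
  proof -
    have "proj E' * g = e12 * (C' * B') * G * C"
      unfolding g_def D'(6) using Gc D(2) D'(1,2) e12_carrier[where 'b = "'f poly poly"]
      by (simp add: assoc_mult_mat[of _ 1 2 _ 2 _ 2] assoc2 carr2 mult_carrier_mat[of _ 1 2 _ 2])
    also have "\<dots> = e12 * G * C" by (simp only: D'(4) right_mult_one_mat[OF e12_carrier])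
    also have "e12 * G = e12" unfolding G_def e12_m2 by (rule eq_matI) (auto simp: e12_def)
    finally show ?thesis unfolding D(6) left_mult_one_mat[OF mult_carrier_mat[OF e12_carrier D(2)]] .
  qed
  ultimately show "ext_morphism (\<alpha> \<cdot>\<^sub>m 1\<^sub>m 1) (1\<^sub>m 1) E E'" by (auto simp: ext_morphism_def)
qed

end

section \<open>Hodge slopes of extensions\<close>

lemma m2_dim: "dim_row (m2 a b c d) = 2" "dim_col (m2 a b c d) = 2" by (simp_all add: m2_def)

lemma elements_m2: "elements_mat (m2 a b c d) \<subseteq> S \<longleftrightarrow> a \<in> S \<and> b \<in> S \<and> c \<in> S \<and> d \<in> S"
proof
  assume s: "elements_mat (m2 a b c d) \<subseteq> S"
  have "m2 a b c d $$ (i, j) \<in> S" if "i < 2" "j < 2" for i j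
    by (rule subsetD[OF s elements_matI[OF m2_carrier that refl]])
  from this[of 0 0] this[of 0 1] this[of 1 0] this[of 1 1] show "a \<in> S \<and> b \<in> S \<and> c \<in> S \<and> d \<in> S"
    unfolding m2_entries by simp
next
  assume "a \<in> S \<and> b \<in> S \<and> c \<in> S \<and> d \<in> S"
  thus "elements_mat (m2 a b c d) \<subseteq> S" by (auto simp: elements_mat_def m2_def)
qed

lemma t_dvd_iff: "t_minus_theta dvd b \<longleftrightarrow> poly b [:0, 1 :: 'f::field:] = 0"
  by (simp add: t_minus_theta_def poly_eq_0_iff_dvd)

lemma t_not_zero: "t_minus_theta \<noteq> (0 :: 'f::field poly poly)" "to_fract t_minus_theta \<noteq> (0 :: 'f poly poly fract)"
  by (simp_all add: t_minus_theta_def to_fract_def Zero_fract_def eq_fract)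

lemma K_local_closed:
  fixes x y :: "'f::field poly poly fract" and a b :: "'f poly poly"
  shows "to_fract a \<in> K_local" "x \<in> K_local \<Longrightarrow> y \<in> K_local \<Longrightarrow> x + y \<in> K_local"
    "x \<in> K_local \<Longrightarrow> y \<in> K_local \<Longrightarrow> x * y \<in> K_local" "\<not> t_minus_theta dvd b \<Longrightarrow> inverse (to_fract b) \<in> K_local"
    "x \<in> K_local \<Longrightarrow> - x \<in> K_local" "(0 :: 'f poly poly fract) \<in> K_local" "(1 :: 'f poly poly fract) \<in> K_local"
    "inverse (to_fract t_minus_theta) \<notin> (K_local :: 'f poly poly fract set)"
proof -
  have n1: "\<not> t_minus_theta dvd (1 :: 'f poly poly)" by (simp add: t_dvd_iff)
  show a: "to_fract a \<in> K_local" for a :: "'f poly poly"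
    unfolding K_local_def to_fract_def by (rule CollectI, rule exI[of _ a], rule exI[of _ 1], rule conjI[OF refl n1])
  show "(0 :: 'f poly poly fract) \<in> K_local" "(1 :: 'f poly poly fract) \<in> K_local"
    using a[of 0] a[of 1] by (simp_all add: to_fract_hom')
  show "inverse (to_fract b) \<in> K_local" if "\<not> t_minus_theta dvd b"
  proof -
    have "inverse (to_fract b) = Fract 1 b" by (simp add: to_fract_def)
    thus ?thesis using that unfolding K_local_def by blast
  qed
  show "- x \<in> K_local" if x: "x \<in> K_local"
  proof -
    obtain a b where ab: "x = Fract a b" "\<not> t_minus_theta dvd b" using x unfolding K_local_def by blast
    have "- x = Fract (- a) b" using ab(1) by simp
    thus ?thesis using ab(2) unfolding K_local_def by blast
  qed
  show "inverse (to_fract t_minus_theta) \<notin> (K_local :: 'f poly poly fract set)"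
  proof
    assume "inverse (to_fract t_minus_theta) \<in> (K_local :: 'f poly poly fract set)"
    then obtain a b :: "'f poly poly" where ab: "inverse (to_fract t_minus_theta) = Fract a b" "\<not> t_minus_theta dvd b"
      unfolding K_local_def by blast
    have "b \<noteq> 0" using ab(2) by auto
    moreover have "Fract 1 t_minus_theta = Fract a b" using ab(1) by (simp add: to_fract_def)
    ultimately have "b = a * t_minus_theta" using t_not_zero(1)[where 'f = 'f] by (simp add: eq_fract)
    thus False using ab(2) by simp
  qed
  assume "x \<in> K_local" "y \<in> K_local"
  then obtain a b c d where ab: "x = Fract a b" "\<not> t_minus_theta dvd b" and cd: "y = Fract c d" "\<not> t_minus_theta dvd d"
    unfolding K_local_def by blast
  have bd: "\<not> t_minus_theta dvd b * d" using ab(2) cd(2) by (simp add: t_dvd_iff)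
  have "b \<noteq> 0" "d \<noteq> 0" using ab(2) cd(2) by auto
  hence "x + y = Fract (a * d + c * b) (b * d)" "x * y = Fract (a * c) (b * d)" by (simp_all add: ab cd)
  thus "x + y \<in> K_local" "x * y \<in> K_local" using bd unfolding K_local_def by blast+
qed

abbreviation GL2 :: "'f::field poly poly fract mat set" where "GL2 \<equiv> GL_over K_local 2"

lemma GL2_I:
  assumes "a \<in> K_local" "b \<in> K_local" "c \<in> K_local" "d \<in> K_local" "a' \<in> K_local" "b' \<in> K_local" "c' \<in> K_local" "d' \<in> K_local"
    "m2 a b c d * m2 a' b' c' d' = 1\<^sub>m 2" "m2 a' b' c' d' * m2 a b c d = 1\<^sub>m 2"
  shows "m2 a b c d \<in> GL2"
  unfolding GL_over_def using assms m2_carrier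
  by (intro CollectI conjI bexI[of _ "m2 a' b' c' d'"]) (simp_all add: elements_m2)

lemma local2_mult:
  assumes "A \<in> carrier_mat 2 2" "B \<in> carrier_mat 2 2" "elements_mat A \<subseteq> K_local" "elements_mat B \<subseteq> K_local"
  shows "elements_mat (A * B) \<subseteq> K_local"
proof -
  obtain a b c d where A: "A = m2 a b c d" using m2_exhaust[OF assms(1)] by blast
  obtain a' b' c' d' where B: "B = m2 a' b' c' d'" using m2_exhaust[OF assms(2)] by blast
  show ?thesis using assms(3,4) unfolding A B m2_mult elements_m2 by (auto intro!: K_local_closed(2,3))
qed

lemma GL2_mult:
  assumes "U \<in> GL2" "V \<in> GL2" shows "U * V \<in> GL2"
proof -
  obtain U' where U: "U \<in> carrier_mat 2 2" "elements_mat U \<subseteq> K_local" "U' \<in> carrier_mat 2 2" "elements_mat U' \<subseteq> K_local"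
    "U * U' = 1\<^sub>m 2" "U' * U = 1\<^sub>m 2" using assms(1) unfolding GL_over_def by blast
  obtain V' where V: "V \<in> carrier_mat 2 2" "elements_mat V \<subseteq> K_local" "V' \<in> carrier_mat 2 2" "elements_mat V' \<subseteq> K_local"
    "V * V' = 1\<^sub>m 2" "V' * V = 1\<^sub>m 2" using assms(2) unfolding GL_over_def by blast
  have "(U * V) * (V' * U') = U * ((V * V') * U')" "(V' * U') * (U * V) = V' * ((U' * U) * V)"
    using U(1,3) V(1,3) by (simp_all add: assoc2 carr2)
  hence "(U * V) * (V' * U') = 1\<^sub>m 2" "(V' * U') * (U * V) = 1\<^sub>m 2"
    unfolding U(6) V(5) using U(1,3,5) V(1,3,6) by simp_all
  moreover have "U * V \<in> carrier_mat 2 2" "V' * U' \<in> carrier_mat 2 2" using U(1,3) V(1,3) by (simp_all add: carr2)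
  ultimately show ?thesis
    unfolding GL_over_def using local2_mult[OF U(1) V(1) U(2) V(2)] local2_mult[OF V(3) U(3) V(4) U(4)] by blast
qed

lemma mat_diag_2: "mat_diag 2 f = m2 (f 0) 0 0 (f 1 :: 'a::comm_ring_1)"
  by (rule eq_matI) (auto simp: mat_diag_def m2_def less_2_cases_iff)

text \<open>The smallest slope is determined by the divisibility of the entries by powers of \<open>t - \<theta>\<close>, and the
  sum of the slopes by that of the determinant.\<close>

lemma slopes_ge:
  fixes w0 w1 w0' w1' :: int and \<pi> :: "'f::field poly poly fract"
  defines "\<pi> \<equiv> to_fract t_minus_theta"
  assumes S: "p \<in> K_local" "q \<in> K_local" "r \<in> K_local" "s \<in> K_local" "x \<in> K_local" "y \<in> K_local" "z \<in> K_local" "w \<in> K_local"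
    and le: "w0' \<le> w1'"
    and eq: "m2 (\<pi> powi w0) 0 0 (\<pi> powi w1) = m2 p q r s * m2 (\<pi> powi w0') 0 0 (\<pi> powi w1') * m2 x y z w"
  shows "w0' \<le> w0 \<and> w0' + w1' \<le> w0 + w1"
proof -
  have \<pi>0: "\<pi> \<noteq> 0" unfolding \<pi>_def by (rule t_not_zero)
  have pw: "\<pi> powi k \<in> K_local" if "k \<ge> 0" for k :: int
  proof -
    have "to_fract (t_minus_theta ^ j) = to_fract (t_minus_theta :: 'f poly poly) ^ j" for j
      by (induction j) (simp_all add: to_fract_hom')
    hence "\<pi> powi k = to_fract (t_minus_theta ^ nat k)" unfolding \<pi>_def using that by (simp add: power_int_def)
    thus ?thesis by (simp add: K_local_closed(1))
  qed
  have pa: "\<pi> powi j * \<pi> powi l = \<pi> powi k" if "j + l = k" for j k l :: int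
    using \<pi>0 that by (auto simp: power_int_add)
  \<comment> \<open>Each wrong inequality between slopes, multiplied by a suitable power of \<pi>,
    would put 1/(t - theta) into the local ring.\<close>
  have bad: "\<pi> powi (-1) \<notin> K_local" unfolding \<pi>_def using K_local_closed(8) by (simp add: power_int_minus)
  let ?a = "\<pi> powi w0'" and ?b = "\<pi> powi w1'"
  have e: "\<pi> powi w0 = p * ?a * x + q * ?b * z" "0 = p * ?a * y + q * ?b * w" "0 = r * ?a * x + s * ?b * z"
      "\<pi> powi w1 = r * ?a * y + s * ?b * w"
    using eq unfolding m2_mult m2_eq_iff by simp_all
  have "w0' \<le> w0"
  proof (rule ccontr)
    assume "\<not> w0' \<le> w0"
    hence 1: "w0' - w0 - 1 \<ge> 0" "w1' - w0 - 1 \<ge> 0" using le by simp_all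
    have "\<pi> powi (-1) = \<pi> powi w0 * \<pi> powi (- w0 - 1)" by (rule pa[symmetric]) simp
    also have "\<dots> = p * (?a * \<pi> powi (- w0 - 1)) * x + q * (?b * \<pi> powi (- w0 - 1)) * z"
      unfolding e(1) by (simp add: algebra_simps)
    also have "?a * \<pi> powi (- w0 - 1) = \<pi> powi (w0' - w0 - 1)" by (rule pa) simp
    also have "?b * \<pi> powi (- w0 - 1) = \<pi> powi (w1' - w0 - 1)" by (rule pa) simp
    finally have "\<pi> powi (-1) \<in> K_local" using pw[OF 1(1)] pw[OF 1(2)] S by (simp add: K_local_closed)
    thus False using bad by contradiction
  qed
  moreover have "w0' + w1' \<le> w0 + w1"
  proof (rule ccontr)
    assume "\<not> w0' + w1' \<le> w0 + w1"
    hence 1: "w0' + w1' - (w0 + w1) - 1 \<ge> 0" by simp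
    have "\<pi> powi w0 * \<pi> powi w1 - 0 * 0 = (p * s - q * r) * (x * w - y * z) * (?a * ?b)"
      unfolding e(1,4) by (subst e(2), subst e(3)) (simp add: algebra_simps)
    hence d: "\<pi> powi (w0 + w1) = (p * s - q * r) * (x * w - y * z) * \<pi> powi (w0' + w1')"
      using \<pi>0 by (simp add: power_int_add)
    have "\<pi> powi (-1) = \<pi> powi (w0 + w1) * \<pi> powi (- (w0 + w1) - 1)" by (rule pa[symmetric]) simp
    also have "\<dots> = (p * s - q * r) * (x * w - y * z) * (\<pi> powi (w0' + w1') * \<pi> powi (- (w0 + w1) - 1))"
      unfolding d by (simp add: mult.assoc)
    also have "\<pi> powi (w0' + w1') * \<pi> powi (- (w0 + w1) - 1) = \<pi> powi (w0' + w1' - (w0 + w1) - 1)"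
      by (rule pa) simp
    also have "(p * s - q * r) * (x * w - y * z) = (p * s + - (q * r)) * (x * w + - (y * z))" by simp
    finally have "\<pi> powi (-1) \<in> K_local" using pw[OF 1] S by (simp only: K_local_closed)
    thus False using bad by contradiction
  qed
  ultimately show ?thesis by blast
qed

text \<open>Moving U and V to the other side expresses one diagonal matrix through the other with
  local factors, to which \<open>slopes_ge\<close> applies. Used in both directions it gives
  uniqueness of the slopes.\<close>

lemma smith_compare:
  assumes U: "U \<in> GL2" "V \<in> GL2" and U': "U' \<in> GL2" "V' \<in> GL2"
    and eq: "U * m2 (to_fract t_minus_theta powi w0) 0 0 (to_fract t_minus_theta powi w1) * V =
      U' * m2 (to_fract t_minus_theta powi w0') 0 0 (to_fract t_minus_theta powi w1') * V'"
    and le: "w0' \<le> w1'"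
  shows "w0' \<le> w0 \<and> w0' + w1' \<le> w0 + w1"
proof -
  let ?D = "m2 (to_fract t_minus_theta powi w0) 0 0 (to_fract t_minus_theta powi w1)"
  let ?D' = "m2 (to_fract t_minus_theta powi w0') 0 0 (to_fract t_minus_theta powi w1')"
  obtain U1 where U1: "U \<in> carrier_mat 2 2" "U1 \<in> carrier_mat 2 2" "elements_mat U1 \<subseteq> K_local" "U1 * U = 1\<^sub>m 2"
    using U(1) unfolding GL_over_def by blast
  obtain V1 where V1: "V \<in> carrier_mat 2 2" "V1 \<in> carrier_mat 2 2" "elements_mat V1 \<subseteq> K_local" "V * V1 = 1\<^sub>m 2"
    using U(2) unfolding GL_over_def by blast
  have U'c: "U' \<in> carrier_mat 2 2" "elements_mat U' \<subseteq> K_local" "V' \<in> carrier_mat 2 2" "elements_mat V' \<subseteq> K_local"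
    using U' unfolding GL_over_def by blast+
  have "?D = (U1 * U) * ?D * (V * V1)" 
    by (simp only: U1(4) V1(4) left_mult_one_mat[OF m2_carrier] right_mult_one_mat[OF m2_carrier])
  also have "\<dots> = U1 * (U * ?D * V) * V1" using U1(1,2) V1(1,2) by (simp add: assoc2 carr2 m2_carrier)
  also have "\<dots> = (U1 * U') * ?D' * (V' * V1)" unfolding eq using U1(2) V1(2) U'c(1,3) by (simp add: assoc2 carr2 m2_carrier)
  finally have e: "?D = (U1 * U') * ?D' * (V' * V1)" .
  have c: "U1 * U' \<in> carrier_mat 2 2" "V' * V1 \<in> carrier_mat 2 2" using U1 V1 U'c by (simp_all add: carr2)
  have el: "elements_mat (U1 * U') \<subseteq> K_local" "elements_mat (V' * V1) \<subseteq> K_local"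
    by (rule local2_mult; use U1 V1 U'c in simp)+
  obtain p q r s where 1: "U1 * U' = m2 p q r s" using m2_exhaust[OF c(1)] by blast
  obtain x y z w where 2: "V' * V1 = m2 x y z w" using m2_exhaust[OF c(2)] by blast
  show ?thesis using el e le unfolding 1 2 elements_m2
    by (elim conjE) (rule slopes_ge[where p = p and q = q and r = r and s = s and x = x and y = y and z = z and w = w]; assumption)
qed

text \<open>Any competing list has the same smallest slope and the same sum, and for rank 2 these
  two numbers determine it.\<close>

lemma hodge_slopes_eqI:
  assumes M: "dim_row M = 2" "M = U * m2 (to_fract t_minus_theta powi w0) 0 0 (to_fract t_minus_theta powi w1) * V"
    and UV: "U \<in> GL2" "V \<in> GL2" and le: "w0 \<le> w1"
  shows "hodge_slopes M = [w0, w1]"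
  unfolding hodge_slopes_def M(1) mat_diag_2
proof (rule the_equality)
  show "sorted [w0, w1] \<and> length [w0, w1] = 2 \<and> (\<exists>U\<in>GL2. \<exists>V\<in>GL2. M = U *
     m2 (to_fract t_minus_theta powi ([w0, w1] ! 0)) 0 0 (to_fract t_minus_theta powi ([w0, w1] ! 1)) * V)"
    using M(2) UV le by auto
next
  fix ws :: "int list"
  assume ws: "sorted ws \<and> length ws = 2 \<and> (\<exists>U\<in>GL2. \<exists>V\<in>GL2. M = U *
     m2 (to_fract t_minus_theta powi (ws ! 0)) 0 0 (to_fract t_minus_theta powi (ws ! 1)) * V)"
  then obtain v0 v1 where v: "ws = [v0, v1]" by (auto simp: length_Suc_conv numeral_2_eq_2)
  have vle: "v0 \<le> v1" using ws unfolding v by simp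
  obtain U' V' where U': "U' \<in> GL2" "V' \<in> GL2"
    "M = U' * m2 (to_fract t_minus_theta powi v0) 0 0 (to_fract t_minus_theta powi v1) * V'"
    using ws unfolding v by auto
  note a = M(2)[unfolded U'(3)]
  show "ws = [w0, w1]" unfolding v
    using smith_compare[OF U'(1,2) UV a le] smith_compare[OF UV U'(1,2) a[symmetric] vle] by simp
qed

text \<open>The pole order k is the least exponent in a representation of u; if t - theta divided
  the numerator, a smaller exponent would do.\<close>

lemma At_loc_cases:
  assumes "u \<in> At_loc"
  obtains (integral) a where "u = to_fract a"
    | (polar) a k where "k \<ge> 1" "\<not> t_minus_theta dvd a" "u = to_fract a * inverse (to_fract t_minus_theta ^ k)"
proof -
  have tp: "to_fract (t_minus_theta ^ k) = to_fract (t_minus_theta :: 'a poly poly) ^ k" for k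
    by (induction k) (simp_all add: to_fract_hom')
  have F: "Fract b (t_minus_theta ^ k) = to_fract b * inverse (to_fract (t_minus_theta :: 'a poly poly) ^ k)" for b k
    unfolding tp[symmetric] by (simp add: to_fract_def)
  obtain a0 k0 where "u = Fract a0 (t_minus_theta ^ k0)" using assms unfolding At_loc_def by blast
  hence ex: "\<exists>k a. u = to_fract a * inverse (to_fract t_minus_theta ^ k)" unfolding F by blast
  define k where "k = (LEAST k. \<exists>a. u = to_fract a * inverse (to_fract t_minus_theta ^ k))"
  obtain a where a: "u = to_fract a * inverse (to_fract t_minus_theta ^ k)"
    using LeastI_ex[OF ex] unfolding k_def by blast
  show ?thesis
  proof (cases k)
    case 0
    thus ?thesis using integral[of a] a by simp
  next
    case (Suc l)
    have "\<not> t_minus_theta dvd a"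
    proof
      assume "t_minus_theta dvd a"
      then obtain b where "a = t_minus_theta * b" by (rule dvdE)
      hence "u = to_fract b * inverse (to_fract t_minus_theta ^ l)"
        using a t_not_zero(2)[where 'f = 'a] by (simp add: Suc to_fract_hom' field_simps)
      hence "k \<le> l" unfolding k_def by (intro Least_le) blast
      thus False using Suc by simp
    qed
    thus ?thesis using polar[of k a] a Suc by simp
  qed
qed

context carlitz_betti
begin

lemma Fm_GL2:
  assumes "B \<in> carrier_mat 2 2" "C \<in> carrier_mat 2 2" "Fm B * Fm C = 1\<^sub>m 2" "Fm C * Fm B = 1\<^sub>m 2"
  shows "Fm B \<in> (GL2 :: 'f motive set)"
  unfolding GL_over_def using assms K_local_closed(1)
  by (intro CollectI conjI bexI[of _ "Fm C"]) auto

lemma frame_slopes: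
  assumes f: "frame E B C u" and eq: "Um u = U * m2 (to_fract t_minus_theta powi w0) 0 0 (to_fract t_minus_theta powi w1) * V"
    and UV: "U \<in> GL2" "V \<in> GL2" and le: "w0 \<le> w1"
  shows "hodge_slopes (mid E) = [w0, w1]"
proof (rule hodge_slopes_eqI[OF _ _ _ _ le])
  note D = frameD[OF f]
  show "dim_row (mid E) = 2" using D(8) by simp
  have 1: "Fm B \<in> (GL2 :: 'f motive set)" by (rule Fm_GL2[OF D(1,2,9,10)])
  have 2: "Fm (Tm C) \<in> (GL2 :: 'f motive set)" by (rule Fm_GL2[of _ "Tm B"]) (use D in auto)
  show "Fm B * U \<in> GL2" "V * Fm (Tm C) \<in> GL2" using 1 2 UV by (auto intro: GL2_mult)
  have c: "U \<in> carrier_mat 2 2" "V \<in> carrier_mat 2 2" using UV by (auto simp: GL_over_def)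
  show "mid E = Fm B * U * m2 (to_fract t_minus_theta powi w0) 0 0 (to_fract t_minus_theta powi w1) * (V * Fm (Tm C))"
    unfolding D(7) eq using c map_mat_carr[OF D(1), of to_fract] map_mat_carr[OF map_mat_carr[OF D(2), of frob_At], of to_fract]
    by (simp add: assoc2 carr2 m2_carrier)
qed

text \<open>The entry 1 clears the integral entry above it, which leaves diag(1, (t - theta)^n) up
  to order.\<close>

lemma slopes_integral:
  assumes f: "frame E B C (to_fract a)" shows "hodge_slopes (mid E) = [0, int n]"
proof (rule frame_slopes[OF f, of "m2 (to_fract a) 1 1 0" _ _ "m2 0 1 1 0"])
  note K = K_local_closed(1,5,6,7)
  show "m2 (to_fract a) 1 1 0 \<in> GL2"
    by (rule GL2_I[of _ _ _ _ 0 1 1 "- to_fract a"]) (simp_all add: K m2_mult m2_one m2_eq_iff)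
  show "m2 0 1 1 0 \<in> GL2" by (rule GL2_I[of _ _ _ _ 0 1 1 0]) (simp_all add: K m2_mult m2_one m2_eq_iff)
  show "Um (to_fract a) = m2 (to_fract a) 1 1 0 *
      m2 (to_fract t_minus_theta powi 0) 0 0 (to_fract t_minus_theta powi int n) * m2 0 1 1 0"
    by (simp add: Um_def m2_mult m2_eq_iff pn_def to_fract_power)
qed simp

text \<open>The upper right entry has order -k, the lowest of all entries, and the determinant has
  order n; hence -k and n + k. The unimodular factors come from elimination with this entry as the
  pivot.\<close>

lemma slopes_polar:
  assumes f: "frame E B C (to_fract a * inverse (to_fract t_minus_theta ^ k))" and a: "\<not> t_minus_theta dvd a"
  shows "hodge_slopes (mid E) = [- int k, int n + int k]"
proof -
  let ?\<pi> = "to_fract t_minus_theta :: 'f poly poly fract" and ?a = "to_fract a"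
  have nz: "?a \<noteq> 0" "?\<pi> \<noteq> 0" using a t_not_zero by (auto simp: to_fract_def Zero_fract_def eq_fract)
  have pw: "?\<pi> ^ j \<in> K_local" for j unfolding to_fract_power[symmetric] by (rule K_local_closed)
  note K = K_local_closed(1,3,5,6,7) K_local_closed(4)[OF a] pw
  have e: "?\<pi> powi (- int k) = inverse (?\<pi> ^ k)" "?\<pi> powi (int n + int k) = ?\<pi> ^ (n + k)"
    by (simp_all add: power_int_minus flip: of_nat_add)
  show ?thesis
  proof (rule frame_slopes[OF f, of "m2 ?a 0 (?\<pi> ^ k) 1" _ _ "m2 (?\<pi> ^ (n + k) * inverse ?a) 1 (- inverse ?a) 0"])
    show "m2 ?a 0 (?\<pi> ^ k) 1 \<in> GL2"
      by (rule GL2_I[of _ _ _ _ "inverse ?a" 0 "- (?\<pi> ^ k * inverse ?a)" 1])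
        (use nz in \<open>simp_all add: K m2_mult m2_one m2_eq_iff\<close>)
    show "m2 (?\<pi> ^ (n + k) * inverse ?a) 1 (- inverse ?a) 0 \<in> GL2"
      by (rule GL2_I[of _ _ _ _ 0 "- ?a" 1 "?\<pi> ^ (n + k)"])
        (use nz in \<open>simp_all add: K m2_mult m2_one m2_eq_iff\<close>)
    show "Um (?a * inverse (?\<pi> ^ k)) = m2 ?a 0 (?\<pi> ^ k) 1 * m2 (?\<pi> powi (- int k)) 0 0 (?\<pi> powi (int n + int k)) *
        m2 (?\<pi> ^ (n + k) * inverse ?a) 1 (- inverse ?a) 0"
      unfolding e using nz by (simp add: Um_def m2_mult m2_eq_iff pn_def to_fract_power power_add field_simps)
  qed simp
qed

definition Estd :: "'f poly poly fract \<Rightarrow> 'f ext" where "Estd u = \<lparr>mid = Um u, incl = e21, proj = e12\<rparr>"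

lemma frame_Estd: "frame (Estd u) (1\<^sub>m 2) (1\<^sub>m 2) u"
  using Um_carrier[of u] e21_carrier[where 'a = "'f poly poly"] e12_carrier[where 'b = "'f poly poly"]
  by (simp add: frame_def Estd_def Fm_one Tm_one)

lemma dsum_unit: "MM \<oplus>\<^sub>m unit_motive = mid (Estd (to_fract 0))"
  unfolding Estd_def Um_def MM_eq unit_motive_def
  by (rule eq_matI) (auto simp: mat_dsum_def m1_def m2_def less_2_cases_iff to_fract_hom')

text \<open>The value of the Hodge polygon at 1 is the smallest slope: 0 for the direct sum, and -k
  when u has a pole of order k at t = theta. So a pole is visible there, while without one all
  slopes agree.\<close>

lemma regulated_iff:
  assumes f: "frame E B C u" and u: "u \<in> At_loc"
  shows "regulated unit_motive MM E \<longleftrightarrow> u \<in> range to_fract"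
proof -
  have d: "dim_row (mid E) = 2" "dim_row (mid (Estd (to_fract 0))) = 2"
    by (rule carrier_matD(1)[OF frameD(8)[OF f]], rule carrier_matD(1)[OF frameD(8)[OF frame_Estd]])
  have s0: "hodge_slopes (mid (Estd (to_fract 0))) = [0, int n]" by (rule slopes_integral[OF frame_Estd])
  show ?thesis using u
  proof (cases rule: At_loc_cases)
    case (integral a)
    have "hodge_slopes (mid E) = [0, int n]" by (rule slopes_integral[OF f[unfolded integral]])
    thus ?thesis unfolding regulated_def dsum_unit hodge_polygon_def d s0 by (simp add: integral)
  next
    case (polar a k)
    have s: "hodge_slopes (mid E) = [- int k, int n + int k]"
      using f[unfolded polar(3)] polar(2) by (rule slopes_polar)
    have "hodge_polygon (mid E) 1 = - real k" "hodge_polygon (mid (Estd (to_fract 0))) 1 = 0"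
      unfolding hodge_polygon_def d s s0 by (simp_all add: numeral_2_eq_2)
    hence "\<not> regulated unit_motive MM E" unfolding regulated_def dsum_unit using polar(1) by auto
    moreover have "u \<notin> range to_fract"
    proof
      assume "u \<in> range to_fract"
      then obtain b where b: "u = to_fract b" by blast
      have "hodge_slopes (mid E) = [0, int n]" by (rule slopes_integral[OF f[unfolded b]])
      thus False using s polar(1) by simp
    qed
    ultimately show ?thesis by simp
  qed
qed

end

section \<open>Betti classes of extensions\<close>

definition v2 :: "'a \<Rightarrow> 'a \<Rightarrow> 'a vec" where "v2 x y = Matrix.vec 2 (\<lambda>i. if i = 0 then x else y)"

lemma v2_carrier: "v2 x y \<in> carrier_vec 2" by (simp add: v2_def)

lemma v2_eq_iff: "v2 x y = v2 x' y' \<longleftrightarrow> x = x' \<and> y = y'"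
proof
  assume e: "v2 x y = v2 x' y'"
  show "x = x' \<and> y = y'"
    using arg_cong[OF e, of "\<lambda>v. vec_index v 0"] arg_cong[OF e, of "\<lambda>v. vec_index v 1"] by (simp add: v2_def)
qed simp

lemma v2_exhaust:
  assumes "v \<in> carrier_vec 2" obtains x y where "v = v2 x y"
proof -
  have "v = v2 (vec_index v 0) (vec_index v 1)"
    by (rule eq_vecI) (use assms in \<open>auto simp: v2_def less_2_cases_iff\<close>)
  thus ?thesis using that by blast
qed

lemma m2_mult_v2: "m2 a b c d *\<^sub>v v2 x y = v2 (a * x + b * y) (c * x + d * y :: 'a::comm_ring_1)"
  by (rule eq_vecI) (auto simp: m2_def v2_def scalar_prod_def numeral_2_eq_2 sum.atLeast0_lessThan_Suc)

lemma v2_diff: "v2 x y - v2 x' y' = v2 (x - x') (y - y' :: 'a::comm_ring_1)"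
  by (rule eq_vecI) (auto simp: v2_def)

lemma map_v2: "map_vec h (v2 x y) = v2 (h x) (h y)" by (rule eq_vecI) (auto simp: v2_def)

lemma e21_vec: "e21 *\<^sub>v vec1 x = v2 x (0 :: 'a::comm_ring_1)"
  by (rule eq_vecI) (auto simp: e21_def v2_def vec1_def scalar_prod_def)

lemma e12_vec: "e12 *\<^sub>v v2 x y = vec1 (y :: 'a::comm_ring_1)"
  by (rule eq_vecI) (auto simp: e12_def v2_def vec1_def scalar_prod_def numeral_2_eq_2 sum.atLeast0_lessThan_Suc)

lemma map_e: "h 0 = 0 \<Longrightarrow> h 1 = 1 \<Longrightarrow> map_mat h e21 = e21" "h 0 = 0 \<Longrightarrow> h 1 = 1 \<Longrightarrow> map_mat h e12 = e12"
  by (rule eq_matI; auto simp: e21_def e12_def)+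

text \<open>The case m = 1 is the standard extension, the case m = 2 the rank 3 extension from which
  Baer sums are built.\<close>

lemma short_exact_coordinate:
  "short_exact m (Suc m) 1 (Matrix.mat (Suc m) m (\<lambda>(i, j). if i = j then 1 else 0 :: 'a::comm_ring_1))
    (Matrix.mat 1 (Suc m) (\<lambda>(i, j). if j = m then 1 else 0))"
proof -
  let ?i = "Matrix.mat (Suc m) m (\<lambda>(i, j). if i = j then 1 else 0 :: 'a)"
  let ?p = "Matrix.mat 1 (Suc m) (\<lambda>(i, j). if j = m then 1 else 0 :: 'a)"
  have iv: "?i *\<^sub>v v = Matrix.vec (Suc m) (\<lambda>k. if k < m then vec_index v k else 0)" if v: "v \<in> carrier_vec m" for v
  proof (rule eq_vecI)
    fix k assume "k < dim_vec (Matrix.vec (Suc m) (\<lambda>k. if k < m then vec_index v k else 0))"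
    hence k: "k < Suc m" by simp
    have "vec_index (?i *\<^sub>v v) k = (\<Sum>j\<in>{0..<m}. (if k = j then 1 else 0) * vec_index v j)"
      using k v by (simp add: scalar_prod_def)
    also have "\<dots> = (\<Sum>j\<in>{0..<m}. if k = j then vec_index v j else 0)" by (intro sum.cong) auto
    finally show "vec_index (?i *\<^sub>v v) k = vec_index (Matrix.vec (Suc m) (\<lambda>k. if k < m then vec_index v k else 0)) k"
      using k by simp
  qed simp
  have pv: "?p *\<^sub>v w = vec1 (vec_index w m)" if w: "w \<in> carrier_vec (Suc m)" for w
  proof (rule eq_vecI)
    fix k assume "k < dim_vec (vec1 (vec_index w m))"
    hence k: "k = 0" by (simp add: vec1_def)
    have "vec_index (?p *\<^sub>v w) k = (\<Sum>j\<in>{0..<Suc m}. (if j = m then 1 else 0) * vec_index w j)"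
      using k w by (simp add: scalar_prod_def)
    also have "\<dots> = (\<Sum>j\<in>{0..<Suc m}. if j = m then vec_index w j else 0)" by (intro sum.cong) auto
    finally show "vec_index (?p *\<^sub>v w) k = vec_index (vec1 (vec_index w m)) k"
      unfolding k by (simp add: vec1_def)
  qed (simp add: vec1_def)
  have z: "(0\<^sub>v 1 :: 'a vec) = vec1 0" by (rule eq_vecI) (auto simp: vec1_def)
  have inj: "inj_on ((*\<^sub>v) ?i) (carrier_vec m)"
  proof (rule inj_onI)
    fix v w :: "'a vec" assume vw: "v \<in> carrier_vec m" "w \<in> carrier_vec m" "?i *\<^sub>v v = ?i *\<^sub>v w"
    show "v = w"
    proof (rule eq_vecI)
      fix k assume "k < dim_vec w"
      thus "vec_index v k = vec_index w k"
        using arg_cong[OF vw(3), of "\<lambda>v. vec_index v k"] vw(1,2) unfolding iv[OF vw(1)] iv[OF vw(2)] by simp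
    qed (use vw in simp)
  qed
  have im: "(*\<^sub>v) ?i ` carrier_vec m = {v \<in> carrier_vec (Suc m). ?p *\<^sub>v v = 0\<^sub>v 1}"
  proof (intro equalityI subsetI)
    fix w assume "w \<in> (*\<^sub>v) ?i ` carrier_vec m"
    then obtain v where v: "v \<in> carrier_vec m" "w = ?i *\<^sub>v v" by blast
    have w: "w = Matrix.vec (Suc m) (\<lambda>k. if k < m then vec_index v k else 0)" using v iv by simp
    hence wc: "w \<in> carrier_vec (Suc m)" by simp
    have "?p *\<^sub>v w = 0\<^sub>v 1" unfolding pv[OF wc] z vec1_simps(1) unfolding w by simp
    thus "w \<in> {v \<in> carrier_vec (Suc m). ?p *\<^sub>v v = 0\<^sub>v 1}" using wc by simp
  next
    fix w :: "'a vec" assume w: "w \<in> {v \<in> carrier_vec (Suc m). ?p *\<^sub>v v = 0\<^sub>v 1}"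
    hence wc: "w \<in> carrier_vec (Suc m)" and "?p *\<^sub>v w = 0\<^sub>v 1" by simp_all
    hence w0: "vec_index w m = 0" unfolding pv[OF wc] z vec1_simps(1) by simp
    have v: "Matrix.vec m (vec_index w) \<in> carrier_vec m" by simp
    have "w = ?i *\<^sub>v Matrix.vec m (vec_index w)"
      unfolding iv[OF v] by (rule eq_vecI) (use wc w0 in \<open>auto simp: less_Suc_eq\<close>)
    thus "w \<in> (*\<^sub>v) ?i ` carrier_vec m" using v by (rule image_eqI)
  qed
  have sur: "(*\<^sub>v) ?p ` carrier_vec (Suc m) = carrier_vec 1"
  proof (intro equalityI subsetI)
    fix w assume "w \<in> (*\<^sub>v) ?p ` carrier_vec (Suc m)"
    thus "w \<in> carrier_vec 1" using pv by (auto simp: vec1_def)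
  next
    fix w :: "'a vec" assume w: "w \<in> carrier_vec 1"
    have v: "Matrix.vec (Suc m) (\<lambda>_. vec_index w 0) \<in> carrier_vec (Suc m)" by simp
    have "w = ?p *\<^sub>v Matrix.vec (Suc m) (\<lambda>_. vec_index w 0)"
      unfolding pv[OF v] using vec1_exhaust[OF w] by simp
    thus "w \<in> (*\<^sub>v) ?p ` carrier_vec (Suc m)" using v by (rule image_eqI)
  qed
  have "?i \<in> carrier_mat (Suc m) m" "?p \<in> carrier_mat 1 (Suc m)" by simp_all
  thus ?thesis unfolding short_exact_def using inj im sur by blast
qed

lemma short_exact_standard: "short_exact 1 2 1 (e21 :: 'a::comm_ring_1 mat) e12"
proof -
  have "(e21 :: 'a mat) = Matrix.mat (Suc 1) 1 (\<lambda>(i, j). if i = j then 1 else 0)" by (rule eq_matI) (auto simp: e21_def)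
  moreover have "(e12 :: 'a mat) = Matrix.mat 1 (Suc 1) (\<lambda>(i, j). if j = 1 then 1 else 0)" by (rule eq_matI) (auto simp: e12_def)
  ultimately show ?thesis using short_exact_coordinate[of 1, where 'a = 'a] by (simp add: numeral_2_eq_2)
qed

lemma map_mult_mat_vec:
  assumes h: "\<And>x y. h (x + y) = h x + h y" "\<And>x y. h (x * y) = h x * h y" "h 0 = 0"
    and A: "dim_col A = dim_vec v"
  shows "map_vec h (A *\<^sub>v v) = map_mat h A *\<^sub>v map_vec h (v :: 'a::comm_ring_1 vec)"
proof (rule eq_vecI)
  fix i assume i: "i < dim_vec (map_mat h A *\<^sub>v map_vec h v)"
  have s: "h (sum f I) = (\<Sum>i\<in>I. h (f i))" for f :: "nat \<Rightarrow> 'a" and I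
    by (induction I rule: infinite_finite_induct) (simp_all add: h)
  show "vec_index (map_vec h (A *\<^sub>v v)) i = vec_index (map_mat h A *\<^sub>v map_vec h v) i"
    using i A by (simp add: scalar_prod_def s h)
qed simp

context carlitz_betti
begin

lemma pn_nonzero: "to_fract pn \<noteq> 0"
  unfolding pn_def to_fract_power by (rule power_not_zero[OF t_not_zero(2)])

lemma Estd_extension:
  assumes u: "u \<in> At_loc" shows "Estd u \<in> extensions unit_motive MM"
proof -
  let ?P = "to_fract pn"
  have i: "inverse ?P \<in> At_loc" unfolding pn_def by (rule At_loc_closed)
  have 01: "0 \<in> (At_loc :: 'f poly poly fract set)" "1 \<in> (At_loc :: 'f poly poly fract set)"
    using At_loc_closed(1)[of 0] At_loc_closed(1)[of 1] by (simp_all add: to_fract_hom')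
  have "Um u \<in> GL_over At_loc 2"
    unfolding GL_over_def Um_def
  proof (intro CollectI conjI bexI[of _ "m2 (inverse ?P) (- (u * inverse ?P)) 0 1"])
    show "elements_mat (m2 ?P u 0 1) \<subseteq> At_loc" "elements_mat (m2 (inverse ?P) (- (u * inverse ?P)) 0 1) \<subseteq> At_loc"
      unfolding elements_m2 using 01 i u At_loc_closed by blast+
    show "m2 ?P u 0 1 * m2 (inverse ?P) (- (u * inverse ?P)) 0 1 = 1\<^sub>m 2"
      "m2 (inverse ?P) (- (u * inverse ?P)) 0 1 * m2 ?P u 0 1 = 1\<^sub>m 2"
      using pn_nonzero by (simp_all add: m2_mult m2_one m2_eq_iff)
  qed (simp_all add: m2_carrier)
  hence 1: "t_motive (mid (Estd u))" using Um_carrier[of u] by (simp add: t_motive_def Estd_def)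
  have dU: "dim_row (Um u) = 2" using Um_carrier[of u] by simp
  have em: "Fm e21 = e21" "Fm (Tm e21) = e21" "Fm e12 = e12" "Fm (Tm e12) = (e12 :: 'f motive)"
    by (simp_all add: map_e to_fract_hom' frob_At_hom)
  have "e21 * MM = Um u * e21" unfolding Um_def m2_e21 MM_eq
    by (rule eq_matI) (auto simp: e21_def m1_def scalar_prod_def)
  hence 2: "motive_hom MM (mid (Estd u)) (incl (Estd u))"
    using e21_carrier[where 'a = "'f poly poly"] by (simp add: motive_hom_def Estd_def MM_carrier dU em)
  have "e12 * Um u = unit_motive * e12" unfolding Um_def e12_m2 unit_motive_def left_mult_one_mat[OF e12_carrier]
    by (rule eq_matI) (auto simp: e12_def)
  hence 3: "motive_hom (mid (Estd u)) unit_motive (proj (Estd u))"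
    using e12_carrier[where 'b = "'f poly poly"] by (simp add: motive_hom_def Estd_def MM_carrier dU em)
  show ?thesis unfolding extensions_def using 1 2 3 short_exact_standard
    by (simp add: MM_carrier dU Estd_def)
qed

text \<open>Its image consists of the integral u whose extension splits, and -psi becomes
  \<open>phi\<close> in the Tate algebra, see \<open>psi_phi\<close>.\<close>

definition psi :: "'f poly poly \<Rightarrow> 'f poly poly" where "psi h = pn * frob_At h - h"

lemma psi_hom: "psi (a + b) = psi a + psi b" "psi (a - b) = psi a - psi b" "psi 0 = 0"
  by (simp_all add: psi_def frob_At_hom algebra_simps)

lemma psi_mult: "frob_At \<alpha> = \<alpha> \<Longrightarrow> psi (\<alpha> * h) = \<alpha> * psi h"
  by (simp add: psi_def frob_At_hom algebra_simps)

definition cls :: "'f poly poly \<Rightarrow> 'f ext set" where "cls a = ext_class unit_motive MM (Estd (to_fract a))"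

lemma one_smult_m: "1 \<cdot>\<^sub>m 1\<^sub>m 1 = (1\<^sub>m 1 :: 'a::comm_ring_1 mat)" by (rule eq_matI) auto

lemma id_morphism_iff:
  assumes "frame E B C u" "frame E' B' C' u'"
  shows "ext_morphism (1\<^sub>m 1) (1\<^sub>m 1) E E' \<longleftrightarrow> (\<exists>h. u' = u - to_fract (psi h))"
proof -
  have "ext_morphism (1\<^sub>m 1) (1\<^sub>m 1) E E' \<longleftrightarrow> (\<exists>h. to_fract 1 * u + to_fract h = to_fract pn * to_fract (frob_At h) + u')"
    using morphism_frame_iff[OF assms frob_At_hom(4)] unfolding one_smult_m .
  also have "\<dots> \<longleftrightarrow> (\<exists>h. u' = u - to_fract (psi h))"
    by (rule arg_cong[where f = Ex], rule ext) (auto simp: psi_def to_fract_hom' algebra_simps)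
  finally show ?thesis .
qed

lemma frame_in_cls:
  assumes "E \<in> cls a" "frame E B C w" obtains h where "w = to_fract (a - psi h)"
  using assms(1) id_morphism_iff[OF frame_Estd assms(2)]
  by (auto simp: cls_def ext_class_def MM_carrier to_fract_hom')

lemma in_cls_frame:
  assumes "E \<in> cls a" obtains B C h where "frame E B C (to_fract (a - psi h))"
proof -
  have "E \<in> extensions unit_motive MM" using assms by (simp add: cls_def ext_class_def)
  then obtain B C u where f: "frame E B C u" by (rule frame_exists)
  show ?thesis using f by (rule frame_in_cls[OF assms]) (use f that in blast)
qed

lemma cls_subset: "E \<in> cls a \<Longrightarrow> E \<in> extensions unit_motive MM"
  by (simp add: cls_def ext_class_def)

lemma in_clsI:
  assumes "E \<in> extensions unit_motive MM" "frame E B C (to_fract (a - psi h))"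
  shows "E \<in> cls a"
  using assms(1) id_morphism_iff[OF frame_Estd assms(2), of "to_fract a"]
  by (auto simp: cls_def ext_class_def MM_carrier to_fract_hom')

lemma ext_class_frame:
  assumes E: "E \<in> extensions unit_motive MM" and f: "frame E B C (to_fract a)"
  shows "ext_class unit_motive MM E = cls a"
proof -
  have "ext_morphism (1\<^sub>m 1) (1\<^sub>m 1) E E' \<longleftrightarrow> ext_morphism (1\<^sub>m 1) (1\<^sub>m 1) (Estd (to_fract a)) E'"
    if "E' \<in> extensions unit_motive MM" for E'
  proof -
    obtain B' C' u' where "frame E' B' C' u'" using \<open>E' \<in> _\<close> by (rule frame_exists)
    thus ?thesis using id_morphism_iff[OF f] id_morphism_iff[OF frame_Estd] by blast
  qed
  thus ?thesis unfolding cls_def ext_class_def MM_carrier by blast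
qed

lemma Estd_in_cls: "Estd (to_fract (a - psi h)) \<in> cls a"
  using Estd_extension[OF At_loc_closed(1)] frame_Estd by (rule in_clsI)

lemma carrier_Ext1_reg: "carrier (Ext1_reg unit_motive MM) = range cls"
proof (intro equalityI subsetI)
  fix X0 assume "X0 \<in> carrier (Ext1_reg unit_motive MM)"
  then obtain E where E: "E \<in> extensions unit_motive MM" "regulated unit_motive MM E" "X0 = ext_class unit_motive MM E"
    by (auto simp: Ext1_reg_def)
  obtain B C u where f: "frame E B C u" "u \<in> At_loc" using E(1) by (rule frame_exists)
  obtain a where a: "u = to_fract a" using E(2) regulated_iff[OF f] by blast
  show "X0 \<in> range cls" using ext_class_frame[OF E(1) f(1)[unfolded a]] E(3) by blast
next
  fix X0 assume "X0 \<in> range cls"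
  then obtain a where a: "X0 = cls a" by blast
  have "regulated unit_motive MM (Estd (to_fract a))"
    using regulated_iff[OF frame_Estd At_loc_closed(1)] by blast
  thus "X0 \<in> carrier (Ext1_reg unit_motive MM)"
    unfolding a cls_def Ext1_reg_def using Estd_extension[OF At_loc_closed(1)] by auto
qed

text \<open>A scalar from F[t] is fixed by the Frobenius, so psi commutes with it and the pushout
  multiplies u by the scalar.\<close>

lemma Ext1_reg_smult: "a \<odot>\<^bsub>Ext1_reg unit_motive MM\<^esub> cls u = cls (Ft_to_At a * u)"
proof -
  let ?\<alpha> = "Ft_to_At a"
  have eq: "a \<odot>\<^bsub>Ext1_reg unit_motive MM\<^esub> cls u =
      {E'' \<in> extensions unit_motive MM. \<exists>E\<in>cls u. ext_morphism (?\<alpha> \<cdot>\<^sub>m 1\<^sub>m 1) (1\<^sub>m 1) E E''}"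
    by (simp add: Ext1_reg_def Ext1_def MM_carrier)
  show ?thesis unfolding eq
  proof (intro equalityI subsetI)
    fix E'' assume "E'' \<in> {E'' \<in> extensions unit_motive MM. \<exists>E\<in>cls u. ext_morphism (?\<alpha> \<cdot>\<^sub>m 1\<^sub>m 1) (1\<^sub>m 1) E E''}"
    then obtain E where E: "E'' \<in> extensions unit_motive MM" "E \<in> cls u" "ext_morphism (?\<alpha> \<cdot>\<^sub>m 1\<^sub>m 1) (1\<^sub>m 1) E E''" by blast
    obtain B C h where f: "frame E B C (to_fract (u - psi h))" using E(2) by (rule in_cls_frame)
    obtain B' C' w where f': "frame E'' B' C' w" using E(1) by (rule frame_exists)
    obtain k where k: "to_fract ?\<alpha> * to_fract (u - psi h) + to_fract k = to_fract pn * to_fract (frob_At k) + w"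
      using E(3) morphism_frame_iff[OF f f' Ft_to_At_frob] by blast
    hence "w = to_fract ?\<alpha> * to_fract (u - psi h) + to_fract k - to_fract pn * to_fract (frob_At k)"
      by (simp add: algebra_simps)
    also have "\<dots> = to_fract (?\<alpha> * u - psi (?\<alpha> * h + k))"
      unfolding psi_hom psi_mult[OF Ft_to_At_frob] by (simp add: psi_def to_fract_hom' algebra_simps)
    finally show "E'' \<in> cls (?\<alpha> * u)" using in_clsI[OF E(1)] f' by blast
  next
    fix E'' assume E: "E'' \<in> cls (?\<alpha> * u)"
    then obtain B' C' k where f': "frame E'' B' C' (to_fract (?\<alpha> * u - psi k))" by (rule in_cls_frame)
    have "to_fract ?\<alpha> * to_fract u + to_fract k = to_fract pn * to_fract (frob_At k) + to_fract (?\<alpha> * u - psi k)"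
      by (simp add: psi_def to_fract_hom' algebra_simps)
    hence "ext_morphism (?\<alpha> \<cdot>\<^sub>m 1\<^sub>m 1) (1\<^sub>m 1) (Estd (to_fract u)) E''"
      using morphism_frame_iff[OF frame_Estd f' Ft_to_At_frob] by blast
    moreover have "Estd (to_fract u) \<in> cls u" using Estd_in_cls[of u 0] by (simp add: psi_hom)
    ultimately show "E'' \<in> {E'' \<in> extensions unit_motive MM. \<exists>E\<in>cls u. ext_morphism (?\<alpha> \<cdot>\<^sub>m 1\<^sub>m 1) (1\<^sub>m 1) E E''}"
      using cls_subset[OF E] by blast
  qed
qed

text \<open>In the basis B a lift of 1 has coordinates (x, 1), and invariance under the Frobenius of
  E means phi x = a. Since B has entries over K_inf and the second coordinate is constant, Galois
  moves only x, so the lift has the cocycle of x.\<close>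

lemma betti_class_frame:
  assumes E: "E \<in> extensions unit_motive MM" and f: "frame E B C (to_fract a)"
  shows "betti_ext_class \<iota> MM E = H1_of (At_to_tate \<iota> a)"
proof -
  note D = frameD[OF f]
  let ?T = "At_to_tate \<iota>" and ?M = "map_mat (At_to_tate \<iota>)"
  have TM: "?M (A * A') = ?M A * ?M A'" if "dim_col A = dim_row A'" for A A'
    by (rule map_mat_mult_hom) (use that in \<open>simp_all add: At_to_tate_hom\<close>)
  have T1: "?M (1\<^sub>m 2) = 1\<^sub>m 2" by (rule eq_matI) (auto simp: At_to_tate_hom)
  have Bc: "?M B \<in> carrier_mat 2 2" "?M C \<in> carrier_mat 2 2" using D(1,2) by simp_all
  have BC: "?M B * ?M C = 1\<^sub>m 2" "?M C * ?M B = 1\<^sub>m 2"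
    using arg_cong[OF D(3), of ?M] arg_cong[OF D(4), of ?M] D(1,2) by (simp_all add: TM T1)
  have cancel: "?M B *\<^sub>v (?M C *\<^sub>v v) = v" "?M C *\<^sub>v (?M B *\<^sub>v v) = v" if "v \<in> carrier_vec 2" for v
    using that Bc BC by (simp_all flip: assoc_mult_mat_vec[of _ 2 2 _ 2])
  let ?N = "m2 pn a 0 1"
  have LT: "map_mat (loc_to_tate \<iota>) (Fm Y) = ?M Y" for Y by (rule eq_matI) (simp_all add: loc_to_tate_to_fract)
  have midE: "mid E = Fm (B * ?N * Tm C)"
    unfolding D(7) Um_def using D(1,2) m2_carrier[of pn a 0 1] by (simp add: Fm_mult m2_map to_fract_hom' assoc2 carr2 m2_carrier m2_dim)
  have mid: "map_mat (loc_to_tate \<iota>) (mid E) = ?M (B * ?N * Tm C)" unfolding midE by (rule LT)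
  have MT: "?M (Tm A) = map_mat fr (?M A)" for A by (rule eq_matI) (simp_all add: At_to_tate_frob)
  have Nc: "?M ?N \<in> carrier_mat 2 2" by (simp add: m2_map m2_carrier)
  have Nv: "?M ?N *\<^sub>v v2 x y = v2 (t_th ^ n * x + ?T a * y) y" for x y
    by (simp add: m2_map m2_mult_v2 At_to_tate_hom pn_def At_to_tate_power At_to_tate_tm)
  have tf: "tate_map (\<lambda>c. c ^ CARD('f)) = fr" by (rule ext) (simp add: fr_def)
  have frv: "map_vec fr (A *\<^sub>v v) = map_mat fr A *\<^sub>v map_vec fr v" if "dim_col A = dim_vec v" for A v
  proof (rule map_mult_mat_vec)
    show "fr 0 = 0" using fr_diff[of 0 0] by simp
  qed (use that in \<open>simp_all add: fr_add fr_mult\<close>)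
  \<comment> \<open>The twist of C in the matrix of E cancels the twist of B that the Frobenius
    produces. In coordinates only the triangular matrix with entries \<open>pn\<close>, a, 0, 1
    remains.\<close>
  have act: "map_mat (loc_to_tate \<iota>) (mid E) *\<^sub>v map_vec (tate_map (\<lambda>c. c ^ CARD('f))) (?M B *\<^sub>v v)
      = ?M B *\<^sub>v (?M ?N *\<^sub>v map_vec fr v)" if v: "v \<in> carrier_vec 2" for v
  proof -
    have fv: "map_vec fr v \<in> carrier_vec 2" using v by simp
    have TC: "map_mat fr (?M C) \<in> carrier_mat 2 2" "map_mat fr (?M B) \<in> carrier_mat 2 2" using Bc by simp_all
    have "map_mat fr (?M C) * map_mat fr (?M B) = ?M (Tm (C * B))"
      using D(1,2) by (simp add: TM Tm_mult flip: MT)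
    hence CB: "map_mat fr (?M C) * map_mat fr (?M B) = 1\<^sub>m 2" unfolding D(4) Tm_one T1 .
    have "?M (B * ?N * Tm C) = ?M B * ?M ?N * map_mat fr (?M C)"
      using D(1,2) m2_carrier[of pn a 0 1] by (simp add: TM MT)
    moreover have "map_vec fr (?M B *\<^sub>v v) = map_mat fr (?M B) *\<^sub>v map_vec fr v" using Bc v by (simp add: frv)
    ultimately have "map_mat (loc_to_tate \<iota>) (mid E) *\<^sub>v map_vec fr (?M B *\<^sub>v v)
        = ?M B *\<^sub>v (?M ?N *\<^sub>v ((map_mat fr (?M C) * map_mat fr (?M B)) *\<^sub>v map_vec fr v))"
      unfolding mid using Bc Nc TC fv
      by (simp add: assoc_mult_mat_vec[of _ 2 2 _ 2] mult_mat_vec_carrier[of _ 2 2] mult_carrier_mat[of _ 2 2 _ 2])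
    thus ?thesis unfolding CB tf using fv by simp
  qed
  have fixed: "map_mat (loc_to_tate \<iota>) (mid E) *\<^sub>v map_vec (tate_map (\<lambda>c. c ^ CARD('f))) (?M B *\<^sub>v v2 x 1) = ?M B *\<^sub>v v2 x 1
      \<longleftrightarrow> phi x = ?T a" for x
  proof -
    have "?M B *\<^sub>v (?M ?N *\<^sub>v map_vec fr (v2 x 1)) = ?M B *\<^sub>v v2 x 1 \<longleftrightarrow> ?M ?N *\<^sub>v map_vec fr (v2 x 1) = v2 x 1"
    proof
      assume e: "?M B *\<^sub>v (?M ?N *\<^sub>v map_vec fr (v2 x 1)) = ?M B *\<^sub>v v2 x 1"
      have "?M ?N *\<^sub>v map_vec fr (v2 x 1) \<in> carrier_vec 2" using Nc by (simp add: map_v2 v2_carrier mult_mat_vec_carrier[of _ 2 2])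
      thus "?M ?N *\<^sub>v map_vec fr (v2 x 1) = v2 x 1"
        using arg_cong[OF e, of "\<lambda>v. ?M C *\<^sub>v v"] cancel(2) v2_carrier by metis
    qed simp
    also have "\<dots> \<longleftrightarrow> phi x = ?T a" by (auto simp: map_v2 Nv v2_eq_iff fr_one phi_def algebra_simps)
    finally show ?thesis unfolding act[OF v2_carrier] .
  qed
  have dE: "dim_row (mid E) = 2" using D(8) by simp
  have tateB: "vec_index (A *\<^sub>v v) i \<in> tate_algebra"
    if "A \<in> {?M B, ?M C}" "v \<in> carrier_vec 2" "\<And>i. i < 2 \<Longrightarrow> vec_index v i \<in> tate_algebra" "i < 2" for A v i
    using that Bc by (auto simp: scalar_prod_def At_to_tate_tate intro!: tate_sum tate_mult)
  have ie: "?M (incl E) = ?M B * e21" "?M (proj E) = e12 * ?M C"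
    unfolding D(5,6) using D(1,2) e21_carrier[where 'a = "'f poly poly"] e12_carrier[where 'b = "'f poly poly"]
    by (simp_all add: TM map_e At_to_tate_hom)
  have projv: "?M (proj E) *\<^sub>v v = e12 *\<^sub>v (?M C *\<^sub>v v)" if "v \<in> carrier_vec 2" for v
    unfolding ie by (rule assoc_mult_mat_vec[OF e12_carrier Bc(2) that])
  have inclv: "?M (incl E) *\<^sub>v vec1 x = ?M B *\<^sub>v v2 x 0" for x
  proof -
    have "vec1 x \<in> carrier_vec 1" by (simp add: vec1_def)
    hence "?M (incl E) *\<^sub>v vec1 x = ?M B *\<^sub>v (e21 *\<^sub>v vec1 x)" unfolding ie
      using Bc e21_carrier by (intro assoc_mult_mat_vec[of _ 2 2 _ 1])
    thus ?thesis by (simp add: e21_vec)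
  qed
  have one: "Matrix.vec 1 (\<lambda>_. 1) = vec1 (1 :: 'c fps)" by (simp add: vec1_def)
  have galB: "gal_act \<iota> \<sigma> (?M B *\<^sub>v v2 x 1) - ?M B *\<^sub>v v2 x 1 = ?M B *\<^sub>v v2 (gs \<sigma> x - x) 0"
    if s: "\<sigma> \<in> Gal \<iota>" and x: "scoef x" for \<sigma> x
  proof -
    obtain b0 b1 b2 b3 where B: "B = m2 b0 b1 b2 b3" using m2_exhaust[OF D(1)] by blast
    have g: "tate_map (gal_ext \<iota> \<sigma>) (?T b * x + ?T c) = ?T b * gs \<sigma> x + ?T c" for b c
    proof -
      have "scoef (?T b * x)" by (rule scoef_mult[OF At_to_tate_scoef x])
      moreover have "scoef (?T b * x + ?T c)"
        using \<open>scoef (?T b * x)\<close> At_to_tate_scoef[of c] sep_ring(3) by simp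
      ultimately show ?thesis
        by (simp only: tate_map_gal_ext[OF s] gs_add[OF s] gs_mult[OF s At_to_tate_scoef x] gs_Kcoef[OF s At_to_tate_Kcoef]
          At_to_tate_scoef simp_thms)
    qed
    show ?thesis
      by (simp add: B m2_map m2_mult_v2 gal_act_def map_v2 g v2_diff v2_eq_iff) (simp add: algebra_simps)
  qed
  have sol: "scoef x" if "phi x = ?T a" for x using that At_to_tate_Kcoef[of a] by (intro phi_eq_scoef[OF refl]) simp
  show ?thesis
  proof (intro equalityI subsetI)
    fix c assume "c \<in> betti_ext_class \<iota> MM E"
    then obtain e where c: "c \<in> cocycles \<iota> (vec1 ` W)" and e: "e \<in> betti \<iota> (mid E)" "?M (proj E) *\<^sub>v e = vec1 1"
      "\<And>\<sigma>. \<sigma> \<in> Gal \<iota> \<Longrightarrow> ?M (incl E) *\<^sub>v c \<sigma> = gal_act \<iota> \<sigma> e - e"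
      unfolding betti_ext_class_def betti_A one by blast
    have ec: "e \<in> carrier_vec 2" "\<And>i. i < 2 \<Longrightarrow> vec_index e i \<in> tate_algebra"
      "map_mat (loc_to_tate \<iota>) (mid E) *\<^sub>v map_vec (tate_map (\<lambda>c. c ^ CARD('f))) e = e"
      using e(1) unfolding betti_def dE by (auto simp: vec_setI)
    have "?M C *\<^sub>v e \<in> carrier_vec 2" using Bc(2) ec(1) by (rule mult_mat_vec_carrier)
    then obtain x y where xy: "?M C *\<^sub>v e = v2 x y" by (rule v2_exhaust)
    have y: "y = 1" using e(2) unfolding projv[OF ec(1)] xy e12_vec vec1_simps .
    have ex: "e = ?M B *\<^sub>v v2 x 1" using cancel(1)[OF ec(1)] unfolding xy y by simp
    have px: "phi x = ?T a" using ec(3) unfolding ex fixed .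
    have "vec_index (?M C *\<^sub>v e) 0 \<in> tate_algebra" by (rule tateB) (use ec in auto)
    hence xt: "x \<in> tate_algebra" unfolding xy by (simp add: v2_def)
    have "c \<sigma> = vec1 (gs \<sigma> x - x)" if s: "\<sigma> \<in> Gal \<iota>" for \<sigma>
    proof -
      have "c \<sigma> \<in> vec1 ` W"
        using c s topspace_krull unfolding cocycles_def continuous_map_def by auto
      then obtain w where w: "c \<sigma> = vec1 w" by blast
      have "?M B *\<^sub>v v2 w 0 = ?M B *\<^sub>v v2 (gs \<sigma> x - x) 0"
        using e(3)[OF s] unfolding w inclv ex galB[OF s sol[OF px]] .
      hence "v2 w 0 = v2 (gs \<sigma> x - x) 0" using cancel(2)[OF v2_carrier] by metis
      thus ?thesis unfolding w v2_eq_iff by simp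
    qed
    moreover have "c \<in> extensional (Gal \<iota>)" using c unfolding cocycles_def by blast
    ultimately have "c = cc x" unfolding cc_def by (intro extensionalityI[of _ "Gal \<iota>"]) auto
    thus "c \<in> H1_of (?T a)" unfolding H1_of_def using xt px by blast
  next
    fix c assume "c \<in> H1_of (?T a)"
    then obtain x where x: "c = cc x" "x \<in> tate_algebra" "phi x = ?T a" unfolding H1_of_def by blast
    have "Kcoef (phi x)" unfolding x(3) by (rule At_to_tate_Kcoef)
    hence cc: "cc x \<in> cocycles \<iota> (vec1 ` W)" using x(2) by (intro cc_cocycle)
    have "1 \<in> (tate_algebra :: 'c fps set)" using tate_const[of 1] by simp
    hence vt: "vec_index (v2 x 1) i \<in> tate_algebra" if "i < 2" for i using that x(2) by (simp add: v2_def)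
    have bc: "?M B *\<^sub>v v2 x 1 \<in> carrier_vec 2" using Bc(1) v2_carrier by (rule mult_mat_vec_carrier)
    have "set\<^sub>v (?M B *\<^sub>v v2 x 1) \<subseteq> tate_algebra"
    proof
      fix z assume "z \<in> set\<^sub>v (?M B *\<^sub>v v2 x 1)"
      then obtain i where i: "vec_index (?M B *\<^sub>v v2 x 1) i = z" "i < dim_vec (?M B *\<^sub>v v2 x 1)" by (rule vec_setE)
      have "i < 2" using i(2) unfolding carrier_vecD[OF bc] .
      thus "z \<in> tate_algebra" unfolding i(1)[symmetric] by (intro tateB[OF _ v2_carrier vt]) auto
    qed
    hence b: "?M B *\<^sub>v v2 x 1 \<in> betti \<iota> (mid E)" unfolding betti_def dE using bc fixed[of x] x(3) by simp
    have p: "?M (proj E) *\<^sub>v (?M B *\<^sub>v v2 x 1) = vec1 1" unfolding projv[OF bc] cancel(2)[OF v2_carrier] e12_vec ..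
    have "?M (incl E) *\<^sub>v cc x \<sigma> = gal_act \<iota> \<sigma> (?M B *\<^sub>v v2 x 1) - ?M B *\<^sub>v v2 x 1" if s: "\<sigma> \<in> Gal \<iota>" for \<sigma>
      unfolding galB[OF s sol[OF x(3)]] using s by (simp add: cc_def inclv)
    thus "c \<in> betti_ext_class \<iota> MM E" unfolding betti_ext_class_def betti_A one x(1) using cc b p by blast
  qed
qed

lemma psi_phi: "phi (At_to_tate \<iota> h) = At_to_tate \<iota> (- psi h)"
proof -
  have "At_to_tate \<iota> (- psi h) = At_to_tate \<iota> (h - pn * frob_At h)" by (simp add: psi_def)
  thus ?thesis by (simp add: phi_def At_to_tate_hom At_to_tate_frob pn_def At_to_tate_power At_to_tate_tm)
qed

lemma H1_of_psi: "H1_of (At_to_tate \<iota> (a - psi h)) = H1_of (At_to_tate \<iota> a)"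
proof -
  have "At_to_tate \<iota> (a - psi h) - At_to_tate \<iota> a = phi (At_to_tate \<iota> h)"
    unfolding psi_phi by (simp flip: At_to_tate_hom)
  thus ?thesis using H1_of_eq_iff[OF At_to_tate_tate At_to_tate_Kcoef At_to_tate_tate At_to_tate_Kcoef]
      At_to_tate_tate At_to_tate_Kcoef by blast
qed

lemma r_B_cls: "r_B \<iota> MM (cls a) = H1_of (At_to_tate \<iota> a)"
proof -
  have "betti_ext_class \<iota> MM E = H1_of (At_to_tate \<iota> a)" if E: "E \<in> cls a" for E
  proof -
    obtain B C h where f: "frame E B C (to_fract (a - psi h))" using E by (rule in_cls_frame)
    show ?thesis unfolding betti_class_frame[OF cls_subset[OF E] f] H1_of_psi ..
  qed
  thus ?thesis unfolding r_B_def using Estd_in_cls[of a 0] by blast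
qed

lemma cls_eqI:
  assumes "a = b + psi h" shows "cls a = cls b"
proof -
  show ?thesis
  proof (intro equalityI subsetI)
    fix E assume E: "E \<in> cls a"
    then obtain B C k where f: "frame E B C (to_fract (a - psi k))" by (rule in_cls_frame)
    have "a - psi k = b - psi (k - h)" by (simp add: assms psi_hom)
    thus "E \<in> cls b" using in_clsI[OF cls_subset[OF E]] f by metis
  next
    fix E assume E: "E \<in> cls b"
    then obtain B C k where f: "frame E B C (to_fract (b - psi k))" by (rule in_cls_frame)
    have "b - psi k = a - psi (k + h)" by (simp add: assms psi_hom)
    thus "E \<in> cls a" using in_clsI[OF cls_subset[OF E]] f by metis
  qed
qed

lemma At_to_tate_inj: "At_to_tate \<iota> a = At_to_tate \<iota> b \<Longrightarrow> a = b"
proof (intro poly_eqI)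
  fix i j
  assume "At_to_tate \<iota> a = At_to_tate \<iota> b"
  hence "\<iota> (eval_X_inv (coeff a i)) = \<iota> (eval_X_inv (coeff b i))" for i by (metis At_to_tate_nth)
  hence "eval_X_inv (coeff a i) = eval_X_inv (coeff b i)" for i by (rule emb_inj')
  hence "fls_nth (eval_X_inv (coeff a i)) (- int j) = fls_nth (eval_X_inv (coeff b i)) (- int j)" for i by simp
  thus "coeff (coeff a i) j = coeff (coeff b i) j" by (simp add: eval_X_inv_nth)
qed

text \<open>Bijectivity of \<open>r\<^sub>B\<close> says that \<open>phi\<close> is bijective on the quotient of \<open>K\<^sub>\<infinity>\<langle>t\<rangle>\<close> by \<open>\<F>[\<theta>,t]\<close>; it
  fails to be surjective as soon as the digit sum condition does.\<close>

lemma r_B_bij_iff: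
  "bij_betw (r_B \<iota> MM) (range cls) (carrier (H1 \<iota> (vec1 ` W))) \<longleftrightarrow> digit_sum CARD('f) n < CARD('f) - 1"
proof
  assume bij: "bij_betw (r_B \<iota> MM) (range cls) (carrier (H1 \<iota> (vec1 ` W)))"
  show "digit_sum CARD('f) n < CARD('f) - 1"
  proof (rule ccontr)
    assume "\<not> digit_sum CARD('f) n < CARD('f) - 1"
    then obtain v where v: "v \<in> tate_algebra" "\<And>i. fps_nth v i \<in> range \<iota>"
      "\<And>g a. g \<in> tate_algebra \<Longrightarrow> (\<And>i. fps_nth g i \<in> range \<iota>) \<Longrightarrow> v - phi g \<noteq> At_to_tate \<iota> a"
      using J_not_frob_surj by metis
    have "H1_of v \<in> carrier (H1 \<iota> (vec1 ` W))" unfolding carrier_H1 using v(1,2) by blast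
    then obtain a where "H1_of v = r_B \<iota> MM (cls a)" using bij unfolding bij_betw_def by blast
    hence "H1_of v = H1_of (At_to_tate \<iota> a)" unfolding r_B_cls .
    then obtain g where "g \<in> tate_algebra" "Kcoef g" "v - At_to_tate \<iota> a = phi g"
      using H1_of_eq_iff[of v "At_to_tate \<iota> a"] v(1,2) At_to_tate_tate At_to_tate_Kcoef by blast
    thus False using v(3)[of g a] by (simp add: algebra_simps)
  qed
next
  assume d: "digit_sum CARD('f) n < CARD('f) - 1"
  have inj: "inj_on (r_B \<iota> MM) (range cls)"
  proof (rule inj_onI)
    fix P Q assume "P \<in> range cls" "Q \<in> range cls" and eq: "r_B \<iota> MM P = r_B \<iota> MM Q"
    then obtain a b where ab: "P = cls a" "Q = cls b" by blast
    have "H1_of (At_to_tate \<iota> a) = H1_of (At_to_tate \<iota> b)" using eq unfolding ab r_B_cls .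
    then obtain g where g: "g \<in> tate_algebra" "Kcoef g" "At_to_tate \<iota> a - At_to_tate \<iota> b = phi g"
      using H1_of_eq_iff[OF At_to_tate_tate At_to_tate_Kcoef At_to_tate_tate At_to_tate_Kcoef] by blast
    have "phi g = At_to_tate \<iota> (a - b)" unfolding At_to_tate_hom using g(3) by simp
    then obtain h where h: "g = At_to_tate \<iota> h" using J_frob_inj[OF d g(1)] g(2) by blast
    have "At_to_tate \<iota> (a - b) = At_to_tate \<iota> (- psi h)" using g(3) unfolding h psi_phi At_to_tate_hom .
    hence "a - b = - psi h" by (rule At_to_tate_inj)
    hence "b = a + psi h" by (simp add: algebra_simps)
    thus "P = Q" unfolding ab by (rule cls_eqI[symmetric])
  qed
  have "r_B \<iota> MM ` range cls = carrier (H1 \<iota> (vec1 ` W))"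
  proof (intro equalityI subsetI)
    fix Q assume "Q \<in> r_B \<iota> MM ` range cls"
    then obtain a where "Q = H1_of (At_to_tate \<iota> a)" using r_B_cls by blast
    thus "Q \<in> carrier (H1 \<iota> (vec1 ` W))" unfolding carrier_H1 using At_to_tate_tate At_to_tate_Kcoef by blast
  next
    fix Q assume "Q \<in> carrier (H1 \<iota> (vec1 ` W))"
    then obtain u where u: "Q = H1_of u" "u \<in> tate_algebra" "Kcoef u" unfolding carrier_H1 by blast
    obtain g a where g: "g \<in> tate_algebra" "Kcoef g" "u - phi g = At_to_tate \<iota> a"
      using J_frob_surj[OF d u(2)] u(3) by metis
    have "u - At_to_tate \<iota> a = phi g" using g(3) by (simp add: algebra_simps)
    hence "Q = r_B \<iota> MM (cls a)" unfolding u(1) r_B_cls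
      using H1_of_eq_iff[OF u(2,3) At_to_tate_tate At_to_tate_Kcoef] g(1,2) by blast
    thus "Q \<in> r_B \<iota> MM ` range cls" by blast
  qed
  thus "bij_betw (r_B \<iota> MM) (range cls) (carrier (H1 \<iota> (vec1 ` W)))" using inj unfolding bij_betw_def by blast
qed

end

section \<open>Baer sums\<close>

lemmas explicit_mat = scalar_prod_def sum.atLeast0_lessThan_Suc less_Suc_eq numeral_eq_Suc

definition i32 :: "'a::comm_ring_1 mat" where "i32 = Matrix.mat 3 2 (\<lambda>(i, j). if i = j then 1 else 0)"
definition p13 :: "'a::comm_ring_1 mat" where "p13 = Matrix.mat 1 3 (\<lambda>(i, j). if j = 2 then 1 else 0)"
text \<open>The first two basis vectors go to the two subobjects, the third to the sum of the two
  lifts: this embeds the pullback along the diagonal into the direct sum of two standard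
  extensions.\<close>

definition g43 :: "'a::comm_ring_1 mat" where
  "g43 = Matrix.mat 4 3 (\<lambda>(i, j). if (i, j) \<in> {(0, 0), (1, 2), (2, 1), (3, 2)} then 1 else 0)"
text \<open>The two copies of the subobject are added and the lift is kept, which is the pushout
  along the sum.\<close>

definition s23 :: "'a::comm_ring_1 mat" where
  "s23 = Matrix.mat 2 3 (\<lambda>(i, j). if (i = 1) = (j = 2) then 1 else 0)"

lemma short_exact_23: "short_exact 2 3 1 (i32 :: 'a::comm_ring_1 mat) p13"
  using short_exact_coordinate[of 2, where 'a = 'a] by (simp add: i32_def p13_def)

lemma map_explicit:
  assumes "h 0 = 0" "h 1 = 1"
  shows "map_mat h i32 = i32" "map_mat h p13 = p13" "map_mat h g43 = g43" "map_mat h s23 = s23"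
  by (rule eq_matI; use assms in \<open>auto simp: i32_def p13_def g43_def s23_def\<close>)+

lemma explicit_carrier:
  "(i32 :: 'a::comm_ring_1 mat) \<in> carrier_mat 3 2" "(p13 :: 'a mat) \<in> carrier_mat 1 3"
  "(g43 :: 'a mat) \<in> carrier_mat 4 3" "(s23 :: 'a mat) \<in> carrier_mat 2 3"
  by (simp_all add: i32_def p13_def g43_def s23_def)

abbreviation ones21 :: "'a::comm_ring_1 mat" where "ones21 \<equiv> 1\<^sub>m 1 @\<^sub>r 1\<^sub>m 1"

lemma ones21_eq: "ones21 = Matrix.mat 2 1 (\<lambda>_. 1 :: 'a::comm_ring_1)" "ones21\<^sup>T = Matrix.mat 1 2 (\<lambda>_. 1 :: 'a)"
proof -
  show 1: "ones21 = Matrix.mat 2 1 (\<lambda>_. 1 :: 'a)" by (rule eq_matI) (auto simp: append_rows_def)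
  show "ones21\<^sup>T = Matrix.mat 1 2 (\<lambda>_. 1 :: 'a)" unfolding 1 by (rule eq_matI) auto
qed

text \<open>Because g commutes with the Frobenius maps, a section and its defect can be pushed
  forward together. Along the two morphisms that define a Baer sum, one section yields the data of
  all three extensions.\<close>

lemma transport_defect:
  assumes c: "g \<in> carrier_mat d e" "D \<in> carrier_mat e e" "D' \<in> carrier_mat d d" "s \<in> carrier_mat e 1"
      "i \<in> carrier_mat e m" "z \<in> carrier_mat m 1"
    and g: "Fm g * D = D' * Fm (Tm g)" and s: "D * Fm (Tm s) = Fm s + Fm i * z"
  shows "D' * Fm (Tm (g * s)) = Fm (g * s) + Fm (g * i) * z"
proof -
  note k = map_mat_carr[OF c(1), of to_fract] map_mat_carr[OF map_mat_carr[OF c(1), of frob_At], of to_fract]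
    map_mat_carr[OF map_mat_carr[OF c(4), of frob_At], of to_fract] map_mat_carr[OF c(4), of to_fract]
    map_mat_carr[OF c(5), of to_fract]
  have "D' * Fm (Tm (g * s)) = D' * (Fm (Tm g) * Fm (Tm s))" using c(1,4) by (simp add: Tm_mult Fm_mult)
  also have "\<dots> = D' * Fm (Tm g) * Fm (Tm s)" by (rule assoc_mult_mat[OF c(3) k(2,3), symmetric])
  also have "\<dots> = Fm g * (D * Fm (Tm s))" unfolding g[symmetric] by (rule assoc_mult_mat[OF k(1) c(2) k(3)])
  also have "\<dots> = Fm g * Fm s + Fm g * (Fm i * z)"
    unfolding s by (rule mult_add_distrib_mat[OF k(1,4) mult_carrier_mat[OF k(5) c(6)]])
  also have "Fm g * (Fm i * z) = Fm g * Fm i * z" by (rule assoc_mult_mat[OF k(1,5) c(6), symmetric])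
  finally show ?thesis using c(1,4,5) by (simp add: Fm_mult)
qed

context carlitz_betti
begin

lemma dim_MM2: "dim_row (MM \<oplus>\<^sub>m MM) = 2" by (simp add: mat_dsum_def MM_carrier)

text \<open>A section of P has a defect with two coordinates. The morphism to the direct sum splits
  it into sections of E and E' with defects \<xi> and \<eta>; the morphism to E'' adds the
  coordinates. Since P may be any witness of the Baer sum, uniqueness of pullbacks and pushouts
  never enters.\<close>

lemma baer_frames:
  assumes E: "E \<in> extensions unit_motive MM" "E' \<in> extensions unit_motive MM" "E'' \<in> extensions unit_motive MM"
    and b: "baer_sum unit_motive MM E E' E''"
  shows "\<exists>\<xi> \<eta>. (\<exists>B C. frame E B C \<xi>) \<and> (\<exists>B C. frame E' B C \<eta>) \<and> (\<exists>B C. frame E'' B C (\<xi> + \<eta>))"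
proof -
  obtain P where P: "P \<in> extensions unit_motive (MM \<oplus>\<^sub>m MM)"
    and m1': "ext_morphism (1\<^sub>m 2) ones21 P (ext_dsum E E')" and m2': "ext_morphism (ones21\<^sup>T) (1\<^sub>m 1) P E''"
    using b unfolding baer_sum_def Let_def MM_carrier one_add_one by blast
  obtain g where g: "motive_hom (mid P) (mid (ext_dsum E E')) g" "g * incl P = incl (ext_dsum E E') * 1\<^sub>m 2"
      "proj (ext_dsum E E') * g = ones21 * proj P"
    using m1' unfolding ext_morphism_def by blast
  obtain g' where g': "motive_hom (mid P) (mid E'') g'" "g' * incl P = incl E'' * ones21\<^sup>T" "proj E'' * g' = 1\<^sub>m 1 * proj P"
    using m2' unfolding ext_morphism_def by blast
  define e where "e = dim_row (mid P)"
  define d where "d = dim_row (mid E)"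
  define d' where "d' = dim_row (mid E')"
  define d'' where "d'' = dim_row (mid E'')"
  note D = extensionsD[OF E(1), folded d_def] and D' = extensionsD[OF E(2), folded d'_def]
    and D'' = extensionsD[OF E(3), folded d''_def]
  have DP: "mid P \<in> carrier_mat e e" using P by (auto simp: extensions_def t_motive_def GL_over_def e_def)
  have se: "short_exact 2 e 1 (incl P) (proj P)" using P unfolding extensions_def dim_MM2 MM_carrier e_def by blast
  hence i: "incl P \<in> carrier_mat e 2" and p: "proj P \<in> carrier_mat 1 e" unfolding short_exact_def by blast+
  have "Fm (proj P) * mid P = unit_motive * Fm (Tm (proj P))"
    using P by (auto simp: extensions_def motive_hom_def)
  hence pD: "Fm (proj P) * mid P = Fm (Tm (proj P))" using p by (simp add: unit_motive_def)
  obtain s where s: "s \<in> carrier_mat e 1" "proj P * s = 1\<^sub>m 1" using short_exact_section[OF se] .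
  obtain r where r: "r \<in> carrier_mat 2 e" "incl P * r + s * proj P = 1\<^sub>m e"
    using short_exact_split[OF se s] by metis
  define z where "z = Fm r * (mid P * Fm (Tm s) - Fm s)"
  have z: "z \<in> carrier_mat (1 + 1) 1"
    unfolding z_def one_add_one by (intro mult_carrier_mat[of _ 2 e] minus_carrier_mat map_mat_carr s(1) r(1))
  have sd: "mid P * Fm (Tm s) = Fm s + Fm (incl P) * z"
    unfolding z_def by (rule section_defect[OF i p DP pD s r])
  obtain x y where xy: "x \<in> carrier_mat 1 1" "y \<in> carrier_mat 1 1" "z = x @\<^sub>r y" using z by (rule split_rows)
  define \<xi> where "\<xi> = x $$ (0, 0)"
  define \<eta> where "\<eta> = y $$ (0, 0)"
  have x: "x = m1 \<xi>" and y: "y = m1 \<eta>" unfolding \<xi>_def \<eta>_def using xy(1,2) by (auto intro: m1_exhaust)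
  have z2: "z \<in> carrier_mat 2 1" using z unfolding one_add_one .
  let ?M = "mid E \<oplus>\<^sub>m mid E'" and ?I = "incl E \<oplus>\<^sub>m incl E'"
  have Mc: "?M \<in> carrier_mat (d + d') (d + d')" and Ic: "?I \<in> carrier_mat (d + d') 2"
    using D(1,3) D'(1,3) by (auto simp: mat_dsum_def)
  have g1: "g \<in> carrier_mat (d + d') e" "Fm g * mid P = ?M * Fm (Tm g)"
    using g(1) Mc unfolding motive_hom_def ext_dsum_def e_def by auto
  have gi: "g * incl P = ?I" using g(2) Ic unfolding ext_dsum_def by simp
  have main: "?M * Fm (Tm (g * s)) = Fm (g * s) + Fm ?I * z"
    using transport_defect[OF g1(1) DP Mc s(1) i z2 g1(2) sd] unfolding gi .
  obtain s1 s2 where s12: "s1 \<in> carrier_mat d 1" "s2 \<in> carrier_mat d' 1" "g * s = s1 @\<^sub>r s2"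
    using mult_carrier_mat[OF g1(1) s(1)] by (rule split_rows)
  have FI: "Fm ?I = Fm (incl E) \<oplus>\<^sub>m Fm (incl E')" by (rule map_dsum) (simp add: to_fract_hom')
  have l: "?M * Fm (Tm (g * s)) = (mid E * Fm (Tm s1)) @\<^sub>r (mid E' * Fm (Tm s2))"
    unfolding s12(3) map_append_rows[OF s12(1,2)] map_append_rows[OF map_mat_carr[OF s12(1)] map_mat_carr[OF s12(2)]]
    by (rule dsum_mult_append[OF D(1) D'(1) map_mat_carr[OF map_mat_carr[OF s12(1)]] map_mat_carr[OF map_mat_carr[OF s12(2)]]])
  have ri: "Fm ?I * z = (Fm (incl E) * m1 \<xi>) @\<^sub>r (Fm (incl E') * m1 \<eta>)"
    unfolding FI xy(3) x y 
    by (rule dsum_mult_append[OF map_mat_carr[OF D(3)] map_mat_carr[OF D'(3)] m1_carrier m1_carrier])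
  have c: "Fm (incl E) * m1 \<xi> \<in> carrier_mat d 1" "Fm (incl E') * m1 \<eta> \<in> carrier_mat d' 1"
    by (rule mult_carrier_mat[OF map_mat_carr m1_carrier]; rule D D')+
  have "(mid E * Fm (Tm s1)) @\<^sub>r (mid E' * Fm (Tm s2)) = (Fm s1 + Fm (incl E) * m1 \<xi>) @\<^sub>r (Fm s2 + Fm (incl E') * m1 \<eta>)"
    using main unfolding l ri unfolding s12(3) map_append_rows[OF s12(1,2)]
      append_rows_add[OF map_mat_carr[OF s12(1)] c(1) map_mat_carr[OF s12(2)] c(2)] .
  note eqs = append_rows_inject[OF mult_carrier_mat[OF D(1) map_mat_carr[OF map_mat_carr[OF s12(1)]]]
      add_carrier_mat[OF c(1)] mult_carrier_mat[OF D'(1) map_mat_carr[OF map_mat_carr[OF s12(2)]]]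
      add_carrier_mat[OF c(2)] this]
  have J1: "(ones21 :: 'f poly poly mat) \<in> carrier_mat 2 1" unfolding ones21_eq(1) by (rule mat_carrier)
  have "(proj E * s1) @\<^sub>r (proj E' * s2) = (proj E \<oplus>\<^sub>m proj E') * (g * s)"
    unfolding s12(3) by (rule dsum_mult_append[OF D(4) D'(4) s12(1,2), symmetric])
  also have "\<dots> = (proj E \<oplus>\<^sub>m proj E') * g * s"
  proof (rule assoc_mult_mat[OF _ g1(1) s(1), symmetric])
    show "proj E \<oplus>\<^sub>m proj E' \<in> carrier_mat 2 (d + d')" using D(4) D'(4) by (auto simp: mat_dsum_def)
  qed
  also have "\<dots> = ones21 * proj P * s" using g(3) unfolding ext_dsum_def by simp
  also have "\<dots> = ones21 * (proj P * s)"
    by (rule assoc_mult_mat[OF J1 p s(1)])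
  also have "\<dots> = ones21" unfolding s(2) by (rule right_mult_one_mat[OF J1])
  finally have ps: "(proj E * s1) @\<^sub>r (proj E' * s2) = ones21" .
  note ps' = append_rows_inject[OF mult_carrier_mat[OF D(4) s12(1)] one_carrier_mat mult_carrier_mat[OF D'(4) s12(2)]
      one_carrier_mat ps]
  have f1: "\<exists>B C. frame E B C \<xi>" using frame_of_section[OF E(1)] s12(1) ps'(1) eqs(1) unfolding d_def by blast
  have f2: "\<exists>B C. frame E' B C \<eta>" using frame_of_section[OF E(2)] s12(2) ps'(2) eqs(2) unfolding d'_def by blast
  have h: "g' \<in> carrier_mat d'' e" "Fm g' * mid P = mid E'' * Fm (Tm g')"
    using g'(1) unfolding motive_hom_def e_def d''_def by blast+
  have Jc: "(ones21\<^sup>T :: 'f poly poly mat) \<in> carrier_mat 1 2" unfolding ones21_eq(2) by (rule mat_carrier)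
  have "mid E'' * Fm (Tm (g' * s)) = Fm (g' * s) + Fm (incl E'' * ones21\<^sup>T) * z"
    using transport_defect[OF h(1) DP D''(1) s(1) i z2 h(2) sd] unfolding g'(2) .
  also have "Fm (incl E'' * ones21\<^sup>T) = Fm (incl E'') * Fm (ones21\<^sup>T)" using D''(3) Jc by (intro Fm_mult) auto
  also have "\<dots> * z = Fm (incl E'') * (Fm (ones21\<^sup>T) * z)"
    by (rule assoc_mult_mat[OF map_mat_carr[OF D''(3)] map_mat_carr[OF Jc] z2])
  also have "Fm (ones21\<^sup>T) * z = m1 (\<xi> + \<eta>)"
    unfolding xy(3) x y ones21_eq by (rule eq_matI) (auto simp: append_rows_def m1_def explicit_mat to_fract_hom')
  finally have eq3: "mid E'' * Fm (Tm (g' * s)) = Fm (g' * s) + Fm (incl E'') * m1 (\<xi> + \<eta>)" .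
  have "proj E'' * (g' * s) = proj E'' * g' * s" by (rule assoc_mult_mat[OF D''(4) h(1) s(1), symmetric])
  also have "\<dots> = 1\<^sub>m 1" unfolding g'(3) left_mult_one_mat[OF p] by (rule s(2))
  finally have "\<exists>B C. frame E'' B C (\<xi> + \<eta>)"
    using frame_of_section[OF E(3)] mult_carrier_mat[OF h(1) s(1)] eq3 unfolding d''_def by blast
  thus ?thesis using f1 f2 by blast
qed

text \<open>The Frobenius of the pullback of two standard extensions along the diagonal: one lift of
  1 that carries both data u and v.\<close>

definition P3 :: "'f poly poly fract \<Rightarrow> 'f poly poly fract \<Rightarrow> 'f motive" where
  "P3 u v = Matrix.mat 3 3 (\<lambda>(i, j). if i = j then (if i = 2 then 1 else to_fract pn)
     else if j = 2 then (if i = 0 then u else v) else 0)"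

lemma P3_extension:
  assumes u: "u \<in> At_loc" "v \<in> At_loc"
  shows "\<lparr>mid = P3 u v, incl = i32, proj = p13\<rparr> \<in> extensions unit_motive (MM \<oplus>\<^sub>m MM)"
proof -
  let ?P = "to_fract pn"
  define R where "R = Matrix.mat 3 3 (\<lambda>(i, j). if i = j then (if i = 2 then 1 else inverse ?P)
     else if j = 2 then - ((if i = 0 then u else v) * inverse ?P) else 0)"
  have i: "inverse ?P \<in> At_loc" unfolding pn_def by (rule At_loc_closed)
  have 01: "0 \<in> (At_loc :: 'f poly poly fract set)" "1 \<in> (At_loc :: 'f poly poly fract set)"
    using At_loc_closed(1)[of 0] At_loc_closed(1)[of 1] by (simp_all add: to_fract_hom')
  have el: "elements_mat (P3 u v) \<subseteq> At_loc" "elements_mat R \<subseteq> At_loc"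
    unfolding elements_mat_def P3_def R_def using u i 01 At_loc_closed(1)[of pn] by (auto intro!: At_loc_closed(3,5))
  have inv: "P3 u v * R = 1\<^sub>m 3" "R * P3 u v = 1\<^sub>m 3"
    by (rule eq_matI; use pn_nonzero in \<open>auto simp: P3_def R_def explicit_mat\<close>)+
  have Pc: "P3 u v \<in> carrier_mat 3 3" "R \<in> carrier_mat 3 3" by (simp_all add: P3_def R_def)
  have "P3 u v \<in> GL_over At_loc 3" unfolding GL_over_def using el inv Pc by blast
  hence t: "t_motive (P3 u v)" using Pc by (simp add: t_motive_def)
  have dP: "dim_row (P3 u v) = 3" using Pc by simp
  have em: "Fm i32 = i32" "Fm (Tm i32) = i32" "Fm p13 = p13" "Fm (Tm p13) = (p13 :: 'f motive)"
    by (simp_all add: map_explicit to_fract_hom' frob_At_hom)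
  have "i32 * (MM \<oplus>\<^sub>m MM) = P3 u v * i32"
    unfolding MM_eq by (rule eq_matI) (auto simp: P3_def i32_def mat_dsum_def m1_def explicit_mat)
  hence 1: "motive_hom (MM \<oplus>\<^sub>m MM) (P3 u v) i32"
    using explicit_carrier(1)[where 'a = "'f poly poly"] unfolding motive_hom_def dim_MM2 dP em by simp
  have "p13 * P3 u v = unit_motive * p13"
    unfolding unit_motive_def by (rule eq_matI) (auto simp: P3_def p13_def explicit_mat)
  hence 2: "motive_hom (P3 u v) unit_motive p13"
    using explicit_carrier(2)[where 'a = "'f poly poly"] unfolding motive_hom_def MM_carrier dP em by simp
  show ?thesis unfolding extensions_def using t 1 2 short_exact_23 by (simp add: dim_MM2 dP MM_carrier)
qed

text \<open>The witness is \<open>P3 u v\<close>, with \<open>g43\<close> as the morphism to the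
  direct sum and B times \<open>s23\<close> as the morphism to E.\<close>

lemma baer_standard:
  assumes u: "u \<in> At_loc" "v \<in> At_loc" and f: "frame E B C (u + v)"
  shows "baer_sum unit_motive MM (Estd u) (Estd v) E"
proof -
  note D = frameD[OF f]
  let ?P = "\<lparr>mid = P3 u v, incl = i32, proj = p13\<rparr> :: 'f ext"
  have dP: "dim_row (P3 u v) = 3" by (simp add: P3_def)
  have em: "Fm g43 = g43" "Fm (Tm g43) = g43" "Fm s23 = s23" "Fm (Tm s23) = (s23 :: 'f motive)"
    by (simp_all add: map_explicit to_fract_hom' frob_At_hom)
  have "g43 * P3 u v = (Um u \<oplus>\<^sub>m Um v) * g43"
    by (rule eq_matI) (auto simp: P3_def g43_def Um_def m2_def mat_dsum_def explicit_mat)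
  moreover have "dim_row (Um u \<oplus>\<^sub>m Um v) = 4" using Um_carrier[of u] Um_carrier[of v] by (simp add: mat_dsum_def)
  ultimately have a1: "motive_hom (P3 u v) (Um u \<oplus>\<^sub>m Um v) g43"
    using explicit_carrier(3)[where 'a = "'f poly poly"] unfolding motive_hom_def dP em by simp
  have a2: "g43 * i32 = (e21 \<oplus>\<^sub>m e21) * (1\<^sub>m 2 :: 'f poly poly mat)"
    by (rule eq_matI) (auto simp: g43_def i32_def e21_def mat_dsum_def explicit_mat)
  have a3: "(e12 \<oplus>\<^sub>m e12) * g43 = ones21 * (p13 :: 'f poly poly mat)"
    unfolding ones21_eq by (rule eq_matI) (auto simp: g43_def p13_def e12_def mat_dsum_def explicit_mat)
  have A: "ext_morphism (1\<^sub>m 2) ones21 ?P (ext_dsum (Estd u) (Estd v))"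
    unfolding ext_morphism_def ext_dsum_def Estd_def using a1 a2 a3 by auto
  let ?g = "B * s23"
  have S: "(s23 :: 'f poly poly mat) \<in> carrier_mat 2 3" "(s23 :: 'f motive) \<in> carrier_mat 2 3" by (rule explicit_carrier)+
  have Pc: "P3 u v \<in> carrier_mat 3 3" by (simp add: P3_def)
  note c = map_mat_carr[OF D(1), of to_fract] map_mat_carr[OF map_mat_carr[OF D(2), of frob_At], of to_fract]
    map_mat_carr[OF map_mat_carr[OF D(1), of frob_At], of to_fract]
  have K: "s23 * P3 u v = Um (u + v) * s23"
    by (rule eq_matI) (auto simp: P3_def s23_def Um_def m2_def explicit_mat)
  have Fg: "Fm ?g = Fm B * s23" "Fm (Tm ?g) = Fm (Tm B) * s23"
    using D(1) S(1) by (simp_all add: Fm_mult Tm_mult em)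
  have "Fm ?g * P3 u v = Fm B * (s23 * P3 u v)" unfolding Fg by (rule assoc_mult_mat[OF c(1) S(2) Pc])
  also have "\<dots> = Fm B * Um (u + v) * s23" unfolding K by (rule assoc_mult_mat[OF c(1) Um_carrier S(2), symmetric])
  also have "\<dots> = Fm B * Um (u + v) * (Fm (Tm C) * Fm (Tm B)) * s23" 
    by (simp only: D(12) right_mult_one_mat[OF mult_carrier_mat[OF c(1) Um_carrier]])
  also have "\<dots> = mid E * Fm (Tm ?g)"
    unfolding Fg D(7) using c S(2) Um_carrier by (simp add: assoc2 carr2 assoc_mult_mat[of _ 2 2 _ 2 _ 3] mult_carrier_mat[of _ 2 2 _ 3])
  finally have "motive_hom (P3 u v) (mid E) ?g"
    using D(1,8) S(1) unfolding motive_hom_def dP by auto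
  moreover have "?g * i32 = incl E * ones21\<^sup>T"
  proof -
    have Jc: "(ones21\<^sup>T :: 'f poly poly mat) \<in> carrier_mat 1 2" unfolding ones21_eq(2) by (rule mat_carrier)
    have k: "s23 * i32 = e21 * (ones21\<^sup>T :: 'f poly poly mat)"
      unfolding ones21_eq by (rule eq_matI) (auto simp: s23_def i32_def e21_def explicit_mat)
    have "?g * i32 = B * (s23 * i32)" by (rule assoc_mult_mat[OF D(1) S(1) explicit_carrier(1)])
    also have "\<dots> = B * e21 * ones21\<^sup>T" unfolding k
      by (rule assoc_mult_mat[OF D(1) e21_carrier Jc, symmetric])
    finally show ?thesis unfolding D(5) .
  qed
  moreover have "proj E * ?g = 1\<^sub>m 1 * p13"
  proof -
    have k: "e12 * s23 = (p13 :: 'f poly poly mat)"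
      by (rule eq_matI) (auto simp: s23_def p13_def e12_def explicit_mat)
    have "e12 * C * ?g = e12 * C * B * s23"
      by (rule assoc_mult_mat[OF mult_carrier_mat[OF e12_carrier D(2)] D(1) S(1), symmetric])
    also have "e12 * C * B = e12 * (C * B)" by (rule assoc_mult_mat[OF e12_carrier D(2,1)])
    also have "\<dots> = e12" unfolding D(4) by (rule right_mult_one_mat[OF e12_carrier])
    finally show ?thesis unfolding D(6) k left_mult_one_mat[OF explicit_carrier(2)] .
  qed
  ultimately have "ext_morphism (ones21\<^sup>T) (1\<^sub>m 1) ?P E" unfolding ext_morphism_def by auto
  thus ?thesis unfolding baer_sum_def Let_def MM_carrier one_add_one using A P3_extension[OF u] by blast
qed

lemma Ext1_reg_add: "cls u \<oplus>\<^bsub>Ext1_reg unit_motive MM\<^esub> cls v = cls (u + v)"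
proof -
  have eq: "cls u \<oplus>\<^bsub>Ext1_reg unit_motive MM\<^esub> cls v =
      {E'' \<in> extensions unit_motive MM. \<exists>E\<in>cls u. \<exists>E'\<in>cls v. baer_sum unit_motive MM E E' E''}"
    by (simp add: Ext1_reg_def Ext1_def)
  show ?thesis unfolding eq
  proof (intro equalityI subsetI)
    fix E'' assume "E'' \<in> {E'' \<in> extensions unit_motive MM. \<exists>E\<in>cls u. \<exists>E'\<in>cls v. baer_sum unit_motive MM E E' E''}"
    then obtain E E' where E: "E'' \<in> extensions unit_motive MM" "E \<in> cls u" "E' \<in> cls v" "baer_sum unit_motive MM E E' E''" by blast
    obtain \<xi> \<eta> B C B' C' B'' C'' where f: "frame E B C \<xi>" "frame E' B' C' \<eta>" "frame E'' B'' C'' (\<xi> + \<eta>)"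
      using baer_frames[OF cls_subset[OF E(2)] cls_subset[OF E(3)] E(1,4)] by blast
    obtain h where h: "\<xi> = to_fract (u - psi h)" using E(2) f(1) by (rule frame_in_cls)
    obtain k where k: "\<eta> = to_fract (v - psi k)" using E(3) f(2) by (rule frame_in_cls)
    have "\<xi> + \<eta> = to_fract (u + v - psi (h + k))" unfolding h k psi_hom by (simp add: to_fract_hom')
    thus "E'' \<in> cls (u + v)" using in_clsI[OF E(1)] f(3) by metis
  next
    fix E'' assume E: "E'' \<in> cls (u + v)"
    then obtain B C h where f: "frame E'' B C (to_fract (u + v - psi h))" by (rule in_cls_frame)
    \<comment> \<open>The indeterminacy psi h can be put entirely into the first summand, so every
      extension in the class of u + v is a Baer sum of two standard ones.\<close>
    have "to_fract (u + v - psi h) = to_fract (u - psi h) + to_fract v" by (simp add: to_fract_hom')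
    hence "baer_sum unit_motive MM (Estd (to_fract (u - psi h))) (Estd (to_fract v)) E''"
      using baer_standard[OF At_loc_closed(1) At_loc_closed(1)] f by metis
    moreover have "Estd (to_fract v) \<in> cls v" using Estd_in_cls[of v 0] by (simp add: psi_hom)
    ultimately show "E'' \<in> {E'' \<in> extensions unit_motive MM. \<exists>E\<in>cls u. \<exists>E'\<in>cls v. baer_sum unit_motive MM E E' E''}"
      using cls_subset[OF E] Estd_in_cls by blast
  qed
qed

lemma r_B_hom:
  "r_B \<iota> MM \<in> LinearCombinations.module_hom (ring_of_type_algebra :: 'f poly ring) (Ext1_reg unit_motive MM) (H1 \<iota> (vec1 ` W))"
proof -
  have 1: "r_B \<iota> MM P \<in> carrier (H1 \<iota> (vec1 ` W))" if "P \<in> range cls" for P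
    using that r_B_cls At_to_tate_tate At_to_tate_Kcoef unfolding carrier_H1 by blast
  have 2: "r_B \<iota> MM (P \<oplus>\<^bsub>Ext1_reg unit_motive MM\<^esub> Q) = r_B \<iota> MM P \<oplus>\<^bsub>H1 \<iota> (vec1 ` W)\<^esub> r_B \<iota> MM Q"
    if PQ: "P \<in> range cls" "Q \<in> range cls" for P Q
  proof -
    obtain a b where ab: "P = cls a" "Q = cls b" using PQ by blast
    show ?thesis
      unfolding ab Ext1_reg_add r_B_cls H1_add[OF At_to_tate_tate At_to_tate_Kcoef At_to_tate_tate At_to_tate_Kcoef]
        At_to_tate_hom ..
  qed
  have 3: "r_B \<iota> MM (c \<odot>\<^bsub>Ext1_reg unit_motive MM\<^esub> P) = c \<odot>\<^bsub>H1 \<iota> (vec1 ` W)\<^esub> r_B \<iota> MM P" if P: "P \<in> range cls" for c P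
  proof -
    obtain a where a: "P = cls a" using P by blast
    show ?thesis
      unfolding a Ext1_reg_smult r_B_cls H1_smult[OF At_to_tate_tate At_to_tate_Kcoef] At_to_tate_hom Ft_to_tate_def ..
  qed
  show ?thesis unfolding LinearCombinations.module_hom_def carrier_Ext1_reg using 1 2 3 by auto
qed

end

theorem corollary3p10:
  fixes \<iota> :: "'f::{finite,field} fls \<Rightarrow> 'c::{field,complete_space}"
    and n :: nat
  assumes "completed_separable_closure \<iota>"
    and "prime CARD('f)"
  shows "module_iso (ring_of_type_algebra :: 'f poly ring)
           (Ext1_reg unit_motive (A_motive (- int n)))
           (H1 \<iota> (betti \<iota> (A_motive (- int n))))
           (r_B \<iota> (A_motive (- int n)))
         \<longleftrightarrow> digit_sum CARD('f) n < CARD('f) - 1"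
proof -
  interpret carlitz_betti \<iota> n
    using assms by (intro carlitz_betti.intro carlitz_betti_axioms.intro)
  show ?thesis
    unfolding module_iso_def betti_A carrier_Ext1_reg using r_B_hom r_B_bij_iff by blast
qed

end
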